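(* Let $\mathcal E$ be a category with pullbacks and pullback-stable reflexive coequalisers, let $\mathcal K=\mathrm{Cat}(\mathcal E)$ be the 2-category of categories internal to $\mathcal E$, and let $X$ be a crossed internal category in $\mathcal K$. Then the codescent object of $X$ exists and $\mathrm{CoDesc}(X)=\pi_{0*}(\mathrm{Cnr}(X))$.
   Context: **Pullback-stable reflexive coequalisers.** $\mathcal E$ has coequalisers of reflexive pairs and for every $f:A\to B$ in $\mathcal E$ the pullback functor $\mathcal E/B\to\mathcal E/A$ preserves them. **$\pi_0$ and $\pi_{0*}$.** $d:\mathcal E\to\mathrm{Cat}(\mathcal E)$ is the inclusion of discrete internal categories and $\pi_0:\mathrm{Cat}(\mathcal E)\to\mathcal E$ its left adjoint, sending an internal category $Y$ to the coequaliser of its source and target maps $Y_1\rightrightarrows Y_0$. For a category object $Y$ in $\mathcal K$ with $Y_0$ discrete (an internal 2-category), $\pi_{0*}Y$ is the simplicial object $d\pi_0Y$ of $\mathcal K$; it is a componentwise discrete category object, and so is identified with an internal category in $\mathcal E$, i.e. with an object of $\mathcal K$, again denoted $\pi_{0*}Y$. **Codescent objects.** A cocone for a simplicial object $X$ in a 2-category with vertex $Z$ is $(f_0,f_1)$ with $f_0:X_0\to Z$ and a 2-cell $f_1:f_0d_1\to f_0d_0$ such that $f_1s_0=1_{f_0}$ and $(f_1d_0)(f_1d_2)=f_1d_1$. A codescent object $\mathrm{CoDesc}(X)$ is an object with a cocone $(q_0,q_1)$ such that for each cocone $(f_0,f_1)$ with vertex $Z$ there is a unique $f':\mathrm{CoDesc}(X)\to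 Z$ with $f'q_0=f_0$, $f'q_1=f_1$, and for cocones $(f_0,f_1),(g_0,g_1)$ with vertex $Z$ and $\phi:f_0\to g_0$ with $(\phi d_0)f_1=g_1(\phi d_1)$ there is a unique $\phi':f'\to g'$ with $\phi'q_0=\phi$. **Split opfibrations.** A split opfibration structure on $f:A\to B$ in a 2-category $\mathcal K$ is a split (Grothendieck) opfibration structure on each functor $\mathcal K(Y,f):\mathcal K(Y,A)\to\mathcal K(Y,B)$, such that precomposition with any $Y'\to Y$ preserves chosen opcartesian arrows; the latter are called chosen $f$-opcartesian 2-cells. A morphism $f\to g$ of split opfibrations over $B$ is a map $u$ with $gu=f$ such that $u\circ-$ preserves chosen opcartesian 2-cells. Split opfibrations compose and are stable under pullback. **Crossed internal categories.** A category object in $\mathcal K$ is a simplicial object $X$ such that for all $n$ the square $d_0d_{n+2}=d_{n+1}d_0:X_{n+2}\to X_n$ is a pullback (source $d_1$, target $d_0:X_1\to X_0$); equivalently a monad in the bicategory $\mathrm{Span}(\mathcal K)$ with underlying span $X_0\xleftarrow{d_1}X_1\xrightarrow{d_0}X_0$. A crossed internal category is a category object $X$ with a split opfibration structure on $d_0:X_1\to X_0$ such that $s_0:X_0\to X_1$ and $d_1:X_2\to X_1$ are morphisms of split opfibrations over $X_0$ from $1_{X_0}$, respectively $d_0d_0:X_2\to X_0$, to $d_0:X_1\to X_0$ (with $d_0:X_2\to X_1$ the pullback of $d_0:X_1\to X_0$ along $d_1:X_1\to X_0$). **The internal 2-category of corners.** Let $X$ be a crossed internal category in $\mathcal K=\mathrm{Cat}(\mathcal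 E)$. The cotensors of $X_0$ with $[n]=\{0<\dots<n\}$ form a category object with underlying span $X_0\xleftarrow{}X_0^{[1]}\xrightarrow{}X_0$ (domain, codomain), hence a monad in $\mathrm{Span}(\mathcal K)$. Composites of spans are by pullback; $X_0^{[1]}\circ X_1$ (first $X_1$, then $X_0^{[1]}$) is the comma object $d_0\downarrow1_{X_0}$, with projections $p_1$ to $X_1$, $q_1$ to $X_0$, and 2-cell $\lambda_1:d_0p_1\to q_1$, and legs $d_1p_1$, $q_1$; $X_1\circ X_0^{[1]}$ is the comma object $1_{X_0}\downarrow d_1$ with projections $p_2$ to $X_0$, $q_2$ to $X_1$, and 2-cell $\lambda_2:p_2\to d_1q_2$, and legs $p_2$, $d_0q_2$. Let $\lambda_3:p_1\to r$ be the chosen $d_0$-opcartesian 2-cell with $d_0\lambda_3=\lambda_1$. Then $\delta_X:X_0^{[1]}\circ X_1\to X_1\circ X_0^{[1]}$ is the unique arrow with $p_2\delta_X=d_1p_1$, $q_2\delta_X=r$, $\lambda_2\delta_X=d_1\lambda_3$; it is a distributive law between monads in $\mathrm{Span}(\mathcal K)$, so $X_1\circ X_0^{[1]}$ is a monad on $X_0$. Let $i:X_{00}\to X_0$ be the inclusion of the object of objects of $X_0$ (a discrete internal category), let $i^{\bullet}$ be the span $X_{00}\xleftarrow{1}X_{00}\xrightarrow{i}X_0$ and $i_{\bullet}$ the span $X_0\xleftarrow{i}X_{00}\xrightarrow{1}X_{00}$, so $i^{\bullet}\dashv i_{\bullet}$. Then $i_{\bullet}\circ X_1\circ X_0^{[1]}\circ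 i^{\bullet}$ is a monad on $X_{00}$ in $\mathrm{Span}(\mathcal K)$, and $\mathrm{Cnr}(X)$ is the corresponding category object in $\mathcal K$ (its object of objects $X_{00}$ is discrete, i.e. it is an internal 2-category). *)

theory Defs
  imports Main
begin

section \<open>Categories and limits\<close>

record ('o, 'a) cat =
  Ob :: "'o set"
  Ar :: "'a set"
  Dom :: "'a \<Rightarrow> 'o"
  Cod :: "'a \<Rightarrow> 'o"
  Ident :: "'o \<Rightarrow> 'a"
  Comp :: "'a \<Rightarrow> 'a \<Rightarrow> 'a"  (infixr "\<cdot>\<index>" 70)

definition hom :: "('o, 'a, 'm) cat_scheme \<Rightarrow> 'o \<Rightarrow> 'o \<Rightarrow> 'a set" where
  "hom C A B = {f \<in> Ar C. Dom C f = A \<and> Cod C f = B}"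

definition category :: "('o, 'a, 'm) cat_scheme \<Rightarrow> bool" where
  "category C \<longleftrightarrow>
     (\<forall>f\<in>Ar C. Dom C f \<in> Ob C \<and> Cod C f \<in> Ob C) \<and>
     (\<forall>A\<in>Ob C. Ident C A \<in> hom C A A) \<and>
     (\<forall>f\<in>Ar C. \<forall>g\<in>Ar C. Dom C g = Cod C f \<longrightarrow>
        g \<cdot>\<^bsub>C\<^esub> f \<in> hom C (Dom C f) (Cod C g)) \<and>
     (\<forall>f\<in>Ar C. f \<cdot>\<^bsub>C\<^esub> Ident C (Dom C f) = f \<and> Ident C (Cod C f) \<cdot>\<^bsub>C\<^esub> f = f) \<and>
     (\<forall>f\<in>Ar C. \<forall>g\<in>Ar C. \<forall>h\<in>Ar C. Dom C g = Cod C f \<and> Dom C h = Cod C g \<longrightarrow>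
        (h \<cdot>\<^bsub>C\<^esub> g) \<cdot>\<^bsub>C\<^esub> f = h \<cdot>\<^bsub>C\<^esub> (g \<cdot>\<^bsub>C\<^esub> f))"

text \<open>The pullback of \<open>f\<close> and \<open>g\<close> has projections \<open>p\<close> and \<open>q\<close> with \<open>f p = g q\<close>.\<close>

definition is_pullback :: "('o, 'a, 'm) cat_scheme \<Rightarrow> 'a \<Rightarrow> 'a \<Rightarrow> 'a \<Rightarrow> 'a \<Rightarrow> bool" where
  "is_pullback C f g p q \<longleftrightarrow>
     f \<in> Ar C \<and> g \<in> Ar C \<and> Cod C f = Cod C g \<and>
     p \<in> Ar C \<and> q \<in> Ar C \<and> Dom C p = Dom C q \<and>
     Cod C p = Dom C f \<and> Cod C q = Dom C g \<and> f \<cdot>\<^bsub>C\<^esub> p = g \<cdot>\<^bsub>C\<^esub> q \<and>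
     (\<forall>u\<in>Ar C. \<forall>v\<in>Ar C.
        Dom C u = Dom C v \<and> Cod C u = Dom C f \<and> Cod C v = Dom C g \<and> f \<cdot>\<^bsub>C\<^esub> u = g \<cdot>\<^bsub>C\<^esub> v \<longrightarrow>
        (\<exists>!w. w \<in> hom C (Dom C u) (Dom C p) \<and> p \<cdot>\<^bsub>C\<^esub> w = u \<and> q \<cdot>\<^bsub>C\<^esub> w = v))"

definition has_pullbacks :: "('o, 'a, 'm) cat_scheme \<Rightarrow> bool" where
  "has_pullbacks C \<longleftrightarrow>
     (\<forall>f\<in>Ar C. \<forall>g\<in>Ar C. Cod C f = Cod C g \<longrightarrow> (\<exists>p q. is_pullback C f g p q))"

text \<open>A chosen pullback, and the arrow \<open>\<langle>u, v\<rangle>\<close> into a pullback with projections \<open>p\<close> and \<open>q\<close>.\<close>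

definition pb :: "('o, 'a, 'm) cat_scheme \<Rightarrow> 'a \<Rightarrow> 'a \<Rightarrow> 'a \<times> 'a" where
  "pb C f g = (SOME pq. is_pullback C f g (fst pq) (snd pq))"

definition pairing :: "('o, 'a, 'm) cat_scheme \<Rightarrow> 'a \<times> 'a \<Rightarrow> 'a \<Rightarrow> 'a \<Rightarrow> 'a" where
  "pairing C pq u v =
     (THE w. w \<in> hom C (Dom C u) (Dom C (fst pq)) \<and> fst pq \<cdot>\<^bsub>C\<^esub> w = u \<and> snd pq \<cdot>\<^bsub>C\<^esub> w = v)"

definition is_coequaliser :: "('o, 'a, 'm) cat_scheme \<Rightarrow> 'a \<Rightarrow> 'a \<Rightarrow> 'a \<Rightarrow> bool" where
  "is_coequaliser C f g c \<longleftrightarrow>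
     f \<in> Ar C \<and> g \<in> Ar C \<and> Dom C f = Dom C g \<and> Cod C f = Cod C g \<and>
     c \<in> Ar C \<and> Dom C c = Cod C f \<and> c \<cdot>\<^bsub>C\<^esub> f = c \<cdot>\<^bsub>C\<^esub> g \<and>
     (\<forall>h\<in>Ar C. Dom C h = Cod C f \<and> h \<cdot>\<^bsub>C\<^esub> f = h \<cdot>\<^bsub>C\<^esub> g \<longrightarrow>
        (\<exists>!k. k \<in> hom C (Cod C c) (Cod C h) \<and> k \<cdot>\<^bsub>C\<^esub> c = h))"

definition reflexive_pair :: "('o, 'a, 'm) cat_scheme \<Rightarrow> 'a \<Rightarrow> 'a \<Rightarrow> bool" where
  "reflexive_pair C f g \<longleftrightarrow>
     f \<in> Ar C \<and> g \<in> Ar C \<and> Dom C f = Dom C g \<and> Cod C f = Cod C g \<and>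
     (\<exists>s\<in>hom C (Cod C f) (Dom C f).
        f \<cdot>\<^bsub>C\<^esub> s = Ident C (Cod C f) \<and> g \<cdot>\<^bsub>C\<^esub> s = Ident C (Cod C f))"

definition has_reflexive_coequalisers :: "('o, 'a, 'm) cat_scheme \<Rightarrow> bool" where
  "has_reflexive_coequalisers C \<longleftrightarrow>
     (\<forall>f g. reflexive_pair C f g \<longrightarrow> (\<exists>c. is_coequaliser C f g c))"

text \<open>In the slice over \<open>B\<close>, an arrow from \<open>p\<close> to \<open>q\<close> is a triple \<open>(p, q, h)\<close> with \<open>q h = p\<close>.\<close>

definition slice :: "('o, 'a, 'm) cat_scheme \<Rightarrow> 'o \<Rightarrow> ('a, 'a \<times> 'a \<times> 'a) cat" where
  "slice C B = \<lparr>
     Ob = {p \<in> Ar C. Cod C p = B},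
     Ar = {(p, q, h). p \<in> Ar C \<and> q \<in> Ar C \<and> Cod C p = B \<and> Cod C q = B \<and>
                      h \<in> hom C (Dom C p) (Dom C q) \<and> q \<cdot>\<^bsub>C\<^esub> h = p},
     Dom = (\<lambda>(p, q, h). p),
     Cod = (\<lambda>(p, q, h). q),
     Ident = (\<lambda>p. (p, p, Ident C (Dom C p))),
     Comp = (\<lambda>(q', r, k) (p, q, h). (p, r, k \<cdot>\<^bsub>C\<^esub> h)) \<rparr>"

text \<open>The action on arrows of the pullback functor \<open>C/B \<rightarrow> C/A\<close> along \<open>f : A \<rightarrow> B\<close>; on objects it
  sends \<open>p\<close> to the projection to \<open>A\<close> of the chosen pullback of \<open>f\<close> and \<open>p\<close>.\<close>

definition pullback_functor ::
    "('o, 'a, 'm) cat_scheme \<Rightarrow> 'a \<Rightarrow> 'a \<times> 'a \<times> 'a \<Rightarrow> 'a \<times> 'a \<times> 'a" where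
  "pullback_functor C f = (\<lambda>(p, q, h).
     (fst (pb C f p), fst (pb C f q),
      pairing C (pb C f q) (fst (pb C f p)) (h \<cdot>\<^bsub>C\<^esub> snd (pb C f p))))"

definition pullback_stable_reflexive_coequalisers :: "('o, 'a, 'm) cat_scheme \<Rightarrow> bool" where
  "pullback_stable_reflexive_coequalisers C \<longleftrightarrow>
     has_reflexive_coequalisers C \<and>
     (\<forall>f\<in>Ar C. \<forall>u v c.
        reflexive_pair (slice C (Cod C f)) u v \<and> is_coequaliser (slice C (Cod C f)) u v c \<longrightarrow>
        is_coequaliser (slice C (Dom C f))
          (pullback_functor C f u) (pullback_functor C f v) (pullback_functor C f c))"


section \<open>Simplicial objects and category objects\<close>

text \<open>Faces and degeneracies are indexed by the lower degree: \<open>face X n i\<close> is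
  \<open>d_i : X_{n+1} \<rightarrow> X_n\<close> for \<open>i \<le> n + 1\<close> and \<open>degen X n i\<close> is \<open>s_i : X_n \<rightarrow> X_{n+1}\<close> for \<open>i \<le> n\<close>.
  Values at other indices are irrelevant.\<close>

record ('o, 'a) simp =
  sob :: "nat \<Rightarrow> 'o"
  face :: "nat \<Rightarrow> nat \<Rightarrow> 'a"
  degen :: "nat \<Rightarrow> nat \<Rightarrow> 'a"

definition simplicial_object :: "('o, 'a, 'm) cat_scheme \<Rightarrow> ('o, 'a) simp \<Rightarrow> bool" where
  "simplicial_object C X \<longleftrightarrow>
     (\<forall>n. sob X n \<in> Ob C) \<and>
     (\<forall>n. \<forall>i\<le>n+1. face X n i \<in> hom C (sob X (n+1)) (sob X n)) \<and>
     (\<forall>n. \<forall>i\<le>n. degen X n i \<in> hom C (sob X n) (sob X (n+1))) \<and>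
     (\<forall>n i j. i \<le> j \<and> j \<le> n + 1 \<longrightarrow>
        face X n i \<cdot>\<^bsub>C\<^esub> face X (n+1) (j+1) = face X n j \<cdot>\<^bsub>C\<^esub> face X (n+1) i) \<and>
     (\<forall>n i j. i \<le> j \<and> j \<le> n \<longrightarrow>
        face X (n+1) i \<cdot>\<^bsub>C\<^esub> degen X (n+1) (j+1) = degen X n j \<cdot>\<^bsub>C\<^esub> face X n i) \<and>
     (\<forall>n. \<forall>j\<le>n. face X n j \<cdot>\<^bsub>C\<^esub> degen X n j = Ident C (sob X n) \<and>
                 face X n (j+1) \<cdot>\<^bsub>C\<^esub> degen X n j = Ident C (sob X n)) \<and>
     (\<forall>n i j. j < i \<and> i \<le> n + 1 \<longrightarrow>
        face X (n+1) (i+1) \<cdot>\<^bsub>C\<^esub> degen X (n+1) j = degen X n j \<cdot>\<^bsub>C\<^esub> face X n i) \<and>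
     (\<forall>n i j. i \<le> j \<and> j \<le> n \<longrightarrow>
        degen X (n+1) i \<cdot>\<^bsub>C\<^esub> degen X n j = degen X (n+1) (j+1) \<cdot>\<^bsub>C\<^esub> degen X n i)"

text \<open>The source of a category object is \<open>d_1\<close>, its target is \<open>d_0\<close>, and a composable pair
  \<open>(d_2 x, d_0 x)\<close>, first arrow first, has composite \<open>d_1 x\<close>.
  In the 2-category of internal categories below, pullbacks of the underlying category
  automatically have the two-dimensional universal property, since cotensors with \<open>[1]\<close> exist.\<close>

definition category_object :: "('o, 'a, 'm) cat_scheme \<Rightarrow> ('o, 'a) simp \<Rightarrow> bool" where
  "category_object C X \<longleftrightarrow>
     simplicial_object C X \<and>
     (\<forall>n. is_pullback C (face X n 0) (face X n (n+1)) (face X (n+1) (n+2)) (face X (n+1) 0))"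

definition compose_pair :: "('o, 'a, 'm) cat_scheme \<Rightarrow> ('o, 'a) simp \<Rightarrow> 'a \<Rightarrow> 'a \<Rightarrow> 'a" where
  "compose_pair C X a b = face X 1 1 \<cdot>\<^bsub>C\<^esub> pairing C (face X 1 2, face X 1 0) a b"

definition disc :: "('o, 'a, 'm) cat_scheme \<Rightarrow> 'o \<Rightarrow> ('o, 'a) simp" where
  "disc C A = \<lparr> sob = (\<lambda>n. A), face = (\<lambda>n i. Ident C A), degen = (\<lambda>n i. Ident C A) \<rparr>"


section \<open>2-categories\<close>

text \<open>Strict 2-categories, with horizontal composition given by whiskering: \<open>g \<rhd> \<alpha>\<close> is the arrow
  \<open>g\<close> after the 2-cell \<open>\<alpha>\<close>, and \<open>\<alpha> \<lhd> f\<close> is the 2-cell \<open>\<alpha>\<close> after the arrow \<open>f\<close>.\<close>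

record ('o, 'a, 't) two_cat = "('o, 'a) cat" +
  Cell :: "'t set"
  Src :: "'t \<Rightarrow> 'a"
  Trg :: "'t \<Rightarrow> 'a"
  Ident2 :: "'a \<Rightarrow> 't"
  VComp :: "'t \<Rightarrow> 't \<Rightarrow> 't"  (infixr "\<bullet>\<index>" 65)
  LWhisk :: "'a \<Rightarrow> 't \<Rightarrow> 't"  (infixr "\<rhd>\<index>" 70)
  RWhisk :: "'t \<Rightarrow> 'a \<Rightarrow> 't"  (infixl "\<lhd>\<index>" 71)

definition cells :: "('o, 'a, 't, 'm) two_cat_scheme \<Rightarrow> 'a \<Rightarrow> 'a \<Rightarrow> 't set" where
  "cells K f g = {\<alpha> \<in> Cell K. Src K \<alpha> = f \<and> Trg K \<alpha> = g}"


subsection \<open>The 2-category of internal categories\<close>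

record ('o, 'a) sfun =
  fdom :: "('o, 'a) simp"
  fcod :: "('o, 'a) simp"
  fmap :: "nat \<Rightarrow> 'a"

definition internal_functor :: "('o, 'a, 'm) cat_scheme \<Rightarrow> ('o, 'a) sfun \<Rightarrow> bool" where
  "internal_functor C F \<longleftrightarrow>
     category_object C (fdom F) \<and> category_object C (fcod F) \<and>
     (\<forall>n. fmap F n \<in> hom C (sob (fdom F) n) (sob (fcod F) n)) \<and>
     (\<forall>n. \<forall>i\<le>n+1. face (fcod F) n i \<cdot>\<^bsub>C\<^esub> fmap F (n+1) = fmap F n \<cdot>\<^bsub>C\<^esub> face (fdom F) n i) \<and>
     (\<forall>n. \<forall>i\<le>n. degen (fcod F) n i \<cdot>\<^bsub>C\<^esub> fmap F n = fmap F (n+1) \<cdot>\<^bsub>C\<^esub> degen (fdom F) n i)"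

record ('o, 'a) snat =
  nsrc :: "('o, 'a) sfun"
  ntrg :: "('o, 'a) sfun"
  ncomp :: "'a"

definition internal_nat_trans :: "('o, 'a, 'm) cat_scheme \<Rightarrow> ('o, 'a) snat \<Rightarrow> bool" where
  "internal_nat_trans C \<alpha> \<longleftrightarrow>
     (let F = nsrc \<alpha>; G = ntrg \<alpha>; X = fdom F; Y = fcod F in
      internal_functor C F \<and> internal_functor C G \<and> fdom G = X \<and> fcod G = Y \<and>
      ncomp \<alpha> \<in> hom C (sob X 0) (sob Y 1) \<and>
      face Y 0 1 \<cdot>\<^bsub>C\<^esub> ncomp \<alpha> = fmap F 0 \<and> face Y 0 0 \<cdot>\<^bsub>C\<^esub> ncomp \<alpha> = fmap G 0 \<and>
      compose_pair C Y (fmap F 1) (ncomp \<alpha> \<cdot>\<^bsub>C\<^esub> face X 0 0) =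
      compose_pair C Y (ncomp \<alpha> \<cdot>\<^bsub>C\<^esub> face X 0 1) (fmap G 1))"

definition comp_functor ::
    "('o, 'a, 'm) cat_scheme \<Rightarrow> ('o, 'a) sfun \<Rightarrow> ('o, 'a) sfun \<Rightarrow> ('o, 'a) sfun" where
  "comp_functor C G F =
     \<lparr> fdom = fdom F, fcod = fcod G, fmap = (\<lambda>n. fmap G n \<cdot>\<^bsub>C\<^esub> fmap F n) \<rparr>"

definition Cat ::
    "('o, 'a, 'm) cat_scheme \<Rightarrow> (('o, 'a) simp, ('o, 'a) sfun, ('o, 'a) snat) two_cat" where
  "Cat C = \<lparr>
     Ob = {X. category_object C X},
     Ar = {F. internal_functor C F},
     Dom = fdom,
     Cod = fcod,
     Ident = (\<lambda>X. \<lparr> fdom = X, fcod = X, fmap = (\<lambda>n. Ident C (sob X n)) \<rparr>),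
     Comp = comp_functor C,
     Cell = {\<alpha>. internal_nat_trans C \<alpha>},
     Src = nsrc,
     Trg = ntrg,
     Ident2 = (\<lambda>F. \<lparr> nsrc = F, ntrg = F, ncomp = degen (fcod F) 0 0 \<cdot>\<^bsub>C\<^esub> fmap F 0 \<rparr>),
     VComp = (\<lambda>\<beta> \<alpha>. \<lparr> nsrc = nsrc \<alpha>, ntrg = ntrg \<beta>,
                      ncomp = compose_pair C (fcod (nsrc \<alpha>)) (ncomp \<alpha>) (ncomp \<beta>) \<rparr>),
     LWhisk = (\<lambda>G \<alpha>. \<lparr> nsrc = comp_functor C G (nsrc \<alpha>), ntrg = comp_functor C G (ntrg \<alpha>),
                       ncomp = fmap G 1 \<cdot>\<^bsub>C\<^esub> ncomp \<alpha> \<rparr>),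
     RWhisk = (\<lambda>\<alpha> F. \<lparr> nsrc = comp_functor C (nsrc \<alpha>) F, ntrg = comp_functor C (ntrg \<alpha>) F,
                       ncomp = ncomp \<alpha> \<cdot>\<^bsub>C\<^esub> fmap F 0 \<rparr>) \<rparr>"


subsection \<open>Codescent objects\<close>

definition codescent_cocone ::
    "('o, 'a, 't, 'm) two_cat_scheme \<Rightarrow> ('o, 'a) simp \<Rightarrow> 'o \<Rightarrow> 'a \<Rightarrow> 't \<Rightarrow> bool" where
  "codescent_cocone K X Z f0 f1 \<longleftrightarrow>
     Z \<in> Ob K \<and> f0 \<in> hom K (sob X 0) Z \<and>
     f1 \<in> cells K (f0 \<cdot>\<^bsub>K\<^esub> face X 0 1) (f0 \<cdot>\<^bsub>K\<^esub> face X 0 0) \<and>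
     f1 \<lhd>\<^bsub>K\<^esub> degen X 0 0 = Ident2 K f0 \<and>
     (f1 \<lhd>\<^bsub>K\<^esub> face X 1 0) \<bullet>\<^bsub>K\<^esub> (f1 \<lhd>\<^bsub>K\<^esub> face X 1 2) = f1 \<lhd>\<^bsub>K\<^esub> face X 1 1"

definition is_codescent_object ::
    "('o, 'a, 't, 'm) two_cat_scheme \<Rightarrow> ('o, 'a) simp \<Rightarrow> 'o \<Rightarrow> 'a \<Rightarrow> 't \<Rightarrow> bool" where
  "is_codescent_object K X Q q0 q1 \<longleftrightarrow>
     codescent_cocone K X Q q0 q1 \<and>
     (\<forall>Z f0 f1. codescent_cocone K X Z f0 f1 \<longrightarrow>
        (\<exists>!f'. f' \<in> hom K Q Z \<and> f' \<cdot>\<^bsub>K\<^esub> q0 = f0 \<and> f' \<rhd>\<^bsub>K\<^esub> q1 = f1)) \<and>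
     (\<forall>Z f0 f1 g0 g1 \<phi> f' g'.
        codescent_cocone K X Z f0 f1 \<and> codescent_cocone K X Z g0 g1 \<and>
        \<phi> \<in> cells K f0 g0 \<and>
        (\<phi> \<lhd>\<^bsub>K\<^esub> face X 0 0) \<bullet>\<^bsub>K\<^esub> f1 = g1 \<bullet>\<^bsub>K\<^esub> (\<phi> \<lhd>\<^bsub>K\<^esub> face X 0 1) \<and>
        f' \<in> hom K Q Z \<and> f' \<cdot>\<^bsub>K\<^esub> q0 = f0 \<and> f' \<rhd>\<^bsub>K\<^esub> q1 = f1 \<and>
        g' \<in> hom K Q Z \<and> g' \<cdot>\<^bsub>K\<^esub> q0 = g0 \<and> g' \<rhd>\<^bsub>K\<^esub> q1 = g1 \<longrightarrow>
        (\<exists>!\<phi>'. \<phi>' \<in> cells K f' g' \<and> \<phi>' \<lhd>\<^bsub>K\<^esub> q0 = \<phi>))"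


subsection \<open>Split opfibrations and crossed internal categories\<close>

text \<open>\<open>\<phi>\<close> is opcartesian for the functor \<open>K(Y, f) : K(Y, A) \<rightarrow> K(Y, B)\<close>, where \<open>f : A \<rightarrow> B\<close> and
  \<open>Y\<close> is the domain of the source and target of \<open>\<phi>\<close>.\<close>

definition opcartesian :: "('o, 'a, 't, 'm) two_cat_scheme \<Rightarrow> 'a \<Rightarrow> 't \<Rightarrow> bool" where
  "opcartesian K f \<phi> \<longleftrightarrow>
     \<phi> \<in> Cell K \<and> Cod K (Src K \<phi>) = Dom K f \<and>
     (\<forall>\<psi>\<in>Cell K. \<forall>\<gamma>\<in>Cell K.
        Src K \<psi> = Src K \<phi> \<and> \<gamma> \<in> cells K (f \<cdot>\<^bsub>K\<^esub> Trg K \<phi>) (f \<cdot>\<^bsub>K\<^esub> Trg K \<psi>) \<and>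
        \<gamma> \<bullet>\<^bsub>K\<^esub> (f \<rhd>\<^bsub>K\<^esub> \<phi>) = f \<rhd>\<^bsub>K\<^esub> \<psi> \<longrightarrow>
        (\<exists>!\<chi>. \<chi> \<in> cells K (Trg K \<phi>) (Trg K \<psi>) \<and> \<chi> \<bullet>\<^bsub>K\<^esub> \<phi> = \<psi> \<and> f \<rhd>\<^bsub>K\<^esub> \<chi> = \<gamma>))"

text \<open>A split opfibration structure on \<open>f\<close> is given by the class \<open>D\<close> of its chosen opcartesian
  2-cells: every lifting problem has exactly one solution in \<open>D\<close>, the identities and composites of
  chosen 2-cells are chosen (the structure is split), and \<open>D\<close> is stable under precomposition.\<close>

definition split_opfibration ::
    "('o, 'a, 't, 'm) two_cat_scheme \<Rightarrow> 'a \<Rightarrow> 't set \<Rightarrow> bool" where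
  "split_opfibration K f D \<longleftrightarrow>
     f \<in> Ar K \<and>
     (\<forall>\<phi>\<in>D. opcartesian K f \<phi>) \<and>
     (\<forall>a\<in>Ar K. \<forall>\<beta>\<in>Cell K. Cod K a = Dom K f \<and> Src K \<beta> = f \<cdot>\<^bsub>K\<^esub> a \<longrightarrow>
        (\<exists>!\<phi>. \<phi> \<in> D \<and> Src K \<phi> = a \<and> f \<rhd>\<^bsub>K\<^esub> \<phi> = \<beta>)) \<and>
     (\<forall>a\<in>Ar K. Cod K a = Dom K f \<longrightarrow> Ident2 K a \<in> D) \<and>
     (\<forall>\<phi>\<in>D. \<forall>\<psi>\<in>D. Src K \<psi> = Trg K \<phi> \<longrightarrow> \<psi> \<bullet>\<^bsub>K\<^esub> \<phi> \<in> D) \<and>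
     (\<forall>\<phi>\<in>D. \<forall>y\<in>Ar K. Cod K y = Dom K (Src K \<phi>) \<longrightarrow> \<phi> \<lhd>\<^bsub>K\<^esub> y \<in> D)"

text \<open>The chosen 2-cells of the identity opfibration on \<open>B\<close>, of a composite \<open>g f\<close> of split
  opfibrations, and of a pullback whose projection to the total object of the given split
  opfibration is \<open>q : P \<rightarrow> A\<close>.\<close>

definition identity_opfib :: "('o, 'a, 't, 'm) two_cat_scheme \<Rightarrow> 'o \<Rightarrow> 't set" where
  "identity_opfib K B = {\<phi> \<in> Cell K. Cod K (Src K \<phi>) = B}"

definition composite_opfib ::
    "('o, 'a, 't, 'm) two_cat_scheme \<Rightarrow> 'a \<Rightarrow> 't set \<Rightarrow> 't set \<Rightarrow> 't set" where
  "composite_opfib K f Df Dg = {\<phi> \<in> Df. f \<rhd>\<^bsub>K\<^esub> \<phi> \<in> Dg}"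

definition pullback_opfib ::
    "('o, 'a, 't, 'm) two_cat_scheme \<Rightarrow> 'a \<Rightarrow> 't set \<Rightarrow> 't set" where
  "pullback_opfib K q D = {\<phi> \<in> Cell K. Cod K (Src K \<phi>) = Dom K q \<and> q \<rhd>\<^bsub>K\<^esub> \<phi> \<in> D}"

definition split_opfibration_morphism ::
    "('o, 'a, 't, 'm) two_cat_scheme \<Rightarrow> 'a \<Rightarrow> 't set \<Rightarrow> 'a \<Rightarrow> 't set \<Rightarrow> 'a \<Rightarrow> bool" where
  "split_opfibration_morphism K f Df g Dg u \<longleftrightarrow>
     u \<in> hom K (Dom K f) (Dom K g) \<and> g \<cdot>\<^bsub>K\<^esub> u = f \<and> (\<forall>\<phi>\<in>Df. u \<rhd>\<^bsub>K\<^esub> \<phi> \<in> Dg)"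

text \<open>A crossed internal category is \<open>X\<close> together with the split opfibration structure \<open>D\<close> on
  \<open>d_0 : X_1 \<rightarrow> X_0\<close>. The arrow \<open>d_0 : X_2 \<rightarrow> X_1\<close> is the pullback of \<open>d_0 : X_1 \<rightarrow> X_0\<close> along
  \<open>d_1 : X_1 \<rightarrow> X_0\<close>, with other projection \<open>d_2 : X_2 \<rightarrow> X_1\<close>.\<close>

definition crossed_internal_category ::
    "('o, 'a, 't, 'm) two_cat_scheme \<Rightarrow> ('o, 'a) simp \<Rightarrow> 't set \<Rightarrow> bool" where
  "crossed_internal_category K X D \<longleftrightarrow>
     category_object K X \<and>
     split_opfibration K (face X 0 0) D \<and>
     split_opfibration_morphism K
       (Ident K (sob X 0)) (identity_opfib K (sob X 0)) (face X 0 0) D (degen X 0 0) \<and>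
     split_opfibration_morphism K
       (face X 0 0 \<cdot>\<^bsub>K\<^esub> face X 1 0)
       (composite_opfib K (face X 1 0) (pullback_opfib K (face X 1 2) D) D)
       (face X 0 0) D (face X 1 1)"


section \<open>Monads in the bicategory of spans\<close>

text \<open>A span is given by its legs. For composites of spans the chosen pullbacks are used: with \<open>S\<close>
  first and then \<open>T\<close>, the apex of the composite \<open>T \<circ> S\<close> has projections \<open>span_proj C T S\<close> to the
  apexes of \<open>S\<close> and \<open>T\<close>, in this order.\<close>

record 'a span =
  lleg :: 'a
  rleg :: 'a

definition span_proj ::
    "('o, 'a, 'm) cat_scheme \<Rightarrow> ('a, 'n) span_scheme \<Rightarrow> ('a, 'k) span_scheme \<Rightarrow> 'a \<times> 'a" where
  "span_proj C T S = pb C (rleg S) (lleg T)"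

definition span_comp ::
    "('o, 'a, 'm) cat_scheme \<Rightarrow> ('a, 'n) span_scheme \<Rightarrow> ('a, 'k) span_scheme \<Rightarrow> 'a span" where
  "span_comp C T S =
     \<lparr> lleg = lleg S \<cdot>\<^bsub>C\<^esub> fst (span_proj C T S), rleg = rleg T \<cdot>\<^bsub>C\<^esub> snd (span_proj C T S) \<rparr>"

text \<open>The data of a monad in the bicategory of spans. The unit goes from the base object to the
  apex, and the multiplication goes to the apex from the apex of the composite of the span with
  itself.\<close>

record 'a span_monad = "'a span" +
  munit :: 'a
  mmult :: 'a

definition monad_of_category_object ::
    "('o, 'a, 'm) cat_scheme \<Rightarrow> ('o, 'a) simp \<Rightarrow> 'a span_monad" where
  "monad_of_category_object C X =
     (let (a, b) = pb C (face X 0 0) (face X 0 1) in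
      \<lparr> lleg = face X 0 1, rleg = face X 0 0, munit = degen X 0 0,
        mmult = compose_pair C X a b \<rparr>)"

text \<open>The monad \<open>T \<circ> S\<close> induced by a distributive law \<open>\<delta> : S \<circ> T \<rightarrow> T \<circ> S\<close>. Its multiplication
  \<open>T \<circ> S \<circ> T \<circ> S \<rightarrow> T \<circ> T \<circ> S \<circ> S \<rightarrow> T \<circ> S\<close> applies \<open>\<delta>\<close> in the middle and then the
  multiplications of \<open>S\<close> and \<open>T\<close>. Here \<open>u\<close> and \<open>v\<close> are the projections to the first and second
  copy of \<open>T \<circ> S\<close>, so that the four factors, in the order in which they are composed, are
  \<open>a u\<close>, \<open>b u\<close>, \<open>a v\<close>, \<open>b v\<close>.\<close>

definition composite_monad ::
    "('o, 'a, 'm) cat_scheme \<Rightarrow> 'a span_monad \<Rightarrow> 'a span_monad \<Rightarrow> 'a \<Rightarrow> 'a span_monad" where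
  "composite_monad C T S \<delta> =
     (let (a, b) = span_proj C T S;
          N = span_comp C T S;
          (u, v) = span_proj C N N;
          w = \<delta> \<cdot>\<^bsub>C\<^esub> pairing C (span_proj C S T) (b \<cdot>\<^bsub>C\<^esub> u) (a \<cdot>\<^bsub>C\<^esub> v)
      in \<lparr> lleg = lleg N, rleg = rleg N,
           munit = pairing C (a, b) (munit S) (munit T),
           mmult = pairing C (a, b)
             (mmult S \<cdot>\<^bsub>C\<^esub> pairing C (span_proj C S S) (a \<cdot>\<^bsub>C\<^esub> u) (a \<cdot>\<^bsub>C\<^esub> w))
             (mmult T \<cdot>\<^bsub>C\<^esub> pairing C (span_proj C T T) (b \<cdot>\<^bsub>C\<^esub> w) (b \<cdot>\<^bsub>C\<^esub> v)) \<rparr>)"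

text \<open>For \<open>i : B \<rightarrow> A\<close>, the spans \<open>(1, i)\<close> from \<open>B\<close> to \<open>A\<close> and \<open>(i, 1)\<close> from \<open>A\<close> to \<open>B\<close>.\<close>

definition upper_span :: "('o, 'a, 'm) cat_scheme \<Rightarrow> 'a \<Rightarrow> 'a span" where
  "upper_span C i = \<lparr> lleg = Ident C (Dom C i), rleg = i \<rparr>"

definition lower_span :: "('o, 'a, 'm) cat_scheme \<Rightarrow> 'a \<Rightarrow> 'a span" where
  "lower_span C i = \<lparr> lleg = i, rleg = Ident C (Dom C i) \<rparr>"

text \<open>The monad \<open>i\<^sub>\<bullet> \<circ> N \<circ> i\<^sup>\<bullet>\<close> on \<open>B\<close> for a monad \<open>N\<close> on \<open>A\<close>. An arrow into its apex is determined by
  its composites with the two legs and with the projection \<open>n\<close> to the apex of \<open>N\<close>. The unit is that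
  of the adjunction, the diagonal, followed by the unit of \<open>N\<close>; the multiplication is the
  counit, given by \<open>i\<close>, followed by the multiplication of \<open>N\<close>.\<close>

definition restricted_monad ::
    "('o, 'a, 'm) cat_scheme \<Rightarrow> 'a \<Rightarrow> 'a span_monad \<Rightarrow> 'a span_monad" where
  "restricted_monad C i N =
     (let M = span_comp C N (upper_span C i);
          R = span_comp C (lower_span C i) M;
          n = snd (span_proj C N (upper_span C i)) \<cdot>\<^bsub>C\<^esub> fst (span_proj C (lower_span C i) M);
          (u, v) = span_proj C R R
      in \<lparr> lleg = lleg R, rleg = rleg R,
           munit = (THE e. e \<in> hom C (Dom C i) (Dom C (lleg R)) \<and>
              lleg R \<cdot>\<^bsub>C\<^esub> e = Ident C (Dom C i) \<and> rleg R \<cdot>\<^bsub>C\<^esub> e = Ident C (Dom C i) \<and>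
              n \<cdot>\<^bsub>C\<^esub> e = munit N \<cdot>\<^bsub>C\<^esub> i),
           mmult = (THE m. m \<in> hom C (Dom C u) (Dom C (lleg R)) \<and>
              lleg R \<cdot>\<^bsub>C\<^esub> m = lleg R \<cdot>\<^bsub>C\<^esub> u \<and> rleg R \<cdot>\<^bsub>C\<^esub> m = rleg R \<cdot>\<^bsub>C\<^esub> v \<and>
              n \<cdot>\<^bsub>C\<^esub> m = mmult N \<cdot>\<^bsub>C\<^esub> pairing C (span_proj C N N) (n \<cdot>\<^bsub>C\<^esub> u) (n \<cdot>\<^bsub>C\<^esub> v)) \<rparr>)"

text \<open>\<open>\<kappa> : s \<rightarrow> t : P \<rightarrow> A\<close> exhibits \<open>P\<close> as the cotensor of \<open>A\<close> with \<open>[1]\<close>.\<close>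

definition is_cotensor :: "('o, 'a, 't, 'm) two_cat_scheme \<Rightarrow> 'o \<Rightarrow> 't \<Rightarrow> bool" where
  "is_cotensor K A \<kappa> \<longleftrightarrow>
     (let s = Src K \<kappa>; t = Trg K \<kappa>; P = Dom K s in
      \<kappa> \<in> Cell K \<and> Cod K s = A \<and>
      (\<forall>\<alpha>\<in>Cell K. Cod K (Src K \<alpha>) = A \<longrightarrow>
         (\<exists>!h. h \<in> hom K (Dom K (Src K \<alpha>)) P \<and> \<kappa> \<lhd>\<^bsub>K\<^esub> h = \<alpha>)) \<and>
      (\<forall>Z. \<forall>h\<in>hom K Z P. \<forall>k\<in>hom K Z P.
         \<forall>\<sigma>\<in>cells K (s \<cdot>\<^bsub>K\<^esub> h) (s \<cdot>\<^bsub>K\<^esub> k). \<forall>\<tau>\<in>cells K (t \<cdot>\<^bsub>K\<^esub> h) (t \<cdot>\<^bsub>K\<^esub> k).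
         (\<kappa> \<lhd>\<^bsub>K\<^esub> k) \<bullet>\<^bsub>K\<^esub> \<sigma> = \<tau> \<bullet>\<^bsub>K\<^esub> (\<kappa> \<lhd>\<^bsub>K\<^esub> h) \<longrightarrow>
         (\<exists>!\<xi>. \<xi> \<in> cells K h k \<and> s \<rhd>\<^bsub>K\<^esub> \<xi> = \<sigma> \<and> t \<rhd>\<^bsub>K\<^esub> \<xi> = \<tau>)))"

definition cotensor_cell :: "('o, 'a, 't, 'm) two_cat_scheme \<Rightarrow> 'o \<Rightarrow> 't" where
  "cotensor_cell K A = (SOME \<kappa>. is_cotensor K A \<kappa>)"

definition cotensor_arrow :: "('o, 'a, 't, 'm) two_cat_scheme \<Rightarrow> 't \<Rightarrow> 't \<Rightarrow> 'a" where
  "cotensor_arrow K \<kappa> \<alpha> =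
     (THE h. h \<in> hom K (Dom K (Src K \<alpha>)) (Dom K (Src K \<kappa>)) \<and> \<kappa> \<lhd>\<^bsub>K\<^esub> h = \<alpha>)"

text \<open>The monad of the category object of cotensors with \<open>[n]\<close>. The cotensor with \<open>[2]\<close> is the pullback
  of composable pairs, on which the multiplication represents vertical composition.\<close>

definition cotensor_monad :: "('o, 'a, 't, 'm) two_cat_scheme \<Rightarrow> 'o \<Rightarrow> 'a span_monad" where
  "cotensor_monad K A =
     (let \<kappa> = cotensor_cell K A;
          (a, b) = pb K (Trg K \<kappa>) (Src K \<kappa>)
      in \<lparr> lleg = Src K \<kappa>, rleg = Trg K \<kappa>,
           munit = cotensor_arrow K \<kappa> (Ident2 K (Ident K A)),
           mmult = cotensor_arrow K \<kappa> ((\<kappa> \<lhd>\<^bsub>K\<^esub> b) \<bullet>\<^bsub>K\<^esub> (\<kappa> \<lhd>\<^bsub>K\<^esub> a)) \<rparr>)"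


section \<open>Corners\<close>

text \<open>With \<open>T = X_1\<close> and \<open>S = X_0^[1]\<close>, the composite span \<open>S \<circ> T\<close> is the comma object of \<open>d_0\<close> and
  \<open>1\<close> via \<open>p1\<close>, \<open>l1\<close>, and \<open>T \<circ> S\<close> is the comma object of \<open>1\<close> and \<open>d_1\<close> via \<open>p2\<close>, \<open>q2\<close>, \<open>l2\<close>:
  the pullback projections \<open>c1\<close> and \<open>c2\<close> to the cotensor correspond to the 2-cells \<open>l1\<close> and \<open>l2\<close>.\<close>

definition corner_law ::
    "('o, 'a, 't, 'm) two_cat_scheme \<Rightarrow> ('o, 'a) simp \<Rightarrow> 't set \<Rightarrow> 'a" where
  "corner_law K X D =
     (let T = monad_of_category_object K X;
          S = cotensor_monad K (sob X 0);
          \<kappa> = cotensor_cell K (sob X 0);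
          (p1, c1) = span_proj K S T;
          l1 = \<kappa> \<lhd>\<^bsub>K\<^esub> c1;
          (c2, q2) = span_proj K T S;
          p2 = Src K \<kappa> \<cdot>\<^bsub>K\<^esub> c2;
          l2 = \<kappa> \<lhd>\<^bsub>K\<^esub> c2;
          l3 = (THE \<phi>. \<phi> \<in> D \<and> Src K \<phi> = p1 \<and> face X 0 0 \<rhd>\<^bsub>K\<^esub> \<phi> = l1);
          r = Trg K l3
      in THE \<delta>. \<delta> \<in> hom K (Dom K p1) (Dom K q2) \<and>
           p2 \<cdot>\<^bsub>K\<^esub> \<delta> = face X 0 1 \<cdot>\<^bsub>K\<^esub> p1 \<and> q2 \<cdot>\<^bsub>K\<^esub> \<delta> = r \<and>
           l2 \<lhd>\<^bsub>K\<^esub> \<delta> = face X 0 1 \<rhd>\<^bsub>K\<^esub> l3)"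

text \<open>The inclusion of the object of objects of an internal category; in degree \<open>n\<close> it is the
  iterated degeneracy \<open>X_0 \<rightarrow> X_n\<close>.\<close>

primrec iterated_degen :: "('o, 'a, 'm) cat_scheme \<Rightarrow> ('o, 'a) simp \<Rightarrow> nat \<Rightarrow> 'a" where
  "iterated_degen C X 0 = Ident C (sob X 0)"
| "iterated_degen C X (Suc n) = degen X n 0 \<cdot>\<^bsub>C\<^esub> iterated_degen C X n"

definition objects_inclusion :: "('o, 'a, 'm) cat_scheme \<Rightarrow> ('o, 'a) simp \<Rightarrow> ('o, 'a) sfun" where
  "objects_inclusion C X =
     \<lparr> fdom = disc C (sob X 0), fcod = X, fmap = iterated_degen C X \<rparr>"

definition corner_monad ::
    "('o, 'a, 'm) cat_scheme \<Rightarrow> (('o, 'a) simp, ('o, 'a) sfun) simp \<Rightarrow> ('o, 'a) snat set \<Rightarrow>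
     ('o, 'a) sfun span_monad" where
  "corner_monad E X D =
     restricted_monad (Cat E) (objects_inclusion E (sob X 0))
       (composite_monad (Cat E)
          (monad_of_category_object (Cat E) X) (cotensor_monad (Cat E) (sob X 0))
          (corner_law (Cat E) X D))"

text \<open>\<open>Y\<close> is the category object corresponding to the corner monad. It is determined up to unique
  isomorphism under \<open>Y_0\<close> and \<open>Y_1\<close>: the degrees above 1 are only fixed as pullbacks.\<close>

definition is_Cnr ::
    "('o, 'a, 'm) cat_scheme \<Rightarrow> (('o, 'a) simp, ('o, 'a) sfun) simp \<Rightarrow> ('o, 'a) snat set \<Rightarrow>
     (('o, 'a) simp, ('o, 'a) sfun) simp \<Rightarrow> bool" where
  "is_Cnr E X D Y \<longleftrightarrow>
     category_object (Cat E) Y \<and> sob Y 0 = disc E (sob (sob X 0) 0) \<and>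
     monad_of_category_object (Cat E) Y = corner_monad E X D"


section \<open>Connected components\<close>

definition pi0_proj :: "('o, 'a, 'm) cat_scheme \<Rightarrow> ('o, 'a) simp \<Rightarrow> 'a" where
  "pi0_proj E A = (SOME c. is_coequaliser E (face A 0 1) (face A 0 0) c)"

definition pi0 :: "('o, 'a, 'm) cat_scheme \<Rightarrow> ('o, 'a) simp \<Rightarrow> 'o" where
  "pi0 E A = Cod E (pi0_proj E A)"

definition pi0_map :: "('o, 'a, 'm) cat_scheme \<Rightarrow> ('o, 'a) sfun \<Rightarrow> 'a" where
  "pi0_map E F =
     (THE h. h \<in> hom E (pi0 E (fdom F)) (pi0 E (fcod F)) \<and>
             h \<cdot>\<^bsub>E\<^esub> pi0_proj E (fdom F) = pi0_proj E (fcod F) \<cdot>\<^bsub>E\<^esub> fmap F 0)"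

definition pi0_star ::
    "('o, 'a, 'm) cat_scheme \<Rightarrow> (('o, 'a) simp, ('o, 'a) sfun) simp \<Rightarrow> ('o, 'a) simp" where
  "pi0_star E Y = \<lparr>
     sob = (\<lambda>n. pi0 E (sob Y n)),
     face = (\<lambda>n i. pi0_map E (face Y n i)),
     degen = (\<lambda>n i. pi0_map E (degen Y n i)) \<rparr>"

end

theory Submission
  imports Defs
begin

text \<open>
  An object of \<open>Y_1\<close>, for \<open>Y = Cnr(X)\<close>, is a corner: an arrow \<open>v\<close> of \<open>X_0\<close> followed by an object \<open>h\<close> of
  \<open>X_1\<close> whose source is the target of \<open>v\<close>. A composite of corners rewrites \<open>h\<close> followed by \<open>v'\<close> to
  \<open>d_1 \<lambda>\<close> followed by the target of \<open>\<lambda>\<close>, where \<open>\<lambda>\<close> is the chosen lift of \<open>v'\<close> at \<open>h\<close>; hence every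
  corner is the composite of a vertical corner \<open>(v, 1)\<close> and a horizontal corner \<open>(1, h)\<close>. An arrow \<open>\<sigma>\<close>
  of \<open>X_1\<close> factors as a chosen lift followed by an arrow over an identity, and the latter is an arrow
  of \<open>Y_1\<close>. So passing to components in \<open>Y_1\<close> makes the vertical and horizontal corners commute along
  every \<open>\<sigma>\<close>, which is the naturality of the universal cocone.

  Conversely a cocone \<open>(f_0, f_1)\<close> sends the corner \<open>(v, h)\<close> to \<open>f_1 h\<close> after \<open>f_0 v\<close>. Naturality of \<open>f_1\<close>
  makes this constant on components and, applied to \<open>\<lambda>\<close>, compatible with composition. Since reflexive
  coequalisers are stable under pullback, \<open>\<pi>_0\<close> preserves the pullbacks over the discrete object \<open>Y_0\<close>,
  so that \<open>\<pi>_0 Y\<close> is again an internal category.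

  Internal categories are handled through generalized elements: \<open>x : U \<rightarrow> A\<close> is treated as an element of \<open>A\<close>,
  and an internal category is reconstructed from a composition operation on such elements as a nerve.
\<close>

text \<open>A category object is a whole simplicial object, so every functor and every constructed
  category needs data in all degrees, while the mathematics lives in degrees 0 and 1. Two devices
  remove the rest: \<open>nerve\<close> builds the simplicial object from a composition on elements,
  and \<open>mkfun\<close> extends a functor through the Segal pullbacks. The corner construction is
  carried out in an abstract 2-category with pullbacks and cotensors. The passage to elements of E
  is made by discrete categories: a functor from the discrete category on U to A is an element of
  A_0 over U, and a 2-cell between two such functors is an element of A_1 over U. Under this
  dictionary the chosen opcartesian 2-cells become an operation \<open>lam\<close> on elements of
  X_1. The obstacle for \<pi>_0 is that a Segal square of Y is a pullback over Y_n, in general not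
  discrete; such squares are replaced by the pullbacks of Y_n and Y_1 over Y_0. Composition in
  \<pi>_0 Y can then be computed on objects of Y_2, because \<pi>_0 of Y_2 is the object of
  composable pairs.\<close>

declare One_nat_def [simp del]

lemma hom_iff [simp]: "f \<in> hom C A B \<longleftrightarrow> f \<in> Ar C \<and> Dom C f = A \<and> Cod C f = B"
  by (simp add: hom_def)

section \<open>Right-nested composites and pullbacks\<close>

locale category_context =
  fixes C :: "('o, 'a, 'm) cat_scheme" (structure)
  assumes is_category: "category C"
begin

lemma Dom_Ob [simp]: "f \<in> Ar C \<Longrightarrow> Dom C f \<in> Ob C"
  and Cod_Ob [simp]: "f \<in> Ar C \<Longrightarrow> Cod C f \<in> Ob C"
  using is_category by (auto simp: category_def)

lemma Ident_Ar [simp]: "A \<in> Ob C \<Longrightarrow> Ident C A \<in> Ar C"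
  and Dom_Ident [simp]: "A \<in> Ob C \<Longrightarrow> Dom C (Ident C A) = A"
  and Cod_Ident [simp]: "A \<in> Ob C \<Longrightarrow> Cod C (Ident C A) = A"
  using is_category by (auto simp: category_def)

lemma comp_Ar [simp]: "f \<in> Ar C \<Longrightarrow> g \<in> Ar C \<Longrightarrow> Dom C g = Cod C f \<Longrightarrow> g \<cdot> f \<in> Ar C"
  and Dom_comp [simp]: "f \<in> Ar C \<Longrightarrow> g \<in> Ar C \<Longrightarrow> Dom C g = Cod C f \<Longrightarrow> Dom C (g \<cdot> f) = Dom C f"
  and Cod_comp [simp]: "f \<in> Ar C \<Longrightarrow> g \<in> Ar C \<Longrightarrow> Dom C g = Cod C f \<Longrightarrow> Cod C (g \<cdot> f) = Cod C g"
  using is_category by (auto simp: category_def)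

lemma comp_Ident [simp]: "f \<in> Ar C \<Longrightarrow> Dom C f = A \<Longrightarrow> f \<cdot> Ident C A = f"
  and Ident_comp [simp]: "f \<in> Ar C \<Longrightarrow> Cod C f = A \<Longrightarrow> Ident C A \<cdot> f = f"
  using is_category by (auto simp: category_def)

lemma comp_assoc [simp]:
  "f \<in> Ar C \<Longrightarrow> g \<in> Ar C \<Longrightarrow> h \<in> Ar C \<Longrightarrow> Dom C g = Cod C f \<Longrightarrow> Dom C h = Cod C g \<Longrightarrow>
   (h \<cdot> g) \<cdot> f = h \<cdot> (g \<cdot> f)"
  using is_category by (auto simp: category_def)

text \<open>\<open>comp_assoc\<close> nests composites to the right, so an equation between
  composites is no longer visible once a further arrow x stands to its right. This rule and the next
  reinstate it there.\<close>

lemma comp_eq_extend: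
  assumes "g \<cdot> f = k" "f \<in> Ar C" "g \<in> Ar C" "Dom C g = Cod C f" "x \<in> Ar C" "Cod C x = Dom C f"
  shows "g \<cdot> (f \<cdot> x) = k \<cdot> x"
  using assms by (metis comp_assoc)

lemma comp2_eq_extend:
  assumes "g \<cdot> f = g' \<cdot> f'" "f \<in> Ar C" "g \<in> Ar C" "Dom C g = Cod C f"
    "f' \<in> Ar C" "g' \<in> Ar C" "Dom C g' = Cod C f'"
    "x \<in> Ar C" "Cod C x = Dom C f" "Cod C x = Dom C f'"
  shows "g \<cdot> (f \<cdot> x) = g' \<cdot> (f' \<cdot> x)"
  using assms by (metis comp_assoc)

lemma pullback_Ar:
  assumes "is_pullback C f g p q"
  shows "f \<in> Ar C" "g \<in> Ar C" "p \<in> Ar C" "q \<in> Ar C" "Cod C f = Cod C g" "Dom C q = Dom C p"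
    "Cod C p = Dom C f" "Cod C q = Dom C g" "f \<cdot> p = g \<cdot> q"
  using assms by (auto simp: is_pullback_def)

lemma pullback_square:
  assumes "is_pullback C f g p q" "x \<in> Ar C" "Cod C x = Dom C p"
  shows "f \<cdot> (p \<cdot> x) = g \<cdot> (q \<cdot> x)"
  using comp2_eq_extend[of f p g q x] pullback_Ar[OF assms(1)] assms(2,3) by simp

lemma pullback_ex1:
  assumes "is_pullback C f g p q" "u \<in> Ar C" "v \<in> Ar C" "Dom C u = Dom C v"
    "Cod C u = Dom C f" "Cod C v = Dom C g" "f \<cdot> u = g \<cdot> v"
  shows "\<exists>!w. w \<in> hom C (Dom C u) (Dom C p) \<and> p \<cdot> w = u \<and> q \<cdot> w = v"
  using assms unfolding is_pullback_def by blast

lemma pairing: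
  assumes "is_pullback C f g p q" "u \<in> Ar C" "v \<in> Ar C" "Dom C u = Dom C v"
    "Cod C u = Dom C f" "Cod C v = Dom C g" "f \<cdot> u = g \<cdot> v"
  shows "pairing C (p, q) u v \<in> Ar C" "Dom C (pairing C (p, q) u v) = Dom C v"
    "Cod C (pairing C (p, q) u v) = Dom C p"
    "p \<cdot> pairing C (p, q) u v = u" "q \<cdot> pairing C (p, q) u v = v"
  using theI'[OF pullback_ex1[OF assms]] assms(4) by (auto simp: pairing_def)

text \<open>Both arrows factor the same cone. Elements of a pullback are therefore compared through
  their two projections, the standard way of proving equations below.\<close>

lemma pullback_eqI:
  assumes "is_pullback C f g p q" "w \<in> Ar C" "w' \<in> Ar C" "Dom C w = Dom C w'"
    "Cod C w = Dom C p" "Cod C w' = Dom C p" "p \<cdot> w = p \<cdot> w'" "q \<cdot> w = q \<cdot> w'"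
  shows "w = w'"
proof -
  note P = pullback_Ar[OF assms(1)]
  have "\<exists>!z. z \<in> hom C (Dom C (p \<cdot> w)) (Dom C p) \<and> p \<cdot> z = p \<cdot> w \<and> q \<cdot> z = q \<cdot> w"
    using pullback_ex1[OF assms(1), of "p \<cdot> w" "q \<cdot> w"] pullback_square[OF assms(1)] P assms
    by simp
  then show ?thesis using P assms by (auto simp: Ex1_def)
qed

lemma is_pullbackI:
  assumes "f \<in> Ar C" "g \<in> Ar C" "p \<in> Ar C" "q \<in> Ar C" "Cod C f = Cod C g" "Dom C p = Dom C q"
    "Cod C p = Dom C f" "Cod C q = Dom C g" "f \<cdot> p = g \<cdot> q"
    "\<And>u v. u \<in> Ar C \<Longrightarrow> v \<in> Ar C \<Longrightarrow> Dom C u = Dom C v \<Longrightarrow> Cod C u = Dom C f \<Longrightarrow> Cod C v = Dom C g \<Longrightarrow>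
      f \<cdot> u = g \<cdot> v \<Longrightarrow> \<exists>w. w \<in> Ar C \<and> Dom C w = Dom C u \<and> Cod C w = Dom C p \<and> p \<cdot> w = u \<and> q \<cdot> w = v"
    "\<And>w w'. w \<in> Ar C \<Longrightarrow> w' \<in> Ar C \<Longrightarrow> Dom C w = Dom C w' \<Longrightarrow> Cod C w = Dom C p \<Longrightarrow> Cod C w' = Dom C p \<Longrightarrow>
      p \<cdot> w = p \<cdot> w' \<Longrightarrow> q \<cdot> w = q \<cdot> w' \<Longrightarrow> w = w'"
  shows "is_pullback C f g p q"
  unfolding is_pullback_def
proof (intro conjI ballI impI)
  fix u v assume uv: "u \<in> Ar C" "v \<in> Ar C"
    "Dom C u = Dom C v \<and> Cod C u = Dom C f \<and> Cod C v = Dom C g \<and> f \<cdot> u = g \<cdot> v"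
  then obtain w where "w \<in> Ar C \<and> Dom C w = Dom C u \<and> Cod C w = Dom C p \<and> p \<cdot> w = u \<and> q \<cdot> w = v"
    using assms(10) by blast
  then show "\<exists>!w. w \<in> hom C (Dom C u) (Dom C p) \<and> p \<cdot> w = u \<and> q \<cdot> w = v"
    by (intro ex1I[of _ w]) (auto intro: assms(11))
qed (use assms in auto)

lemma pairing_pullback:
  assumes "is_pullback C f g p q"
  shows "pairing C (p, q) p q = Ident C (Dom C p)"
  apply (rule pullback_eqI[OF assms])
  using pullback_Ar[OF assms] pairing[OF assms, of p q] by simp_all

lemma pullback_swap: "is_pullback C f g p q \<Longrightarrow> is_pullback C g f q p"
proof (rule is_pullbackI)
  fix u v assume P: "is_pullback C f g p q" and "u \<in> Ar C" "v \<in> Ar C" "Dom C u = Dom C v"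
    "Cod C u = Dom C g" "Cod C v = Dom C f" "g \<cdot> u = f \<cdot> v"
  then show "\<exists>w. w \<in> Ar C \<and> Dom C w = Dom C u \<and> Cod C w = Dom C q \<and> q \<cdot> w = u \<and> p \<cdot> w = v"
    using ex1_implies_ex[OF pullback_ex1[OF P, of v u]] pullback_Ar[OF P] by auto
next
  fix w w' assume P: "is_pullback C f g p q" and w: "w \<in> Ar C" "w' \<in> Ar C" "Dom C w = Dom C w'"
    "Cod C w = Dom C q" "Cod C w' = Dom C q" "q \<cdot> w = q \<cdot> w'" "p \<cdot> w = p \<cdot> w'"
  then show "w = w'"
    using pullback_eqI[OF P w(1-3)] pullback_Ar[OF P] by simp
qed (auto simp: pullback_Ar)

lemma pb_is_pullback:
  assumes "has_pullbacks C" "f \<in> Ar C" "g \<in> Ar C" "Cod C f = Cod C g"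
  shows "is_pullback C f g (fst (pb C f g)) (snd (pb C f g))"
proof -
  obtain p q where "is_pullback C f g p q"
    using assms unfolding has_pullbacks_def by blast
  then show ?thesis
    unfolding pb_def by (intro someI[of "\<lambda>pq. is_pullback C f g (fst pq) (snd pq)" "(p, q)"]) simp
qed

text \<open>The cancellation half of the pasting law: if one square of a rectangle and the outer
  rectangle are pullbacks, so is the other square. It recovers Segal squares from pullbacks over the
  object of objects.\<close>

lemma pullback_cancel:
  assumes R: "is_pullback C f g p q" and O: "is_pullback C f (g \<cdot> g') p' q'"
    and "g' \<in> Ar C" "Cod C g' = Dom C g" "h \<in> Ar C" "Dom C h = Dom C p'" "Cod C h = Dom C p"
    and ph: "p \<cdot> h = p'" and qh: "q \<cdot> h = g' \<cdot> q'"
  shows "is_pullback C q g' h q'"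
proof (rule is_pullbackI)
  note R' = pullback_Ar[OF R] and O' = pullback_Ar[OF O]
  note A = R' O' assms(3-)
  fix u v assume uv: "u \<in> Ar C" "v \<in> Ar C" "Dom C u = Dom C v" "Cod C u = Dom C q" "Cod C v = Dom C g'"
    "q \<cdot> u = g' \<cdot> v"
  have "f \<cdot> (p \<cdot> u) = (g \<cdot> g') \<cdot> v"
    using A uv pullback_square[OF R, of u] by simp
  then have "\<exists>!w. w \<in> hom C (Dom C (p \<cdot> u)) (Dom C p') \<and> p' \<cdot> w = p \<cdot> u \<and> q' \<cdot> w = v"
    using A uv by (intro pullback_ex1[OF O]) simp_all
  then obtain w where w: "w \<in> Ar C" "Dom C w = Dom C u" "Cod C w = Dom C p'" "p' \<cdot> w = p \<cdot> u" "q' \<cdot> w = v"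
    using A uv by auto
  have "h \<cdot> w = u"
    apply (rule pullback_eqI[OF R])
    using A uv w comp_eq_extend[OF ph, of w] comp2_eq_extend[OF qh, of w] by simp_all
  with w show "\<exists>w. w \<in> Ar C \<and> Dom C w = Dom C u \<and> Cod C w = Dom C h \<and> h \<cdot> w = u \<and> q' \<cdot> w = v"
    using A by auto
next
  note A = pullback_Ar[OF R] pullback_Ar[OF O] assms(3-)
  fix w w' assume w: "w \<in> Ar C" "w' \<in> Ar C" "Dom C w = Dom C w'" "Cod C w = Dom C h" "Cod C w' = Dom C h"
    "h \<cdot> w = h \<cdot> w'" "q' \<cdot> w = q' \<cdot> w'"
  have "p' \<cdot> w = p \<cdot> (h \<cdot> w)" "p' \<cdot> w' = p \<cdot> (h \<cdot> w')"
    using A w(1-5) comp_eq_extend[OF ph, of w] comp_eq_extend[OF ph, of w'] by simp_all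
  then show "w = w'"
    using assms(6) w by (intro pullback_eqI[OF O w(1-3)]) simp_all
qed (use pullback_Ar[OF R] pullback_Ar[OF O] assms(3-) in simp_all)

end

section \<open>Internal categories and functors\<close>

declare add_2_eq_Suc [simp del] add_2_eq_Suc' [simp del]

text \<open>Degrees are kept in the forms n + 1, n + 2, n + 3 rather than as successors, so that
  face and degeneracy indices match the simplicial identities syntactically.\<close>

lemma add_small_nat [simp]: "(n::nat) + 1 + 1 = n + 2" "n + 1 + 2 = n + 3" "n + 2 + 1 = n + 3" "Suc 0 = 1"
  by simp_all

definition ob :: "('o, 'a) simp \<Rightarrow> 'o" where "ob A = sob A 0"
definition ar :: "('o, 'a) simp \<Rightarrow> 'o" where "ar A = sob A 1"
definition src :: "('o, 'a) simp \<Rightarrow> 'a" where "src A = face A 0 1"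
definition trg :: "('o, 'a) simp \<Rightarrow> 'a" where "trg A = face A 0 0"
definition idn :: "('o, 'a) simp \<Rightarrow> 'a" where "idn A = degen A 0 0"
text \<open>The arguments of \<open>compose_pair\<close> are swapped: \<open>cmp C A g f\<close> is
  g after f, as for composition of arrows.\<close>

definition cmp :: "('o, 'a, 'm) cat_scheme \<Rightarrow> ('o, 'a) simp \<Rightarrow> 'a \<Rightarrow> 'a \<Rightarrow> 'a" where
  "cmp C A g f = compose_pair C A f g"
definition fo :: "('o, 'a) sfun \<Rightarrow> 'a" where "fo F = fmap F 0"
definition fa :: "('o, 'a) sfun \<Rightarrow> 'a" where "fa F = fmap F 1"

context category_context
begin

lemma category_object_simplicial: "category_object C A \<Longrightarrow> simplicial_object C A"
  by (simp add: category_object_def)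

lemma face_Ar:
  assumes "category_object C A" "i \<le> n + 1"
  shows "face A n i \<in> Ar C" "Dom C (face A n i) = sob A (n + 1)" "Cod C (face A n i) = sob A n"
  using assms by (auto simp: category_object_def simplicial_object_def)

lemma degen_Ar:
  assumes "category_object C A" "i \<le> n"
  shows "degen A n i \<in> Ar C" "Dom C (degen A n i) = sob A n" "Cod C (degen A n i) = sob A (n + 1)"
  using assms by (auto simp: category_object_def simplicial_object_def)

lemma sob_Ob [simp]: "category_object C A \<Longrightarrow> sob A n \<in> Ob C"
  by (auto simp: category_object_def simplicial_object_def)

text \<open>Here and below the simplicial identities are composed with an element x, the form in
  which right-nested rewriting meets them.\<close>

lemma face_face:
  assumes "category_object C A" "i \<le> j" "j \<le> n + 1" "x \<in> Ar C" "Cod C x = sob A (n + 2)"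
  shows "face A n i \<cdot> (face A (n + 1) (j + 1) \<cdot> x) = face A n j \<cdot> (face A (n + 1) i \<cdot> x)"
proof -
  have "\<forall>n i j. i \<le> j \<and> j \<le> n + 1 \<longrightarrow> face A n i \<cdot> face A (n + 1) (j + 1) = face A n j \<cdot> face A (n + 1) i"
    using category_object_simplicial[OF assms(1)] unfolding simplicial_object_def by (elim conjE)
  then have eq: "face A n i \<cdot> face A (n + 1) (j + 1) = face A n j \<cdot> face A (n + 1) i"
    using assms(2,3) by blast
  show ?thesis
    by (rule comp2_eq_extend[OF eq]) (use assms face_Ar[OF assms(1), of i n] face_Ar[OF assms(1), of j n]
      face_Ar[OF assms(1), of "j + 1" "n + 1"] face_Ar[OF assms(1), of i "n + 1"] in simp_all)
qed

lemma face_degen_less: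
  assumes "category_object C A" "i \<le> j" "j \<le> n" "x \<in> Ar C" "Cod C x = sob A (n + 1)"
  shows "face A (n + 1) i \<cdot> (degen A (n + 1) (j + 1) \<cdot> x) = degen A n j \<cdot> (face A n i \<cdot> x)"
proof -
  have "\<forall>n i j. i \<le> j \<and> j \<le> n \<longrightarrow> face A (n + 1) i \<cdot> degen A (n + 1) (j + 1) = degen A n j \<cdot> face A n i"
    using category_object_simplicial[OF assms(1)] unfolding simplicial_object_def by (elim conjE)
  then have eq: "face A (n + 1) i \<cdot> degen A (n + 1) (j + 1) = degen A n j \<cdot> face A n i"
    using assms(2,3) by blast
  show ?thesis
    by (rule comp2_eq_extend[OF eq]) (use assms face_Ar[OF assms(1), of i "n + 1"] degen_Ar[OF assms(1), of "j + 1" "n + 1"]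
      degen_Ar[OF assms(1), of j n] face_Ar[OF assms(1), of i n] in simp_all)
qed

lemma face_degen_greater:
  assumes "category_object C A" "j < i" "i \<le> n + 1" "x \<in> Ar C" "Cod C x = sob A (n + 1)"
  shows "face A (n + 1) (i + 1) \<cdot> (degen A (n + 1) j \<cdot> x) = degen A n j \<cdot> (face A n i \<cdot> x)"
proof -
  have "\<forall>n i j. j < i \<and> i \<le> n + 1 \<longrightarrow> face A (n + 1) (i + 1) \<cdot> degen A (n + 1) j = degen A n j \<cdot> face A n i"
    using category_object_simplicial[OF assms(1)] unfolding simplicial_object_def by (elim conjE)
  then have eq: "face A (n + 1) (i + 1) \<cdot> degen A (n + 1) j = degen A n j \<cdot> face A n i"
    using assms(2,3) by blast
  show ?thesis
    by (rule comp2_eq_extend[OF eq]) (use assms face_Ar[OF assms(1), of "i + 1" "n + 1"] degen_Ar[OF assms(1), of j "n + 1"]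
      degen_Ar[OF assms(1), of j n] face_Ar[OF assms(1), of i n] in simp_all)
qed

lemma face_degen_same:
  assumes "category_object C A" "j \<le> n" "x \<in> Ar C" "Cod C x = sob A n"
  shows "face A n j \<cdot> (degen A n j \<cdot> x) = x" "face A n (j + 1) \<cdot> (degen A n j \<cdot> x) = x"
proof -
  have "face A n j \<cdot> degen A n j = Ident C (sob A n)" "face A n (j + 1) \<cdot> degen A n j = Ident C (sob A n)"
    using category_object_simplicial[OF assms(1)] assms(2) unfolding simplicial_object_def by simp_all
  from comp_eq_extend[OF this(1)] comp_eq_extend[OF this(2)]
  show "face A n j \<cdot> (degen A n j \<cdot> x) = x" "face A n (j + 1) \<cdot> (degen A n j \<cdot> x) = x"
    using assms face_Ar[OF assms(1), of j n] degen_Ar[OF assms(1), of j n]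
      face_Ar[OF assms(1), of "j + 1" n] by simp_all
qed

lemma degen_degen:
  assumes "category_object C A" "i \<le> j" "j \<le> n" "x \<in> Ar C" "Cod C x = sob A n"
  shows "degen A (n + 1) i \<cdot> (degen A n j \<cdot> x) = degen A (n + 1) (j + 1) \<cdot> (degen A n i \<cdot> x)"
proof -
  have "\<forall>n i j. i \<le> j \<and> j \<le> n \<longrightarrow> degen A (n + 1) i \<cdot> degen A n j = degen A (n + 1) (j + 1) \<cdot> degen A n i"
    using category_object_simplicial[OF assms(1)] unfolding simplicial_object_def by (elim conjE)
  then have eq: "degen A (n + 1) i \<cdot> degen A n j = degen A (n + 1) (j + 1) \<cdot> degen A n i"
    using assms(2,3) by blast
  show ?thesis
    by (rule comp2_eq_extend[OF eq]) (use assms degen_Ar[OF assms(1), of i "n + 1"] degen_Ar[OF assms(1), of j n]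
      degen_Ar[OF assms(1), of "j + 1" "n + 1"] degen_Ar[OF assms(1), of i n] in simp_all)
qed

lemma segal_pullback:
  "category_object C A \<Longrightarrow>
    is_pullback C (face A n 0) (face A n (n + 1)) (face A (n + 1) (n + 2)) (face A (n + 1) 0)"
  by (simp add: category_object_def)

lemma obar_Ob [simp]: "category_object C A \<Longrightarrow> ob A \<in> Ob C" "category_object C A \<Longrightarrow> ar A \<in> Ob C"
  by (simp_all add: ob_def ar_def)

lemma
  assumes "category_object C A"
  shows src_Ar [simp]: "src A \<in> Ar C" and Dom_src [simp]: "Dom C (src A) = ar A"
    and Cod_src [simp]: "Cod C (src A) = ob A"
    and trg_Ar [simp]: "trg A \<in> Ar C" and Dom_trg [simp]: "Dom C (trg A) = ar A"
    and Cod_trg [simp]: "Cod C (trg A) = ob A"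
    and idn_Ar [simp]: "idn A \<in> Ar C" and Dom_idn [simp]: "Dom C (idn A) = ob A"
    and Cod_idn [simp]: "Cod C (idn A) = ar A"
  using face_Ar[OF assms, of 0 0] face_Ar[OF assms, of 1 0] degen_Ar[OF assms, of 0 0]
  by (simp_all add: src_def trg_def idn_def ob_def ar_def)

lemma
  assumes "category_object C A" "x \<in> Ar C" "Cod C x = ob A"
  shows src_idn [simp]: "src A \<cdot> (idn A \<cdot> x) = x" and trg_idn [simp]: "trg A \<cdot> (idn A \<cdot> x) = x"
  using face_degen_same[OF assms(1), of 0 0 x] assms by (simp_all add: src_def trg_def idn_def ob_def)

lemma composable_pullback:
  "category_object C A \<Longrightarrow> is_pullback C (trg A) (src A) (face A 1 2) (face A 1 0)"
  using segal_pullback[of A 0] by (simp add: trg_def src_def)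

text \<open>By the Segal condition an element of \<open>sob A 2\<close> is the pairing of its outer
  faces; hence its inner face is their composite.\<close>

lemma cmp_simplex:
  assumes "category_object C A" "x \<in> Ar C" "Cod C x = sob A 2"
  shows "cmp C A (face A 1 0 \<cdot> x) (face A 1 2 \<cdot> x) = face A 1 1 \<cdot> x"
proof -
  note P = composable_pullback[OF assms(1)]
  note F = face_Ar[OF assms(1), of 0 1] face_Ar[OF assms(1), of 2 1]
  note Q = pullback_Ar[OF P]
  have sq: "trg A \<cdot> (face A 1 2 \<cdot> x) = src A \<cdot> (face A 1 0 \<cdot> x)"
    using pullback_square[OF P, of x] F assms by simp
  note R = pairing[OF P, of "face A 1 2 \<cdot> x" "face A 1 0 \<cdot> x"]
  have "pairing C (face A 1 2, face A 1 0) (face A 1 2 \<cdot> x) (face A 1 0 \<cdot> x) = x"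
    apply (rule pullback_eqI[OF P])
    using R sq F Q assms by simp_all
  then show ?thesis by (simp add: cmp_def compose_pair_def)
qed

lemma composable_simplex:
  assumes "category_object C A" "f \<in> Ar C" "g \<in> Ar C" "Cod C f = ar A" "Cod C g = ar A"
    "Dom C f = Dom C g" "trg A \<cdot> f = src A \<cdot> g"
  obtains x where "x \<in> Ar C" "Dom C x = Dom C f" "Cod C x = sob A 2"
    "face A 1 2 \<cdot> x = f" "face A 1 0 \<cdot> x = g" "face A 1 1 \<cdot> x = cmp C A g f"
proof -
  note P = composable_pullback[OF assms(1)]
  note R = pairing[OF P, of f g]
  let ?x = "pairing C (face A 1 2, face A 1 0) f g"
  show ?thesis
  proof
    show "face A 1 1 \<cdot> ?x = cmp C A g f" by (simp add: cmp_def compose_pair_def)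
  qed (use R assms face_Ar[OF assms(1), of 2 1] in auto)
qed

lemma
  assumes "category_object C A" "f \<in> Ar C" "g \<in> Ar C" "Cod C f = ar A" "Cod C g = ar A"
    "Dom C f = Dom C g" "trg A \<cdot> f = src A \<cdot> g"
  shows cmp_Ar [simp]: "cmp C A g f \<in> Ar C"
    and Dom_cmp [simp]: "Dom C (cmp C A g f) = Dom C g"
    and Cod_cmp [simp]: "Cod C (cmp C A g f) = ar A"
    and src_cmp [simp]: "src A \<cdot> cmp C A g f = src A \<cdot> f"
    and trg_cmp [simp]: "trg A \<cdot> cmp C A g f = trg A \<cdot> g"
proof -
  obtain x where x: "x \<in> Ar C" "Dom C x = Dom C f" "Cod C x = sob A 2"
    "face A 1 2 \<cdot> x = f" "face A 1 0 \<cdot> x = g" "face A 1 1 \<cdot> x = cmp C A g f"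
    by (rule composable_simplex[OF assms])
  note F = face_Ar[OF assms(1), of 1 1] face_Ar[OF assms(1), of 0 0] face_Ar[OF assms(1), of 1 0]
  show "cmp C A g f \<in> Ar C" "Dom C (cmp C A g f) = Dom C g" "Cod C (cmp C A g f) = ar A"
    using x F assms by (simp_all flip: x(6) add: ar_def)
  show "src A \<cdot> cmp C A g f = src A \<cdot> f"
    using face_face[OF assms(1), of 1 1 0 x] x by (simp add: src_def)
  show "trg A \<cdot> cmp C A g f = trg A \<cdot> g"
    using face_face[OF assms(1), of 0 0 0 x] x by (simp add: trg_def)
qed

text \<open>If y is the 2-simplex of the pair (f, g), then \<open>y \<cdot> x\<close> is that of the
  precomposed pair. So composition of elements is natural in their domain.\<close>

lemma cmp_comp [simp]:
  assumes "category_object C A" "f \<in> Ar C" "g \<in> Ar C" "Cod C f = ar A" "Cod C g = ar A"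
    "Dom C f = Dom C g" "trg A \<cdot> f = src A \<cdot> g" "x \<in> Ar C" "Cod C x = Dom C g"
  shows "cmp C A g f \<cdot> x = cmp C A (g \<cdot> x) (f \<cdot> x)"
proof -
  obtain y where y: "y \<in> Ar C" "Dom C y = Dom C f" "Cod C y = sob A 2"
    "face A 1 2 \<cdot> y = f" "face A 1 0 \<cdot> y = g" "face A 1 1 \<cdot> y = cmp C A g f"
    by (rule composable_simplex[OF assms(1-7)])
  note F = face_Ar[OF assms(1), of 1 1] face_Ar[OF assms(1), of 0 1] face_Ar[OF assms(1), of 2 1]
  show ?thesis
    using cmp_simplex[OF assms(1), of "y \<cdot> x"] y F assms comp_eq_extend[OF y(4), of x]
      comp_eq_extend[OF y(5), of x] comp_eq_extend[OF y(6), of x]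
    by simp
qed

text \<open>The degenerate 2-simplices s_0 f and s_1 f have f as inner face and as one outer face,
  the other outer face being an identity.\<close>

lemma
  assumes "category_object C A" "f \<in> Ar C" "Cod C f = ar A"
  shows cmp_idn_right [simp]: "x = src A \<cdot> f \<Longrightarrow> cmp C A f (idn A \<cdot> x) = f"
    and cmp_idn_left [simp]: "x = trg A \<cdot> f \<Longrightarrow> cmp C A (idn A \<cdot> x) f = f"
proof -
  note D = degen_Ar[OF assms(1), of 0 1] degen_Ar[OF assms(1), of 1 1]
  have f: "Cod C f = sob A (0 + 1)" "Cod C f = sob A 1" using assms by (simp_all add: ar_def)
  show "cmp C A f (idn A \<cdot> x) = f" if "x = src A \<cdot> f"
    using cmp_simplex[OF assms(1), of "degen A 1 0 \<cdot> f"] D assms(2) f that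
      face_degen_same[OF assms(1), of 0 1 f] face_degen_greater[OF assms(1) _ _ assms(2) f(1), of 0 1]
    by (simp add: src_def idn_def)
  show "cmp C A (idn A \<cdot> x) f = f" if "x = trg A \<cdot> f"
    using cmp_simplex[OF assms(1), of "degen A 1 1 \<cdot> f"] D assms(2) f that
      face_degen_same[OF assms(1), of 1 1 f] face_degen_less[OF assms(1) _ _ assms(2) f(1), of 0 0]
    by (simp add: trg_def idn_def)
qed

text \<open>The 2-simplices (f, g) and (g, h) agree on g and so glue to a 3-simplex z. Its inner
  faces d_1 z and d_2 z are the pairs (g f, h) and (f, h g), and d_1 d_1 = d_1 d_2 equates their
  composites.\<close>

lemma cmp_assoc:
  assumes A: "category_object C A" and "f \<in> Ar C" "g \<in> Ar C" "h \<in> Ar C"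
    "Cod C f = ar A" "Cod C g = ar A" "Cod C h = ar A" "Dom C f = Dom C g" "Dom C h = Dom C g"
    "trg A \<cdot> f = src A \<cdot> g" "trg A \<cdot> g = src A \<cdot> h"
  shows "cmp C A (cmp C A h g) f = cmp C A h (cmp C A g f)"
proof -
  obtain x where x: "x \<in> Ar C" "Dom C x = Dom C f" "Cod C x = sob A 2"
    "face A 1 2 \<cdot> x = f" "face A 1 0 \<cdot> x = g" "face A 1 1 \<cdot> x = cmp C A g f"
    by (rule composable_simplex[of A f g]) (use assms in auto)
  obtain y where y: "y \<in> Ar C" "Dom C y = Dom C g" "Cod C y = sob A 2"
    "face A 1 2 \<cdot> y = g" "face A 1 0 \<cdot> y = h" "face A 1 1 \<cdot> y = cmp C A h g"
    by (rule composable_simplex[of A g h]) (use assms in auto)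
  have P: "is_pullback C (face A 1 0) (face A 1 2) (face A 2 3) (face A 2 0)"
    using segal_pullback[OF A, of 1] by simp
  have "\<exists>!z. z \<in> hom C (Dom C x) (Dom C (face A 2 3)) \<and> face A 2 3 \<cdot> z = x \<and> face A 2 0 \<cdot> z = y"
    apply (rule pullback_ex1[OF P])
    using x y assms face_Ar[OF A, of 0 1] face_Ar[OF A, of 2 1] by simp_all
  then obtain z where z: "z \<in> Ar C" "Cod C z = sob A 3" "face A 2 3 \<cdot> z = x" "face A 2 0 \<cdot> z = y"
    using face_Ar[OF A, of 3 2] by auto
  note F = face_Ar[OF A, of 1 2] face_Ar[OF A, of 2 2]
  have z': "Cod C z = sob A (1 + 2)" using z by simp
  have "cmp C A h (cmp C A g f) = face A 1 1 \<cdot> (face A 2 1 \<cdot> z)"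
    using cmp_simplex[OF A, of "face A 2 1 \<cdot> z"] F z x y face_face[OF A _ _ z(1) z', of 0 0]
      face_face[OF A _ _ z(1) z', of 1 2] by simp
  also have "\<dots> = face A 1 1 \<cdot> (face A 2 2 \<cdot> z)"
    using face_face[OF A _ _ z(1) z', of 1 1] by simp
  also have "\<dots> = cmp C A (cmp C A h g) f"
    using cmp_simplex[OF A, of "face A 2 2 \<cdot> z"] F z x y face_face[OF A _ _ z(1) z', of 0 1]
      face_face[OF A _ _ z(1) z', of 2 2] by simp
  finally show ?thesis by simp
qed

lemma Ident_comp_src [simp]: "category_object C A \<Longrightarrow> src A \<cdot> idn A = Ident C (ob A)"
  "category_object C A \<Longrightarrow> trg A \<cdot> idn A = Ident C (ob A)"
  using src_idn[of A "Ident C (ob A)"] trg_idn[of A "Ident C (ob A)"] by simp_all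

section \<open>Internal functors and their extension from degrees 0 and 1\<close>

lemma functor_objects [simp]:
  "internal_functor C F \<Longrightarrow> category_object C (fdom F)"
  "internal_functor C F \<Longrightarrow> category_object C (fcod F)"
  by (simp_all add: internal_functor_def)

lemma fmap_Ar:
  assumes "internal_functor C F"
  shows "fmap F n \<in> Ar C" "Dom C (fmap F n) = sob (fdom F) n" "Cod C (fmap F n) = sob (fcod F) n"
proof -
  have "\<forall>n. fmap F n \<in> hom C (sob (fdom F) n) (sob (fcod F) n)"
    using assms unfolding internal_functor_def by (elim conjE)
  then show "fmap F n \<in> Ar C" "Dom C (fmap F n) = sob (fdom F) n" "Cod C (fmap F n) = sob (fcod F) n"
    by auto
qed

lemma
  assumes "internal_functor C F"
  shows fo_Ar [simp]: "fo F \<in> Ar C" and Dom_fo [simp]: "Dom C (fo F) = ob (fdom F)"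
    and Cod_fo [simp]: "Cod C (fo F) = ob (fcod F)"
    and fa_Ar [simp]: "fa F \<in> Ar C" and Dom_fa [simp]: "Dom C (fa F) = ar (fdom F)"
    and Cod_fa [simp]: "Cod C (fa F) = ar (fcod F)"
  using fmap_Ar[OF assms] by (simp_all add: fo_def fa_def ob_def ar_def)

lemma internal_functorD:
  assumes "internal_functor C F"
  shows "i \<le> n + 1 \<Longrightarrow> face (fcod F) n i \<cdot> fmap F (n + 1) = fmap F n \<cdot> face (fdom F) n i"
    and "j \<le> n \<Longrightarrow> degen (fcod F) n j \<cdot> fmap F n = fmap F (n + 1) \<cdot> degen (fdom F) n j"
  using assms unfolding internal_functor_def by - (elim conjE, blast)+

lemma fmap_face:
  assumes "internal_functor C F" "i \<le> n + 1" "x \<in> Ar C" "Cod C x = sob (fdom F) (n + 1)"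
  shows "face (fcod F) n i \<cdot> (fmap F (n + 1) \<cdot> x) = fmap F n \<cdot> (face (fdom F) n i \<cdot> x)"
proof -
  have eq: "face (fcod F) n i \<cdot> fmap F (n + 1) = fmap F n \<cdot> face (fdom F) n i"
    using internal_functorD[OF assms(1)] assms(2) by blast
  show ?thesis
    by (rule comp2_eq_extend[OF eq]) (use assms fmap_Ar[OF assms(1)] face_Ar[of "fcod F" i n] face_Ar[of "fdom F" i n] in simp_all)
qed

lemma fmap_degen:
  assumes "internal_functor C F" "i \<le> n" "x \<in> Ar C" "Cod C x = sob (fdom F) n"
  shows "degen (fcod F) n i \<cdot> (fmap F n \<cdot> x) = fmap F (n + 1) \<cdot> (degen (fdom F) n i \<cdot> x)"
proof -
  have eq: "degen (fcod F) n i \<cdot> fmap F n = fmap F (n + 1) \<cdot> degen (fdom F) n i"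
    using internal_functorD[OF assms(1)] assms(2) by blast
  show ?thesis
    by (rule comp2_eq_extend[OF eq]) (use assms fmap_Ar[OF assms(1)] degen_Ar[of "fcod F" i n] degen_Ar[of "fdom F" i n] in simp_all)
qed

lemma
  assumes "internal_functor C F" "x \<in> Ar C" "Cod C x = ar (fdom F)"
  shows src_fa [simp]: "fcod F = B \<Longrightarrow> src B \<cdot> (fa F \<cdot> x) = fo F \<cdot> (src (fdom F) \<cdot> x)"
    and trg_fa [simp]: "fcod F = B \<Longrightarrow> trg B \<cdot> (fa F \<cdot> x) = fo F \<cdot> (trg (fdom F) \<cdot> x)"
  using fmap_face[OF assms(1), of 0 0 x] fmap_face[OF assms(1), of 1 0 x] assms
  by (simp_all add: src_def trg_def fo_def fa_def ar_def)

lemma fa_idn: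
  assumes "internal_functor C F" "x \<in> Ar C" "Cod C x = ob (fdom F)"
  shows "fdom F = A \<Longrightarrow> fa F \<cdot> (idn A \<cdot> x) = idn (fcod F) \<cdot> (fo F \<cdot> x)"
  using fmap_degen[OF assms(1), of 0 0 x] assms
  by (auto simp: idn_def fo_def fa_def ob_def)

text \<open>The component of F in degree 2 carries the 2-simplex of the pair (f, g) to that of its
  image, and it commutes with the inner face.\<close>

lemma fa_cmp:
  assumes F: "internal_functor C F" and "f \<in> Ar C" "g \<in> Ar C" "Cod C f = ar (fdom F)" "Cod C g = ar (fdom F)"
    "Dom C f = Dom C g" "trg (fdom F) \<cdot> f = src (fdom F) \<cdot> g"
  shows "fa F \<cdot> cmp C (fdom F) g f = cmp C (fcod F) (fa F \<cdot> g) (fa F \<cdot> f)"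
proof -
  obtain x where x: "x \<in> Ar C" "Dom C x = Dom C f" "Cod C x = sob (fdom F) 2"
    "face (fdom F) 1 2 \<cdot> x = f" "face (fdom F) 1 0 \<cdot> x = g"
    "face (fdom F) 1 1 \<cdot> x = cmp C (fdom F) g f"
    by (rule composable_simplex[of "fdom F" f g]) (use assms in auto)
  have x': "Cod C x = sob (fdom F) (1 + 1)" using x by simp
  note G = fmap_Ar[OF F, of 2]
  show ?thesis
    using cmp_simplex[of "fcod F" "fmap F 2 \<cdot> x"] F G x
      fmap_face[OF F _ x(1) x', of 0] fmap_face[OF F _ x(1) x', of 1] fmap_face[OF F _ x(1) x', of 2]
    by (simp add: fa_def)
qed

text \<open>Degree n + 2 of the codomain is a Segal pullback whose projections are faces, and these
  commute with both functors; so the components in degrees 0 and 1 determine all others.\<close>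

lemma functor_eqI:
  assumes F: "internal_functor C F" and G: "internal_functor C G"
    and "fdom F = fdom G" "fcod F = fcod G" "fo F = fo G" "fa F = fa G"
  shows "F = G"
proof -
  have "fmap F n = fmap G n \<and> fmap F (n + 1) = fmap G (n + 1)" for n
  proof (induction n)
    case 0 then show ?case using assms by (simp add: fo_def fa_def)
  next
    case (Suc n)
    note D = internal_functorD(1)[OF F, of _ "n + 1"] internal_functorD(1)[OF G, of _ "n + 1"]
    have "fmap F (n + 2) = fmap G (n + 2)"
      apply (rule pullback_eqI[OF segal_pullback[of "fcod F" n]])
      using D[of "n + 2"] D[of 0] fmap_Ar[OF F, of "n + 2"] fmap_Ar[OF G, of "n + 2"]
        assms Suc face_Ar[of "fcod G" "n + 2" "n + 1"] by simp_all
    then show ?case using Suc by (simp add: Suc_eq_plus1)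
  qed
  then have "fmap F = fmap G" by blast
  then show ?thesis using assms by (cases F; cases G) simp
qed

text \<open>In degree n + 2 the component is induced by the Segal pullback of B from the two outer
  faces, each already mapped by the component of degree n + 1.\<close>

fun functor_ext :: "('o, 'a) simp \<Rightarrow> ('o, 'a) simp \<Rightarrow> 'a \<Rightarrow> 'a \<Rightarrow> nat \<Rightarrow> 'a" where
  "functor_ext A B f0 f1 0 = f0"
| "functor_ext A B f0 f1 (Suc 0) = f1"
| "functor_ext A B f0 f1 (Suc (Suc n)) =
    pairing C (face B (n + 1) (n + 2), face B (n + 1) 0)
      (functor_ext A B f0 f1 (Suc n) \<cdot> face A (n + 1) (n + 2))
      (functor_ext A B f0 f1 (Suc n) \<cdot> face A (n + 1) 0)"

definition mkfun :: "('o, 'a) simp \<Rightarrow> ('o, 'a) simp \<Rightarrow> 'a \<Rightarrow> 'a \<Rightarrow> ('o, 'a) sfun" where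
  "mkfun A B f0 f1 = \<lparr>fdom = A, fcod = B, fmap = functor_ext A B f0 f1\<rparr>"

lemma face_face_arr:
  assumes "category_object C A" "i \<le> j" "j \<le> n + 1"
  shows "face A n i \<cdot> face A (n + 1) (j + 1) = face A n j \<cdot> face A (n + 1) i"
  using face_face[OF assms, of "Ident C (sob A (n + 2))"] assms face_Ar[OF assms(1), of _ "n + 1"] by simp

text \<open>Preservation of sources, targets, units and composites suffices: an equation in a higher
  degree of B can be tested on the two outer faces, which lead back to the degree below.\<close>

lemma
  assumes A: "category_object C A" and B: "category_object C B"
    and f0: "f0 \<in> Ar C" "Dom C f0 = ob A" "Cod C f0 = ob B"
    and f1: "f1 \<in> Ar C" "Dom C f1 = ar A" "Cod C f1 = ar B"
    and st: "src B \<cdot> f1 = f0 \<cdot> src A" "trg B \<cdot> f1 = f0 \<cdot> trg A"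
    and id: "f1 \<cdot> idn A = idn B \<cdot> f0"
    and cm: "\<And>f g. f \<in> Ar C \<Longrightarrow> g \<in> Ar C \<Longrightarrow> Cod C f = ar A \<Longrightarrow> Cod C g = ar A \<Longrightarrow> Dom C f = Dom C g \<Longrightarrow>
      trg A \<cdot> f = src A \<cdot> g \<Longrightarrow> f1 \<cdot> cmp C A g f = cmp C B (f1 \<cdot> g) (f1 \<cdot> f)"
  shows internal_functor_mkfun: "internal_functor C (mkfun A B f0 f1)"
    and fo_mkfun: "fo (mkfun A B f0 f1) = f0" and fa_mkfun: "fa (mkfun A B f0 f1) = f1"
proof -
  define F where "F = functor_ext A B f0 f1"
  have F0: "F 0 = f0" and F1: "F 1 = f1" by (simp_all add: F_def flip: add_small_nat(4))
  have F2: "F (n + 2) = pairing C (face B (n + 1) (n + 2), face B (n + 1) 0)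
      (F (n + 1) \<cdot> face A (n + 1) (n + 2)) (F (n + 1) \<cdot> face A (n + 1) 0)" for n
    unfolding F_def add_2_eq_Suc' functor_ext.simps by (simp add: Suc_eq_plus1)
  note fA = face_Ar[OF A] and fB = face_Ar[OF B]
  have step: "F (n + 2) \<in> Ar C \<and> Dom C (F (n + 2)) = sob A (n + 2) \<and> Cod C (F (n + 2)) = sob B (n + 2) \<and>
      face B (n + 1) (n + 2) \<cdot> F (n + 2) = F (n + 1) \<cdot> face A (n + 1) (n + 2) \<and>
      face B (n + 1) 0 \<cdot> F (n + 2) = F (n + 1) \<cdot> face A (n + 1) 0"
    if T: "\<And>k. k \<le> n + 1 \<Longrightarrow> F k \<in> Ar C \<and> Dom C (F k) = sob A k \<and> Cod C (F k) = sob B k"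
      and S: "\<And>i. i \<le> n + 1 \<Longrightarrow> face B n i \<cdot> F (n + 1) = F n \<cdot> face A n i" for n
  proof -
    have eq: "face B n 0 \<cdot> (F (n + 1) \<cdot> face A (n + 1) (n + 2))
      = face B n (n + 1) \<cdot> (F (n + 1) \<cdot> face A (n + 1) 0)"
      using T[of n] T[of "n + 1"] fA[of "n + 2" "n + 1"] fA[of 0 "n + 1"] fA[of 0 n] fA[of "n + 1" n]
        fB[of 0 n] fB[of "n + 1" n] comp_eq_extend[OF S[of 0], of "face A (n + 1) (n + 2)"]
        comp_eq_extend[OF S[of "n + 1"], of "face A (n + 1) 0"] face_face_arr[OF A, of 0 "n + 1" n]
      by simp
    note P = pairing[OF segal_pullback[OF B, of n] _ _ _ _ _ eq]
    show ?thesis unfolding F2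
      using P T[of "n + 1"] fA[of "n + 2" "n + 1"] fA[of 0 "n + 1"] fB[of 0 n] fB[of "n + 1" n] fB[of "n + 2" "n + 1"]
      by simp
  qed
  \<comment> \<open>Typing and compatibility with all faces have to be proved together, since a
    component is well defined only if the faces of the preceding one commute.\<close>
  have main: "(\<forall>k \<le> n + 1. F k \<in> Ar C \<and> Dom C (F k) = sob A k \<and> Cod C (F k) = sob B k) \<and>
    (\<forall>i \<le> n + 1. face B n i \<cdot> F (n + 1) = F n \<cdot> face A n i)" for n
  proof (induction n)
    case 0
    have *: "k \<le> 1 \<longleftrightarrow> k = 0 \<or> k = 1" for k :: nat by auto
    show ?case using F0 F1 f0 f1 st by (simp add: * ob_def ar_def src_def trg_def)
  next
    case (Suc n)
    then have T: "\<And>k. k \<le> n + 1 \<Longrightarrow> F k \<in> Ar C \<and> Dom C (F k) = sob A k \<and> Cod C (F k) = sob B k"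
      and S: "\<And>i. i \<le> n + 1 \<Longrightarrow> face B n i \<cdot> F (n + 1) = F n \<cdot> face A n i" by auto
    note N = step[OF T S]
    have T': "F k \<in> Ar C \<and> Dom C (F k) = sob A k \<and> Cod C (F k) = sob B k" if "k \<le> n + 2" for k
      using T N that by (cases "k = n + 2") auto
    have S': "face B (n + 1) i \<cdot> F (n + 2) = F (n + 1) \<cdot> face A (n + 1) i" if "i \<le> n + 2" for i
    proof -
      consider "i = 0" | "i = n + 2" | "0 < i" "i < n + 2" "n = 0" | "0 < i" "i < n + 2" "n > 0"
        using \<open>i \<le> n + 2\<close> by linarith
      then show ?thesis
      proof cases
        \<comment> \<open>The middle face of a 2-simplex is not controlled by outer faces; here the
          preservation of composites \<open>cm\<close> enters.\<close>
        case 3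
        then have i: "i = 1" by simp
        have T2: "F 2 \<in> Ar C" "Dom C (F 2) = sob A 2" "Cod C (F 2) = sob B 2"
          and e: "face B 1 2 \<cdot> F 2 = f1 \<cdot> face A 1 2" "face B 1 0 \<cdot> F 2 = f1 \<cdot> face A 1 0"
          using N 3 F1 by simp_all
        have "cmp C A (face A 1 0) (face A 1 2) = face A 1 1"
          using cmp_simplex[OF A, of "Ident C (sob A 2)"] fA[of _ 1] A by simp
        moreover have "cmp C B (f1 \<cdot> face A 1 0) (f1 \<cdot> face A 1 2) = face B 1 1 \<cdot> F 2"
          using cmp_simplex[OF B, of "F 2"] T2 e by simp
        moreover have "f1 \<cdot> cmp C A (face A 1 0) (face A 1 2) = cmp C B (f1 \<cdot> face A 1 0) (f1 \<cdot> face A 1 2)"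
          using fA[of 2 1] fA[of 0 1] pullback_Ar(9)[OF composable_pullback[OF A]]
          by (intro cm) (simp_all add: ar_def)
        ultimately show ?thesis using 3(3) F1 unfolding i by simp
      next
        \<comment> \<open>For n > 0 the target in degree n + 1 is itself a Segal pullback, so an
          inner face is compared after d_0 and d_(n+1), and the simplicial identities move it past
          them.\<close>
        case 4
        obtain m where n: "n = m + 1" using 4 by (cases n) auto
        obtain k where k: "i = k + 1" using 4 by (cases i) auto
        have k': "k \<le> n" using 4 k by simp
        let ?F1 = "F (n + 1)" and ?F2 = "F (n + 2)"
        note ty = T'[of n] T'[of "n + 1"] T'[of "n + 2"] fA[of _ n] fB[of _ n] fA[of _ "n + 1"] fB[of _ "n + 1"]
        have a: "face B n 0 \<cdot> (face B (n + 1) i \<cdot> ?F2) = face B n 0 \<cdot> (?F1 \<cdot> face A (n + 1) i)"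
        proof -
          have "face B n 0 \<cdot> (face B (n + 1) i \<cdot> ?F2) = face B n k \<cdot> (face B (n + 1) 0 \<cdot> ?F2)"
            using face_face[OF B, of 0 k n ?F2] k k' ty by simp
          also have "\<dots> = (face B n k \<cdot> ?F1) \<cdot> face A (n + 1) 0" using N k' ty by simp
          also have "\<dots> = F n \<cdot> (face A n k \<cdot> face A (n + 1) 0)" using S[of k] k' ty by simp
          also have "\<dots> = (F n \<cdot> face A n 0) \<cdot> face A (n + 1) i"
            using face_face_arr[OF A, of 0 k n] k k' ty by simp
          also have "\<dots> = face B n 0 \<cdot> (?F1 \<cdot> face A (n + 1) i)"
            using k k' ty by (simp flip: S[of 0])
          finally show ?thesis .
        qed
        have b: "face B n (n + 1) \<cdot> (face B (n + 1) i \<cdot> ?F2) = face B n (n + 1) \<cdot> (?F1 \<cdot> face A (n + 1) i)"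
        proof -
          have "face B n (n + 1) \<cdot> (face B (n + 1) i \<cdot> ?F2) = face B n i \<cdot> (face B (n + 1) (n + 2) \<cdot> ?F2)"
            using face_face[OF B, of i "n + 1" n ?F2] k k' ty by simp
          also have "\<dots> = (face B n i \<cdot> ?F1) \<cdot> face A (n + 1) (n + 2)" using N k k' ty by simp
          also have "\<dots> = F n \<cdot> (face A n i \<cdot> face A (n + 1) (n + 2))" using S[of i] k k' ty by simp
          also have "\<dots> = (F n \<cdot> face A n (n + 1)) \<cdot> face A (n + 1) i"
            using face_face_arr[OF A, of i "n + 1" n] k k' ty by simp
          also have "\<dots> = face B n (n + 1) \<cdot> (?F1 \<cdot> face A (n + 1) i)"
            using k k' ty by (simp flip: S[of "n + 1"])
          finally show ?thesis .
        qed
        show ?thesis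
          apply (rule pullback_eqI[OF segal_pullback[OF B, of m]])
          using a b n k k' ty by simp_all
      qed (use N in auto)
    qed
    have e: "Suc n + 1 = n + 2" "Suc n = n + 1" by simp_all
    show ?case unfolding e by (simp add: T' S')
  qed
  have T: "F n \<in> Ar C" "Dom C (F n) = sob A n" "Cod C (F n) = sob B n" for n
    using main[of n] by auto
  have S: "face B n i \<cdot> F (n + 1) = F n \<cdot> face A n i" if "i \<le> n + 1" for n i
    using main[of n] that by auto
  \<comment> \<open>A degeneracy followed by an outer face is either an identity or that outer face
    followed by a degeneracy one degree lower, to which the induction hypothesis applies.\<close>
  have Dg: "degen B n i \<cdot> F n = F (n + 1) \<cdot> degen A n i" if "i \<le> n" for n i
    using that
  proof (induction n arbitrary: i)
    case 0
    then show ?case using id F0 F1 by (simp add: idn_def)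
  next
    case (Suc n)
    note gA = degen_Ar[OF A] and gB = degen_Ar[OF B]
    note ty = T[of n] T[of "n + 1"] T[of "n + 2"] fA[of _ n] fB[of _ n] fA[of _ "n + 1"] fB[of _ "n + 1"]
      gA[of _ n] gB[of _ n] gA[of _ "n + 1"] gB[of _ "n + 1"]
    have i: "i \<le> n + 1" using Suc.prems by simp
    have S0: "face B (n + 1) j \<cdot> (F (n + 2) \<cdot> degen A (n + 1) i) = F (n + 1) \<cdot> (face A (n + 1) j \<cdot> degen A (n + 1) i)"
      if "j \<le> n + 2" for j
      using S[of j "n + 1"] that ty i comp_eq_extend[OF S[of j "n + 1"], of "degen A (n + 1) i"] by simp
    let ?I = "Ident C (sob A (n + 1))"
    have a: "face B (n + 1) 0 \<cdot> (degen B (n + 1) i \<cdot> F (n + 1)) = F (n + 1) \<cdot> (face A (n + 1) 0 \<cdot> degen A (n + 1) i)"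
    proof (cases i)
      case 0
      then show ?thesis
        using face_degen_same(1)[OF A, of 0 "n + 1" ?I] face_degen_same(1)[OF B, of 0 "n + 1" "F (n + 1)"] ty A
        by simp
    next
      case (Suc j)
      then have "i = j + 1" and j: "j \<le> n" using i by simp_all
      have "face B (n + 1) 0 \<cdot> (degen B (n + 1) i \<cdot> F (n + 1)) = degen B n j \<cdot> (F n \<cdot> face A n 0)"
        using face_degen_less[OF B, of 0 j n "F (n + 1)"] \<open>i = j + 1\<close> j ty S[of 0 n] by simp
      also have "\<dots> = F (n + 1) \<cdot> (degen A n j \<cdot> face A n 0)"
        using comp_eq_extend[OF Suc.IH[OF j], of "face A n 0"] ty j by simp
      also have "\<dots> = F (n + 1) \<cdot> (face A (n + 1) 0 \<cdot> degen A (n + 1) i)"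
        using face_degen_less[OF A, of 0 j n ?I] \<open>i = j + 1\<close> j ty A by simp
      finally show ?thesis .
    qed
    have b: "face B (n + 1) (n + 2) \<cdot> (degen B (n + 1) i \<cdot> F (n + 1))
        = F (n + 1) \<cdot> (face A (n + 1) (n + 2) \<cdot> degen A (n + 1) i)"
    proof (cases "i = n + 1")
      case True
      then show ?thesis
        using face_degen_same(2)[OF A, of i "n + 1" ?I] face_degen_same(2)[OF B, of i "n + 1" "F (n + 1)"] ty A
        by simp
    next
      case False
      then have j: "i \<le> n" using i by simp
      have "face B (n + 1) (n + 2) \<cdot> (degen B (n + 1) i \<cdot> F (n + 1)) = degen B n i \<cdot> (F n \<cdot> face A n (n + 1))"
        using face_degen_greater[OF B, of i "n + 1" n "F (n + 1)"] j ty S[of "n + 1" n] by simp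
      also have "\<dots> = F (n + 1) \<cdot> (degen A n i \<cdot> face A n (n + 1))"
        using comp_eq_extend[OF Suc.IH[OF j], of "face A n (n + 1)"] ty j by simp
      also have "\<dots> = F (n + 1) \<cdot> (face A (n + 1) (n + 2) \<cdot> degen A (n + 1) i)"
        using face_degen_greater[OF A, of i "n + 1" n ?I] j ty A by simp
      finally show ?thesis .
    qed
    have "degen B (n + 1) i \<cdot> F (n + 1) = F (n + 2) \<cdot> degen A (n + 1) i"
      apply (rule pullback_eqI[OF segal_pullback[OF B, of n]])
      using a b S0[of 0] S0[of "n + 2"] ty i by simp_all
    then show ?case by (simp add: Suc_eq_plus1)
  qed
  show "internal_functor C (mkfun A B f0 f1)"
    unfolding internal_functor_def mkfun_def F_def[symmetric]
    using A B T S Dg by (intro conjI allI impI) simp_all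
  show "fo (mkfun A B f0 f1) = f0" "fa (mkfun A B f0 f1) = f1"
    using F0 F1 by (simp_all add: mkfun_def F_def fo_def fa_def)
qed

lemma fdom_mkfun [simp]: "fdom (mkfun A B f0 f1) = A" and fcod_mkfun [simp]: "fcod (mkfun A B f0 f1) = B"
  by (simp_all add: mkfun_def)

end

section \<open>Nerves\<close>

text \<open>Composition is an operation on pairs of elements with a common domain. Its naturality
  \<open>m_comp\<close> in that domain makes it, by the Yoneda argument, an arrow out of any object
  of composable pairs, so that none has to be chosen in advance.\<close>

locale internal_category = category_context C
  for C :: "('o, 'a, 'm) cat_scheme" (structure) +
  fixes c0 c1 :: 'o and s t i :: 'a and m :: "'a \<Rightarrow> 'a \<Rightarrow> 'a"
  assumes pullbacks: "has_pullbacks C"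
    and c0 [simp]: "c0 \<in> Ob C" and c1 [simp]: "c1 \<in> Ob C"
    and s [simp]: "s \<in> Ar C" "Dom C s = c1" "Cod C s = c0"
    and t [simp]: "t \<in> Ar C" "Dom C t = c1" "Cod C t = c0"
    and i [simp]: "i \<in> Ar C" "Dom C i = c0" "Cod C i = c1"
    and s_i: "s \<cdot> i = Ident C c0" and t_i: "t \<cdot> i = Ident C c0"
    and m [simp]: "\<lbrakk>f \<in> Ar C; g \<in> Ar C; Cod C f = c1; Cod C g = c1; Dom C f = Dom C g; t \<cdot> f = s \<cdot> g\<rbrakk> \<Longrightarrow> m g f \<in> Ar C"
      "\<lbrakk>f \<in> Ar C; g \<in> Ar C; Cod C f = c1; Cod C g = c1; Dom C f = Dom C g; t \<cdot> f = s \<cdot> g\<rbrakk> \<Longrightarrow> Dom C (m g f) = Dom C g"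
      "\<lbrakk>f \<in> Ar C; g \<in> Ar C; Cod C f = c1; Cod C g = c1; Dom C f = Dom C g; t \<cdot> f = s \<cdot> g\<rbrakk> \<Longrightarrow> Cod C (m g f) = c1"
      "\<lbrakk>f \<in> Ar C; g \<in> Ar C; Cod C f = c1; Cod C g = c1; Dom C f = Dom C g; t \<cdot> f = s \<cdot> g\<rbrakk> \<Longrightarrow> s \<cdot> m g f = s \<cdot> f"
      "\<lbrakk>f \<in> Ar C; g \<in> Ar C; Cod C f = c1; Cod C g = c1; Dom C f = Dom C g; t \<cdot> f = s \<cdot> g\<rbrakk> \<Longrightarrow> t \<cdot> m g f = t \<cdot> g"
    and m_comp: "\<lbrakk>f \<in> Ar C; g \<in> Ar C; Cod C f = c1; Cod C g = c1; Dom C f = Dom C g; t \<cdot> f = s \<cdot> g;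
        x \<in> Ar C; Cod C x = Dom C g\<rbrakk> \<Longrightarrow> m g f \<cdot> x = m (g \<cdot> x) (f \<cdot> x)"
    and m_unit: "\<lbrakk>f \<in> Ar C; Cod C f = c1\<rbrakk> \<Longrightarrow> m f (i \<cdot> (s \<cdot> f)) = f"
      "\<lbrakk>f \<in> Ar C; Cod C f = c1\<rbrakk> \<Longrightarrow> m (i \<cdot> (t \<cdot> f)) f = f"
    and m_assoc: "\<lbrakk>f \<in> Ar C; g \<in> Ar C; h \<in> Ar C; Cod C f = c1; Cod C g = c1; Cod C h = c1;
        Dom C f = Dom C g; Dom C h = Dom C g; t \<cdot> f = s \<cdot> g; t \<cdot> g = s \<cdot> h\<rbrakk> \<Longrightarrow> m (m h g) f = m h (m g f)"
begin

lemma s_i_comp [simp]: "x \<in> Ar C \<Longrightarrow> Cod C x = c0 \<Longrightarrow> s \<cdot> (i \<cdot> x) = x"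
  and t_i_comp [simp]: "x \<in> Ar C \<Longrightarrow> Cod C x = c0 \<Longrightarrow> t \<cdot> (i \<cdot> x) = x"
  using comp_eq_extend[OF s_i] comp_eq_extend[OF t_i] by simp_all

text \<open>An \<open>n\<close>-simplex \<open>x\<close> over \<open>U\<close> is a functor from \<open>[n]\<close> to the category of \<open>U\<close>-elements, given by its
  arrows \<open>x a b\<close> for \<open>a \<le> b \<le> n\<close>. The simplicial identities of the nerve then hold by functoriality.\<close>

definition simplex :: "nat \<Rightarrow> 'o \<Rightarrow> (nat \<Rightarrow> nat \<Rightarrow> 'a) \<Rightarrow> bool" where
  "simplex n U x \<longleftrightarrow> U \<in> Ob C \<and>
     (\<forall>a b. a \<le> b \<and> b \<le> n \<longrightarrow> x a b \<in> Ar C \<and> Dom C (x a b) = U \<and> Cod C (x a b) = c1) \<and>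
     (\<forall>a\<le>n. i \<cdot> (s \<cdot> x a a) = x a a) \<and>
     (\<forall>a b c. a \<le> b \<and> b \<le> c \<and> c \<le> n \<longrightarrow> t \<cdot> x a b = s \<cdot> x b c \<and> m (x b c) (x a b) = x a c)"

text \<open>Representability of the contravariant functor of n-simplices over U, with
  \<open>\<nu>\<close> as the universal simplex.\<close>

definition represents :: "nat \<Rightarrow> 'o \<Rightarrow> (nat \<Rightarrow> nat \<Rightarrow> 'a) \<Rightarrow> bool" where
  "represents n P \<nu> \<longleftrightarrow> simplex n P \<nu> \<and>
     (\<forall>U x. simplex n U x \<longrightarrow>
       (\<exists>!w. w \<in> hom C U P \<and> (\<forall>a b. a \<le> b \<and> b \<le> n \<longrightarrow> \<nu> a b \<cdot> w = x a b)))"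

lemma simplexD:
  assumes "simplex n U x"
  shows "U \<in> Ob C"
    and "a \<le> b \<Longrightarrow> b \<le> n \<Longrightarrow> x a b \<in> Ar C" "a \<le> b \<Longrightarrow> b \<le> n \<Longrightarrow> Dom C (x a b) = U" "a \<le> b \<Longrightarrow> b \<le> n \<Longrightarrow> Cod C (x a b) = c1"
    and "a \<le> n \<Longrightarrow> i \<cdot> (s \<cdot> x a a) = x a a"
    and "a \<le> b \<Longrightarrow> b \<le> c \<Longrightarrow> c \<le> n \<Longrightarrow> t \<cdot> x a b = s \<cdot> x b c"
    and "a \<le> b \<Longrightarrow> b \<le> c \<Longrightarrow> c \<le> n \<Longrightarrow> m (x b c) (x a b) = x a c"
proof -
  have 1: "\<forall>a b. a \<le> b \<and> b \<le> n \<longrightarrow> x a b \<in> Ar C \<and> Dom C (x a b) = U \<and> Cod C (x a b) = c1"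
    and 2: "\<forall>a\<le>n. i \<cdot> (s \<cdot> x a a) = x a a" and 3: "U \<in> Ob C"
    and 4: "\<forall>a b c. a \<le> b \<and> b \<le> c \<and> c \<le> n \<longrightarrow> t \<cdot> x a b = s \<cdot> x b c \<and> m (x b c) (x a b) = x a c"
    using assms unfolding simplex_def by - (elim conjE, assumption)+
  show "U \<in> Ob C" by (rule 3)
  show "a \<le> b \<Longrightarrow> b \<le> n \<Longrightarrow> x a b \<in> Ar C" "a \<le> b \<Longrightarrow> b \<le> n \<Longrightarrow> Dom C (x a b) = U"
    "a \<le> b \<Longrightarrow> b \<le> n \<Longrightarrow> Cod C (x a b) = c1" using 1 by simp_all
  show "a \<le> n \<Longrightarrow> i \<cdot> (s \<cdot> x a a) = x a a" using 2 by simp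
  show "a \<le> b \<Longrightarrow> b \<le> c \<Longrightarrow> c \<le> n \<Longrightarrow> t \<cdot> x a b = s \<cdot> x b c"
    "a \<le> b \<Longrightarrow> b \<le> c \<Longrightarrow> c \<le> n \<Longrightarrow> m (x b c) (x a b) = x a c"
    using spec[OF spec[OF spec[OF 4, of a], of b], of c] by simp_all
qed

text \<open>The diagonal entries are identities, so the ends of every entry are recorded on the
  diagonal.\<close>

lemma simplexD':
  assumes "simplex n U x"
  shows "a \<le> n \<Longrightarrow> s \<cdot> x a a = t \<cdot> x a a"
    and "a \<le> b \<Longrightarrow> b \<le> n \<Longrightarrow> i \<cdot> (s \<cdot> x a b) = x a a"
    and "a \<le> b \<Longrightarrow> b \<le> n \<Longrightarrow> i \<cdot> (t \<cdot> x a b) = x b b"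
proof -
  show 1: "s \<cdot> x a a = t \<cdot> x a a" if "a \<le> n" for a
    using simplexD(6)[OF assms, of a a a] that by simp
  show "i \<cdot> (s \<cdot> x a b) = x a a" if "a \<le> b" "b \<le> n"
    using simplexD(6)[OF assms, of a a b] simplexD(5)[OF assms, of a] 1[of a] that by simp
  show "i \<cdot> (t \<cdot> x a b) = x b b" if "a \<le> b" "b \<le> n"
    using simplexD(6)[OF assms, of a b b] simplexD(5)[OF assms, of b] that by simp
qed

lemma simplex_comp:
  assumes x: "simplex n U x" and w: "w \<in> Ar C" "Cod C w = U"
  shows "simplex n (Dom C w) (\<lambda>a b. x a b \<cdot> w)"
  unfolding simplex_def
proof (intro conjI allI impI)
  note D = simplexD[OF x]
  fix a b c
  { assume "a \<le> b \<and> b \<le> n"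
    then show "x a b \<cdot> w \<in> Ar C" "Dom C (x a b \<cdot> w) = Dom C w" "Cod C (x a b \<cdot> w) = c1"
      using D w by auto }
  { assume "a \<le> n"
    then show "i \<cdot> (s \<cdot> (x a a \<cdot> w)) = x a a \<cdot> w"
      using D(2,3,4)[of a a] w comp_eq_extend[OF D(5)[of a], of w] by simp }
  { assume "a \<le> b \<and> b \<le> c \<and> c \<le> n"
    then show "t \<cdot> (x a b \<cdot> w) = s \<cdot> (x b c \<cdot> w)" "m (x b c \<cdot> w) (x a b \<cdot> w) = x a c \<cdot> w"
      using D(2,3,4)[of a b] D(2,3,4)[of b c] w comp2_eq_extend[OF D(6)[of a b c], of w]
        m_comp[of "x a b" "x b c" w] D(6,7)[of a b c] by simp_all }
qed (use w in auto)

lemma simplex_reindex: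
  assumes x: "simplex n U x" and \<theta>: "mono \<theta>" "\<theta> k \<le> n"
  shows "simplex k U (\<lambda>a b. x (\<theta> a) (\<theta> b))"
proof -
  have "\<theta> a \<le> \<theta> b" "\<theta> b \<le> n" if "a \<le> b" "b \<le> k" for a b
    using that \<theta> by (auto simp: mono_def intro: order_trans)
  then show ?thesis using simplexD[OF x] unfolding simplex_def by (meson order_refl order_trans)
qed

lemma representsD:
  assumes "represents n P \<nu>"
  shows "simplex n P \<nu>"
    and "simplex n U x \<Longrightarrow> \<exists>!w. w \<in> hom C U P \<and> (\<forall>a b. a \<le> b \<and> b \<le> n \<longrightarrow> \<nu> a b \<cdot> w = x a b)"
  using assms unfolding represents_def by blast+

lemma represents_eqI:
  assumes \<nu>: "represents n P \<nu>" and w: "w \<in> Ar C" "w' \<in> Ar C" "Cod C w = P" "Cod C w' = P" "Dom C w = Dom C w'"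
    "\<And>a b. a \<le> b \<Longrightarrow> b \<le> n \<Longrightarrow> \<nu> a b \<cdot> w = \<nu> a b \<cdot> w'"
  shows "w = w'"
proof -
  have "simplex n (Dom C w') (\<lambda>a b. \<nu> a b \<cdot> w')"
    using simplex_comp representsD(1)[OF \<nu>] w by simp
  from representsD(2)[OF \<nu> this]
  obtain z where z: "\<And>y. y \<in> hom C (Dom C w') P \<and> (\<forall>a b. a \<le> b \<and> b \<le> n \<longrightarrow> \<nu> a b \<cdot> y = \<nu> a b \<cdot> w') \<Longrightarrow> y = z"
    by (elim ex1E) blast
  have "w = z" "w' = z" using w by (auto intro: z)
  then show ?thesis by simp
qed

text \<open>A 0-simplex is stored as the identity arrow of its vertex; hence the universal one is i,
  and s recovers the vertex.\<close>

lemma represents_0: "represents 0 c0 (\<lambda>a b. i)"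
  unfolding represents_def
proof (intro conjI allI impI)
  show "simplex 0 c0 (\<lambda>a b. i)"
    using m_unit(1)[of i] s_i t_i by (simp add: simplex_def)
  fix U x assume x: "simplex 0 U x"
  note D = simplexD(2-4)[OF x, of 0 0] simplexD(1)[OF x]
  show "\<exists>!w. w \<in> hom C U c0 \<and> (\<forall>a b. a \<le> b \<and> b \<le> 0 \<longrightarrow> i \<cdot> w = x a b)"
  proof (rule ex1I[of _ "s \<cdot> x 0 0"])
    show "s \<cdot> x 0 0 \<in> hom C U c0 \<and> (\<forall>a b. a \<le> b \<and> b \<le> 0 \<longrightarrow> i \<cdot> (s \<cdot> x 0 0) = x a b)"
      using D simplexD(5)[OF x, of 0] by simp
    fix w assume "w \<in> hom C U c0 \<and> (\<forall>a b. a \<le> b \<and> b \<le> 0 \<longrightarrow> i \<cdot> w = x a b)"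
    then have w: "w \<in> Ar C" "Cod C w = c0" "x 0 0 = i \<cdot> w" by auto
    then show "w = s \<cdot> x 0 0" by simp
  qed
qed

text \<open>The universal 1-simplex: the generic arrow at (0, 1), the identities of its source and
  target at (0, 0) and (1, 1).\<close>

definition edge1 :: "nat \<Rightarrow> nat \<Rightarrow> 'a" where
  "edge1 a b = (if b = 0 then i \<cdot> s else if a = 0 then Ident C c1 else i \<cdot> t)"

lemma represents_1: "represents 1 c1 edge1"
  unfolding represents_def
proof (intro conjI allI impI)
  have le1: "(a::nat) \<le> 1 \<longleftrightarrow> a = 0 \<or> a = 1" for a by auto
  have u: "m (i \<cdot> s) (i \<cdot> s) = i \<cdot> s" "m (i \<cdot> t) (i \<cdot> t) = i \<cdot> t" "m (Ident C c1) (i \<cdot> s) = Ident C c1"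
    "m (i \<cdot> t) (Ident C c1) = Ident C c1"
    using m_unit(1)[of "i \<cdot> s"] m_unit(1)[of "i \<cdot> t"] m_unit[of "Ident C c1"] by simp_all
  show "simplex 1 c1 edge1"
    unfolding simplex_def
  proof (intro conjI allI impI)
    fix a b c :: nat assume "a \<le> b \<and> b \<le> c \<and> c \<le> 1"
    then have "a = 0 \<and> b = 0 \<and> c = 0 \<or> a = 0 \<and> b = 0 \<and> c = 1 \<or> a = 0 \<and> b = 1 \<and> c = 1 \<or> a = 1 \<and> b = 1 \<and> c = 1"
      by auto
    then show "t \<cdot> edge1 a b = s \<cdot> edge1 b c" "m (edge1 b c) (edge1 a b) = edge1 a c"
      by (elim disjE; simp add: edge1_def u)+
  qed (auto simp: edge1_def le1)
  fix U x assume x: "simplex 1 U x"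
  note D = simplexD(2-4)[OF x, of 0 1] simplexD(1)[OF x]
  show "\<exists>!w. w \<in> hom C U c1 \<and> (\<forall>a b. a \<le> b \<and> b \<le> 1 \<longrightarrow> edge1 a b \<cdot> w = x a b)"
  proof (rule ex1I[of _ "x 0 1"])
    have "edge1 a b \<cdot> x 0 1 = x a b" if "a \<le> b" "b \<le> 1" for a b
    proof -
      have "a = 0 \<and> b = 0 \<or> a = 0 \<and> b = 1 \<or> a = 1 \<and> b = 1" using that by auto
      then show ?thesis using D simplexD'(2)[OF x, of 0 1] simplexD'(3)[OF x, of 0 1]
        by (elim disjE) (auto simp: edge1_def)
    qed
    then show "x 0 1 \<in> hom C U c1 \<and> (\<forall>a b. a \<le> b \<and> b \<le> 1 \<longrightarrow> edge1 a b \<cdot> x 0 1 = x a b)"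
      using D by simp
    fix w assume w: "w \<in> hom C U c1 \<and> (\<forall>a b. a \<le> b \<and> b \<le> 1 \<longrightarrow> edge1 a b \<cdot> w = x a b)"
    then have "edge1 0 1 \<cdot> w = x 0 1" by (auto dest!: spec[of _ 0] spec[of _ 1])
    with w show "w = x 0 1" by (simp add: edge1_def)
  qed
qed

text \<open>An arrow y leaving the last vertex prolongs a simplex: a new entry (a, n + 1) is y after
  x a n, and functoriality comes from associativity and the unit laws.\<close>

lemma simplex_extend:
  assumes x: "simplex n U x" and y: "y \<in> Ar C" "Dom C y = U" "Cod C y = c1" "t \<cdot> x n n = s \<cdot> y"
  shows "simplex (n + 1) U (\<lambda>a b. if b \<le> n then x a b else if a \<le> n then m y (x a n) else i \<cdot> (t \<cdot> y))"
  unfolding simplex_def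
proof (intro conjI allI impI)
  note D = simplexD[OF x] and D' = simplexD'[OF x]
  have ty: "t \<cdot> x a n = s \<cdot> y" if "a \<le> n" for a using D(6)[of a n n] D'(1)[of n] that y(4) by simp
  let ?z = "\<lambda>a b. if b \<le> n then x a b else if a \<le> n then m y (x a n) else i \<cdot> (t \<cdot> y)"
  fix a b c
  { assume "a \<le> b \<and> b \<le> n + 1"
    then show "?z a b \<in> Ar C" "Dom C (?z a b) = U" "Cod C (?z a b) = c1"
      using D y ty by auto }
  { assume "a \<le> n + 1"
    then show "i \<cdot> (s \<cdot> ?z a a) = ?z a a" using D y by simp }
  { assume abc: "a \<le> b \<and> b \<le> c \<and> c \<le> n + 1"
    consider "c \<le> n" | "c = n + 1" "b \<le> n" | "c = n + 1" "b = n + 1" "a \<le> n" | "c = n + 1" "b = n + 1" "a = n + 1"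
      using abc by linarith
    then have "t \<cdot> ?z a b = s \<cdot> ?z b c \<and> m (?z b c) (?z a b) = ?z a c"
    proof cases
      case 1 then show ?thesis using D abc by auto
    next
      case 2
      then show ?thesis
        using D(2-4)[of a b] D(2-4)[of b n] D(6,7)[of a b n] abc ty[of b] y m_assoc[of "x a b" "x b n" y] by simp
    next
      case 3
      then show ?thesis using D(2-4)[of a n] ty[of a] y m_unit(2)[of "m y (x a n)"] by simp
    next
      case 4
      then show ?thesis using y m_unit(2)[of "i \<cdot> (t \<cdot> y)"] by simp
    qed
    then show "t \<cdot> ?z a b = s \<cdot> ?z b c" "m (?z b c) (?z a b) = ?z a c" by auto }
qed (rule simplexD(1)[OF x])

text \<open>An (n + 1)-simplex is an n-simplex together with an arrow out of its last vertex. Such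
  pairs are represented by the pullback of \<open>t \<cdot> \<nu> n n\<close> and s.\<close>

lemma represents_Suc:
  assumes \<nu>: "represents n P \<nu>"
  shows "\<exists>P' \<nu>'. represents (n + 1) P' \<nu>'"
proof -
  note S = representsD(1)[OF \<nu>] and E = representsD(2)[OF \<nu>]
  note D = simplexD[OF S] and D' = simplexD'[OF S]
  obtain p q where PB: "is_pullback C (t \<cdot> \<nu> n n) s p q"
    using pb_is_pullback[OF pullbacks, of "t \<cdot> \<nu> n n" s] D by auto
  note pq = pullback_Ar[OF PB]
  let ?P = "Dom C p"
  let ?\<nu> = "\<lambda>a b. if b \<le> n then \<nu> a b \<cdot> p else if a \<le> n then m q (\<nu> a n \<cdot> p) else i \<cdot> (t \<cdot> q)"
  have "simplex (n + 1) ?P ?\<nu>"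
    using simplex_extend[OF simplex_comp[OF S], of p q] pq D by simp
  moreover have "\<exists>!w. w \<in> hom C U ?P \<and> (\<forall>a b. a \<le> b \<and> b \<le> n + 1 \<longrightarrow> ?\<nu> a b \<cdot> w = x a b)"
    if x: "simplex (n + 1) U x" for U x
  proof -
    note X = simplexD[OF x] and X' = simplexD'[OF x]
    have x': "simplex n U x"
      using x unfolding simplex_def by auto
    obtain u where u: "u \<in> Ar C" "Dom C u = U" "Cod C u = P" "\<And>a b. a \<le> b \<Longrightarrow> b \<le> n \<Longrightarrow> \<nu> a b \<cdot> u = x a b"
      using E[OF x'] by (auto simp: Ex1_def)
    have tv: "(t \<cdot> \<nu> n n) \<cdot> u = s \<cdot> x n (n + 1)"
      using X(6)[of n n "n + 1"] u D by simp
    have "\<exists>!w. w \<in> hom C (Dom C u) ?P \<and> p \<cdot> w = u \<and> q \<cdot> w = x n (n + 1)"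
      using pullback_ex1[OF PB, of u "x n (n + 1)"] tv u X(2-4)[of n "n + 1"] D by simp
    then obtain w where w: "w \<in> Ar C" "Dom C w = U" "Cod C w = ?P" "p \<cdot> w = u" "q \<cdot> w = x n (n + 1)"
      using u by auto
    have tq: "t \<cdot> (\<nu> a n \<cdot> p) = s \<cdot> q" if "a \<le> n" for a
      using pq(9) D(2-4,6) D'(1)[of n] that comp2_eq_extend[OF D(6)[of a n n], of p]
        comp2_eq_extend[OF D'(1)[of n], of p] pq by simp
    have mq: "m q (\<nu> a n \<cdot> p) \<cdot> w' = m (q \<cdot> w') (\<nu> a n \<cdot> (p \<cdot> w'))"
      if "w' \<in> Ar C" "Cod C w' = ?P" "a \<le> n" for w' a
      using m_comp[of "\<nu> a n \<cdot> p" q w'] tq[OF that(3)] that pq D(2-4)[of a n] D(2-4)[of n n] by simp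
    show ?thesis
    proof (rule ex1I[of _ w])
      have "?\<nu> a b \<cdot> w = x a b" if ab: "a \<le> b" "b \<le> n + 1" for a b
      proof -
        consider "b \<le> n" | "b = n + 1" "a \<le> n" | "b = n + 1" "a = n + 1"
          using ab by linarith
        then show ?thesis
        proof cases
          case 1 then show ?thesis using u w D(2-4)[of a b] D(2-4)[of n n] ab pq by simp
        next
          case 2
          then show ?thesis using mq[of w a] w u(4)[of a n] X(7)[of a n "n + 1"] by simp
        next
          case 3
          then show ?thesis using w pq X'(3)[of n "n + 1"] by simp
        qed
      qed
      then show "w \<in> hom C U ?P \<and> (\<forall>a b. a \<le> b \<and> b \<le> n + 1 \<longrightarrow> ?\<nu> a b \<cdot> w = x a b)"
        using w by simp
      fix w' assume "w' \<in> hom C U ?P \<and> (\<forall>a b. a \<le> b \<and> b \<le> n + 1 \<longrightarrow> ?\<nu> a b \<cdot> w' = x a b)"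
      then have w': "w' \<in> Ar C" "Dom C w' = U" "Cod C w' = ?P"
        and e: "\<And>a b. a \<le> b \<Longrightarrow> b \<le> n + 1 \<Longrightarrow> ?\<nu> a b \<cdot> w' = x a b" by auto
      have pw': "p \<cdot> w' = u"
      proof (rule represents_eqI[OF \<nu>])
        fix a b :: nat assume "a \<le> b" "b \<le> n"
        then show "\<nu> a b \<cdot> (p \<cdot> w') = \<nu> a b \<cdot> u"
          using e[of a b] u(4)[of a b] D(2-4)[of a b] D(2-4)[of n n] w' pq by simp
      qed (use w' u pq D(2-4)[of n n] in simp_all)
      \<comment> \<open>The entry (n, n + 1) is q after the identity at vertex n, hence q itself;
        this determines the second coordinate of w'.\<close>
      have "i \<cdot> (s \<cdot> (q \<cdot> w')) = \<nu> n n \<cdot> (p \<cdot> w')"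
        using pullback_square[OF PB, of w'] w' pq D(2-4)[of n n] D'(1)[of n] D'(2)[of n n]
          comp_eq_extend[OF D'(2)[of n n], of "p \<cdot> w'"] comp2_eq_extend[OF D'(1)[of n], of "p \<cdot> w'"] by simp
      then have "q \<cdot> w' = x n (n + 1)"
        using e[of n "n + 1"] mq[of w' n] m_unit(1)[of "q \<cdot> w'"] w' pq by simp
      then show "w' = w" using pw' w w' by (intro pullback_eqI[OF PB w'(1) w(1)]) simp_all
    qed
  qed
  ultimately have "represents (n + 1) ?P ?\<nu>" unfolding represents_def by blast
  then show ?thesis by blast
qed

text \<open>Representing objects are unique only up to isomorphism; degrees 0 and 1 are prescribed
  here so that the nerve has exactly \<open>c0\<close> and \<open>c1\<close> as its objects of
  objects and of arrows.\<close>

lemma represents_ex: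
  "\<exists>P \<nu>. (\<forall>n. represents n (P n) (\<nu> n)) \<and> P 0 = c0 \<and> \<nu> 0 = (\<lambda>a b. i) \<and> P 1 = c1 \<and> \<nu> 1 = edge1"
proof -
  have ex: "\<exists>P \<nu>. represents n P \<nu>" for n
    by (induction n) (use represents_0 represents_Suc in \<open>fastforce simp: Suc_eq_plus1\<close>)+
  have "\<exists>z. represents n (fst z) (snd z) \<and> (n = 0 \<longrightarrow> z = (c0, \<lambda>a b. i)) \<and> (n = 1 \<longrightarrow> z = (c1, edge1))" for n
  proof -
    consider "n = 0" | "n = 1" | "n \<noteq> 0" "n \<noteq> 1" by blast
    then show ?thesis using ex[of n] represents_0 represents_1 by cases auto
  qed
  then obtain z where z: "\<And>n. represents n (fst (z n)) (snd (z n)) \<and> (n = 0 \<longrightarrow> z n = (c0, \<lambda>a b. i)) \<and> (n = 1 \<longrightarrow> z n = (c1, edge1))"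
    by metis
  show ?thesis
    by (intro exI[of _ "fst \<circ> z"] exI[of _ "snd \<circ> z"]) (use z in simp)
qed

text \<open>The generators of the simplex category are taken as maps on all natural numbers. Only
  their values up to a given degree matter, which is why reindexing carries bounds on the
  maps.\<close>

definition coface :: "nat \<Rightarrow> nat \<Rightarrow> nat" where "coface j a = (if a < j then a else a + 1)"
definition codegen :: "nat \<Rightarrow> nat \<Rightarrow> nat" where "codegen j a = (if a \<le> j then a else a - 1)"

theorem nerve:
  "\<exists>X. category_object C X \<and> ob X = c0 \<and> ar X = c1 \<and> src X = s \<and> trg X = t \<and> idn X = i \<and>
    (\<forall>f g. f \<in> Ar C \<and> g \<in> Ar C \<and> Cod C f = c1 \<and> Cod C g = c1 \<and> Dom C f = Dom C g \<and> t \<cdot> f = s \<cdot> g \<longrightarrow>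
      cmp C X g f = m g f)"
proof -
  obtain P \<nu> where R: "\<And>n. represents n (P n) (\<nu> n)"
    and P0: "P 0 = c0" "\<nu> 0 = (\<lambda>a b. i)" and P1: "P 1 = c1" "\<nu> 1 = edge1"
    using represents_ex by blast
  note S = representsD(1)[OF R]
  note D = simplexD[OF S]
  \<comment> \<open>A monotone map \<theta> : [n] -> [k] reindexes k-simplices to n-simplices;
    \<open>act k n \<theta>\<close> is the arrow between representing objects that this natural
    operation induces.\<close>
  define act where "act k n \<theta> = (THE w. w \<in> hom C (P k) (P n) \<and>
     (\<forall>a b. a \<le> b \<and> b \<le> n \<longrightarrow> \<nu> n a b \<cdot> w = \<nu> k (\<theta> a) (\<theta> b)))" for k n \<theta>
  have "act k n \<theta> \<in> hom C (P k) (P n) \<and>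
     (\<forall>a b. a \<le> b \<and> b \<le> n \<longrightarrow> \<nu> n a b \<cdot> act k n \<theta> = \<nu> k (\<theta> a) (\<theta> b))" if "mono \<theta>" "\<theta> n \<le> k" for k n \<theta>
    unfolding act_def by (rule theI', rule representsD(2)[OF R simplex_reindex[OF S that]])
  then have act: "act k n \<theta> \<in> Ar C" "Dom C (act k n \<theta>) = P k" "Cod C (act k n \<theta>) = P n"
     "a \<le> b \<Longrightarrow> b \<le> n \<Longrightarrow> \<nu> n a b \<cdot> act k n \<theta> = \<nu> k (\<theta> a) (\<theta> b)" if "mono \<theta>" "\<theta> n \<le> k" for k n \<theta> a b
    using that by auto
  have le: "\<theta> a \<le> \<theta> b" "\<theta> b \<le> k" if "mono \<theta>" "\<theta> n \<le> k" "a \<le> b" "b \<le> n" for \<theta> :: "nat \<Rightarrow> nat" and n k a b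
    using that by (auto simp: mono_def intro: order_trans)
  have actx: "\<nu> n a b \<cdot> (act k n \<theta> \<cdot> w) = \<nu> k (\<theta> a) (\<theta> b) \<cdot> w"
    if "mono \<theta>" "\<theta> n \<le> k" "a \<le> b" "b \<le> n" "w \<in> Ar C" "Cod C w = P k" for k n \<theta> a b w
    using comp_eq_extend[OF act(4)[OF that(1-4)]] that act[OF that(1,2)] D(2-4)[of a b n] le[OF that(1-4)] by simp
  have act_eqI: "w = act k n \<theta>"
    if "mono \<theta>" "\<theta> n \<le> k" "w \<in> Ar C" "Dom C w = P k" "Cod C w = P n"
      "\<And>a b. a \<le> b \<Longrightarrow> b \<le> n \<Longrightarrow> \<nu> n a b \<cdot> w = \<nu> k (\<theta> a) (\<theta> b)" for w k n \<theta>
    apply (rule represents_eqI[OF R[of n]])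
    using that act[OF that(1,2)] by simp_all
  \<comment> \<open>Contravariant functoriality. With it every simplicial identity becomes an
    identity between maps of natural numbers, settled by cases.\<close>
  have act_comp: "act k n \<theta> \<cdot> act l k \<phi> = act l n \<psi>"
    if "mono \<theta>" "\<theta> n \<le> k" "mono \<phi>" "\<phi> k \<le> l" "mono \<psi>" "\<And>a. a \<le> n \<Longrightarrow> \<psi> a = \<phi> (\<theta> a)" for k n l \<theta> \<phi> \<psi>
  proof (rule act_eqI)
    show "\<psi> n \<le> l" using that(6)[of n] le(2)[OF that(3,4), of "\<theta> n" "\<theta> n"] that(2) by simp
    fix a b assume ab: "a \<le> b" "b \<le> n"
    show "\<nu> n a b \<cdot> (act k n \<theta> \<cdot> act l k \<phi>) = \<nu> l (\<psi> a) (\<psi> b)"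
      using actx[OF that(1,2) ab, of "act l k \<phi>"] act[OF that(3,4)] le[OF that(1,2) ab] that(6)[of a] that(6)[of b] ab
      by simp
  qed (use that act[OF that(1,2)] act[OF that(3,4)] in simp_all)
  have act_id: "act n n \<theta> = Ident C (P n)" if "mono \<theta>" "\<And>a. a \<le> n \<Longrightarrow> \<theta> a = a" for n \<theta>
    using act_eqI[of \<theta> n n "Ident C (P n)"] that D(1)[of n] D(2-4)[of _ _ n] by simp
  define X :: "('o, 'a) simp" where
    "X = \<lparr>sob = P, face = (\<lambda>n j. act (n + 1) n (coface j)), degen = (\<lambda>n j. act n (n + 1) (codegen j))\<rparr>"
  have X: "sob X = P" "face X n j = act (n + 1) n (coface j)" "degen X n j = act n (n + 1) (codegen j)" for n j
    by (simp_all add: X_def)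
  have cf: "mono (coface j)" "coface j n \<le> n + 1" and cd: "mono (codegen j)" "j \<le> n \<Longrightarrow> codegen j (n + 1) \<le> n" for j n
    by (auto simp: coface_def codegen_def mono_def)
  have mc: "mono (\<lambda>a. \<theta> (\<phi> a))" if "mono \<theta>" "mono \<phi>" for \<theta> \<phi> :: "nat \<Rightarrow> nat"
    using that by (simp add: mono_def)
  have simp: "simplicial_object C X"
    unfolding simplicial_object_def X
  proof (intro conjI allI impI)
    fix n j k :: nat
    show "P n \<in> Ob C" by (rule D(1))
    show "act (n + 1) n (coface j) \<in> hom C (P (n + 1)) (P n)" using act[OF cf] by simp
    { assume "j \<le> n"
      then show "act n (n + 1) (codegen j) \<in> hom C (P n) (P (n + 1))" using act[OF cd] by simp
      have "act (n + 1) n (coface j) \<cdot> act n (n + 1) (codegen j) = act n n (\<lambda>a. codegen j (coface j a))"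
        "act (n + 1) n (coface (j + 1)) \<cdot> act n (n + 1) (codegen j) = act n n (\<lambda>a. codegen j (coface (j + 1) a))"
        using cf cd \<open>j \<le> n\<close> mc by (auto intro!: act_comp)
      then show "act (n + 1) n (coface j) \<cdot> act n (n + 1) (codegen j) = Ident C (P n)"
        "act (n + 1) n (coface (j + 1)) \<cdot> act n (n + 1) (codegen j) = Ident C (P n)"
        using mc[OF cd(1)[of j] cf(1)[of j]] mc[OF cd(1)[of j] cf(1)[of "j + 1"]]
        by (auto simp: act_id coface_def codegen_def) }
    { assume jk: "j \<le> k \<and> k \<le> n + 1"
      have "act (n + 1) n (coface j) \<cdot> act (n + 1 + 1) (n + 1) (coface (k + 1)) = act (n + 1 + 1) n (\<lambda>a. coface (k + 1) (coface j a))"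
        "act (n + 1) n (coface k) \<cdot> act (n + 1 + 1) (n + 1) (coface j) = act (n + 1 + 1) n (\<lambda>a. coface (k + 1) (coface j a))"
        using cf(1) cf(2)[of _ n] cf(1) cf(2)[of _ "n + 1"] mc jk by (auto intro!: act_comp) (auto simp: coface_def)
      then show "act (n + 1) n (coface j) \<cdot> act (n + 1 + 1) (n + 1) (coface (k + 1))
        = act (n + 1) n (coface k) \<cdot> act (n + 1 + 1) (n + 1) (coface j)" by simp }
    { assume jk: "j \<le> k \<and> k \<le> n"
      have "act (n + 1 + 1) (n + 1) (coface j) \<cdot> act (n + 1) (n + 1 + 1) (codegen (k + 1)) = act (n + 1) (n + 1) (\<lambda>a. codegen (k + 1) (coface j a))"
        "act n (n + 1) (codegen k) \<cdot> act (n + 1) n (coface j) = act (n + 1) (n + 1) (\<lambda>a. codegen (k + 1) (coface j a))"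
        using cf(1) cf(2)[of _ n] cf(1) cf(2)[of _ "n + 1"] cd(1) cd(2)[of k n] cd(2)[of "k + 1" "n + 1"] mc jk
        by (auto intro!: act_comp) (auto simp: coface_def codegen_def)
      then show "act (n + 1 + 1) (n + 1) (coface j) \<cdot> act (n + 1) (n + 1 + 1) (codegen (k + 1))
        = act n (n + 1) (codegen k) \<cdot> act (n + 1) n (coface j)" by simp
      have "act (n + 1) (n + 1 + 1) (codegen j) \<cdot> act n (n + 1) (codegen k) = act n (n + 1 + 1) (\<lambda>a. codegen k (codegen j a))"
        "act (n + 1) (n + 1 + 1) (codegen (k + 1)) \<cdot> act n (n + 1) (codegen j) = act n (n + 1 + 1) (\<lambda>a. codegen k (codegen j a))"
        using cd(1) cd(2)[of _ n] cd(2)[of _ "n + 1"] mc jk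
        by (auto intro!: act_comp) (auto simp: codegen_def)
      then show "act (n + 1) (n + 1 + 1) (codegen j) \<cdot> act n (n + 1) (codegen k)
        = act (n + 1) (n + 1 + 1) (codegen (k + 1)) \<cdot> act n (n + 1) (codegen j)" by simp }
    { assume kj: "k < j \<and> j \<le> n + 1"
      have "act (n + 1 + 1) (n + 1) (coface (j + 1)) \<cdot> act (n + 1) (n + 1 + 1) (codegen k) = act (n + 1) (n + 1) (\<lambda>a. codegen k (coface (j + 1) a))"
        "act n (n + 1) (codegen k) \<cdot> act (n + 1) n (coface j) = act (n + 1) (n + 1) (\<lambda>a. codegen k (coface (j + 1) a))"
        using cf(1) cf(2)[of _ n] cf(1) cf(2)[of _ "n + 1"] cd(1) cd(2)[of k n] cd(2)[of k "n + 1"] mc kj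
        by (auto intro!: act_comp) (auto simp: coface_def codegen_def)
      then show "act (n + 1 + 1) (n + 1) (coface (j + 1)) \<cdot> act (n + 1) (n + 1 + 1) (codegen k)
        = act n (n + 1) (codegen k) \<cdot> act (n + 1) n (coface j)" by simp }
  qed
  have fx: "\<nu> n a b \<cdot> (face X n j \<cdot> w) = \<nu> (n + 1) (coface j a) (coface j b) \<cdot> w"
    "face X n j \<in> Ar C" "Dom C (face X n j) = P (n + 1)" "Cod C (face X n j) = P n"
    if "a \<le> b" "b \<le> n" "w \<in> Ar C" "Cod C w = P (n + 1)" for n j a b w
    using actx[OF cf that] act[OF cf] unfolding X by simp_all
  have fxA: "face X n j \<in> Ar C" "Dom C (face X n j) = P (n + 1)" "Cod C (face X n j) = P n" for n j
    using act[OF cf] unfolding X by simp_all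
  \<comment> \<open>The Segal condition. The faces omitting the last and the first vertex contain
    all entries of an (n + 2)-simplex except (0, n + 2), and that entry is the composite of (0, 1)
    and (1, n + 2).\<close>
  have "is_pullback C (face X n 0) (face X n (n + 1)) (face X (n + 1) (n + 2)) (face X (n + 1) 0)" for n
  proof (rule is_pullbackI)
    have "\<forall>n j k. j \<le> k \<and> k \<le> n + 1 \<longrightarrow> face X n j \<cdot> face X (n + 1) (k + 1) = face X n k \<cdot> face X (n + 1) j"
      using simp unfolding simplicial_object_def by (elim conjE)
    from this[rule_format, of 0 "n + 1" n]
    show "face X n 0 \<cdot> face X (n + 1) (n + 2) = face X n (n + 1) \<cdot> face X (n + 1) 0" by simp
    fix w w' assume w: "w \<in> Ar C" "w' \<in> Ar C" "Dom C w = Dom C w'" "Cod C w = Dom C (face X (n + 1) (n + 2))"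
      "Cod C w' = Dom C (face X (n + 1) (n + 2))" "face X (n + 1) (n + 2) \<cdot> w = face X (n + 1) (n + 2) \<cdot> w'"
      "face X (n + 1) 0 \<cdot> w = face X (n + 1) 0 \<cdot> w'"
    then have ww: "Cod C w = P (n + 2)" "Cod C w' = P (n + 2)" using fxA by simp_all
    have e1: "\<nu> (n + 2) a b \<cdot> w = \<nu> (n + 2) a b \<cdot> w'" if "a \<le> b" "b \<le> n + 1" for a b
      using fx(1)[of a b "n + 1" w "n + 2"] fx(1)[of a b "n + 1" w' "n + 2"] w ww that by (simp add: coface_def)
    have e2: "\<nu> (n + 2) (a + 1) (b + 1) \<cdot> w = \<nu> (n + 2) (a + 1) (b + 1) \<cdot> w'" if "a \<le> b" "b \<le> n + 1" for a b
      using fx(1)[of a b "n + 1" w 0] fx(1)[of a b "n + 1" w' 0] w ww that by (simp add: coface_def)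
    have m3: "\<nu> (n + 2) 0 (n + 2) \<cdot> x = m (\<nu> (n + 2) 1 (n + 2) \<cdot> x) (\<nu> (n + 2) 0 1 \<cdot> x)"
      if "x \<in> Ar C" "Cod C x = P (n + 2)" for x
      using m_comp[of "\<nu> (n + 2) 0 1" "\<nu> (n + 2) 1 (n + 2)" x] D(2-4)[of 0 1 "n + 2"] D(2-4)[of 1 "n + 2" "n + 2"]
        D(6,7)[of 0 1 "n + 2" "n + 2"] that by simp
    show "w = w'"
    proof (rule represents_eqI[OF R[of "n + 2"] w(1,2) ww w(3)])
      fix a b assume ab: "a \<le> b" "b \<le> n + 2"
      consider "b \<le> n + 1" | "a > 0" | "a = 0" "b = n + 2" using ab by linarith
      then show "\<nu> (n + 2) a b \<cdot> w = \<nu> (n + 2) a b \<cdot> w'"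
      proof cases
        case 1 then show ?thesis using e1 ab by blast
      next
        case 2 then show ?thesis using e2[of "a - 1" "b - 1"] ab by simp
      next
        case 3 then show ?thesis using m3 w ww e1[of 0 1] e2[of 0 "n + 1"] by simp
      qed
    qed
  next
    fix u v assume uv: "u \<in> Ar C" "v \<in> Ar C" "Dom C u = Dom C v" "Cod C u = Dom C (face X n 0)"
      "Cod C v = Dom C (face X n (n + 1))" "face X n 0 \<cdot> u = face X n (n + 1) \<cdot> v"
    then have uv': "Cod C u = P (n + 1)" "Cod C v = P (n + 1)" using fxA by simp_all
    let ?x = "\<lambda>a b. \<nu> (n + 1) a b \<cdot> u" and ?y = "\<lambda>a b. \<nu> (n + 1) a b \<cdot> v"
    have x: "simplex (n + 1) (Dom C u) ?x" and y: "simplex (n + 1) (Dom C u) ?y"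
      using simplex_comp[OF S uv(1) uv'(1)] simplex_comp[OF S uv(2) uv'(2)] uv by simp_all
    note X = simplexD[OF x] and Y = simplexD[OF y] and X' = simplexD'[OF x] and Y' = simplexD'[OF y]
    have ov: "?x (a + 1) (b + 1) = ?y a b" if "a \<le> b" "b \<le> n" for a b
      using fx(1)[of a b n u 0] fx(1)[of a b n v "n + 1"] uv uv' that by (simp add: coface_def)
    \<comment> \<open>The simplices u and v are glued along their overlap \<open>ov\<close>: u
      supplies the entries up to n + 1, v shifted by one those starting after 0, and the one
      remaining entry is a composite.\<close>
    let ?z = "\<lambda>a b. if b \<le> n + 1 then ?x a b else if a = 0 then m (?y 0 (n + 1)) (?x 0 1) else ?y (a - 1) (b - 1)"
    have z1: "?z (a + 1) (b + 1) = ?y a b" if "a \<le> b" "b \<le> n + 1" for a b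
      using ov[of a b] that by simp
    have tz: "t \<cdot> ?x 0 1 = s \<cdot> ?y 0 (n + 1)"
      using X(6)[of 0 1 1] ov[of 0 0] Y(6)[of 0 0 "n + 1"] Y'(1)[of 0] by simp
    have z: "simplex (n + 2) (Dom C u) ?z"
      unfolding simplex_def
    proof (intro conjI allI impI)
      fix a b c
      { assume ab: "a \<le> b \<and> b \<le> n + 2"
        then show "?z a b \<in> Ar C" "Dom C (?z a b) = Dom C u" "Cod C (?z a b) = c1"
          using X(2-4)[of a b] X(2-4)[of 0 1] Y(2-4)[of 0 "n + 1"] Y(2-4)[of "a - 1" "b - 1"] tz by auto }
      { assume "a \<le> n + 2"
        then show "i \<cdot> (s \<cdot> ?z a a) = ?z a a" using X(5)[of a] Y(5)[of "a - 1"] by (cases "a \<le> n + 1") auto }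
      { assume abc: "a \<le> b \<and> b \<le> c \<and> c \<le> n + 2"
        consider "c \<le> n + 1" | "0 < a" | "a = 0" "c = n + 2" "b = 0" | "a = 0" "c = n + 2" "0 < b"
          using abc by linarith
        then have "t \<cdot> ?z a b = s \<cdot> ?z b c \<and> m (?z b c) (?z a b) = ?z a c"
        proof cases
          case 1 then show ?thesis using X(6,7)[of a b c] abc by simp
        next
          case 2
          then obtain a' b' c' where e: "a = a' + 1" "b = b' + 1" "c = c' + 1"
            using abc by (metis Suc_eq_plus1 gr0_implies_Suc less_le_trans)
          have zz: "?z a b = ?y a' b'" "?z b c = ?y b' c'" "?z a c = ?y a' c'"
            using z1[of a' b'] z1[of b' c'] z1[of a' c'] abc unfolding e by simp_all
          show ?thesis
            unfolding zz using Y(6,7)[of a' b' c'] abc e by simp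
        next
          case 3
          have "m (m (?y 0 (n + 1)) (?x 0 1)) (i \<cdot> (s \<cdot> ?x 0 1)) = m (?y 0 (n + 1)) (?x 0 1)"
            using m_unit(1)[of "m (?y 0 (n + 1)) (?x 0 1)"] X(2-4)[of 0 1] Y(2-4)[of 0 "n + 1"] tz by simp
          then show ?thesis
            using 3 X(6)[of 0 0 1] X'(2)[of 0 1] X(2-4)[of 0 1] Y(2-4)[of 0 "n + 1"] tz by simp
        next
          case 4
          then obtain b' where e: "b = b' + 1" using gr0_implies_Suc by (metis Suc_eq_plus1)
          have b': "b' \<le> n + 1" using abc e 4 by simp
          have zbc: "?z b c = ?y b' (n + 1)"
            using z1[of b' "n + 1"] e 4 b' by simp
          have b'': "b' \<le> n \<or> b' = n + 1" using b' by linarith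
          have z0b: "?z 0 b = m (?y 0 b') (?x 0 1)" "t \<cdot> ?x 0 1 = s \<cdot> ?y 0 b'"
            using b'' ov[of 0 b'] X(6,7)[of 0 1 "b' + 1"] tz unfolding e by auto
          show ?thesis
            unfolding \<open>a = 0\<close> zbc z0b(1)
            using z0b(2) tz 4 X(2-4)[of 0 1] Y(2-4)[of 0 b'] Y(2-4)[of b' "n + 1"] b' Y(6,7)[of 0 b' "n + 1"]
              m_assoc[of "?x 0 1" "?y 0 b'" "?y b' (n + 1)"] by simp
        qed
        then show "t \<cdot> ?z a b = s \<cdot> ?z b c" "m (?z b c) (?z a b) = ?z a c" by auto }
    qed (use uv in simp)
    obtain w where w: "w \<in> Ar C" "Dom C w = Dom C u" "Cod C w = P (n + 2)"
      "\<And>a b. a \<le> b \<Longrightarrow> b \<le> n + 2 \<Longrightarrow> \<nu> (n + 2) a b \<cdot> w = ?z a b"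
      using ex1_implies_ex[OF representsD(2)[OF R z]] by auto
    have "face X (n + 1) (n + 2) \<cdot> w = u"
      apply (rule represents_eqI[OF R[of "n + 1"]])
      using fxA[of "n + 1" "n + 2"] w(1-3) uv uv' fx(1)[of _ _ "n + 1" w "n + 2"] w(4) by (simp_all add: coface_def)
    moreover have "face X (n + 1) 0 \<cdot> w = v"
      apply (rule represents_eqI[OF R[of "n + 1"]])
      using fxA[of "n + 1" 0] w(1-3) uv uv' fx(1)[of _ _ "n + 1" w 0] w(4)[of "_ + 1" "_ + 1"] z1 by (simp_all add: coface_def)
    ultimately show "\<exists>w. w \<in> Ar C \<and> Dom C w = Dom C u \<and> Cod C w = Dom C (face X (n + 1) (n + 2)) \<and>
        face X (n + 1) (n + 2) \<cdot> w = u \<and> face X (n + 1) 0 \<cdot> w = v"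
      using w fxA by auto
  qed (use fxA in simp_all)
  then have cat: "category_object C X" using simp by (simp add: category_object_def)
  have lo: "ob X = c0" "ar X = c1" using P0 P1 by (simp_all add: ob_def ar_def X_def)
  have s: "src X = s"
    using act_eqI[of "coface 1" 0 1 s] cf(1) cf(2)[of _ 0] P0 P1 by (simp add: X src_def coface_def edge1_def)
  have t: "trg X = t"
    using act_eqI[of "coface 0" 0 1 t] cf(1) cf(2)[of _ 0] P0 P1 by (simp add: X trg_def coface_def edge1_def)
  have i: "idn X = i"
  proof -
    have "i = act 0 1 (codegen 0)"
    proof (rule act_eqI)
      fix a b :: nat assume "a \<le> b" "b \<le> 1"
      then show "\<nu> 1 a b \<cdot> i = \<nu> 0 (codegen 0 a) (codegen 0 b)"
        using P0 P1 s_i t_i by (auto simp: edge1_def)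
    qed (use cd(1) cd(2)[of 0 0] P0 P1 in simp_all)
    then show ?thesis by (simp add: X idn_def)
  qed
  have "cmp C X g f = m g f" if fg: "f \<in> Ar C" "g \<in> Ar C" "Cod C f = c1" "Cod C g = c1" "Dom C f = Dom C g" "t \<cdot> f = s \<cdot> g" for f g
  proof -
    obtain x where x: "x \<in> Ar C" "Dom C x = Dom C f" "Cod C x = sob X 2"
      "face X 1 2 \<cdot> x = f" "face X 1 0 \<cdot> x = g" "face X 1 1 \<cdot> x = cmp C X g f"
      by (rule composable_simplex[OF cat, of f g]) (use fg lo s t in auto)
    have x': "Cod C x = P 2" using x X(1) by simp
    have c: "coface 2 0 = 0" "coface 2 1 = 1" "coface 0 0 = 1" "coface 0 1 = 2" "coface 1 0 = 0" "coface 1 1 = 2"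
      by (simp_all add: coface_def)
    have id1: "\<nu> 1 0 1 = Ident C c1" using P1 by (simp add: edge1_def)
    have ci: "Ident C c1 \<cdot> cmp C X g f = cmp C X g f"
      using x(1) x' fxA[of 1 1] P1(1) by (simp flip: x(6))
    have e: "f = \<nu> 2 0 1 \<cdot> x" "g = \<nu> 2 1 2 \<cdot> x" "cmp C X g f = \<nu> 2 0 2 \<cdot> x"
      using fx(1)[of 0 1 1 x 2] fx(1)[of 0 1 1 x 0] fx(1)[of 0 1 1 x 1] x x' c id1 ci fxA[of 1] P1(1) fg by simp_all
    have "m (\<nu> 2 1 2 \<cdot> x) (\<nu> 2 0 1 \<cdot> x) = \<nu> 2 0 2 \<cdot> x"
      using m_comp[of "\<nu> 2 0 1" "\<nu> 2 1 2" x] D(2-4)[of 0 1 2] D(2-4)[of 1 2 2] D(6,7)[of 0 1 2 2] x x'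
      by simp
    then show ?thesis using e by simp
  qed
  then show ?thesis using cat lo s t i by blast
qed

end

section \<open>The 2-category of internal categories\<close>

text \<open>The laws of a strict 2-category in conditional form. They are verified once for Cat(C);
  the monad of corners is then built from these laws and not from the encoding of functors and
  transformations.\<close>

locale two_category = category_context K
  for K :: "('o, 'a, 't, 'm) two_cat_scheme" (structure) +
  assumes Src_Ar [simp]: "\<alpha> \<in> Cell K \<Longrightarrow> Src K \<alpha> \<in> Ar K" and Trg_Ar [simp]: "\<alpha> \<in> Cell K \<Longrightarrow> Trg K \<alpha> \<in> Ar K"
    and Dom_Trg [simp]: "\<alpha> \<in> Cell K \<Longrightarrow> Dom K (Trg K \<alpha>) = Dom K (Src K \<alpha>)"
    and Cod_Trg [simp]: "\<alpha> \<in> Cell K \<Longrightarrow> Cod K (Trg K \<alpha>) = Cod K (Src K \<alpha>)"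
    and Ident2 [simp]: "f \<in> Ar K \<Longrightarrow> Ident2 K f \<in> Cell K" "f \<in> Ar K \<Longrightarrow> Src K (Ident2 K f) = f"
      "f \<in> Ar K \<Longrightarrow> Trg K (Ident2 K f) = f"
    and VComp [simp]: "\<lbrakk>\<alpha> \<in> Cell K; \<beta> \<in> Cell K; Src K \<beta> = Trg K \<alpha>\<rbrakk> \<Longrightarrow> \<beta> \<bullet> \<alpha> \<in> Cell K"
      "\<lbrakk>\<alpha> \<in> Cell K; \<beta> \<in> Cell K; Src K \<beta> = Trg K \<alpha>\<rbrakk> \<Longrightarrow> Src K (\<beta> \<bullet> \<alpha>) = Src K \<alpha>"
      "\<lbrakk>\<alpha> \<in> Cell K; \<beta> \<in> Cell K; Src K \<beta> = Trg K \<alpha>\<rbrakk> \<Longrightarrow> Trg K (\<beta> \<bullet> \<alpha>) = Trg K \<beta>"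
    and LWhisk [simp]: "\<lbrakk>\<alpha> \<in> Cell K; g \<in> Ar K; Dom K g = Cod K (Src K \<alpha>)\<rbrakk> \<Longrightarrow> g \<rhd> \<alpha> \<in> Cell K"
      "\<lbrakk>\<alpha> \<in> Cell K; g \<in> Ar K; Dom K g = Cod K (Src K \<alpha>)\<rbrakk> \<Longrightarrow> Src K (g \<rhd> \<alpha>) = g \<cdot> Src K \<alpha>"
      "\<lbrakk>\<alpha> \<in> Cell K; g \<in> Ar K; Dom K g = Cod K (Src K \<alpha>)\<rbrakk> \<Longrightarrow> Trg K (g \<rhd> \<alpha>) = g \<cdot> Trg K \<alpha>"
    and RWhisk [simp]: "\<lbrakk>\<alpha> \<in> Cell K; f \<in> Ar K; Cod K f = Dom K (Src K \<alpha>)\<rbrakk> \<Longrightarrow> \<alpha> \<lhd> f \<in> Cell K"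
      "\<lbrakk>\<alpha> \<in> Cell K; f \<in> Ar K; Cod K f = Dom K (Src K \<alpha>)\<rbrakk> \<Longrightarrow> Src K (\<alpha> \<lhd> f) = Src K \<alpha> \<cdot> f"
      "\<lbrakk>\<alpha> \<in> Cell K; f \<in> Ar K; Cod K f = Dom K (Src K \<alpha>)\<rbrakk> \<Longrightarrow> Trg K (\<alpha> \<lhd> f) = Trg K \<alpha> \<cdot> f"
    and VComp_assoc: "\<lbrakk>\<alpha> \<in> Cell K; \<beta> \<in> Cell K; \<gamma> \<in> Cell K; Src K \<beta> = Trg K \<alpha>; Src K \<gamma> = Trg K \<beta>\<rbrakk> \<Longrightarrow>
      (\<gamma> \<bullet> \<beta>) \<bullet> \<alpha> = \<gamma> \<bullet> (\<beta> \<bullet> \<alpha>)"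
    and VComp_Ident2 [simp]: "\<lbrakk>\<alpha> \<in> Cell K; f = Src K \<alpha>\<rbrakk> \<Longrightarrow> \<alpha> \<bullet> Ident2 K f = \<alpha>"
    and Ident2_VComp [simp]: "\<lbrakk>\<alpha> \<in> Cell K; f = Trg K \<alpha>\<rbrakk> \<Longrightarrow> Ident2 K f \<bullet> \<alpha> = \<alpha>"
    and LWhisk_VComp: "\<lbrakk>\<alpha> \<in> Cell K; \<beta> \<in> Cell K; g \<in> Ar K; Src K \<beta> = Trg K \<alpha>; Dom K g = Cod K (Src K \<alpha>)\<rbrakk> \<Longrightarrow>
      g \<rhd> (\<beta> \<bullet> \<alpha>) = (g \<rhd> \<beta>) \<bullet> (g \<rhd> \<alpha>)"
    and RWhisk_VComp: "\<lbrakk>\<alpha> \<in> Cell K; \<beta> \<in> Cell K; f \<in> Ar K; Src K \<beta> = Trg K \<alpha>; Cod K f = Dom K (Src K \<alpha>)\<rbrakk> \<Longrightarrow>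
      (\<beta> \<bullet> \<alpha>) \<lhd> f = (\<beta> \<lhd> f) \<bullet> (\<alpha> \<lhd> f)"
    and LWhisk_LWhisk: "\<lbrakk>\<alpha> \<in> Cell K; g \<in> Ar K; h \<in> Ar K; Dom K g = Cod K (Src K \<alpha>); Dom K h = Cod K g\<rbrakk> \<Longrightarrow>
      h \<rhd> (g \<rhd> \<alpha>) = (h \<cdot> g) \<rhd> \<alpha>"
    and RWhisk_RWhisk: "\<lbrakk>\<alpha> \<in> Cell K; f \<in> Ar K; e \<in> Ar K; Cod K f = Dom K (Src K \<alpha>); Cod K e = Dom K f\<rbrakk> \<Longrightarrow>
      (\<alpha> \<lhd> f) \<lhd> e = \<alpha> \<lhd> (f \<cdot> e)"
    and LWhisk_RWhisk: "\<lbrakk>\<alpha> \<in> Cell K; f \<in> Ar K; g \<in> Ar K; Cod K f = Dom K (Src K \<alpha>); Dom K g = Cod K (Src K \<alpha>)\<rbrakk> \<Longrightarrow>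
      g \<rhd> (\<alpha> \<lhd> f) = (g \<rhd> \<alpha>) \<lhd> f"
    and LWhisk_Ident: "\<lbrakk>\<alpha> \<in> Cell K; A = Cod K (Src K \<alpha>)\<rbrakk> \<Longrightarrow> Ident K A \<rhd> \<alpha> = \<alpha>"
    and RWhisk_Ident: "\<lbrakk>\<alpha> \<in> Cell K; A = Dom K (Src K \<alpha>)\<rbrakk> \<Longrightarrow> \<alpha> \<lhd> Ident K A = \<alpha>"
    and LWhisk_Ident2: "\<lbrakk>f \<in> Ar K; g \<in> Ar K; Dom K g = Cod K f\<rbrakk> \<Longrightarrow> g \<rhd> Ident2 K f = Ident2 K (g \<cdot> f)"
    and Ident2_RWhisk: "\<lbrakk>f \<in> Ar K; g \<in> Ar K; Dom K g = Cod K f\<rbrakk> \<Longrightarrow> Ident2 K g \<lhd> f = Ident2 K (g \<cdot> f)"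

definition cat_cell :: "('o, 'a) sfun \<Rightarrow> ('o, 'a) sfun \<Rightarrow> 'a \<Rightarrow> ('o, 'a) snat" where
  "cat_cell F G n = \<lparr>nsrc = F, ntrg = G, ncomp = n\<rparr>"

lemma cat_cell_simps [simp]: "nsrc (cat_cell F G n) = F" "ntrg (cat_cell F G n) = G" "ncomp (cat_cell F G n) = n"
  by (simp_all add: cat_cell_def)

lemma cat_cell_eqI: "nsrc \<alpha> = nsrc \<beta> \<Longrightarrow> ntrg \<alpha> = ntrg \<beta> \<Longrightarrow> ncomp \<alpha> = ncomp \<beta> \<Longrightarrow> \<alpha> = \<beta>"
  for \<alpha> \<beta> :: "('o, 'a) snat"
  by (cases \<alpha>; cases \<beta>) simp

lemma comp_functor_simps [simp]:
  "fdom (comp_functor C G F) = fdom F" "fcod (comp_functor C G F) = fcod G"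
  "fmap (comp_functor C G F) n = fmap G n \<cdot>\<^bsub>C\<^esub> fmap F n"
  "fo (comp_functor C G F) = fo G \<cdot>\<^bsub>C\<^esub> fo F" "fa (comp_functor C G F) = fa G \<cdot>\<^bsub>C\<^esub> fa F"
  by (simp_all add: comp_functor_def fo_def fa_def)

lemma Cat_simps:
  "X \<in> Ob (Cat C) \<longleftrightarrow> category_object C X"
  "F \<in> Ar (Cat C) \<longleftrightarrow> internal_functor C F"
  "Dom (Cat C) F = fdom F" "Cod (Cat C) F = fcod F"
  "Ident (Cat C) X = \<lparr>fdom = X, fcod = X, fmap = (\<lambda>n. Ident C (sob X n))\<rparr>"
  "G \<cdot>\<^bsub>Cat C\<^esub> F = comp_functor C G F"
  "\<alpha> \<in> Cell (Cat C) \<longleftrightarrow> internal_nat_trans C \<alpha>"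
  "Src (Cat C) \<alpha> = nsrc \<alpha>" "Trg (Cat C) \<alpha> = ntrg \<alpha>"
  "Ident2 (Cat C) F = cat_cell F F (idn (fcod F) \<cdot>\<^bsub>C\<^esub> fo F)"
  "\<beta> \<bullet>\<^bsub>Cat C\<^esub> \<alpha> = cat_cell (nsrc \<alpha>) (ntrg \<beta>) (cmp C (fcod (nsrc \<alpha>)) (ncomp \<beta>) (ncomp \<alpha>))"
  "G \<rhd>\<^bsub>Cat C\<^esub> \<alpha> = cat_cell (comp_functor C G (nsrc \<alpha>)) (comp_functor C G (ntrg \<alpha>)) (fa G \<cdot>\<^bsub>C\<^esub> ncomp \<alpha>)"
  "\<alpha> \<lhd>\<^bsub>Cat C\<^esub> F = cat_cell (comp_functor C (nsrc \<alpha>) F) (comp_functor C (ntrg \<alpha>) F) (ncomp \<alpha> \<cdot>\<^bsub>C\<^esub> fo F)"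
  by (simp_all add: Cat_def cat_cell_def idn_def fo_def fa_def cmp_def)

context category_context
begin

lemma
  assumes "internal_nat_trans C \<alpha>"
  shows nt_functors [simp]: "internal_functor C (nsrc \<alpha>)" "internal_functor C (ntrg \<alpha>)"
    and nt_fdom [simp]: "fdom (ntrg \<alpha>) = fdom (nsrc \<alpha>)" and nt_fcod [simp]: "fcod (ntrg \<alpha>) = fcod (nsrc \<alpha>)"
    and nt_Ar [simp]: "ncomp \<alpha> \<in> Ar C" and Dom_nt [simp]: "Dom C (ncomp \<alpha>) = ob (fdom (nsrc \<alpha>))"
    and Cod_nt [simp]: "Cod C (ncomp \<alpha>) = ar (fcod (nsrc \<alpha>))"
    and src_nt [simp]: "fcod (nsrc \<alpha>) = B \<Longrightarrow> src B \<cdot> ncomp \<alpha> = fo (nsrc \<alpha>)"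
    and trg_nt [simp]: "fcod (nsrc \<alpha>) = B \<Longrightarrow> trg B \<cdot> ncomp \<alpha> = fo (ntrg \<alpha>)"
    and nt_natural_arr: "cmp C (fcod (nsrc \<alpha>)) (ncomp \<alpha> \<cdot> trg (fdom (nsrc \<alpha>))) (fa (nsrc \<alpha>)) =
      cmp C (fcod (nsrc \<alpha>)) (fa (ntrg \<alpha>)) (ncomp \<alpha> \<cdot> src (fdom (nsrc \<alpha>)))"
  using assms by (auto simp: internal_nat_trans_def Let_def ob_def ar_def src_def trg_def fo_def fa_def cmp_def)

lemma src_nt_comp [simp]:
  "internal_nat_trans C \<alpha> \<Longrightarrow> x \<in> Ar C \<Longrightarrow> Cod C x = ob (fdom (nsrc \<alpha>)) \<Longrightarrow> fcod (nsrc \<alpha>) = B \<Longrightarrow>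
    src B \<cdot> (ncomp \<alpha> \<cdot> x) = fo (nsrc \<alpha>) \<cdot> x"
  "internal_nat_trans C \<alpha> \<Longrightarrow> x \<in> Ar C \<Longrightarrow> Cod C x = ob (fdom (nsrc \<alpha>)) \<Longrightarrow> fcod (nsrc \<alpha>) = B \<Longrightarrow>
    trg B \<cdot> (ncomp \<alpha> \<cdot> x) = fo (ntrg \<alpha>) \<cdot> x"
  by (auto intro!: comp_eq_extend)

lemma src_fa_arr [simp]:
  assumes "internal_functor C F"
  shows "fcod F = B \<Longrightarrow> src B \<cdot> fa F = fo F \<cdot> src (fdom F)" "fcod F = B \<Longrightarrow> trg B \<cdot> fa F = fo F \<cdot> trg (fdom F)"
  using src_fa[OF assms, of "Ident C (ar (fdom F))"] trg_fa[OF assms, of "Ident C (ar (fdom F))"] assms by simp_all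

lemma nt_natural:
  assumes "internal_nat_trans C \<alpha>" "f \<in> Ar C" "Cod C f = ar (fdom (nsrc \<alpha>))"
  shows "cmp C (fcod (nsrc \<alpha>)) (ncomp \<alpha> \<cdot> (trg (fdom (nsrc \<alpha>)) \<cdot> f)) (fa (nsrc \<alpha>) \<cdot> f) =
      cmp C (fcod (nsrc \<alpha>)) (fa (ntrg \<alpha>) \<cdot> f) (ncomp \<alpha> \<cdot> (src (fdom (nsrc \<alpha>)) \<cdot> f))"
  using arg_cong[OF nt_natural_arr[OF assms(1)], of "\<lambda>z. z \<cdot> f"] assms by simp

text \<open>Naturality at the generic arrow, the identity of \<open>ar (fdom F)\<close>, is the
  defining equation; stating it for an element f keeps the composites in the form that rewriting
  handles.\<close>

lemma internal_nat_transI: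
  assumes "internal_functor C F" "internal_functor C G" "fdom G = fdom F" "fcod G = fcod F"
    "n \<in> Ar C" "Dom C n = ob (fdom F)" "Cod C n = ar (fcod F)" "src (fcod F) \<cdot> n = fo F" "trg (fcod F) \<cdot> n = fo G"
    and nat: "\<And>f. f \<in> Ar C \<Longrightarrow> Cod C f = ar (fdom F) \<Longrightarrow> Dom C f = ar (fdom F) \<Longrightarrow>
      cmp C (fcod F) (n \<cdot> (trg (fdom F) \<cdot> f)) (fa F \<cdot> f) = cmp C (fcod F) (fa G \<cdot> f) (n \<cdot> (src (fdom F) \<cdot> f))"
  shows "internal_nat_trans C (cat_cell F G n)"
  using assms(1-9) nat[of "Ident C (ar (fdom F))"]
  by (simp add: internal_nat_trans_def Let_def ob_def ar_def src_def trg_def fo_def fa_def cmp_def face_Ar fmap_Ar)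

lemma internal_functor_comp [simp]:
  assumes F: "internal_functor C F" and G: "internal_functor C G" and FG: "fdom G = fcod F"
  shows "internal_functor C (comp_functor C G F)"
  unfolding internal_functor_def
proof (intro conjI allI impI)
  fix n j :: nat
  note ty = fmap_Ar[OF F] fmap_Ar[OF G] FG face_Ar[of "fdom F" _ n] face_Ar[of "fcod F" _ n] face_Ar[of "fcod G" _ n]
    degen_Ar[of "fdom F" _ n] degen_Ar[of "fcod F" _ n] degen_Ar[of "fcod G" _ n] F G
  { assume "j \<le> n + 1"
    then show "face (fcod (comp_functor C G F)) n j \<cdot> fmap (comp_functor C G F) (n + 1) =
        fmap (comp_functor C G F) n \<cdot> face (fdom (comp_functor C G F)) n j"
      using fmap_face[OF G, of j n "fmap F (n + 1)"] internal_functorD(1)[OF F, of j n] ty by simp }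
  { assume "j \<le> n"
    then show "degen (fcod (comp_functor C G F)) n j \<cdot> fmap (comp_functor C G F) n =
        fmap (comp_functor C G F) (n + 1) \<cdot> degen (fdom (comp_functor C G F)) n j"
      using fmap_degen[OF G, of j n "fmap F n"] internal_functorD(2)[OF F, of j n] ty by simp }
qed (use F G FG fmap_Ar[OF F] fmap_Ar[OF G] in simp_all)

lemma category_Cat: "category (Cat C)"
proof -
  have id: "internal_functor C (Ident (Cat C) X)" if X: "category_object C X" for X
    unfolding internal_functor_def Cat_simps using that face_Ar[OF X] degen_Ar[OF X]
    by (intro conjI allI impI) simp_all
  have "comp_functor C F (Ident (Cat C) (fdom F)) = F" "comp_functor C (Ident (Cat C) (fcod F)) F = F"
    if F: "internal_functor C F" for F
    using fmap_Ar[OF F] by (cases F; simp add: Cat_simps comp_functor_def; fail)+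
  moreover have "comp_functor C (comp_functor C H G) F = comp_functor C H (comp_functor C G F)"
    if "internal_functor C F" "internal_functor C G" "internal_functor C H" "fdom G = fcod F" "fdom H = fcod G" for F G H
    using fmap_Ar[OF that(1)] fmap_Ar[OF that(2)] fmap_Ar[OF that(3)] that by (simp add: comp_functor_def)
  ultimately show ?thesis
    unfolding category_def using id by (simp add: Cat_simps)
qed

lemma fo_Ident: "fo (Ident (Cat C) X) = Ident C (ob X)" "fa (Ident (Cat C) X) = Ident C (ar X)"
  by (simp_all add: Cat_simps fo_def fa_def ob_def ar_def)

lemma internal_nat_trans_VComp:
  assumes \<alpha>: "internal_nat_trans C \<alpha>" and \<beta>: "internal_nat_trans C \<beta>" and e: "nsrc \<beta> = ntrg \<alpha>"
  shows "internal_nat_trans C (cat_cell (nsrc \<alpha>) (ntrg \<beta>) (cmp C (fcod (nsrc \<alpha>)) (ncomp \<beta>) (ncomp \<alpha>)))"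
proof (rule internal_nat_transI)
  have [simp]: "fdom (nsrc \<beta>) = fdom (nsrc \<alpha>)" "fcod (nsrc \<beta>) = fcod (nsrc \<alpha>)" using \<alpha> e by simp_all
  let ?A = "fdom (nsrc \<alpha>)" and ?B = "fcod (nsrc \<alpha>)"
  fix f assume f: "f \<in> Ar C" "Cod C f = ar ?A"
  have "cmp C ?B (cmp C ?B (ncomp \<beta>) (ncomp \<alpha>) \<cdot> (trg ?A \<cdot> f)) (fa (nsrc \<alpha>) \<cdot> f)
    = cmp C ?B (ncomp \<beta> \<cdot> (trg ?A \<cdot> f)) (cmp C ?B (ncomp \<alpha> \<cdot> (trg ?A \<cdot> f)) (fa (nsrc \<alpha>) \<cdot> f))"
    using \<alpha> \<beta> f e by (subst cmp_assoc[symmetric]) simp_all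
  also have "\<dots> = cmp C ?B (cmp C ?B (ncomp \<beta> \<cdot> (trg ?A \<cdot> f)) (fa (ntrg \<alpha>) \<cdot> f)) (ncomp \<alpha> \<cdot> (src ?A \<cdot> f))"
    using \<alpha> \<beta> f e by (simp add: nt_natural cmp_assoc)
  also have "\<dots> = cmp C ?B (fa (ntrg \<beta>) \<cdot> f) (cmp C ?B (ncomp \<beta>) (ncomp \<alpha>) \<cdot> (src ?A \<cdot> f))"
    using \<alpha> \<beta> f e nt_natural[OF \<beta>, of f] by (simp add: cmp_assoc)
  finally show "cmp C ?B (cmp C ?B (ncomp \<beta>) (ncomp \<alpha>) \<cdot> (trg ?A \<cdot> f)) (fa (nsrc \<alpha>) \<cdot> f)
    = cmp C ?B (fa (ntrg \<beta>) \<cdot> f) (cmp C ?B (ncomp \<beta>) (ncomp \<alpha>) \<cdot> (src ?A \<cdot> f))" .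
qed (use assms in simp_all)

lemma internal_nat_trans_Ident2:
  assumes F: "internal_functor C F"
  shows "internal_nat_trans C (cat_cell F F (idn (fcod F) \<cdot> fo F))"
  by (rule internal_nat_transI) (use F in simp_all)

lemma internal_nat_trans_LWhisk:
  assumes \<alpha>: "internal_nat_trans C \<alpha>" and G: "internal_functor C G" and e: "fdom G = fcod (nsrc \<alpha>)"
  shows "internal_nat_trans C (cat_cell (comp_functor C G (nsrc \<alpha>)) (comp_functor C G (ntrg \<alpha>)) (fa G \<cdot> ncomp \<alpha>))"
proof (rule internal_nat_transI)
  let ?A = "fdom (nsrc \<alpha>)" and ?B = "fcod (nsrc \<alpha>)"
  fix f assume "f \<in> Ar C" "Cod C f = ar (fdom (comp_functor C G (nsrc \<alpha>)))"
  then have f: "f \<in> Ar C" "Cod C f = ar ?A" by simp_all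
  have "fa G \<cdot> cmp C ?B (ncomp \<alpha> \<cdot> (trg ?A \<cdot> f)) (fa (nsrc \<alpha>) \<cdot> f) =
      fa G \<cdot> cmp C ?B (fa (ntrg \<alpha>) \<cdot> f) (ncomp \<alpha> \<cdot> (src ?A \<cdot> f))"
    using nt_natural[OF \<alpha> f] by simp
  then show "cmp C (fcod (comp_functor C G (nsrc \<alpha>))) ((fa G \<cdot> ncomp \<alpha>) \<cdot> (trg (fdom (comp_functor C G (nsrc \<alpha>))) \<cdot> f))
      (fa (comp_functor C G (nsrc \<alpha>)) \<cdot> f) =
     cmp C (fcod (comp_functor C G (nsrc \<alpha>))) (fa (comp_functor C G (ntrg \<alpha>)) \<cdot> f)
      ((fa G \<cdot> ncomp \<alpha>) \<cdot> (src (fdom (comp_functor C G (nsrc \<alpha>))) \<cdot> f))"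
    using fa_cmp[OF G, of "fa (nsrc \<alpha>) \<cdot> f" "ncomp \<alpha> \<cdot> (trg ?A \<cdot> f)"]
      fa_cmp[OF G, of "ncomp \<alpha> \<cdot> (src ?A \<cdot> f)" "fa (ntrg \<alpha>) \<cdot> f"] f \<alpha> G e by simp
qed (use assms in simp_all)

lemma internal_nat_trans_RWhisk:
  assumes \<alpha>: "internal_nat_trans C \<alpha>" and F: "internal_functor C F" and e: "fcod F = fdom (nsrc \<alpha>)"
  shows "internal_nat_trans C (cat_cell (comp_functor C (nsrc \<alpha>) F) (comp_functor C (ntrg \<alpha>) F) (ncomp \<alpha> \<cdot> fo F))"
proof (rule internal_nat_transI)
  fix f assume "f \<in> Ar C" "Cod C f = ar (fdom (comp_functor C (nsrc \<alpha>) F))"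
  then show "cmp C (fcod (comp_functor C (nsrc \<alpha>) F)) ((ncomp \<alpha> \<cdot> fo F) \<cdot> (trg (fdom (comp_functor C (nsrc \<alpha>) F)) \<cdot> f))
      (fa (comp_functor C (nsrc \<alpha>) F) \<cdot> f) =
     cmp C (fcod (comp_functor C (nsrc \<alpha>) F)) (fa (comp_functor C (ntrg \<alpha>) F) \<cdot> f)
      ((ncomp \<alpha> \<cdot> fo F) \<cdot> (src (fdom (comp_functor C (nsrc \<alpha>) F)) \<cdot> f))"
    using nt_natural[OF \<alpha>, of "fa F \<cdot> f"] \<alpha> F e by simp
qed (use assms in simp_all)

theorem two_category_Cat: "two_category (Cat C)"
proof -
  interpret K: category_context "Cat C" by unfold_locales (rule category_Cat)
  have comp_functor_assoc: "comp_functor C (comp_functor C H G) F = comp_functor C H (comp_functor C G F)"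
    if "internal_functor C F" "internal_functor C G" "internal_functor C H" "fdom G = fcod F" "fdom H = fcod G" for F G H
    using K.comp_assoc[of F G H] that by (simp add: Cat_simps)
  have unit: "comp_functor C F (Ident (Cat C) A) = F" if "internal_functor C F" "fdom F = A" for F A
    using K.comp_Ident[of F A] that by (simp add: Cat_simps)
  have unit': "comp_functor C (Ident (Cat C) A) F = F" if "internal_functor C F" "fcod F = A" for F A
    using K.Ident_comp[of F A] that by (simp add: Cat_simps)
  note D = Cat_simps(1-4) Cat_simps(6-) internal_nat_trans_VComp internal_nat_trans_Ident2
    internal_nat_trans_LWhisk internal_nat_trans_RWhisk
  show ?thesis
    apply unfold_locales
    apply (simp_all add: D)
    apply (simp_all add: cmp_assoc comp_functor_assoc unit unit' fo_Ident fa_idn)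
    subgoal for \<alpha> \<beta> g
      using fa_cmp[of g "ncomp \<alpha>" "ncomp \<beta>"] by simp
    done
qed

section \<open>Pullbacks of internal categories\<close>

lemma pullback_iso_transport:
  assumes P: "is_pullback C f g p q" and w: "w \<in> Ar C" "w' \<in> Ar C" "Dom C w' = Cod C w" "Cod C w' = Dom C w"
    "Cod C w = Dom C p" "w \<cdot> w' = Ident C (Cod C w)" "w' \<cdot> w = Ident C (Dom C w)"
  shows "is_pullback C f g (p \<cdot> w) (q \<cdot> w)"
proof (rule is_pullbackI)
  note A = pullback_Ar[OF P] w
  show "f \<cdot> (p \<cdot> w) = g \<cdot> (q \<cdot> w)" using pullback_square[OF P, of w] A by simp
  { fix u v assume "u \<in> Ar C" "v \<in> Ar C" "Dom C u = Dom C v" "Cod C u = Dom C f" "Cod C v = Dom C g" "f \<cdot> u = g \<cdot> v"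
    from pairing[OF P this] this(1-3) show "\<exists>x. x \<in> Ar C \<and> Dom C x = Dom C u \<and> Cod C x = Dom C (p \<cdot> w) \<and> (p \<cdot> w) \<cdot> x = u \<and> (q \<cdot> w) \<cdot> x = v"
      using A comp_eq_extend[OF w(6), of "pairing C (p, q) u v"]
      by (intro exI[of _ "w' \<cdot> pairing C (p, q) u v"]) simp }
  { fix x y assume x: "x \<in> Ar C" "y \<in> Ar C" "Dom C x = Dom C y" "Cod C x = Dom C (p \<cdot> w)" "Cod C y = Dom C (p \<cdot> w)"
      "(p \<cdot> w) \<cdot> x = (p \<cdot> w) \<cdot> y" "(q \<cdot> w) \<cdot> x = (q \<cdot> w) \<cdot> y"
    then have x': "Cod C x = Dom C w" "Cod C y = Dom C w" using A by simp_all
    have "w \<cdot> x = w \<cdot> y"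
      by (rule pullback_eqI[OF P]) (use A x x' in simp_all)
    then have "w' \<cdot> (w \<cdot> x) = w' \<cdot> (w \<cdot> y)" by simp
    then show "x = y" using comp_eq_extend[OF w(7), of x] comp_eq_extend[OF w(7), of y] A x x' by simp }
qed (use pullback_Ar[OF P] w in simp_all)

lemma pullback_iso:
  assumes P: "is_pullback C f g p q" and Q: "is_pullback C f g p' q'"
  obtains w w' where "w \<in> Ar C" "w' \<in> Ar C" "Dom C w' = Cod C w" "Cod C w' = Dom C w" "Dom C w = Dom C p'" "Cod C w = Dom C p"
    "w \<cdot> w' = Ident C (Cod C w)" "w' \<cdot> w = Ident C (Dom C w)" "p \<cdot> w = p'" "q \<cdot> w = q'"
proof -
  note A = pullback_Ar[OF P] pullback_Ar[OF Q]
  note B = pairing[OF P, of p' q'] pairing[OF Q, of p q]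
  let ?w = "pairing C (p, q) p' q'" and ?w' = "pairing C (p', q') p q"
  have w: "?w \<in> Ar C" "Dom C ?w = Dom C p'" "Cod C ?w = Dom C p" "p \<cdot> ?w = p'" "q \<cdot> ?w = q'"
    and w': "?w' \<in> Ar C" "Dom C ?w' = Dom C p" "Cod C ?w' = Dom C p'" "p' \<cdot> ?w' = p" "q' \<cdot> ?w' = q"
    using A B by simp_all
  show ?thesis
  proof
    show "?w \<cdot> ?w' = Ident C (Cod C ?w)"
      by (rule pullback_eqI[OF P]) (use w w' A comp_eq_extend[OF w(4)] comp_eq_extend[OF w(5)] in simp_all)
    show "?w' \<cdot> ?w = Ident C (Dom C ?w)"
      by (rule pullback_eqI[OF Q]) (use w w' A comp_eq_extend[OF w'(4)] comp_eq_extend[OF w'(5)] in simp_all)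
  qed (use w w' in simp_all)
qed

text \<open>Pullbacks are taken in degrees 0 and 1 of C. The structure arrows are pairings and
  composition is componentwise, so every law is checked after the two projections; the nerve
  supplies the remaining degrees.\<close>

lemma Cat_pullback_exists:
  assumes hp: "has_pullbacks C" and F: "internal_functor C F" and G: "internal_functor C G" and FG: "fcod F = fcod G"
  obtains p q where "is_pullback (Cat C) F G p q" "is_pullback C (fo F) (fo G) (fo p) (fo q)"
    "is_pullback C (fa F) (fa G) (fa p) (fa q)"
proof -
  let ?A = "fdom F" and ?B = "fdom G"
  obtain p0 q0 where P0: "is_pullback C (fo F) (fo G) p0 q0"
    using pb_is_pullback[OF hp, of "fo F" "fo G"] F G FG by auto
  obtain p1 q1 where P1: "is_pullback C (fa F) (fa G) p1 q1"
    using pb_is_pullback[OF hp, of "fa F" "fa G"] F G FG by auto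
  have A0 [simp]: "p0 \<in> Ar C" "q0 \<in> Ar C" "Dom C q0 = Dom C p0" "Cod C p0 = ob ?A" "Cod C q0 = ob ?B"
    using pullback_Ar[OF P0] F G by simp_all
  have A1 [simp]: "p1 \<in> Ar C" "q1 \<in> Ar C" "Dom C q1 = Dom C p1" "Cod C p1 = ar ?A" "Cod C q1 = ar ?B"
    using pullback_Ar[OF P1] F G by simp_all
  have sq1: "fa F \<cdot> (p1 \<cdot> x) = fa G \<cdot> (q1 \<cdot> x)" if "x \<in> Ar C" "Cod C x = Dom C p1" for x
    using pullback_square[OF P1 that] .
  note sq0' = pullback_Ar(9)[OF P0] and sq1' = pullback_Ar(9)[OF P1]
  note [simp] = F G FG
  define s where "s = pairing C (p0, q0) (src ?A \<cdot> p1) (src ?B \<cdot> q1)"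
  define t where "t = pairing C (p0, q0) (trg ?A \<cdot> p1) (trg ?B \<cdot> q1)"
  define i where "i = pairing C (p1, q1) (idn ?A \<cdot> p0) (idn ?B \<cdot> q0)"
  define m where "m g f = pairing C (p1, q1) (cmp C ?A (p1 \<cdot> g) (p1 \<cdot> f)) (cmp C ?B (q1 \<cdot> g) (q1 \<cdot> f))" for g f
  have es: "fo F \<cdot> (src ?A \<cdot> p1) = fo G \<cdot> (src ?B \<cdot> q1)" "fo F \<cdot> (trg ?A \<cdot> p1) = fo G \<cdot> (trg ?B \<cdot> q1)"
    using arg_cong[OF sq1', of "\<lambda>z. src (fcod F) \<cdot> z"] arg_cong[OF sq1', of "\<lambda>z. trg (fcod F) \<cdot> z"] by simp_all
  have ei: "fa F \<cdot> (idn ?A \<cdot> p0) = fa G \<cdot> (idn ?B \<cdot> q0)"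
    using sq0' by (simp add: fa_idn)
  have s [simp]: "s \<in> Ar C" "Dom C s = Dom C p1" "Cod C s = Dom C p0" and sp: "p0 \<cdot> s = src ?A \<cdot> p1" "q0 \<cdot> s = src ?B \<cdot> q1"
    unfolding s_def using pairing[OF P0 _ _ _ _ _ es(1)] by simp_all
  have t [simp]: "t \<in> Ar C" "Dom C t = Dom C p1" "Cod C t = Dom C p0" and tp: "p0 \<cdot> t = trg ?A \<cdot> p1" "q0 \<cdot> t = trg ?B \<cdot> q1"
    unfolding t_def using pairing[OF P0 _ _ _ _ _ es(2)] by simp_all
  have i [simp]: "i \<in> Ar C" "Dom C i = Dom C p0" "Cod C i = Dom C p1" and ip: "p1 \<cdot> i = idn ?A \<cdot> p0" "q1 \<cdot> i = idn ?B \<cdot> q0"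
    unfolding i_def using pairing[OF P1 _ _ _ _ _ ei] by simp_all
  have spx [simp]: "p0 \<cdot> (s \<cdot> x) = src ?A \<cdot> (p1 \<cdot> x)" "q0 \<cdot> (s \<cdot> x) = src ?B \<cdot> (q1 \<cdot> x)"
    "p0 \<cdot> (t \<cdot> x) = trg ?A \<cdot> (p1 \<cdot> x)" "q0 \<cdot> (t \<cdot> x) = trg ?B \<cdot> (q1 \<cdot> x)" if "x \<in> Ar C" "Cod C x = Dom C p1" for x
    using that comp_eq_extend[OF sp(1), of x] comp_eq_extend[OF sp(2), of x] comp_eq_extend[OF tp(1), of x]
      comp_eq_extend[OF tp(2), of x] by simp_all
  have ipx [simp]: "p1 \<cdot> (i \<cdot> x) = idn ?A \<cdot> (p0 \<cdot> x)" "q1 \<cdot> (i \<cdot> x) = idn ?B \<cdot> (q0 \<cdot> x)" if "x \<in> Ar C" "Cod C x = Dom C p0" for x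
    using that comp_eq_extend[OF ip(1), of x] comp_eq_extend[OF ip(2), of x] by simp_all
  have eq0: "x = y" if "x \<in> Ar C" "y \<in> Ar C" "Dom C x = Dom C y" "Cod C x = Dom C p0" "Cod C y = Dom C p0"
    "p0 \<cdot> x = p0 \<cdot> y" "q0 \<cdot> x = q0 \<cdot> y" for x y by (rule pullback_eqI[OF P0 that])
  have eq1: "x = y" if "x \<in> Ar C" "y \<in> Ar C" "Dom C x = Dom C y" "Cod C x = Dom C p1" "Cod C y = Dom C p1"
    "p1 \<cdot> x = p1 \<cdot> y" "q1 \<cdot> x = q1 \<cdot> y" for x y by (rule pullback_eqI[OF P1 that])
  have cmpd: "trg ?A \<cdot> (p1 \<cdot> f) = src ?A \<cdot> (p1 \<cdot> g)" "trg ?B \<cdot> (q1 \<cdot> f) = src ?B \<cdot> (q1 \<cdot> g)"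
    if "f \<in> Ar C" "g \<in> Ar C" "Cod C f = Dom C p1" "Cod C g = Dom C p1" "t \<cdot> f = s \<cdot> g" for f g
    using that spx(1,2)[of g] spx(3,4)[of f] by metis+
  have m: "m g f \<in> Ar C" "Dom C (m g f) = Dom C g" "Cod C (m g f) = Dom C p1"
    "p1 \<cdot> m g f = cmp C ?A (p1 \<cdot> g) (p1 \<cdot> f)" "q1 \<cdot> m g f = cmp C ?B (q1 \<cdot> g) (q1 \<cdot> f)"
    if "f \<in> Ar C" "g \<in> Ar C" "Cod C f = Dom C p1" "Cod C g = Dom C p1" "Dom C f = Dom C g" "t \<cdot> f = s \<cdot> g" for f g
  proof -
    note c = cmpd[OF that(1-4,6)]
    \<comment> \<open>The componentwise composites agree in the common codomain because F and G
      preserve composition.\<close>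
    have e: "fa F \<cdot> cmp C ?A (p1 \<cdot> g) (p1 \<cdot> f) = fa G \<cdot> cmp C ?B (q1 \<cdot> g) (q1 \<cdot> f)"
      using that c sq1[of f] sq1[of g] fa_cmp[of F "p1 \<cdot> f" "p1 \<cdot> g"] fa_cmp[of G "q1 \<cdot> f" "q1 \<cdot> g"] by simp
    show "m g f \<in> Ar C" "Dom C (m g f) = Dom C g" "Cod C (m g f) = Dom C p1"
      "p1 \<cdot> m g f = cmp C ?A (p1 \<cdot> g) (p1 \<cdot> f)" "q1 \<cdot> m g f = cmp C ?B (q1 \<cdot> g) (q1 \<cdot> f)"
      unfolding m_def using pairing[OF P1 _ _ _ _ _ e] that c by simp_all
  qed
  have st: "s \<cdot> m g f = s \<cdot> f" "t \<cdot> m g f = t \<cdot> g"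
    if "f \<in> Ar C" "g \<in> Ar C" "Cod C f = Dom C p1" "Cod C g = Dom C p1" "Dom C f = Dom C g" "t \<cdot> f = s \<cdot> g" for f g
    by (rule eq0; use that m[OF that] cmpd[OF that(1-4,6)] in simp)+
  interpret I: internal_category C "Dom C p0" "Dom C p1" s t i m
  proof unfold_locales
    show "s \<cdot> i = Ident C (Dom C p0)" "t \<cdot> i = Ident C (Dom C p0)"
      by (rule eq0; simp add: ip)+
    fix f g h x
    assume f: "f \<in> Ar C" "Cod C f = Dom C p1"
    show "m f (i \<cdot> (s \<cdot> f)) = f" "m (i \<cdot> (t \<cdot> f)) f = f"
    proof -
      have "t \<cdot> (i \<cdot> (s \<cdot> f)) = s \<cdot> f" "s \<cdot> (i \<cdot> (t \<cdot> f)) = t \<cdot> f"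
        by (rule eq0; use f in simp)+
      then show "m f (i \<cdot> (s \<cdot> f)) = f" "m (i \<cdot> (t \<cdot> f)) f = f"
        using m[of "i \<cdot> (s \<cdot> f)" f] m[of f "i \<cdot> (t \<cdot> f)"] f by - (rule eq1; simp)+
    qed
    assume g: "g \<in> Ar C" "Cod C g = Dom C p1" "Dom C f = Dom C g" "t \<cdot> f = s \<cdot> g"
    note mm = m[OF f(1) g(1) f(2) g(2-4)] and c = cmpd[OF f(1) g(1) f(2) g(2,4)]
    { assume x: "x \<in> Ar C" "Cod C x = Dom C g"
      have e: "t \<cdot> (f \<cdot> x) = s \<cdot> (g \<cdot> x)" using f g x comp2_eq_extend[OF g(4), of x] by simp
      show "m g f \<cdot> x = m (g \<cdot> x) (f \<cdot> x)"
        by (rule eq1) (use f g x mm c m[OF _ _ _ _ _ e] comp_eq_extend[OF mm(4), of x] comp_eq_extend[OF mm(5), of x] in simp_all) }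
    { assume h: "h \<in> Ar C" "Cod C h = Dom C p1" "Dom C h = Dom C g" "t \<cdot> g = s \<cdot> h"
      have gh: "Dom C g = Dom C h" using h by simp
      note mh = m[OF g(1) h(1) g(2) h(2) gh h(4)] and ch = cmpd[OF g(1) h(1) g(2) h(2,4)]
        and sh = st[OF g(1) h(1) g(2) h(2) gh h(4)] and sm = st[OF f(1) g(1) f(2) g(2-4)]
      show "m (m h g) f = m h (m g f)"
        by (rule eq1) (use f g h mm mh c ch sh sm m[of f "m h g"] m[of "m g f" h] in \<open>simp_all add: cmp_assoc\<close>) }
  qed (use m st hp in simp_all)
  obtain P where P: "category_object C P" "ob P = Dom C p0" "ar P = Dom C p1" "src P = s" "trg P = t" "idn P = i"
    and cP: "\<And>f g. f \<in> Ar C \<Longrightarrow> g \<in> Ar C \<Longrightarrow> Cod C f = Dom C p1 \<Longrightarrow> Cod C g = Dom C p1 \<Longrightarrow> Dom C f = Dom C g \<Longrightarrow> t \<cdot> f = s \<cdot> g \<Longrightarrow>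
      cmp C P g f = m g f"
    using I.nerve by blast
  have "internal_functor C (mkfun P ?A p0 p1) \<and> fo (mkfun P ?A p0 p1) = p0 \<and> fa (mkfun P ?A p0 p1) = p1"
    by (intro conjI internal_functor_mkfun fo_mkfun fa_mkfun; use P sp tp ip m cP in simp)
  then have p: "internal_functor C (mkfun P ?A p0 p1)" "fo (mkfun P ?A p0 p1) = p0" "fa (mkfun P ?A p0 p1) = p1" by blast+
  have "internal_functor C (mkfun P ?B q0 q1) \<and> fo (mkfun P ?B q0 q1) = q0 \<and> fa (mkfun P ?B q0 q1) = q1"
    by (intro conjI internal_functor_mkfun fo_mkfun fa_mkfun; use P sp tp ip m cP in simp)
  then have q: "internal_functor C (mkfun P ?B q0 q1)" "fo (mkfun P ?B q0 q1) = q0" "fa (mkfun P ?B q0 q1) = q1" by blast+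
  let ?p = "mkfun P ?A p0 p1" and ?q = "mkfun P ?B q0 q1"
  interpret K: category_context "Cat C" by unfold_locales (rule category_Cat)
  have "is_pullback (Cat C) F G ?p ?q"
  proof (rule K.is_pullbackI)
    show "F \<cdot>\<^bsub>Cat C\<^esub> ?p = G \<cdot>\<^bsub>Cat C\<^esub> ?q"
      unfolding Cat_simps by (rule functor_eqI) (use p q sq0' sq1' in simp_all)
    { fix w w' assume "w \<in> Ar (Cat C)" "w' \<in> Ar (Cat C)" "Dom (Cat C) w = Dom (Cat C) w'" "Cod (Cat C) w = Dom (Cat C) ?p"
        "Cod (Cat C) w' = Dom (Cat C) ?p" and e: "?p \<cdot>\<^bsub>Cat C\<^esub> w = ?p \<cdot>\<^bsub>Cat C\<^esub> w'" "?q \<cdot>\<^bsub>Cat C\<^esub> w = ?q \<cdot>\<^bsub>Cat C\<^esub> w'"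
      then have w: "internal_functor C w" "internal_functor C w'" "fdom w = fdom w'" "fcod w = P" "fcod w' = P"
        by (simp_all add: Cat_simps)
      have e': "p0 \<cdot> fo w = p0 \<cdot> fo w'" "p1 \<cdot> fa w = p1 \<cdot> fa w'" "q0 \<cdot> fo w = q0 \<cdot> fo w'" "q1 \<cdot> fa w = q1 \<cdot> fa w'"
        using arg_cong[OF e(1), of fo] arg_cong[OF e(1), of fa] arg_cong[OF e(2), of fo] arg_cong[OF e(2), of fa] p q
        by (simp_all add: Cat_simps)
      have "fo w = fo w'" by (rule eq0) (use w e' P in simp_all)
      moreover have "fa w = fa w'" by (rule eq1) (use w e' P in simp_all)
      ultimately show "w = w'" using functor_eqI w by simp }
    { fix U V assume "U \<in> Ar (Cat C)" "V \<in> Ar (Cat C)" "Dom (Cat C) U = Dom (Cat C) V" "Cod (Cat C) U = Dom (Cat C) F"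
        "Cod (Cat C) V = Dom (Cat C) G" and e: "F \<cdot>\<^bsub>Cat C\<^esub> U = G \<cdot>\<^bsub>Cat C\<^esub> V"
      then have w [simp]: "internal_functor C U" "internal_functor C V" "fdom U = fdom V" "fcod U = ?A" "fcod V = ?B"
        by (simp_all add: Cat_simps)
      have e': "fo F \<cdot> fo U = fo G \<cdot> fo V" "fa F \<cdot> fa U = fa G \<cdot> fa V"
        using arg_cong[OF e, of fo] arg_cong[OF e, of fa] by (simp_all add: Cat_simps)
      let ?w0 = "pairing C (p0, q0) (fo U) (fo V)" and ?w1 = "pairing C (p1, q1) (fa U) (fa V)"
      have w0: "?w0 \<in> Ar C" "Dom C ?w0 = ob (fdom V)" "Cod C ?w0 = Dom C p0" "p0 \<cdot> ?w0 = fo U" "q0 \<cdot> ?w0 = fo V"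
        using pairing[OF P0 _ _ _ _ _ e'(1)] by simp_all
      have w1: "?w1 \<in> Ar C" "Dom C ?w1 = ar (fdom V)" "Cod C ?w1 = Dom C p1" "p1 \<cdot> ?w1 = fa U" "q1 \<cdot> ?w1 = fa V"
        using pairing[OF P1 _ _ _ _ _ e'(2)] by simp_all
      have w1x: "p1 \<cdot> (?w1 \<cdot> x) = fa U \<cdot> x" "q1 \<cdot> (?w1 \<cdot> x) = fa V \<cdot> x" if "x \<in> Ar C" "Cod C x = ar (fdom V)" for x
        using comp_eq_extend[OF w1(4), of x] comp_eq_extend[OF w1(5), of x] w1 that by simp_all
      have w0x: "p0 \<cdot> (?w0 \<cdot> x) = fo U \<cdot> x" "q0 \<cdot> (?w0 \<cdot> x) = fo V \<cdot> x" if "x \<in> Ar C" "Cod C x = ob (fdom V)" for x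
        using comp_eq_extend[OF w0(4), of x] comp_eq_extend[OF w0(5), of x] w0 that by simp_all
      have sw: "s \<cdot> ?w1 = ?w0 \<cdot> src (fdom V)" "t \<cdot> ?w1 = ?w0 \<cdot> trg (fdom V)"
        by (rule eq0; use w0 w1 w0x in simp)+
      have iw: "?w1 \<cdot> idn (fdom V) = i \<cdot> ?w0"
        by (rule eq1) (use w0 w1 w1x fa_idn[of U "Ident C (ob (fdom V))" "fdom V"] fa_idn[of V "Ident C (ob (fdom V))" "fdom V"] in simp_all)
      have cw: "?w1 \<cdot> cmp C (fdom V) g f = cmp C P (?w1 \<cdot> g) (?w1 \<cdot> f)"
        if fg: "f \<in> Ar C" "g \<in> Ar C" "Cod C f = ar (fdom V)" "Cod C g = ar (fdom V)" "Dom C f = Dom C g" "trg (fdom V) \<cdot> f = src (fdom V) \<cdot> g" for f g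
      proof -
        have c: "t \<cdot> (?w1 \<cdot> f) = s \<cdot> (?w1 \<cdot> g)"
          using fg w0 w1 comp2_eq_extend[OF sw(1), of g] comp2_eq_extend[OF sw(2), of f] by simp
        show ?thesis
          by (rule eq1) (use fg w1 w1x c cP[OF _ _ _ _ _ c] m[OF _ _ _ _ _ c] fa_cmp[of U f g] fa_cmp[of V f g] in simp_all)
      qed
      have "internal_functor C (mkfun (fdom V) P ?w0 ?w1) \<and> fo (mkfun (fdom V) P ?w0 ?w1) = ?w0 \<and> fa (mkfun (fdom V) P ?w0 ?w1) = ?w1"
        by (intro conjI internal_functor_mkfun fo_mkfun fa_mkfun; use P w0 w1 sw iw cw in simp)
      then have W: "internal_functor C (mkfun (fdom V) P ?w0 ?w1)" "fo (mkfun (fdom V) P ?w0 ?w1) = ?w0" "fa (mkfun (fdom V) P ?w0 ?w1) = ?w1"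
        by blast+
      have "comp_functor C ?p (mkfun (fdom V) P ?w0 ?w1) = U" "comp_functor C ?q (mkfun (fdom V) P ?w0 ?w1) = V"
        by (rule functor_eqI; use W p q w0 w1 in simp)+
      then show "\<exists>w. w \<in> Ar (Cat C) \<and> Dom (Cat C) w = Dom (Cat C) U \<and> Cod (Cat C) w = Dom (Cat C) ?p \<and>
          ?p \<cdot>\<^bsub>Cat C\<^esub> w = U \<and> ?q \<cdot>\<^bsub>Cat C\<^esub> w = V"
        by (intro exI[of _ "mkfun (fdom V) P ?w0 ?w1"]) (use W in \<open>simp add: Cat_simps\<close>) }
  qed (use p q P in \<open>simp_all add: Cat_simps\<close>)
  then show ?thesis using that[of ?p ?q] P0 P1 p q by simp
qed

lemma has_pullbacks_Cat: "has_pullbacks C \<Longrightarrow> has_pullbacks (Cat C)"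
  unfolding has_pullbacks_def[of "Cat C"]
proof (intro ballI impI)
  fix F G assume "has_pullbacks C" "F \<in> Ar (Cat C)" "G \<in> Ar (Cat C)" "Cod (Cat C) F = Cod (Cat C) G"
  then show "\<exists>p q. is_pullback (Cat C) F G p q"
    using Cat_pullback_exists[of F G] by (metis Cat_simps(2,4))
qed

text \<open>For one pullback this holds by construction. The comparison isomorphism carries it to an
  arbitrary one, such as those picked by \<open>pb\<close> and the Segal squares.\<close>

lemma Cat_pullback_degreewise:
  assumes hp: "has_pullbacks C" and P: "is_pullback (Cat C) F G p q"
  shows "is_pullback C (fo F) (fo G) (fo p) (fo q)" "is_pullback C (fa F) (fa G) (fa p) (fa q)"
proof -
  interpret K: category_context "Cat C" by unfold_locales (rule category_Cat)
  have FG: "internal_functor C F" "internal_functor C G" "fcod F = fcod G"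
    using K.pullback_Ar[OF P] by (simp_all add: Cat_simps)
  obtain p' q' where Q: "is_pullback (Cat C) F G p' q'" and Q': "is_pullback C (fo F) (fo G) (fo p') (fo q')"
    "is_pullback C (fa F) (fa G) (fa p') (fa q')"
    by (rule Cat_pullback_exists[OF hp FG])
  obtain w w' where "w \<in> Ar (Cat C)" "w' \<in> Ar (Cat C)" "Dom (Cat C) w' = Cod (Cat C) w" "Cod (Cat C) w' = Dom (Cat C) w"
    "Cod (Cat C) w = Dom (Cat C) p'" and e:
    "w \<cdot>\<^bsub>Cat C\<^esub> w' = Ident (Cat C) (Cod (Cat C) w)" "w' \<cdot>\<^bsub>Cat C\<^esub> w = Ident (Cat C) (Dom (Cat C) w)"
    "p' \<cdot>\<^bsub>Cat C\<^esub> w = p" "q' \<cdot>\<^bsub>Cat C\<^esub> w = q"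
    by (rule K.pullback_iso[OF Q P])
  then have w: "internal_functor C w" "internal_functor C w'" "fdom w' = fcod w" "fcod w' = fdom w" "fcod w = fdom p'"
    by (simp_all add: Cat_simps)
  have p': "internal_functor C p'" "internal_functor C q'" "fdom q' = fdom p'"
    using K.pullback_Ar[OF Q] by (simp_all add: Cat_simps)
  have o: "fo w \<cdot> fo w' = Ident C (ob (fcod w))" "fo w' \<cdot> fo w = Ident C (ob (fdom w))"
    "fo p' \<cdot> fo w = fo p" "fo q' \<cdot> fo w = fo q"
    using e[THEN arg_cong, of fo] fo_Ident[of "fcod w"] fo_Ident[of "fdom w"] by (simp_all add: Cat_simps(3,4,6))
  have a: "fa w \<cdot> fa w' = Ident C (ar (fcod w))" "fa w' \<cdot> fa w = Ident C (ar (fdom w))"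
    "fa p' \<cdot> fa w = fa p" "fa q' \<cdot> fa w = fa q"
    using e[THEN arg_cong, of fa] fo_Ident[of "fcod w"] fo_Ident[of "fdom w"] by (simp_all add: Cat_simps(3,4,6))
  show "is_pullback C (fo F) (fo G) (fo p) (fo q)" "is_pullback C (fa F) (fa G) (fa p) (fa q)"
    using pullback_iso_transport[OF Q'(1), of "fo w" "fo w'"] pullback_iso_transport[OF Q'(2), of "fa w" "fa w'"] w p' o a
    by simp_all
qed

text \<open>The existence half of the two-dimensional universal property: components of
  transformations are elements of degree 1, where p and q form a pullback, so the component of \<xi>
  is a pairing.\<close>

lemma Cat_pullback_cells:
  assumes hp: "has_pullbacks C" and P: "is_pullback (Cat C) F G p q"
    and \<nu>: "internal_nat_trans C \<nu>" and \<mu>: "internal_nat_trans C \<mu>"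
    and ty: "fcod (nsrc \<nu>) = fdom F" "fcod (nsrc \<mu>) = fdom G" "fdom (nsrc \<nu>) = fdom (nsrc \<mu>)"
    and e: "F \<rhd>\<^bsub>Cat C\<^esub> \<nu> = G \<rhd>\<^bsub>Cat C\<^esub> \<mu>"
  obtains \<xi> where "internal_nat_trans C \<xi>" "fcod (nsrc \<xi>) = fdom p" "p \<rhd>\<^bsub>Cat C\<^esub> \<xi> = \<nu>" "q \<rhd>\<^bsub>Cat C\<^esub> \<xi> = \<mu>"
proof -
  interpret K: category_context "Cat C" by unfold_locales (rule category_Cat)
  note D = K.pullback_Ar[OF P, unfolded Cat_simps] \<nu> \<mu> ty
  have ee: "comp_functor C F (nsrc \<nu>) = comp_functor C G (nsrc \<mu>)" "comp_functor C F (ntrg \<nu>) = comp_functor C G (ntrg \<mu>)"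
    "fa F \<cdot> ncomp \<nu> = fa G \<cdot> ncomp \<mu>"
    using e[THEN arg_cong, of nsrc] e[THEN arg_cong, of ntrg] e[THEN arg_cong, of ncomp] by (simp_all add: Cat_simps)
  obtain x where x: "internal_functor C x" "fdom x = fdom (nsrc \<mu>)" "fcod x = fdom p" "comp_functor C p x = nsrc \<nu>" "comp_functor C q x = nsrc \<mu>"
    using K.pairing[OF P, unfolded Cat_simps, OF _ _ _ _ _ ee(1)] D by auto
  obtain y where y: "internal_functor C y" "fdom y = fdom (nsrc \<mu>)" "fcod y = fdom p" "comp_functor C p y = ntrg \<nu>" "comp_functor C q y = ntrg \<mu>"
    using K.pairing[OF P, unfolded Cat_simps, OF _ _ _ _ _ ee(2)] D by auto
  note P0 = Cat_pullback_degreewise(1)[OF hp P] and P1 = Cat_pullback_degreewise(2)[OF hp P]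
  let ?n = "pairing C (fa p, fa q) (ncomp \<nu>) (ncomp \<mu>)"
  have n: "?n \<in> Ar C" "Dom C ?n = ob (fdom (nsrc \<mu>))" "Cod C ?n = ar (fdom p)" "fa p \<cdot> ?n = ncomp \<nu>" "fa q \<cdot> ?n = ncomp \<mu>"
    using pairing[OF P1 _ _ _ _ _ ee(3)] D by simp_all
  have nx: "fa p \<cdot> (?n \<cdot> z) = ncomp \<nu> \<cdot> z" "fa q \<cdot> (?n \<cdot> z) = ncomp \<mu> \<cdot> z"
    if "z \<in> Ar C" "Cod C z = ob (fdom (nsrc \<mu>))" for z
    using comp_eq_extend[OF n(4), of z] comp_eq_extend[OF n(5), of z] n D that by simp_all
  have st: "fo (comp_functor C p x) = fo p \<cdot> fo x" "fo (comp_functor C q x) = fo q \<cdot> fo x"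
     "fo (comp_functor C p y) = fo p \<cdot> fo y" "fo (comp_functor C q y) = fo q \<cdot> fo y" 
     "fa (comp_functor C p x) = fa p \<cdot> fa x" "fa (comp_functor C q x) = fa q \<cdot> fa x"
     "fa (comp_functor C p y) = fa p \<cdot> fa y" "fa (comp_functor C q y) = fa q \<cdot> fa y" by simp_all
  note st = st[unfolded x(4,5) y(4,5)]
  have s: "src (fdom p) \<cdot> ?n = fo x" "trg (fdom p) \<cdot> ?n = fo y"
  proof -
    have "fo p \<cdot> (src (fdom p) \<cdot> ?n) = src (fcod p) \<cdot> (fa p \<cdot> ?n)" "fo q \<cdot> (src (fdom p) \<cdot> ?n) = src (fcod q) \<cdot> (fa q \<cdot> ?n)"
      "fo p \<cdot> (trg (fdom p) \<cdot> ?n) = trg (fcod p) \<cdot> (fa p \<cdot> ?n)" "fo q \<cdot> (trg (fdom p) \<cdot> ?n) = trg (fcod q) \<cdot> (fa q \<cdot> ?n)"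
      using n(1-3) D by simp_all
    note k = this[unfolded n(4,5)]
    show "src (fdom p) \<cdot> ?n = fo x"
      by (rule pullback_eqI[OF P0]) (use k D n x st in simp_all)
    show "trg (fdom p) \<cdot> ?n = fo y"
      by (rule pullback_eqI[OF P0]) (use k D n y st in simp_all)
  qed
  have sx: "src (fdom p) \<cdot> (?n \<cdot> z) = fo x \<cdot> z" "trg (fdom p) \<cdot> (?n \<cdot> z) = fo y \<cdot> z"
    if "z \<in> Ar C" "Cod C z = ob (fdom (nsrc \<mu>))" for z
    using comp_eq_extend[OF s(1), of z] comp_eq_extend[OF s(2), of z] n D that by simp_all
  have "internal_nat_trans C (cat_cell x y ?n)"
  proof (rule internal_nat_transI)
    fix f assume f0: "f \<in> Ar C" "Cod C f = ar (fdom x)"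
    then have f: "f \<in> Ar C" "Cod C f = ar (fdom (nsrc \<mu>))" "Cod C f = ar (fdom (nsrc \<nu>))" using x D by simp_all
    have c: "fdom x = fdom (nsrc \<mu>)" "fcod x = fdom p" by (fact x)+
    have fst: "fa p \<cdot> (fa x \<cdot> z) = fa (nsrc \<nu>) \<cdot> z" "fa q \<cdot> (fa x \<cdot> z) = fa (nsrc \<mu>) \<cdot> z"
      "fa p \<cdot> (fa y \<cdot> z) = fa (ntrg \<nu>) \<cdot> z" "fa q \<cdot> (fa y \<cdot> z) = fa (ntrg \<mu>) \<cdot> z" if "z \<in> Ar C" "Cod C z = ar (fdom (nsrc \<mu>))" for z
      using D x(1-3) y(1-3) that unfolding st by simp_all
    note N = nt_natural[OF \<nu> f(1,3)] nt_natural[OF \<mu> f(1,2)]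
    show "cmp C (fcod x) (?n \<cdot> (trg (fdom x) \<cdot> f)) (fa x \<cdot> f) = cmp C (fcod x) (fa y \<cdot> f) (?n \<cdot> (src (fdom x) \<cdot> f))"
      unfolding c
      apply (rule pullback_eqI[OF P1])
      using f x y n D sx N nx fst
        fa_cmp[of p "fa x \<cdot> f" "?n \<cdot> (trg (fdom (nsrc \<mu>)) \<cdot> f)"]
        fa_cmp[of q "fa x \<cdot> f" "?n \<cdot> (trg (fdom (nsrc \<mu>)) \<cdot> f)"]
        fa_cmp[of p "?n \<cdot> (src (fdom (nsrc \<mu>)) \<cdot> f)" "fa y \<cdot> f"]
        fa_cmp[of q "?n \<cdot> (src (fdom (nsrc \<mu>)) \<cdot> f)" "fa y \<cdot> f"] by simp_all
  qed (use x y n s D in simp_all)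
  then show ?thesis
    using that[of "cat_cell x y ?n"] x y n by (simp add: Cat_simps cat_cell_def)
qed

section \<open>Cotensors with [1]\<close>

lemma composable_eqI:
  assumes "category_object C A" "x \<in> Ar C" "y \<in> Ar C" "Dom C x = Dom C y" "Cod C x = sob A 2" "Cod C y = sob A 2"
    "face A 1 2 \<cdot> x = face A 1 2 \<cdot> y" "face A 1 0 \<cdot> x = face A 1 0 \<cdot> y"
  shows "x = y"
  by (rule pullback_eqI[OF composable_pullback[OF assms(1)]]) (use assms face_Ar[OF assms(1), of 2 1] in simp_all)

text \<open>S is the object of commutative squares v f = g u, the pullback of the composition map
  \<open>face A 1 1\<close> with itself: an element is a pair of composable pairs with equal
  composites. The operation \<open>sq\<close> builds a square from its four sides.\<close>

lemma commutative_squares: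
  assumes hp: "has_pullbacks C" and A: "category_object C A"
  obtains S U V F G sq where "U \<in> Ar C" "V \<in> Ar C" "F \<in> Ar C" "G \<in> Ar C"
    "Dom C U = S" "Dom C V = S" "Dom C F = S" "Dom C G = S"
    "Cod C U = ar A" "Cod C V = ar A" "Cod C F = ar A" "Cod C G = ar A"
    "src A \<cdot> F = src A \<cdot> U" "trg A \<cdot> F = src A \<cdot> V" "src A \<cdot> G = trg A \<cdot> U" "trg A \<cdot> G = trg A \<cdot> V"
    "cmp C A V F = cmp C A G U"
    "\<forall>x y. x \<in> Ar C \<longrightarrow> y \<in> Ar C \<longrightarrow> Dom C x = Dom C y \<longrightarrow> Cod C x = S \<longrightarrow> Cod C y = S \<longrightarrow> U \<cdot> x = U \<cdot> y \<longrightarrow>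
       V \<cdot> x = V \<cdot> y \<longrightarrow> F \<cdot> x = F \<cdot> y \<longrightarrow> G \<cdot> x = G \<cdot> y \<longrightarrow> x = y"
    "\<forall>u v f g. u \<in> Ar C \<longrightarrow> v \<in> Ar C \<longrightarrow> f \<in> Ar C \<longrightarrow> g \<in> Ar C \<longrightarrow> Dom C v = Dom C u \<longrightarrow> Dom C f = Dom C u \<longrightarrow> Dom C g = Dom C u \<longrightarrow>
       Cod C u = ar A \<longrightarrow> Cod C v = ar A \<longrightarrow> Cod C f = ar A \<longrightarrow> Cod C g = ar A \<longrightarrow> trg A \<cdot> f = src A \<cdot> v \<longrightarrow> src A \<cdot> g = trg A \<cdot> u \<longrightarrow>
       cmp C A v f = cmp C A g u \<longrightarrow> sq u v f g \<in> Ar C \<and> Dom C (sq u v f g) = Dom C u \<and> Cod C (sq u v f g) = S \<and>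
       U \<cdot> sq u v f g = u \<and> V \<cdot> sq u v f g = v \<and> F \<cdot> sq u v f g = f \<and> G \<cdot> sq u v f g = g"
proof -
  note fA = face_Ar[OF A, of _ 1]
  obtain X Y where P: "is_pullback C (face A 1 1) (face A 1 1) X Y"
    using pb_is_pullback[OF hp, of "face A 1 1" "face A 1 1"] fA by auto
  have XY: "X \<in> Ar C" "Y \<in> Ar C" "Dom C Y = Dom C X" "Cod C X = sob A 2" "Cod C Y = sob A 2" "face A 1 1 \<cdot> X = face A 1 1 \<cdot> Y"
    using pullback_Ar[OF P] fA by simp_all
  let ?U = "face A 1 2 \<cdot> Y" and ?V = "face A 1 0 \<cdot> X" and ?F = "face A 1 2 \<cdot> X" and ?G = "face A 1 0 \<cdot> Y"
  let ?Q = "\<lambda>u v f g w. w \<in> Ar C \<and> Dom C w = Dom C u \<and> Cod C w = Dom C X \<and>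
       ?U \<cdot> w = u \<and> ?V \<cdot> w = v \<and> ?F \<cdot> w = f \<and> ?G \<cdot> w = g"
  have c: "trg A \<cdot> ?F = src A \<cdot> ?V" "src A \<cdot> ?G = trg A \<cdot> ?U"
    using pullback_square[OF composable_pullback[OF A]] XY fA by simp_all
  have cm: "cmp C A ?V ?F = face A 1 1 \<cdot> X" "cmp C A ?G ?U = face A 1 1 \<cdot> Y"
    using cmp_simplex[OF A, of X] cmp_simplex[OF A, of Y] XY by simp_all
  have ar: "ar A = sob A 1" by (simp add: ar_def)
  have sc: "src A \<cdot> ?F = src A \<cdot> ?U" "trg A \<cdot> ?G = trg A \<cdot> ?V"
    using src_cmp[OF A, of ?F ?V] src_cmp[OF A, of ?U ?G] trg_cmp[OF A, of ?F ?V] trg_cmp[OF A, of ?U ?G] c cm XY fA ar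
    by simp_all
  have ex: "\<exists>w. ?Q u v f g w" if uv: "u \<in> Ar C" "v \<in> Ar C" "f \<in> Ar C" "g \<in> Ar C" "Dom C v = Dom C u" "Dom C f = Dom C u" "Dom C g = Dom C u"
       "Cod C u = ar A" "Cod C v = ar A" "Cod C f = ar A" "Cod C g = ar A" "trg A \<cdot> f = src A \<cdot> v" "src A \<cdot> g = trg A \<cdot> u"
       "cmp C A v f = cmp C A g u" for u v f g
  proof -
    obtain x where x: "x \<in> Ar C" "Dom C x = Dom C f" "Cod C x = sob A 2"
      "face A 1 2 \<cdot> x = f" "face A 1 0 \<cdot> x = v" "face A 1 1 \<cdot> x = cmp C A v f"
      by (rule composable_simplex[OF A, of f v]) (use uv in auto)
    obtain y where y: "y \<in> Ar C" "Dom C y = Dom C u" "Cod C y = sob A 2"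
      "face A 1 2 \<cdot> y = u" "face A 1 0 \<cdot> y = g" "face A 1 1 \<cdot> y = cmp C A g u"
      by (rule composable_simplex[OF A, of u g]) (use uv in auto)
    have e: "face A 1 1 \<cdot> x = face A 1 1 \<cdot> y" using x y uv by simp
    have "?Q u v f g (pairing C (X, Y) x y)"
      using pairing[OF P _ _ _ _ _ e] x y uv XY fA by simp
    then show ?thesis by blast
  qed
  define sq where "sq u v f g = (SOME w. ?Q u v f g w)" for u v f g
  show ?thesis
  proof (rule that[of ?U ?V ?F ?G "Dom C X" sq]; (intro allI impI)?)
    fix u v f g assume "u \<in> Ar C" "v \<in> Ar C" "f \<in> Ar C" "g \<in> Ar C" "Dom C v = Dom C u" "Dom C f = Dom C u" "Dom C g = Dom C u"
       "Cod C u = ar A" "Cod C v = ar A" "Cod C f = ar A" "Cod C g = ar A" "trg A \<cdot> f = src A \<cdot> v" "src A \<cdot> g = trg A \<cdot> u"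
       "cmp C A v f = cmp C A g u"
    from ex[OF this] show "?Q u v f g (sq u v f g)"
      unfolding sq_def by (rule someI_ex)
  next
    fix x y assume xy: "x \<in> Ar C" "y \<in> Ar C" "Dom C x = Dom C y" "Cod C x = Dom C X" "Cod C y = Dom C X"
      "?U \<cdot> x = ?U \<cdot> y" "?V \<cdot> x = ?V \<cdot> y" "?F \<cdot> x = ?F \<cdot> y" "?G \<cdot> x = ?G \<cdot> y"
    have "X \<cdot> x = X \<cdot> y" by (rule composable_eqI[OF A]) (use xy XY fA in simp_all)
    moreover have "Y \<cdot> x = Y \<cdot> y" by (rule composable_eqI[OF A]) (use xy XY fA in simp_all)
    ultimately show "x = y" using xy by (intro pullback_eqI[OF P xy(1-5)]) simp_all
  qed (use XY fA c cm sc ar in simp_all)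
qed

text \<open>The cotensor is the internal arrow category: its objects are the arrows of A, its arrows
  the commutative squares, composed by pasting.\<close>

theorem Cat_cotensor:
  assumes hp: "has_pullbacks C" and A: "category_object C A"
  shows "\<exists>\<kappa>. is_cotensor (Cat C) A \<kappa>"
proof -
  note [simp] = A
  obtain S U V F G sq where [simp]: "U \<in> Ar C" "V \<in> Ar C" "F \<in> Ar C" "G \<in> Ar C"
    "Dom C U = S" "Dom C V = S" "Dom C F = S" "Dom C G = S"
    "Cod C U = ar A" "Cod C V = ar A" "Cod C F = ar A" "Cod C G = ar A"
    and st: "src A \<cdot> F = src A \<cdot> U" "trg A \<cdot> F = src A \<cdot> V" "src A \<cdot> G = trg A \<cdot> U" "trg A \<cdot> G = trg A \<cdot> V"
    and cm: "cmp C A V F = cmp C A G U"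
    and eqI0: "\<forall>x y. x \<in> Ar C \<longrightarrow> y \<in> Ar C \<longrightarrow> Dom C x = Dom C y \<longrightarrow> Cod C x = S \<longrightarrow> Cod C y = S \<longrightarrow> U \<cdot> x = U \<cdot> y \<longrightarrow>
       V \<cdot> x = V \<cdot> y \<longrightarrow> F \<cdot> x = F \<cdot> y \<longrightarrow> G \<cdot> x = G \<cdot> y \<longrightarrow> x = y"
    and sq0: "\<forall>u v f g. u \<in> Ar C \<longrightarrow> v \<in> Ar C \<longrightarrow> f \<in> Ar C \<longrightarrow> g \<in> Ar C \<longrightarrow> Dom C v = Dom C u \<longrightarrow> Dom C f = Dom C u \<longrightarrow> Dom C g = Dom C u \<longrightarrow>
       Cod C u = ar A \<longrightarrow> Cod C v = ar A \<longrightarrow> Cod C f = ar A \<longrightarrow> Cod C g = ar A \<longrightarrow> trg A \<cdot> f = src A \<cdot> v \<longrightarrow> src A \<cdot> g = trg A \<cdot> u \<longrightarrow>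
       cmp C A v f = cmp C A g u \<longrightarrow> sq u v f g \<in> Ar C \<and> Dom C (sq u v f g) = Dom C u \<and> Cod C (sq u v f g) = S \<and>
       U \<cdot> sq u v f g = u \<and> V \<cdot> sq u v f g = v \<and> F \<cdot> sq u v f g = f \<and> G \<cdot> sq u v f g = g"
    by (rule commutative_squares[OF hp A])
  note eqI = eqI0[rule_format] and sq = sq0[rule_format]
  have [simp]: "S \<in> Ob C" using Dom_Ob[of U] by simp
  have stx [simp]: "src A \<cdot> (F \<cdot> x) = src A \<cdot> (U \<cdot> x)" "trg A \<cdot> (F \<cdot> x) = src A \<cdot> (V \<cdot> x)"
    "src A \<cdot> (G \<cdot> x) = trg A \<cdot> (U \<cdot> x)" "trg A \<cdot> (G \<cdot> x) = trg A \<cdot> (V \<cdot> x)" if "x \<in> Ar C" "Cod C x = S" for x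
    using comp2_eq_extend[OF st(1), of x] comp2_eq_extend[OF st(2), of x] comp2_eq_extend[OF st(3), of x]
      comp2_eq_extend[OF st(4), of x] that by simp_all
  have cmx: "cmp C A (V \<cdot> x) (F \<cdot> x) = cmp C A (G \<cdot> x) (U \<cdot> x)" if "x \<in> Ar C" "Cod C x = S" for x
    using arg_cong[OF cm, of "\<lambda>z. z \<cdot> x"] that st by simp
  define i where "i = sq (Ident C (ar A)) (Ident C (ar A)) (idn A \<cdot> src A) (idn A \<cdot> trg A)"
  have i [simp]: "i \<in> Ar C" "Dom C i = ar A" "Cod C i = S" and ip: "U \<cdot> i = Ident C (ar A)" "V \<cdot> i = Ident C (ar A)"
      "F \<cdot> i = idn A \<cdot> src A" "G \<cdot> i = idn A \<cdot> trg A"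
    using sq[of "Ident C (ar A)" "Ident C (ar A)" "idn A \<cdot> src A" "idn A \<cdot> trg A"] by (simp_all add: i_def)
  have ix [simp]: "U \<cdot> (i \<cdot> x) = x" "V \<cdot> (i \<cdot> x) = x" "F \<cdot> (i \<cdot> x) = idn A \<cdot> (src A \<cdot> x)" "G \<cdot> (i \<cdot> x) = idn A \<cdot> (trg A \<cdot> x)"
    if "x \<in> Ar C" "Cod C x = ar A" for x
    using comp_eq_extend[OF ip(1), of x] comp_eq_extend[OF ip(2), of x] comp_eq_extend[OF ip(3), of x]
      comp_eq_extend[OF ip(4), of x] that by simp_all
  define m where "m g f = sq (U \<cdot> f) (V \<cdot> g) (cmp C A (F \<cdot> g) (F \<cdot> f)) (cmp C A (G \<cdot> g) (G \<cdot> f))" for g f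
  have m: "m g f \<in> Ar C" "Dom C (m g f) = Dom C g" "Cod C (m g f) = S" "U \<cdot> m g f = U \<cdot> f" "V \<cdot> m g f = V \<cdot> g"
    "F \<cdot> m g f = cmp C A (F \<cdot> g) (F \<cdot> f)" "G \<cdot> m g f = cmp C A (G \<cdot> g) (G \<cdot> f)"
    if fg: "f \<in> Ar C" "g \<in> Ar C" "Cod C f = S" "Cod C g = S" "Dom C f = Dom C g" "V \<cdot> f = U \<cdot> g" for f g
  proof -
    \<comment> \<open>Pasting along the shared side \<open>V \<cdot> f = U \<cdot> g\<close> again
      gives a commutative square.\<close>
    have "cmp C A (V \<cdot> g) (cmp C A (F \<cdot> g) (F \<cdot> f)) = cmp C A (cmp C A (V \<cdot> g) (F \<cdot> g)) (F \<cdot> f)"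
      using fg by (subst cmp_assoc) simp_all
    also have "\<dots> = cmp C A (G \<cdot> g) (cmp C A (V \<cdot> f) (F \<cdot> f))"
      using fg by (simp add: cmx cmp_assoc)
    also have "\<dots> = cmp C A (cmp C A (G \<cdot> g) (G \<cdot> f)) (U \<cdot> f)"
      using fg cmx[of f] by (simp add: cmp_assoc)
    finally have e: "cmp C A (V \<cdot> g) (cmp C A (F \<cdot> g) (F \<cdot> f)) = cmp C A (cmp C A (G \<cdot> g) (G \<cdot> f)) (U \<cdot> f)" .
    show "m g f \<in> Ar C" "Dom C (m g f) = Dom C g" "Cod C (m g f) = S" "U \<cdot> m g f = U \<cdot> f" "V \<cdot> m g f = V \<cdot> g"
      "F \<cdot> m g f = cmp C A (F \<cdot> g) (F \<cdot> f)" "G \<cdot> m g f = cmp C A (G \<cdot> g) (G \<cdot> f)"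
      unfolding m_def using sq[OF _ _ _ _ _ _ _ _ _ _ _ _ _ e] fg by simp_all
  qed
  interpret I: internal_category C "ar A" S U V i m
  proof unfold_locales
    fix f g h x
    assume f: "f \<in> Ar C" "Cod C f = S"
    show "m f (i \<cdot> (U \<cdot> f)) = f" "m (i \<cdot> (V \<cdot> f)) f = f"
      using m[of "i \<cdot> (U \<cdot> f)" f] m[of f "i \<cdot> (V \<cdot> f)"] f by - (rule eqI; simp)+
    assume g: "g \<in> Ar C" "Cod C g = S" "Dom C f = Dom C g" "V \<cdot> f = U \<cdot> g"
    note mm = m[OF f(1) g(1) f(2) g(2-4)]
    { assume x: "x \<in> Ar C" "Cod C x = Dom C g"
      have e: "V \<cdot> (f \<cdot> x) = U \<cdot> (g \<cdot> x)" using f g x comp2_eq_extend[OF g(4), of x] by simp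
      show "m g f \<cdot> x = m (g \<cdot> x) (f \<cdot> x)"
        by (rule eqI) (use f g x mm m[OF _ _ _ _ _ e] comp_eq_extend[OF mm(4), of x] comp_eq_extend[OF mm(5), of x]
          comp_eq_extend[OF mm(6), of x] comp_eq_extend[OF mm(7), of x] in simp_all) }
    { assume h: "h \<in> Ar C" "Cod C h = S" "Dom C h = Dom C g" "V \<cdot> g = U \<cdot> h"
      have gh: "Dom C g = Dom C h" using h by simp
      note mh = m[OF g(1) h(1) g(2) h(2) gh h(4)]
      show "m (m h g) f = m h (m g f)"
        by (rule eqI) (use f g h mm mh m[of f "m h g"] m[of "m g f" h] in \<open>simp_all add: cmp_assoc\<close>) }
  qed (use m hp ip in simp_all)
  obtain P where P [simp]: "category_object C P" "ob P = ar A" "ar P = S" "src P = U" "trg P = V" "idn P = i"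
    and cP: "\<And>f g. f \<in> Ar C \<Longrightarrow> g \<in> Ar C \<Longrightarrow> Cod C f = S \<Longrightarrow> Cod C g = S \<Longrightarrow> Dom C f = Dom C g \<Longrightarrow> V \<cdot> f = U \<cdot> g \<Longrightarrow>
      cmp C P g f = m g f"
    using I.nerve by blast
  have "internal_functor C (mkfun P A (src A) F) \<and> fo (mkfun P A (src A) F) = src A \<and> fa (mkfun P A (src A) F) = F"
    by (intro conjI internal_functor_mkfun fo_mkfun fa_mkfun; use st ip m cP in simp)
  then have s [simp]: "internal_functor C (mkfun P A (src A) F)" "fo (mkfun P A (src A) F) = src A" "fa (mkfun P A (src A) F) = F" by blast+
  have "internal_functor C (mkfun P A (trg A) G) \<and> fo (mkfun P A (trg A) G) = trg A \<and> fa (mkfun P A (trg A) G) = G"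
    by (intro conjI internal_functor_mkfun fo_mkfun fa_mkfun; use st ip m cP in simp)
  then have t [simp]: "internal_functor C (mkfun P A (trg A) G)" "fo (mkfun P A (trg A) G) = trg A" "fa (mkfun P A (trg A) G) = G" by blast+
  let ?s = "mkfun P A (src A) F" and ?t = "mkfun P A (trg A) G"
  \<comment> \<open>An object of the arrow category is an arrow of A, so the component of the
    universal 2-cell is the identity of \<open>ar A\<close>.\<close>
  let ?\<kappa> = "cat_cell ?s ?t (Ident C (ar A))"
  have "is_cotensor (Cat C) A ?\<kappa>"
    unfolding is_cotensor_def Let_def hom_iff cells_def Cat_simps mem_Collect_eq
  proof (intro conjI ballI allI impI)
    show "internal_nat_trans C ?\<kappa>"
      by (rule internal_nat_transI) (use cmx in simp_all)
    fix \<alpha> assume "\<alpha> \<in> Cell (Cat C)" and \<alpha>A: "fcod (nsrc \<alpha>) = A"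
    then have \<alpha>: "internal_nat_trans C \<alpha>" by (simp add: Cat_simps)
    note [simp] = \<alpha> \<alpha>A
    let ?Z = "fdom (nsrc \<alpha>)"
    \<comment> \<open>A transformation \<alpha> is classified by the functor that sends an object to
      its component and an arrow to its naturality square.\<close>
    let ?h1 = "sq (ncomp \<alpha> \<cdot> src ?Z) (ncomp \<alpha> \<cdot> trg ?Z) (fa (nsrc \<alpha>)) (fa (ntrg \<alpha>))"
    have h1: "?h1 \<in> Ar C \<and> Dom C ?h1 = ar ?Z \<and> Cod C ?h1 = S \<and>
       U \<cdot> ?h1 = ncomp \<alpha> \<cdot> src ?Z \<and> V \<cdot> ?h1 = ncomp \<alpha> \<cdot> trg ?Z \<and> F \<cdot> ?h1 = fa (nsrc \<alpha>) \<and> G \<cdot> ?h1 = fa (ntrg \<alpha>)"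
      using sq[of "ncomp \<alpha> \<cdot> src ?Z" "ncomp \<alpha> \<cdot> trg ?Z" "fa (nsrc \<alpha>)" "fa (ntrg \<alpha>)"] nt_natural_arr[OF \<alpha>] by simp
    then have h1x: "U \<cdot> (?h1 \<cdot> x) = ncomp \<alpha> \<cdot> (src ?Z \<cdot> x)" "V \<cdot> (?h1 \<cdot> x) = ncomp \<alpha> \<cdot> (trg ?Z \<cdot> x)"
      "F \<cdot> (?h1 \<cdot> x) = fa (nsrc \<alpha>) \<cdot> x" "G \<cdot> (?h1 \<cdot> x) = fa (ntrg \<alpha>) \<cdot> x" if "x \<in> Ar C" "Cod C x = ar ?Z" for x
      using comp_eq_extend[of U ?h1 _ x] comp_eq_extend[of V ?h1 _ x] comp_eq_extend[of F ?h1 _ x]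
        comp_eq_extend[of G ?h1 _ x] that by simp_all
    let ?h = "mkfun ?Z P (ncomp \<alpha>) ?h1"
    have "internal_functor C ?h \<and> fo ?h = ncomp \<alpha> \<and> fa ?h = ?h1"
    proof -
      have id: "?h1 \<cdot> idn ?Z = i \<cdot> ncomp \<alpha>"
        by (rule eqI) (use h1 h1x fa_idn[of "nsrc \<alpha>" "Ident C (ob ?Z)" ?Z] fa_idn[of "ntrg \<alpha>" "Ident C (ob ?Z)" ?Z] in simp_all)
      have c: "?h1 \<cdot> cmp C ?Z g f = cmp C P (?h1 \<cdot> g) (?h1 \<cdot> f)"
        if fg: "f \<in> Ar C" "g \<in> Ar C" "Cod C f = ar ?Z" "Cod C g = ar ?Z" "Dom C f = Dom C g" "trg ?Z \<cdot> f = src ?Z \<cdot> g" for f g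
      proof -
        have "V \<cdot> (?h1 \<cdot> f) = U \<cdot> (?h1 \<cdot> g)" using fg h1x by simp
        then show ?thesis
          using cP[of "?h1 \<cdot> f" "?h1 \<cdot> g"] m[of "?h1 \<cdot> f" "?h1 \<cdot> g"] h1 h1x fg
            fa_cmp[of "nsrc \<alpha>" f g] fa_cmp[of "ntrg \<alpha>" f g] by - (rule eqI, simp_all)
      qed
      show ?thesis
        by (intro conjI internal_functor_mkfun fo_mkfun fa_mkfun; use h1 id c in simp)
    qed
    then have h [simp]: "internal_functor C ?h" "fo ?h = ncomp \<alpha>" "fa ?h = ?h1" by blast+
    show "\<exists>!h. (internal_functor C h \<and> fdom h = fdom (nsrc \<alpha>) \<and> fcod h = fdom (nsrc ?\<kappa>)) \<and>
        cat_cell (comp_functor C (nsrc ?\<kappa>) h) (comp_functor C (ntrg ?\<kappa>) h) (ncomp ?\<kappa> \<cdot> fo h) = \<alpha>"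
    proof (rule ex1I[of _ ?h])
      have "comp_functor C ?s ?h = nsrc \<alpha>" "comp_functor C ?t ?h = ntrg \<alpha>"
        by (rule functor_eqI; use h1 in simp)+
      then show "(internal_functor C ?h \<and> fdom ?h = fdom (nsrc \<alpha>) \<and> fcod ?h = fdom (nsrc ?\<kappa>)) \<and>
        cat_cell (comp_functor C (nsrc ?\<kappa>) ?h) (comp_functor C (ntrg ?\<kappa>) ?h) (ncomp ?\<kappa> \<cdot> fo ?h) = \<alpha>"
        by (simp add: cat_cell_def)
      fix h' assume "(internal_functor C h' \<and> fdom h' = fdom (nsrc \<alpha>) \<and> fcod h' = fdom (nsrc ?\<kappa>)) \<and>
        cat_cell (comp_functor C (nsrc ?\<kappa>) h') (comp_functor C (ntrg ?\<kappa>) h') (ncomp ?\<kappa> \<cdot> fo h') = \<alpha>"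
      then have [simp]: "internal_functor C h'" "fdom h' = ?Z" "fcod h' = P"
        and e: "\<alpha> = cat_cell (comp_functor C ?s h') (comp_functor C ?t h') (Ident C (ar A) \<cdot> fo h')"
        by (auto simp only: cat_cell_simps fdom_mkfun)
      have e': "fo h' = ncomp \<alpha>" "F \<cdot> fa h' = fa (nsrc \<alpha>)" "G \<cdot> fa h' = fa (ntrg \<alpha>)"
        using e by simp_all
      have "fa h' = ?h1"
        by (rule eqI) (use h1 e' src_fa_arr[of h' P] in simp_all)
      then show "h' = ?h" using e' by (intro functor_eqI) simp_all
    qed
  next
    fix Z h k \<sigma> \<tau>
    assume "h \<in> hom (Cat C) Z (fdom (nsrc ?\<kappa>))" "k \<in> hom (Cat C) Z (fdom (nsrc ?\<kappa>))"
      and \<sigma>0: "\<sigma> \<in> {\<alpha>. internal_nat_trans C \<alpha> \<and> nsrc \<alpha> = comp_functor C (nsrc ?\<kappa>) h \<and> ntrg \<alpha> = comp_functor C (nsrc ?\<kappa>) k}"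
      and \<tau>0: "\<tau> \<in> {\<alpha>. internal_nat_trans C \<alpha> \<and> nsrc \<alpha> = comp_functor C (ntrg ?\<kappa>) h \<and> ntrg \<alpha> = comp_functor C (ntrg ?\<kappa>) k}"
      and e: "cat_cell (nsrc \<sigma>) (ntrg (cat_cell (comp_functor C (nsrc ?\<kappa>) k) (comp_functor C (ntrg ?\<kappa>) k) (ncomp ?\<kappa> \<cdot> fo k)))
        (cmp C (fcod (nsrc \<sigma>)) (ncomp (cat_cell (comp_functor C (nsrc ?\<kappa>) k) (comp_functor C (ntrg ?\<kappa>) k) (ncomp ?\<kappa> \<cdot> fo k))) (ncomp \<sigma>)) =
        cat_cell (nsrc (cat_cell (comp_functor C (nsrc ?\<kappa>) h) (comp_functor C (ntrg ?\<kappa>) h) (ncomp ?\<kappa> \<cdot> fo h))) (ntrg \<tau>)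
        (cmp C (fcod (nsrc (cat_cell (comp_functor C (nsrc ?\<kappa>) h) (comp_functor C (ntrg ?\<kappa>) h) (ncomp ?\<kappa> \<cdot> fo h)))) (ncomp \<tau>)
          (ncomp (cat_cell (comp_functor C (nsrc ?\<kappa>) h) (comp_functor C (ntrg ?\<kappa>) h) (ncomp ?\<kappa> \<cdot> fo h))))"
    then have hk [simp]: "internal_functor C h" "internal_functor C k" "fdom h = Z" "fdom k = Z" "fcod h = P" "fcod k = P"
      by (simp_all add: Cat_simps)
    have \<sigma>: "internal_nat_trans C \<sigma>" "nsrc \<sigma> = comp_functor C ?s h" "ntrg \<sigma> = comp_functor C ?s k"
      and \<tau>: "internal_nat_trans C \<tau>" "nsrc \<tau> = comp_functor C ?t h" "ntrg \<tau> = comp_functor C ?t k"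
      using \<sigma>0 \<tau>0 by simp_all
    have Z [simp]: "category_object C Z" using functor_objects(1)[OF hk(1)] by simp
    have [simp]: "ncomp \<sigma> \<in> Ar C" "Dom C (ncomp \<sigma>) = ob Z" "Cod C (ncomp \<sigma>) = ar A" "ncomp \<tau> \<in> Ar C" "Dom C (ncomp \<tau>) = ob Z" "Cod C (ncomp \<tau>) = ar A"
      using \<sigma> \<tau> by simp_all
    have \<sigma>x: "src A \<cdot> ncomp \<sigma> = src A \<cdot> fo h" "trg A \<cdot> ncomp \<sigma> = src A \<cdot> fo k"
      and \<tau>x: "src A \<cdot> ncomp \<tau> = trg A \<cdot> fo h" "trg A \<cdot> ncomp \<tau> = trg A \<cdot> fo k"
      using src_nt[OF \<sigma>(1), of A] trg_nt[OF \<sigma>(1), of A] src_nt[OF \<tau>(1), of A] trg_nt[OF \<tau>(1), of A]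
      unfolding \<sigma>(2,3) \<tau>(2,3) by simp_all
    have e': "cmp C A (fo k) (ncomp \<sigma>) = cmp C A (ncomp \<tau>) (fo h)"
      using arg_cong[OF e, of ncomp] \<sigma>(2) by simp
    \<comment> \<open>By e' the components of \<sigma> and \<tau> form a commutative square with the
      object parts of h and k; this square is the component of the induced 2-cell.\<close>
    let ?n = "sq (fo h) (fo k) (ncomp \<sigma>) (ncomp \<tau>)"
    have n: "?n \<in> Ar C \<and> Dom C ?n = ob Z \<and> Cod C ?n = S \<and> U \<cdot> ?n = fo h \<and> V \<cdot> ?n = fo k \<and> F \<cdot> ?n = ncomp \<sigma> \<and> G \<cdot> ?n = ncomp \<tau>"
      using sq[of "fo h" "fo k" "ncomp \<sigma>" "ncomp \<tau>"] e' \<sigma>x \<tau>x by simp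
    then have nx: "U \<cdot> (?n \<cdot> x) = fo h \<cdot> x" "V \<cdot> (?n \<cdot> x) = fo k \<cdot> x" "F \<cdot> (?n \<cdot> x) = ncomp \<sigma> \<cdot> x" "G \<cdot> (?n \<cdot> x) = ncomp \<tau> \<cdot> x"
      if "x \<in> Ar C" "Cod C x = ob Z" for x
      using comp_eq_extend[of U ?n _ x] comp_eq_extend[of V ?n _ x] comp_eq_extend[of F ?n _ x]
        comp_eq_extend[of G ?n _ x] that by simp_all
    have \<xi>: "internal_nat_trans C (cat_cell h k ?n)"
    proof (rule internal_nat_transI)
      fix f assume "f \<in> Ar C" "Cod C f = ar (fdom h)"
      then have f: "f \<in> Ar C" "Cod C f = ar Z" by simp_all
      have c: "V \<cdot> (fa h \<cdot> f) = U \<cdot> (?n \<cdot> (trg Z \<cdot> f))" "V \<cdot> (?n \<cdot> (src Z \<cdot> f)) = U \<cdot> (fa k \<cdot> f)"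
        using f nx trg_fa[of h f P] src_fa[of k f P] by simp_all
      have u: "U \<cdot> (fa h \<cdot> f) = fo h \<cdot> (src Z \<cdot> f)" "V \<cdot> (fa k \<cdot> f) = fo k \<cdot> (trg Z \<cdot> f)"
        using f src_fa[of h f P] trg_fa[of k f P] by simp_all
      show "cmp C (fcod h) (?n \<cdot> (trg (fdom h) \<cdot> f)) (fa h \<cdot> f) = cmp C (fcod h) (fa k \<cdot> f) (?n \<cdot> (src (fdom h) \<cdot> f))"
        using f n nx c u cP[OF _ _ _ _ _ c(1)] cP[OF _ _ _ _ _ c(2)] m[OF _ _ _ _ _ c(1)] m[OF _ _ _ _ _ c(2)]
          nt_natural[OF \<sigma>(1), of f] nt_natural[OF \<tau>(1), of f] \<sigma>(2,3) \<tau>(2,3)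
        by - (rule eqI, simp_all)
    qed (use n in simp_all)
    show "\<exists>!\<xi>. (internal_nat_trans C \<xi> \<and> nsrc \<xi> = h \<and> ntrg \<xi> = k) \<and>
        cat_cell (comp_functor C (nsrc ?\<kappa>) (nsrc \<xi>)) (comp_functor C (nsrc ?\<kappa>) (ntrg \<xi>)) (fa (nsrc ?\<kappa>) \<cdot> ncomp \<xi>) = \<sigma> \<and>
        cat_cell (comp_functor C (ntrg ?\<kappa>) (nsrc \<xi>)) (comp_functor C (ntrg ?\<kappa>) (ntrg \<xi>)) (fa (ntrg ?\<kappa>) \<cdot> ncomp \<xi>) = \<tau>"
    proof (rule ex1I[of _ "cat_cell h k ?n"])
      show "(internal_nat_trans C (cat_cell h k ?n) \<and> nsrc (cat_cell h k ?n) = h \<and> ntrg (cat_cell h k ?n) = k) \<and>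
        cat_cell (comp_functor C (nsrc ?\<kappa>) (nsrc (cat_cell h k ?n))) (comp_functor C (nsrc ?\<kappa>) (ntrg (cat_cell h k ?n))) (fa (nsrc ?\<kappa>) \<cdot> ncomp (cat_cell h k ?n)) = \<sigma> \<and>
        cat_cell (comp_functor C (ntrg ?\<kappa>) (nsrc (cat_cell h k ?n))) (comp_functor C (ntrg ?\<kappa>) (ntrg (cat_cell h k ?n))) (fa (ntrg ?\<kappa>) \<cdot> ncomp (cat_cell h k ?n)) = \<tau>"
        using \<xi> n \<sigma> \<tau> by (simp add: cat_cell_eqI)
      fix \<xi> assume "(internal_nat_trans C \<xi> \<and> nsrc \<xi> = h \<and> ntrg \<xi> = k) \<and>
        cat_cell (comp_functor C (nsrc ?\<kappa>) (nsrc \<xi>)) (comp_functor C (nsrc ?\<kappa>) (ntrg \<xi>)) (fa (nsrc ?\<kappa>) \<cdot> ncomp \<xi>) = \<sigma> \<and>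
        cat_cell (comp_functor C (ntrg ?\<kappa>) (nsrc \<xi>)) (comp_functor C (ntrg ?\<kappa>) (ntrg \<xi>)) (fa (ntrg ?\<kappa>) \<cdot> ncomp \<xi>) = \<tau>"
      then have x: "internal_nat_trans C \<xi>" "nsrc \<xi> = h" "ntrg \<xi> = k" "F \<cdot> ncomp \<xi> = ncomp \<sigma>" "G \<cdot> ncomp \<xi> = ncomp \<tau>"
        by auto
      have "ncomp \<xi> = ?n"
        by (rule eqI) (use x n src_nt[OF x(1), of P] trg_nt[OF x(1), of P] in simp_all)
      then show "\<xi> = cat_cell h k ?n" using x by (simp add: cat_cell_eqI)
    qed
  qed simp_all
  then show ?thesis by blast
qed

end

section \<open>The monad of corners\<close>

text \<open>The features of Cat(E) that enter the construction: pullbacks with induced 2-cells,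
  cotensors with [1], and interchange. The arrow i into X_0 is arbitrary here; it becomes the
  inclusion of the object of objects.\<close>

locale corner = two_category K
  for K :: "('o, 'a, 't, 'm) two_cat_scheme" (structure) +
  fixes X :: "('o, 'a) simp" and D :: "'t set" and i :: 'a
  assumes pullbacks: "has_pullbacks K"
    and cotensors: "A \<in> Ob K \<Longrightarrow> \<exists>\<kappa>. is_cotensor K A \<kappa>"
    and pullback_cells: "\<lbrakk>is_pullback K f g p q; \<nu> \<in> Cell K; \<mu> \<in> Cell K; Cod K (Src K \<nu>) = Dom K f;
        Cod K (Src K \<mu>) = Dom K g; Dom K (Src K \<nu>) = Dom K (Src K \<mu>); f \<rhd> \<nu> = g \<rhd> \<mu>\<rbrakk> \<Longrightarrow>
        \<exists>\<xi>\<in>Cell K. Cod K (Src K \<xi>) = Dom K p \<and> p \<rhd> \<xi> = \<nu> \<and> q \<rhd> \<xi> = \<mu>"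
    and interchange: "\<lbrakk>\<alpha> \<in> Cell K; \<beta> \<in> Cell K; Dom K (Src K \<beta>) = Cod K (Src K \<alpha>)\<rbrakk> \<Longrightarrow>
        (\<beta> \<lhd> Trg K \<alpha>) \<bullet> (Src K \<beta> \<rhd> \<alpha>) = (Trg K \<beta> \<rhd> \<alpha>) \<bullet> (\<beta> \<lhd> Src K \<alpha>)"
    and crossed: "crossed_internal_category K X D"
    and i [simp]: "i \<in> Ar K" "Cod K i = ob X"
begin

lemma X [simp]: "category_object K X"
  using crossed by (simp add: crossed_internal_category_def)

lemma opfib: "split_opfibration K (trg X) D"
  using crossed by (simp add: crossed_internal_category_def trg_def)

lemma D_Cell [simp]: "\<phi> \<in> D \<Longrightarrow> \<phi> \<in> Cell K" and D_Cod [simp]: "\<phi> \<in> D \<Longrightarrow> Cod K (Src K \<phi>) = ar X"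
  and D_opcartesian: "\<phi> \<in> D \<Longrightarrow> opcartesian K (trg X) \<phi>"
  using opfib by (auto simp: split_opfibration_def opcartesian_def)

text \<open>The 2-cell \<lambda>_3 of the distributive law, here taken at any arrow h into X_1 and
  any 2-cell \<beta> starting at its image under d_0.\<close>

definition lift :: "'a \<Rightarrow> 't \<Rightarrow> 't" where
  "lift h \<beta> = (THE \<phi>. \<phi> \<in> D \<and> Src K \<phi> = h \<and> trg X \<rhd> \<phi> = \<beta>)"

lemma lift_ex1:
  assumes "h \<in> Ar K" "\<beta> \<in> Cell K" "Cod K h = ar X" "Src K \<beta> = trg X \<cdot> h"
  shows "\<exists>!\<phi>. \<phi> \<in> D \<and> Src K \<phi> = h \<and> trg X \<rhd> \<phi> = \<beta>"
  using opfib assms unfolding split_opfibration_def by simp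

lemma lift [simp]:
  assumes "h \<in> Ar K" "\<beta> \<in> Cell K" "Cod K h = ar X" "Src K \<beta> = trg X \<cdot> h"
  shows "lift h \<beta> \<in> D" "Src K (lift h \<beta>) = h" "trg X \<rhd> lift h \<beta> = \<beta>"
  using theI'[OF lift_ex1[OF assms]] by (simp_all add: lift_def)

lemma lift_eqI:
  assumes "\<phi> \<in> D" "Src K \<phi> = h" "trg X \<rhd> \<phi> = \<beta>"
  shows "lift h \<beta> = \<phi>"
  unfolding lift_def
  by (rule the1_equality[OF lift_ex1]) (use assms D_Cod[OF assms(1)] in auto)

text \<open>Chosen 2-cells are stable under precomposition, so the lift at a generic pair determines
  the lift at every element.\<close>

lemma lift_RWhisk:
  assumes "h \<in> Ar K" "\<beta> \<in> Cell K" "Cod K h = ar X" "Src K \<beta> = trg X \<cdot> h" "y \<in> Ar K" "Cod K y = Dom K h"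
  shows "lift h \<beta> \<lhd> y = lift (h \<cdot> y) (\<beta> \<lhd> y)"
proof (rule lift_eqI[symmetric])
  show "lift h \<beta> \<lhd> y \<in> D"
    using opfib assms unfolding split_opfibration_def by simp
qed (use assms in \<open>simp_all add: LWhisk_RWhisk\<close>)

lemma Trg_lift [simp]:
  assumes "h \<in> Ar K" "\<beta> \<in> Cell K" "Cod K h = ar X" "Src K \<beta> = trg X \<cdot> h"
  shows "trg X \<cdot> Trg K (lift h \<beta>) = Trg K \<beta>"
proof -
  have "trg X \<cdot> Trg K (lift h \<beta>) = Trg K (trg X \<rhd> lift h \<beta>)"
    using assms by (simp del: lift(3))
  then show ?thesis using assms by simp
qed

text \<open>Splitness: the composite of the two chosen lifts is chosen and lies over the composite
  2-cell.\<close>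

lemma lift_VComp:
  assumes "h \<in> Ar K" "\<beta> \<in> Cell K" "Cod K h = ar X" "Src K \<beta> = trg X \<cdot> h" "\<gamma> \<in> Cell K" "Src K \<gamma> = Trg K \<beta>"
  shows "lift h (\<gamma> \<bullet> \<beta>) = lift (Trg K (lift h \<beta>)) \<gamma> \<bullet> lift h \<beta>"
proof (rule lift_eqI)
  have "trg X \<cdot> Trg K (lift h \<beta>) = Trg K \<beta>"
    using assms by simp
  then show "lift (Trg K (lift h \<beta>)) \<gamma> \<bullet> lift h \<beta> \<in> D"
    using opfib assms unfolding split_opfibration_def by simp
qed (use assms in \<open>simp_all add: LWhisk_VComp\<close>)

lemma lift_Ident2:
  assumes "h \<in> Ar K" "Cod K h = ar X"
  shows "lift h (Ident2 K (trg X \<cdot> h)) = Ident2 K h"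
  by (rule lift_eqI) (use opfib assms in \<open>simp_all add: split_opfibration_def LWhisk_Ident2\<close>)

text \<open>Every 2-cell is chosen for the identity opfibration, and the morphism s_0 carries it to
  a chosen one; so lifts at unit arrows are degenerate.\<close>

lemma lift_idn:
  assumes "\<beta> \<in> Cell K" "Cod K (Src K \<beta>) = ob X"
  shows "lift (idn X \<cdot> Src K \<beta>) \<beta> = idn X \<rhd> \<beta>"
proof (rule lift_eqI)
  show "idn X \<rhd> \<beta> \<in> D"
    using crossed assms
    by (simp add: crossed_internal_category_def split_opfibration_morphism_def identity_opfib_def idn_def ob_def)
qed (use assms in \<open>simp_all add: LWhisk_LWhisk LWhisk_Ident\<close>)

text \<open>The axiom on d_1 : X_2 -> X_1 in usable form. The lift \<mu> of \<gamma> at k and the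
  lift \<nu> at h of the source of \<mu> form a 2-cell \<xi> into X_2 that is chosen for the
  composite opfibration; its image under d_1 is therefore the lift at the composite arrow.\<close>

lemma lift_cmp:
  assumes h: "h \<in> Ar K" "Cod K h = ar X" and k: "k \<in> Ar K" "Cod K k = ar X" "Dom K h = Dom K k" "trg X \<cdot> h = src X \<cdot> k"
    and \<gamma>: "\<gamma> \<in> Cell K" "Src K \<gamma> = trg X \<cdot> k"
  defines "\<mu> \<equiv> lift k \<gamma>"
  defines "\<nu> \<equiv> lift h (src X \<rhd> \<mu>)"
  shows "src X \<rhd> lift (cmp K X k h) \<gamma> = src X \<rhd> \<nu>"
    and "Trg K (lift (cmp K X k h) \<gamma>) = cmp K X (Trg K \<mu>) (Trg K \<nu>)"
proof -
  note P = composable_pullback[OF X]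
  note F = face_Ar[OF X, of _ 1]
  have \<mu>: "\<mu> \<in> D" "Src K \<mu> = k" "trg X \<rhd> \<mu> = \<gamma>" unfolding \<mu>_def using k \<gamma> by simp_all
  have \<nu>: "\<nu> \<in> D" "Src K \<nu> = h" "trg X \<rhd> \<nu> = src X \<rhd> \<mu>" unfolding \<nu>_def using k h \<mu> by simp_all
  obtain \<xi> where \<xi>: "\<xi> \<in> Cell K" "Cod K (Src K \<xi>) = Dom K (face X 1 2)" "face X 1 2 \<rhd> \<xi> = \<nu>" "face X 1 0 \<rhd> \<xi> = \<mu>"
    using pullback_cells[OF P, of \<nu> \<mu>] \<mu> \<nu> h k by auto
  then have \<xi>': "Cod K (Src K \<xi>) = sob X 2" using F by simp
  have "\<xi> \<in> composite_opfib K (face X 1 0) (pullback_opfib K (face X 1 2) D) D"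
    using \<xi> \<mu> \<nu> by (simp add: composite_opfib_def pullback_opfib_def)
  then have D1: "face X 1 1 \<rhd> \<xi> \<in> D"
    using crossed unfolding crossed_internal_category_def split_opfibration_morphism_def by blast
  have s: "face X 1 2 \<cdot> Src K \<xi> = h" "face X 1 0 \<cdot> Src K \<xi> = k" "face X 1 2 \<cdot> Trg K \<xi> = Trg K \<nu>" "face X 1 0 \<cdot> Trg K \<xi> = Trg K \<mu>"
    using arg_cong[OF \<xi>(3), of "Src K"] arg_cong[OF \<xi>(4), of "Src K"] arg_cong[OF \<xi>(3), of "Trg K"] arg_cong[OF \<xi>(4), of "Trg K"]
      \<xi>(1) \<xi>' F \<mu>(2) \<nu>(2) by simp_all
  have c: "face X 1 1 \<cdot> Src K \<xi> = cmp K X k h" "face X 1 1 \<cdot> Trg K \<xi> = cmp K X (Trg K \<mu>) (Trg K \<nu>)"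
    using cmp_simplex[OF X, of "Src K \<xi>"] cmp_simplex[OF X, of "Trg K \<xi>"] \<xi> \<xi>' s by simp_all
  have dd: "trg X \<cdot> face X 1 1 = trg X \<cdot> face X 1 0" "src X \<cdot> face X 1 1 = src X \<cdot> face X 1 2"
    using face_face_arr[OF X, of 0 0 0] face_face_arr[OF X, of 1 1 0] by (simp_all add: src_def trg_def)
  have ar2: "ar X = sob X 1" by (simp add: ar_def)
  have "trg X \<rhd> (face X 1 1 \<rhd> \<xi>) = (trg X \<cdot> face X 1 0) \<rhd> \<xi>"
    using \<xi>(1) \<xi>' F ar2 by (simp add: LWhisk_LWhisk dd)
  also have "\<dots> = \<gamma>"
    using \<xi>(1,4) \<xi>' F ar2 \<mu>(3) by (simp flip: LWhisk_LWhisk)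
  finally have l: "lift (cmp K X k h) \<gamma> = face X 1 1 \<rhd> \<xi>"
    using D1 c \<xi>(1) \<xi>' F by (intro lift_eqI) simp_all
  have "src X \<rhd> (face X 1 1 \<rhd> \<xi>) = (src X \<cdot> face X 1 2) \<rhd> \<xi>"
    using \<xi>(1) \<xi>' F ar2 by (simp add: LWhisk_LWhisk dd)
  also have "\<dots> = src X \<rhd> \<nu>"
    using \<xi>(1,3) \<xi>' F ar2 by (simp flip: LWhisk_LWhisk)
  finally show "src X \<rhd> lift (cmp K X k h) \<gamma> = src X \<rhd> \<nu>" unfolding l .
  show "Trg K (lift (cmp K X k h) \<gamma>) = cmp K X (Trg K \<mu>) (Trg K \<nu>)"
    unfolding l using c \<xi>(1) \<xi>' F by simp
qed

section \<open>The cotensor of X_0 and the two monads\<close>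

definition \<kappa> :: 't where "\<kappa> = cotensor_cell K (ob X)"
definition ds :: 'a where "ds = Src K \<kappa>"
definition ct :: 'a where "ct = Trg K \<kappa>"
definition arr :: "'t \<Rightarrow> 'a" where "arr \<alpha> = cotensor_arrow K \<kappa> \<alpha>"

lemma cotensor: "is_cotensor K (ob X) \<kappa>"
  unfolding \<kappa>_def cotensor_cell_def by (rule someI_ex) (simp add: cotensors)

lemma \<kappa> [simp]: "\<kappa> \<in> Cell K" "Src K \<kappa> = ds" "Trg K \<kappa> = ct" "ds \<in> Ar K" "ct \<in> Ar K" "Cod K ds = ob X" "Cod K ct = ob X"
  "Dom K ct = Dom K ds"
  using cotensor unfolding is_cotensor_def ds_def ct_def by (simp_all add: Let_def)

lemma arr_ex1:
  assumes "\<alpha> \<in> Cell K" "Cod K (Src K \<alpha>) = ob X"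
  shows "\<exists>!h. h \<in> hom K (Dom K (Src K \<alpha>)) (Dom K ds) \<and> \<kappa> \<lhd> h = \<alpha>"
proof -
  have "\<forall>\<alpha>\<in>Cell K. Cod K (Src K \<alpha>) = ob X \<longrightarrow>
      (\<exists>!h. h \<in> hom K (Dom K (Src K \<alpha>)) (Dom K (Src K \<kappa>)) \<and> \<kappa> \<lhd> h = \<alpha>)"
    using cotensor unfolding is_cotensor_def Let_def by (elim conjE)
  then show ?thesis using assms unfolding ds_def by blast
qed

lemma arr [simp]:
  assumes "\<alpha> \<in> Cell K" "Cod K (Src K \<alpha>) = ob X"
  shows "arr \<alpha> \<in> Ar K" "Dom K (arr \<alpha>) = Dom K (Src K \<alpha>)" "Cod K (arr \<alpha>) = Dom K ds" "\<kappa> \<lhd> arr \<alpha> = \<alpha>"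
  using theI'[OF arr_ex1[OF assms]] by (simp_all add: arr_def cotensor_arrow_def)

lemma cotensor_eqI:
  assumes "h \<in> Ar K" "k \<in> Ar K" "Cod K h = Dom K ds" "Cod K k = Dom K ds" "\<kappa> \<lhd> h = \<kappa> \<lhd> k" "Dom K h = Dom K k"
  shows "h = k"
proof -
  have "\<exists>!z. z \<in> hom K (Dom K (Src K (\<kappa> \<lhd> k))) (Dom K ds) \<and> \<kappa> \<lhd> z = \<kappa> \<lhd> k"
    by (rule arr_ex1) (use assms in simp_all)
  then obtain z where "\<forall>y. y \<in> hom K (Dom K (Src K (\<kappa> \<lhd> k))) (Dom K ds) \<and> \<kappa> \<lhd> y = \<kappa> \<lhd> k \<longrightarrow> y = z"
    by (elim ex1E)
  then have z: "y = z" if "y \<in> hom K (Dom K k) (Dom K ds) \<and> \<kappa> \<lhd> y = \<kappa> \<lhd> k" for y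
    using that assms by simp
  have "h = z" "k = z" by (rule z; use assms in simp)+
  then show ?thesis by simp
qed

lemma ds_arr [simp]:
  assumes "\<alpha> \<in> Cell K" "Cod K (Src K \<alpha>) = ob X"
  shows "ds \<cdot> arr \<alpha> = Src K \<alpha>" "ct \<cdot> arr \<alpha> = Trg K \<alpha>"
proof -
  have "ds \<cdot> arr \<alpha> = Src K (\<kappa> \<lhd> arr \<alpha>)" "ct \<cdot> arr \<alpha> = Trg K (\<kappa> \<lhd> arr \<alpha>)"
    using assms by (simp_all del: arr(4))
  then show "ds \<cdot> arr \<alpha> = Src K \<alpha>" "ct \<cdot> arr \<alpha> = Trg K \<alpha>" using assms by simp_all
qed

lemma cotensor_cells:
  assumes "h \<in> Ar K" "k \<in> Ar K" "Cod K h = Dom K ds" "Cod K k = Dom K ds" "Dom K h = Dom K k"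
    "\<sigma> \<in> Cell K" "Src K \<sigma> = ds \<cdot> h" "Trg K \<sigma> = ds \<cdot> k" "\<tau> \<in> Cell K" "Src K \<tau> = ct \<cdot> h" "Trg K \<tau> = ct \<cdot> k"
    "(\<kappa> \<lhd> k) \<bullet> \<sigma> = \<tau> \<bullet> (\<kappa> \<lhd> h)"
  obtains \<xi> where "\<xi> \<in> Cell K" "Src K \<xi> = h" "Trg K \<xi> = k" "ds \<rhd> \<xi> = \<sigma>" "ct \<rhd> \<xi> = \<tau>"
proof -
  have "\<forall>Z. \<forall>h\<in>hom K Z (Dom K ds). \<forall>k\<in>hom K Z (Dom K ds).
         \<forall>\<sigma>\<in>cells K (ds \<cdot> h) (ds \<cdot> k). \<forall>\<tau>\<in>cells K (ct \<cdot> h) (ct \<cdot> k).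
         (\<kappa> \<lhd> k) \<bullet> \<sigma> = \<tau> \<bullet> (\<kappa> \<lhd> h) \<longrightarrow>
         (\<exists>!\<xi>. \<xi> \<in> cells K h k \<and> ds \<rhd> \<xi> = \<sigma> \<and> ct \<rhd> \<xi> = \<tau>)"
    using cotensor unfolding is_cotensor_def Let_def \<kappa>(2,3) by (elim conjE)
  then have "\<exists>!\<xi>. \<xi> \<in> cells K h k \<and> ds \<rhd> \<xi> = \<sigma> \<and> ct \<rhd> \<xi> = \<tau>"
    using assms by (simp add: cells_def)
  then show ?thesis using that by (auto simp: cells_def)
qed

definition T :: "'a span_monad" where "T = monad_of_category_object K X"
definition S :: "'a span_monad" where "S = cotensor_monad K (sob X 0)"

lemma T_simps [simp]: "lleg T = src X" "rleg T = trg X" "munit T = idn X"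
  by (simp_all add: T_def monad_of_category_object_def src_def trg_def idn_def split: prod.split)

lemma S_simps [simp]: "lleg S = ds" "rleg S = ct" "munit S = arr (Ident2 K (Ident K (ob X)))"
  by (simp_all add: S_def cotensor_monad_def Let_def ds_def ct_def \<kappa>_def arr_def ob_def split: prod.split)

lemma pb_pair:
  "f \<in> Ar K \<Longrightarrow> g \<in> Ar K \<Longrightarrow> Cod K f = Cod K g \<Longrightarrow> pb K f g = (p, q) \<Longrightarrow> is_pullback K f g p q"
  using pb_is_pullback[OF pullbacks, of f g] by simp

text \<open>The multiplication is defined at the generic composable pair; composing with a pairing
  evaluates it at f and g. The next lemma does the same for the cotensor monad.\<close>

lemma mmult_T:
  assumes "f \<in> Ar K" "g \<in> Ar K" "Cod K f = ar X" "Cod K g = ar X" "Dom K f = Dom K g" "trg X \<cdot> f = src X \<cdot> g"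
  shows "mmult T \<cdot> pairing K (span_proj K T T) f g = cmp K X g f"
proof -
  obtain p q where pq: "pb K (trg X) (src X) = (p, q)" by (cases "pb K (trg X) (src X)")
  note P = pb_pair[OF _ _ _ pq, simplified]
  note A = pullback_Ar[OF P] and B = pairing[OF P, of f g]
  have "mmult T = cmp K X q p"
    using pq by (simp add: T_def monad_of_category_object_def cmp_def flip: src_def trg_def)
  then show ?thesis
    using A B assms pq by (simp add: span_proj_def)
qed

lemma mmult_S:
  assumes "f \<in> Ar K" "g \<in> Ar K" "Cod K f = Dom K ds" "Cod K g = Dom K ds" "Dom K f = Dom K g" "ct \<cdot> f = ds \<cdot> g"
  shows "mmult S \<cdot> pairing K (span_proj K S S) f g = arr ((\<kappa> \<lhd> g) \<bullet> (\<kappa> \<lhd> f))"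
proof -
  obtain p q where pq: "pb K ct ds = (p, q)" by (cases "pb K ct ds")
  note P = pb_pair[OF _ _ _ pq, simplified]
  note A = pullback_Ar[OF P] and B = pairing[OF P, of f g]
  have m: "mmult S = arr ((\<kappa> \<lhd> q) \<bullet> (\<kappa> \<lhd> p))"
    using pq by (simp add: S_def cotensor_monad_def Let_def arr_def flip: ob_def \<kappa>_def ds_def ct_def)
  show ?thesis
    unfolding m
    apply (rule cotensor_eqI)
    using A B assms pq RWhisk_RWhisk[of \<kappa> "arr ((\<kappa> \<lhd> q) \<bullet> (\<kappa> \<lhd> p))" "pairing K (p, q) f g", symmetric]
    by (simp_all add: span_proj_def RWhisk_VComp RWhisk_RWhisk)
qed

section \<open>The composite monad N\<close>

definition na :: 'a where "na = fst (span_proj K T S)"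
definition nb :: 'a where "nb = snd (span_proj K T S)"
definition nl :: 'a where "nl = ds \<cdot> na"
definition nr :: 'a where "nr = trg X \<cdot> nb"
definition N :: "'a span_monad" where "N = composite_monad K T S (corner_law K X D)"

lemma N_pullback: "is_pullback K ct (src X) na nb"
  unfolding na_def nb_def span_proj_def by (simp add: pb_is_pullback[OF pullbacks])

lemma nab [simp]: "na \<in> Ar K" "nb \<in> Ar K" "Dom K nb = Dom K na" "Cod K na = Dom K ds" "Cod K nb = ar X"
  using pullback_Ar[OF N_pullback] by simp_all

lemma ct_na [simp]: "x \<in> Ar K \<Longrightarrow> Cod K x = Dom K na \<Longrightarrow> ct \<cdot> (na \<cdot> x) = src X \<cdot> (nb \<cdot> x)"
  by (rule pullback_square[OF N_pullback])

lemma nlr [simp]: "nl \<in> Ar K" "nr \<in> Ar K" "Dom K nl = Dom K na" "Dom K nr = Dom K na" "Cod K nl = ob X" "Cod K nr = ob X"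
  by (simp_all add: nl_def nr_def)

text \<open>An arrow \<open>e\<close> into the apex of \<open>N\<close> is a pair of a 2-cell \<open>vrt e\<close> into \<open>X_0\<close> and an arrow \<open>hor e\<close> into
  \<open>X_1\<close>.\<close>

definition vrt :: "'a \<Rightarrow> 't" where "vrt e = \<kappa> \<lhd> (na \<cdot> e)"
definition hor :: "'a \<Rightarrow> 'a" where "hor e = nb \<cdot> e"

lemma vrt_hor [simp]:
  assumes "e \<in> Ar K" "Cod K e = Dom K na"
  shows "vrt e \<in> Cell K" "Src K (vrt e) = nl \<cdot> e" "Trg K (vrt e) = src X \<cdot> hor e"
    "hor e \<in> Ar K" "Dom K (hor e) = Dom K e" "Cod K (hor e) = ar X" "trg X \<cdot> hor e = nr \<cdot> e"
  using assms by (simp_all add: vrt_def hor_def nl_def nr_def)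

lemma N_eqI:
  assumes "e \<in> Ar K" "e' \<in> Ar K" "Dom K e = Dom K e'" "Cod K e = Dom K na" "Cod K e' = Dom K na" "vrt e = vrt e'" "hor e = hor e'"
  shows "e = e'"
proof (rule pullback_eqI[OF N_pullback assms(1-5)])
  show "na \<cdot> e = na \<cdot> e'" by (rule cotensor_eqI) (use assms in \<open>simp_all add: vrt_def\<close>)
qed (use assms in \<open>simp add: hor_def\<close>)

definition mkN :: "'t \<Rightarrow> 'a \<Rightarrow> 'a" where "mkN \<alpha> h = pairing K (na, nb) (arr \<alpha>) h"

lemma mkN [simp]:
  assumes "\<alpha> \<in> Cell K" "Cod K (Src K \<alpha>) = ob X" "h \<in> Ar K" "Cod K h = ar X" "Dom K h = Dom K (Src K \<alpha>)" "Trg K \<alpha> = src X \<cdot> h"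
  shows "mkN \<alpha> h \<in> Ar K" "Dom K (mkN \<alpha> h) = Dom K h" "Cod K (mkN \<alpha> h) = Dom K na" "vrt (mkN \<alpha> h) = \<alpha>" "hor (mkN \<alpha> h) = h"
    "na \<cdot> mkN \<alpha> h = arr \<alpha>" "nb \<cdot> mkN \<alpha> h = h"
  using pairing[OF N_pullback, of "arr \<alpha>" h] assms by (simp_all add: mkN_def vrt_def hor_def)

text \<open>Evaluates the distributive law at an element (h, c). At the generic pair it is
  classified by the lift \<open>?l3\<close>, and stability of lifts under precomposition moves this
  to h and c.\<close>

lemma corner_law:
  assumes "h \<in> Ar K" "c \<in> Ar K" "Dom K h = Dom K c" "Cod K h = ar X" "Cod K c = Dom K ds" "trg X \<cdot> h = ds \<cdot> c"
  shows "corner_law K X D \<cdot> pairing K (span_proj K S T) h c =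
    mkN (src X \<rhd> lift h (\<kappa> \<lhd> c)) (Trg K (lift h (\<kappa> \<lhd> c)))"
proof -
  obtain p1 c1 where pc: "pb K (trg X) ds = (p1, c1)" by (cases "pb K (trg X) ds")
  note P = pb_pair[OF _ _ _ pc, simplified]
  note A = pullback_Ar[OF P] and B = pairing[OF P, of h c]
  have nn: "pb K ct (src X) = (na, nb)" by (simp add: na_def nb_def span_proj_def)
  let ?l3 = "lift p1 (\<kappa> \<lhd> c1)"
  have l3: "?l3 \<in> D" "Src K ?l3 = p1" "?l3 \<in> Cell K" using A by simp_all
  have "corner_law K X D = (THE \<delta>. \<delta> \<in> hom K (Dom K p1) (Dom K nb) \<and>
           (ds \<cdot> na) \<cdot> \<delta> = src X \<cdot> p1 \<and> nb \<cdot> \<delta> = Trg K ?l3 \<and> (\<kappa> \<lhd> na) \<lhd> \<delta> = src X \<rhd> ?l3)"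
    unfolding corner_law_def lift_def Let_def
    by (simp add: span_proj_def pc nn flip: T_def S_def[folded ob_def] ob_def \<kappa>_def src_def trg_def)
  also have "\<dots> = mkN (src X \<rhd> ?l3) (Trg K ?l3)"
  proof (rule the_equality)
    show "mkN (src X \<rhd> ?l3) (Trg K ?l3) \<in> hom K (Dom K p1) (Dom K nb) \<and>
       (ds \<cdot> na) \<cdot> mkN (src X \<rhd> ?l3) (Trg K ?l3) = src X \<cdot> p1 \<and> nb \<cdot> mkN (src X \<rhd> ?l3) (Trg K ?l3) = Trg K ?l3 \<and>
       (\<kappa> \<lhd> na) \<lhd> mkN (src X \<rhd> ?l3) (Trg K ?l3) = src X \<rhd> ?l3"
      using A l3 by (simp add: RWhisk_RWhisk)
    fix \<delta> assume "\<delta> \<in> hom K (Dom K p1) (Dom K nb) \<and>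
       (ds \<cdot> na) \<cdot> \<delta> = src X \<cdot> p1 \<and> nb \<cdot> \<delta> = Trg K ?l3 \<and> (\<kappa> \<lhd> na) \<lhd> \<delta> = src X \<rhd> ?l3"
    then have d: "\<delta> \<in> Ar K" "Dom K \<delta> = Dom K p1" "Cod K \<delta> = Dom K na" "nb \<cdot> \<delta> = Trg K ?l3" "(\<kappa> \<lhd> na) \<lhd> \<delta> = src X \<rhd> ?l3"
      by simp_all
    have "hor \<delta> = Trg K ?l3" "vrt \<delta> = src X \<rhd> ?l3"
      using d(4) d(5)[symmetric] d(1,3) by (simp_all add: hor_def vrt_def RWhisk_RWhisk)
    then show "\<delta> = mkN (src X \<rhd> ?l3) (Trg K ?l3)"
      using A l3 d by - (rule N_eqI, simp_all)
  qed
  finally have \<delta>: "corner_law K X D = mkN (src X \<rhd> ?l3) (Trg K ?l3)" .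
  let ?x = "pairing K (p1, c1) h c"
  have x: "?x \<in> Ar K" "Dom K ?x = Dom K c" "Cod K ?x = Dom K p1" "p1 \<cdot> ?x = h" "c1 \<cdot> ?x = c"
    using B assms by simp_all
  have lx: "lift h (\<kappa> \<lhd> c) = ?l3 \<lhd> ?x"
    using lift_RWhisk[of p1 "\<kappa> \<lhd> c1" ?x] A x by (simp add: RWhisk_RWhisk)
  let ?L = "lift h (\<kappa> \<lhd> c)"
  have L: "?L \<in> D" "Src K ?L = h" "src X \<cdot> Trg K ?L = Trg K (src X \<rhd> ?L)" using assms by simp_all
  have "mkN (src X \<rhd> ?l3) (Trg K ?l3) \<cdot> ?x = mkN (src X \<rhd> ?L) (Trg K ?L)"
  proof (rule N_eqI)
    let ?d = "mkN (src X \<rhd> ?l3) (Trg K ?l3)"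
    have d: "?d \<in> Ar K" "Dom K ?d = Dom K p1" "Cod K ?d = Dom K na" "vrt ?d = src X \<rhd> ?l3" "hor ?d = Trg K ?l3"
      using A l3 by simp_all
    have "vrt (?d \<cdot> ?x) = vrt ?d \<lhd> ?x" "hor (?d \<cdot> ?x) = hor ?d \<cdot> ?x"
      using d(1-3) x by (simp_all add: vrt_def hor_def RWhisk_RWhisk)
    moreover have "(src X \<rhd> ?l3) \<lhd> ?x = src X \<rhd> ?L" "Trg K ?l3 \<cdot> ?x = Trg K ?L"
      unfolding lx using l3 x A by (simp_all add: LWhisk_RWhisk)
    moreover have "vrt (mkN (src X \<rhd> ?L) (Trg K ?L)) = src X \<rhd> ?L" "hor (mkN (src X \<rhd> ?L) (Trg K ?L)) = Trg K ?L"
      using L assms by simp_all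
    ultimately show "vrt (?d \<cdot> ?x) = vrt (mkN (src X \<rhd> ?L) (Trg K ?L))"
      "hor (?d \<cdot> ?x) = hor (mkN (src X \<rhd> ?L) (Trg K ?L))"
      using d(4,5) by simp_all
  qed (use l3 x A L assms in simp_all)
  then show ?thesis unfolding \<delta> using pc by (simp add: span_proj_def)
qed

lemma N_legs [simp]: "lleg N = nl" "rleg N = nr"
  by (simp_all add: N_def composite_monad_def Let_def span_comp_def nl_def nr_def na_def nb_def split: prod.split)

definition mN :: "'a \<Rightarrow> 'a \<Rightarrow> 'a" where "mN g f = mmult N \<cdot> pairing K (span_proj K N N) f g"

text \<open>The multiplication is unfolded at the generic pair (u, v), where \<open>?w\<close> is
  the distributive law applied to the two middle factors; precomposition with \<open>?z\<close> then
  gives the formula at f and g.\<close>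

lemma mN [simp]:
  assumes "f \<in> Ar K" "g \<in> Ar K" "Cod K f = Dom K na" "Cod K g = Dom K na" "Dom K f = Dom K g" "nr \<cdot> f = nl \<cdot> g"
  shows "mN g f \<in> Ar K" "Dom K (mN g f) = Dom K g" "Cod K (mN g f) = Dom K na"
    "vrt (mN g f) = (src X \<rhd> lift (hor f) (vrt g)) \<bullet> vrt f"
    "hor (mN g f) = cmp K X (hor g) (Trg K (lift (hor f) (vrt g)))"
proof -
  obtain u v where uv: "pb K nr nl = (u, v)" by (cases "pb K nr nl")
  note P = pb_pair[OF _ _ _ uv, simplified]
  note A = pullback_Ar[OF P] and B = pairing[OF P, of f g]
  have sp: "span_proj K T S = (na, nb)" by (simp add: na_def nb_def)
  let ?w = "corner_law K X D \<cdot> pairing K (span_proj K S T) (nb \<cdot> u) (na \<cdot> v)"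
  have legs: "lleg (span_comp K T S) = nl" "rleg (span_comp K T S) = nr"
    by (simp_all add: span_comp_def sp nl_def nr_def)
  have uv2: "span_proj K (span_comp K T S) (span_comp K T S) = (u, v)"
    by (simp add: span_proj_def legs uv)
  have nv: "trg X \<cdot> (nb \<cdot> u) = ds \<cdot> (na \<cdot> v)" using A by (simp add: nr_def nl_def)
  have w: "?w = mkN (src X \<rhd> lift (hor u) (vrt v)) (Trg K (lift (hor u) (vrt v)))"
    using corner_law[of "nb \<cdot> u" "na \<cdot> v"] A nv by (simp add: vrt_def hor_def)
  let ?l = "lift (hor u) (vrt v)"
  have l: "?l \<in> D" "Src K ?l = hor u" using A by simp_all
  have W: "?w \<in> Ar K" "Dom K ?w = Dom K u" "Cod K ?w = Dom K na" "vrt ?w = src X \<rhd> ?l" "hor ?w = Trg K ?l"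
    unfolding w using l A by simp_all
  have "ds \<cdot> (na \<cdot> ?w) = Src K (vrt ?w)" using W(1-3) by (simp add: nl_def)
  then have ctu: "ct \<cdot> (na \<cdot> u) = ds \<cdot> (na \<cdot> ?w)" unfolding W(4) using l A by (simp add: hor_def)
  have tw: "trg X \<cdot> (nb \<cdot> ?w) = src X \<cdot> (nb \<cdot> v)"
  proof -
    have "trg X \<cdot> hor ?w = src X \<cdot> hor v" unfolding W(5) using A by simp
    then show ?thesis by (simp add: hor_def)
  qed
  let ?x = "mmult S \<cdot> pairing K (span_proj K S S) (na \<cdot> u) (na \<cdot> ?w)"
  let ?y = "mmult T \<cdot> pairing K (span_proj K T T) (nb \<cdot> ?w) (nb \<cdot> v)"
  have x: "?x = arr (vrt ?w \<bullet> vrt u)"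
    using mmult_S[of "na \<cdot> u" "na \<cdot> ?w"] ctu W A by (simp add: vrt_def)
  have y: "?y = cmp K X (hor v) (hor ?w)"
    using mmult_T[of "nb \<cdot> ?w" "nb \<cdot> v"] tw W A by (simp add: hor_def)
  have "mmult N = pairing K (na, nb) ?x ?y"
    unfolding N_def composite_monad_def Let_def by (simp add: sp uv2)
  also have "\<dots> = mkN (vrt ?w \<bullet> vrt u) (cmp K X (hor v) (hor ?w))"
    unfolding x y mkN_def ..
  finally have mm: "mmult N = mkN ((src X \<rhd> ?l) \<bullet> vrt u) (cmp K X (hor v) (Trg K ?l))"
    unfolding W(4,5) .
  let ?z = "pairing K (u, v) f g"
  have z: "?z \<in> Ar K" "Dom K ?z = Dom K g" "Cod K ?z = Dom K u" "u \<cdot> ?z = f" "v \<cdot> ?z = g"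
    using B assms by simp_all
  have mz: "mN g f = mmult N \<cdot> ?z" unfolding mN_def by (simp add: span_proj_def uv)
  have tl: "trg X \<cdot> Trg K ?l = src X \<cdot> hor v" using A by simp
  have ty: "mmult N \<in> Ar K" "Dom K (mmult N) = Dom K u" "Cod K (mmult N) = Dom K na"
    "vrt (mmult N) = (src X \<rhd> ?l) \<bullet> vrt u" "hor (mmult N) = cmp K X (hor v) (Trg K ?l)"
    unfolding mm using l tl A by simp_all
  show "mN g f \<in> Ar K" "Dom K (mN g f) = Dom K g" "Cod K (mN g f) = Dom K na"
    unfolding mz using ty z by simp_all
  have hv: "hor u \<cdot> ?z = hor f" "vrt v \<lhd> ?z = vrt g" "vrt u \<lhd> ?z = vrt f" "hor v \<cdot> ?z = hor g"
    using z A by (simp_all add: hor_def vrt_def RWhisk_RWhisk)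
  have lz: "?l \<lhd> ?z = lift (hor f) (vrt g)"
    using lift_RWhisk[of "hor u" "vrt v" ?z] z A hv by simp
  have "vrt (mmult N \<cdot> ?z) = vrt (mmult N) \<lhd> ?z" "hor (mmult N \<cdot> ?z) = hor (mmult N) \<cdot> ?z"
    using ty(1-3) z by (simp_all add: vrt_def hor_def RWhisk_RWhisk)
  then show "vrt (mN g f) = (src X \<rhd> lift (hor f) (vrt g)) \<bullet> vrt f"
    "hor (mN g f) = cmp K X (hor g) (Trg K (lift (hor f) (vrt g)))"
    unfolding mz ty(4,5) using z hv l A tl by (simp_all add: RWhisk_VComp flip: LWhisk_RWhisk lz)
qed

lemma mN_legs [simp]:
  assumes "f \<in> Ar K" "g \<in> Ar K" "Cod K f = Dom K na" "Cod K g = Dom K na" "Dom K f = Dom K g" "nr \<cdot> f = nl \<cdot> g"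
  shows "nl \<cdot> mN g f = nl \<cdot> f" "nr \<cdot> mN g f = nr \<cdot> g"
proof -
  note m = mN[OF assms]
  have "nl \<cdot> mN g f = Src K (vrt (mN g f))" using m(1-3) by simp
  then show "nl \<cdot> mN g f = nl \<cdot> f" unfolding m(4) using assms by simp
  have "nr \<cdot> mN g f = trg X \<cdot> hor (mN g f)" using m(1-3) by simp
  then show "nr \<cdot> mN g f = nr \<cdot> g" unfolding m(5) using assms by simp
qed

lemma vrt_hor_comp:
  assumes "e \<in> Ar K" "Cod K e = Dom K na" "x \<in> Ar K" "Cod K x = Dom K e"
  shows "vrt (e \<cdot> x) = vrt e \<lhd> x" "hor (e \<cdot> x) = hor e \<cdot> x"
  using assms by (simp_all add: vrt_def hor_def RWhisk_RWhisk)

lemma mN_comp: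
  assumes "f \<in> Ar K" "g \<in> Ar K" "Cod K f = Dom K na" "Cod K g = Dom K na" "Dom K f = Dom K g" "nr \<cdot> f = nl \<cdot> g"
    "x \<in> Ar K" "Cod K x = Dom K g"
  shows "mN g f \<cdot> x = mN (g \<cdot> x) (f \<cdot> x)"
proof (rule N_eqI)
  have e: "nr \<cdot> (f \<cdot> x) = nl \<cdot> (g \<cdot> x)" using comp2_eq_extend[OF assms(6), of x] assms by simp
  have ty: "f \<cdot> x \<in> Ar K" "g \<cdot> x \<in> Ar K" "Cod K (f \<cdot> x) = Dom K na" "Cod K (g \<cdot> x) = Dom K na"
    "Dom K (f \<cdot> x) = Dom K (g \<cdot> x)" using assms by simp_all
  note m = mN[OF assms(1-6)] and mx = mN[OF ty e]
  have l: "lift (hor f) (vrt g) \<lhd> x = lift (hor (f \<cdot> x)) (vrt (g \<cdot> x))"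
    using assms by (simp add: lift_RWhisk vrt_hor_comp)
  have L: "lift (hor f) (vrt g) \<in> D" "Src K (lift (hor f) (vrt g)) = hor f"
    "src X \<cdot> hor g = trg X \<cdot> Trg K (lift (hor f) (vrt g))" using assms by simp_all
  have "vrt (mN g f \<cdot> x) = (src X \<rhd> (lift (hor f) (vrt g) \<lhd> x)) \<bullet> (vrt f \<lhd> x)"
    using m assms L by (simp add: vrt_hor_comp RWhisk_VComp LWhisk_RWhisk)
  moreover have "hor (mN g f \<cdot> x) = cmp K X (hor g \<cdot> x) (Trg K (lift (hor f) (vrt g) \<lhd> x))"
    using m assms L by (simp add: vrt_hor_comp)
  moreover have "vrt (mN (g \<cdot> x) (f \<cdot> x)) = (src X \<rhd> lift (hor (f \<cdot> x)) (vrt (g \<cdot> x))) \<bullet> vrt (f \<cdot> x)"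
    "hor (mN (g \<cdot> x) (f \<cdot> x)) = cmp K X (hor (g \<cdot> x)) (Trg K (lift (hor (f \<cdot> x)) (vrt (g \<cdot> x))))"
    by (fact mx)+
  moreover have "vrt (f \<cdot> x) = vrt f \<lhd> x" "hor (g \<cdot> x) = hor g \<cdot> x"
    using assms by (simp_all add: vrt_hor_comp)
  ultimately show "vrt (mN g f \<cdot> x) = vrt (mN (g \<cdot> x) (f \<cdot> x))" "hor (mN g f \<cdot> x) = hor (mN (g \<cdot> x) (f \<cdot> x))"
    unfolding l by presburger+
  show "mN g f \<cdot> x \<in> Ar K" "mN (g \<cdot> x) (f \<cdot> x) \<in> Ar K" "Dom K (mN g f \<cdot> x) = Dom K (mN (g \<cdot> x) (f \<cdot> x))"
    "Cod K (mN g f \<cdot> x) = Dom K na" "Cod K (mN (g \<cdot> x) (f \<cdot> x)) = Dom K na"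
    using m(1-3) mx(1-3) assms by simp_all
qed

text \<open>Both bracketings are governed by three lifts: \<zeta> of the second vertical cell at the
  first horizontal arrow, \<mu> of the third at the second, and \<nu> of the source of \<mu> at the
  target of \<zeta>. \<open>lift_VComp\<close> treats one bracketing and \<open>lift_cmp\<close> the
  other; what remains is associativity of vertical composition and of X.\<close>

lemma mN_assoc:
  assumes f: "f \<in> Ar K" "Cod K f = Dom K na" and g: "g \<in> Ar K" "Cod K g = Dom K na" "Dom K f = Dom K g" "nr \<cdot> f = nl \<cdot> g"
    and h: "h \<in> Ar K" "Cod K h = Dom K na" "Dom K h = Dom K g" "nr \<cdot> g = nl \<cdot> h"
  shows "mN (mN h g) f = mN h (mN g f)"
proof -
  have hg: "Dom K g = Dom K h" using h by simp
  note mgf = mN[OF f(1) g(1) f(2) g(2-4)] mN_legs[OF f(1) g(1) f(2) g(2-4)]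
    and mhg = mN[OF g(1) h(1) g(2) h(2) hg h(4)] mN_legs[OF g(1) h(1) g(2) h(2) hg h(4)]
  define \<zeta> where "\<zeta> = lift (hor f) (vrt g)"
  define \<mu> where "\<mu> = lift (hor g) (vrt h)"
  define \<nu> where "\<nu> = lift (Trg K \<zeta>) (src X \<rhd> \<mu>)"
  have \<zeta>: "\<zeta> \<in> D" "Src K \<zeta> = hor f" "trg X \<rhd> \<zeta> = vrt g" "trg X \<cdot> Trg K \<zeta> = src X \<cdot> hor g"
    unfolding \<zeta>_def using f g by simp_all
  have \<mu>: "\<mu> \<in> D" "Src K \<mu> = hor g" "trg X \<rhd> \<mu> = vrt h" "trg X \<cdot> Trg K \<mu> = src X \<cdot> hor h"
    unfolding \<mu>_def using g h by simp_all
  have \<nu>: "\<nu> \<in> D" "Src K \<nu> = Trg K \<zeta>" "trg X \<rhd> \<nu> = src X \<rhd> \<mu>" "trg X \<cdot> Trg K \<nu> = src X \<cdot> Trg K \<mu>"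
    unfolding \<nu>_def using \<zeta> \<mu> f g h by simp_all
  have l1: "lift (hor f) (vrt (mN h g)) = \<nu> \<bullet> \<zeta>"
    unfolding mhg(4) using lift_VComp[of "hor f" "vrt g" "src X \<rhd> \<mu>"] f g h \<mu> by (simp add: \<nu>_def flip: \<zeta>_def \<mu>_def)
  have l2: "src X \<rhd> lift (hor (mN g f)) (vrt h) = src X \<rhd> \<nu>" "Trg K (lift (hor (mN g f)) (vrt h)) = cmp K X (Trg K \<mu>) (Trg K \<nu>)"
    unfolding mgf(5) using lift_cmp[of "Trg K \<zeta>" "hor g" "vrt h"] f g h \<zeta> by (simp_all add: \<nu>_def flip: \<zeta>_def \<mu>_def)
  have ls: "nr \<cdot> f = nl \<cdot> mN h g" "nr \<cdot> mN g f = nl \<cdot> h" "Dom K (mN g f) = Dom K h" "Dom K f = Dom K (mN h g)"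
    using mgf(1-3,6,7) mhg(1-3,6,7) f g h by simp_all
  note a = mN[OF f(1) mhg(1) f(2) mhg(3) ls(4) ls(1)] and b = mN[OF mgf(1) h(1) mgf(3) h(2) ls(3) ls(2)]
  have d: "Dom K f = Dom K h" using g h by simp
  show ?thesis
  proof (rule N_eqI[OF a(1) b(1) _ a(3) b(3)])
    show "Dom K (mN (mN h g) f) = Dom K (mN h (mN g f))" using a(2) b(2) mhg(2) by simp
    have "vrt (mN (mN h g) f) = ((src X \<rhd> \<nu>) \<bullet> (src X \<rhd> \<zeta>)) \<bullet> vrt f"
      unfolding a(4) l1 using \<nu> \<zeta> f by (simp add: LWhisk_VComp)
    also have "\<dots> = (src X \<rhd> \<nu>) \<bullet> ((src X \<rhd> \<zeta>) \<bullet> vrt f)"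
      by (rule VComp_assoc) (use \<nu> \<zeta> f in simp_all)
    finally show "vrt (mN (mN h g) f) = vrt (mN h (mN g f))"
      unfolding b(4) l2 mgf(4) \<zeta>_def .
    have "hor (mN (mN h g) f) = cmp K X (cmp K X (hor h) (Trg K \<mu>)) (Trg K \<nu>)"
      unfolding a(5) l1 mhg(5) using \<nu> \<zeta> by (simp flip: \<mu>_def)
    also have "\<dots> = cmp K X (hor h) (cmp K X (Trg K \<mu>) (Trg K \<nu>))"
      by (rule cmp_assoc) (use \<mu> \<nu> \<zeta> f g h d in simp_all)
    finally show "hor (mN (mN h g) f) = hor (mN h (mN g f))"
      unfolding b(5) l2 .
  qed
qed

lemma munit_N: "munit N = mkN (Ident2 K (Ident K (ob X))) (idn X)"
proof -
  have sp: "span_proj K T S = (na, nb)" by (simp add: na_def nb_def)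
  show ?thesis by (simp add: N_def composite_monad_def Let_def sp mkN_def split: prod.split)
qed

lemma munit_N_simps [simp]:
  "munit N \<in> Ar K" "Dom K (munit N) = ob X" "Cod K (munit N) = Dom K na"
  "x \<in> Ar K \<Longrightarrow> Cod K x = ob X \<Longrightarrow> vrt (munit N \<cdot> x) = Ident2 K x"
  "x \<in> Ar K \<Longrightarrow> Cod K x = ob X \<Longrightarrow> hor (munit N \<cdot> x) = idn X \<cdot> x"
  "x \<in> Ar K \<Longrightarrow> Cod K x = ob X \<Longrightarrow> nl \<cdot> (munit N \<cdot> x) = x"
  "x \<in> Ar K \<Longrightarrow> Cod K x = ob X \<Longrightarrow> nr \<cdot> (munit N \<cdot> x) = x"
proof -
  show a: "munit N \<in> Ar K" "Dom K (munit N) = ob X" "Cod K (munit N) = Dom K na"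
    unfolding munit_N by simp_all
  assume x: "x \<in> Ar K" "Cod K x = ob X"
  have "vrt (munit N) = Ident2 K (Ident K (ob X))" "hor (munit N) = idn X"
    unfolding munit_N by simp_all
  then show v: "vrt (munit N \<cdot> x) = Ident2 K x" and h: "hor (munit N \<cdot> x) = idn X \<cdot> x"
    using x a vrt_hor_comp[of "munit N" x] by (simp_all add: Ident2_RWhisk)
  have "nl \<cdot> (munit N \<cdot> x) = Src K (vrt (munit N \<cdot> x))" using a x by simp
  then show "nl \<cdot> (munit N \<cdot> x) = x" unfolding v using x by simp
  have "nr \<cdot> (munit N \<cdot> x) = trg X \<cdot> hor (munit N \<cdot> x)" using a x by simp
  then show "nr \<cdot> (munit N \<cdot> x) = x" unfolding h using x by simp
qed

text \<open>The lift at a unit arrow is degenerate and the lift of an identity is an identity, so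
  both laws reduce to the unit laws of X and of vertical composition.\<close>

lemma mN_unit:
  assumes "f \<in> Ar K" "Cod K f = Dom K na"
  shows "mN f (munit N \<cdot> (nl \<cdot> f)) = f" "mN (munit N \<cdot> (nr \<cdot> f)) f = f"
proof -
  have e: "nr \<cdot> (munit N \<cdot> (nl \<cdot> f)) = nl \<cdot> f" "nr \<cdot> f = nl \<cdot> (munit N \<cdot> (nr \<cdot> f))" using assms by simp_all
  note a = mN[OF _ _ _ _ _ e(1)] and b = mN[OF _ _ _ _ _ e(2)]
  have l: "lift (idn X \<cdot> (nl \<cdot> f)) (vrt f) = idn X \<rhd> vrt f" "lift (hor f) (Ident2 K (nr \<cdot> f)) = Ident2 K (hor f)"
    using lift_idn[of "vrt f"] lift_Ident2[of "hor f"] assms by simp_all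
  show "mN f (munit N \<cdot> (nl \<cdot> f)) = f"
    by (rule N_eqI) (use a assms l in \<open>simp_all add: LWhisk_LWhisk LWhisk_Ident\<close>)
  show "mN (munit N \<cdot> (nr \<cdot> f)) f = f"
    by (rule N_eqI) (use b assms l in \<open>simp_all add: LWhisk_Ident2\<close>)
qed

section \<open>Restriction of N along i\<close>

definition mi :: 'a where "mi = fst (pb K i nl)"
definition mn :: 'a where "mn = snd (pb K i nl)"
definition rm :: 'a where "rm = fst (pb K (nr \<cdot> mn) i)"
definition rr :: 'a where "rr = snd (pb K (nr \<cdot> mn) i)"
definition rl :: 'a where "rl = mi \<cdot> rm"
definition rn :: 'a where "rn = mn \<cdot> rm"
definition R :: "'a span_monad" where "R = restricted_monad K i N"

lemma M_pullback: "is_pullback K i nl mi mn"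
  unfolding mi_def mn_def by (rule pb_is_pullback[OF pullbacks]) simp_all

lemma M_simps [simp]: "mi \<in> Ar K" "mn \<in> Ar K" "Dom K mn = Dom K mi" "Cod K mi = Dom K i" "Cod K mn = Dom K na"
  using pullback_Ar[OF M_pullback] by simp_all

lemma R_pullback: "is_pullback K (nr \<cdot> mn) i rm rr"
  unfolding rm_def rr_def by (rule pb_is_pullback[OF pullbacks]) simp_all

lemma R_simps [simp]: "rm \<in> Ar K" "rr \<in> Ar K" "Dom K rr = Dom K rm" "Cod K rm = Dom K mi" "Cod K rr = Dom K i"
  using pullback_Ar[OF R_pullback] by simp_all

lemma rl_simps [simp]: "rl \<in> Ar K" "Dom K rl = Dom K rm" "Cod K rl = Dom K i"
  "rn \<in> Ar K" "Dom K rn = Dom K rm" "Cod K rn = Dom K na"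
  by (simp_all add: rl_def rn_def)

lemma i_legs:
  assumes "e \<in> Ar K" "Cod K e = Dom K rm"
  shows "i \<cdot> (rl \<cdot> e) = nl \<cdot> (rn \<cdot> e)" "i \<cdot> (rr \<cdot> e) = nr \<cdot> (rn \<cdot> e)"
  using pullback_square[OF M_pullback, of "rm \<cdot> e"] pullback_square[OF R_pullback, of e] assms
  by (simp_all add: rl_def rn_def)

text \<open>The apex arises from N by two pullbacks along i: an element is an element of N with its
  two ends lifted through i.\<close>

lemma R_eqI:
  assumes "e \<in> Ar K" "e' \<in> Ar K" "Dom K e = Dom K e'" "Cod K e = Dom K rm" "Cod K e' = Dom K rm"
    "rl \<cdot> e = rl \<cdot> e'" "rr \<cdot> e = rr \<cdot> e'" "rn \<cdot> e = rn \<cdot> e'"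
  shows "e = e'"
proof (rule pullback_eqI[OF R_pullback assms(1-5)])
  show "rm \<cdot> e = rm \<cdot> e'"
    by (rule pullback_eqI[OF M_pullback]) (use assms in \<open>simp_all add: rl_def rn_def\<close>)
qed (fact assms(7))

lemma R_ex:
  assumes "x \<in> Ar K" "y \<in> Ar K" "z \<in> Ar K" "Dom K x = Dom K y" "Dom K z = Dom K y" "Cod K x = Dom K i" "Cod K z = Dom K i"
    "Cod K y = Dom K na" "i \<cdot> x = nl \<cdot> y" "i \<cdot> z = nr \<cdot> y"
  obtains e where "e \<in> Ar K" "Dom K e = Dom K y" "Cod K e = Dom K rm" "rl \<cdot> e = x" "rr \<cdot> e = z" "rn \<cdot> e = y"
proof -
  note A = pairing[OF M_pullback, of x y]
  have e: "(nr \<cdot> mn) \<cdot> pairing K (mi, mn) x y = i \<cdot> z" using A assms by simp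
  show ?thesis
    by (rule that[of "pairing K (rm, rr) (pairing K (mi, mn) x y) z"])
      (use A assms pairing[OF R_pullback _ _ _ _ _ e] in
        \<open>simp_all add: rl_def rn_def\<close>)
qed

lemma R_span: "span_comp K N (upper_span K i) = \<lparr>lleg = mi, rleg = nr \<cdot> mn\<rparr>"
  "span_comp K (lower_span K i) (span_comp K N (upper_span K i)) = \<lparr>lleg = rl, rleg = rr\<rparr>"
proof -
  show M: "span_comp K N (upper_span K i) = \<lparr>lleg = mi, rleg = nr \<cdot> mn\<rparr>"
    using M_simps by (simp add: span_comp_def span_proj_def upper_span_def flip: mi_def mn_def)
  show "span_comp K (lower_span K i) (span_comp K N (upper_span K i)) = \<lparr>lleg = rl, rleg = rr\<rparr>"
    unfolding M using R_simps by (simp add: span_comp_def span_proj_def lower_span_def rl_def flip: rm_def rr_def)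
qed

lemma R_fields:
  assumes "pb K rr rl = (u, v)"
  shows "lleg R = rl" "rleg R = rr"
    "munit R = (THE e. e \<in> hom K (Dom K i) (Dom K rm) \<and> rl \<cdot> e = Ident K (Dom K i) \<and> rr \<cdot> e = Ident K (Dom K i) \<and> rn \<cdot> e = munit N \<cdot> i)"
    "mmult R = (THE m. m \<in> hom K (Dom K u) (Dom K rm) \<and> rl \<cdot> m = rl \<cdot> u \<and> rr \<cdot> m = rr \<cdot> v \<and> rn \<cdot> m = mN (rn \<cdot> v) (rn \<cdot> u))"
proof -
  have n: "snd (span_proj K N (upper_span K i)) \<cdot> fst (span_proj K (lower_span K i) (span_comp K N (upper_span K i))) = rn"
    unfolding R_span by (simp add: span_proj_def upper_span_def lower_span_def rn_def flip: mn_def rm_def)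
  show "lleg R = rl" "rleg R = rr"
    "munit R = (THE e. e \<in> hom K (Dom K i) (Dom K rm) \<and> rl \<cdot> e = Ident K (Dom K i) \<and> rr \<cdot> e = Ident K (Dom K i) \<and> rn \<cdot> e = munit N \<cdot> i)"
    "mmult R = (THE m. m \<in> hom K (Dom K u) (Dom K rm) \<and> rl \<cdot> m = rl \<cdot> u \<and> rr \<cdot> m = rr \<cdot> v \<and> rn \<cdot> m = mN (rn \<cdot> v) (rn \<cdot> u))"
    unfolding R_def restricted_monad_def Let_def n unfolding R_span(2)
    using assms by (simp_all add: span_proj_def[of K "\<lparr>lleg = rl, rleg = rr\<rparr>"] mN_def)
qed

definition mR :: "'a \<Rightarrow> 'a \<Rightarrow> 'a" where "mR g f = mmult R \<cdot> pairing K (span_proj K R R) f g"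

text \<open>The definite description of the multiplication in \<open>restricted_monad\<close> is
  met: composition in N keeps the outer ends, so the composite lifts uniquely to the restricted
  apex.\<close>

lemma mmult_R:
  assumes uv: "pb K rr rl = (u, v)"
  shows "is_pullback K rr rl u v" "nr \<cdot> (rn \<cdot> u) = nl \<cdot> (rn \<cdot> v)"
    "mmult R \<in> Ar K" "Dom K (mmult R) = Dom K u" "Cod K (mmult R) = Dom K rm"
    "rl \<cdot> mmult R = rl \<cdot> u" "rr \<cdot> mmult R = rr \<cdot> v" "rn \<cdot> mmult R = mN (rn \<cdot> v) (rn \<cdot> u)"
proof -
  show P: "is_pullback K rr rl u v" by (rule pb_pair[OF _ _ _ uv]) simp_all
  note A = pullback_Ar[OF P]
  note F = R_fields[OF uv]
  show c: "nr \<cdot> (rn \<cdot> u) = nl \<cdot> (rn \<cdot> v)" using i_legs[of u] i_legs[of v] A by simp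
  have ty: "rn \<cdot> u \<in> Ar K" "rn \<cdot> v \<in> Ar K" "Cod K (rn \<cdot> u) = Dom K na" "Cod K (rn \<cdot> v) = Dom K na"
    "Dom K (rn \<cdot> u) = Dom K (rn \<cdot> v)" using A by simp_all
  note m = mN[OF ty c] mN_legs[OF ty c]
  have il: "i \<cdot> (rl \<cdot> u) = nl \<cdot> mN (rn \<cdot> v) (rn \<cdot> u)" "i \<cdot> (rr \<cdot> v) = nr \<cdot> mN (rn \<cdot> v) (rn \<cdot> u)"
    unfolding m(6,7) using i_legs(1)[of u] i_legs(2)[of v] A by simp_all
  have ty2: "rl \<cdot> u \<in> Ar K" "rr \<cdot> v \<in> Ar K" "Dom K (rl \<cdot> u) = Dom K (mN (rn \<cdot> v) (rn \<cdot> u))"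
    "Dom K (rr \<cdot> v) = Dom K (mN (rn \<cdot> v) (rn \<cdot> u))" "Cod K (rl \<cdot> u) = Dom K i" "Cod K (rr \<cdot> v) = Dom K i"
    "Dom K (mN (rn \<cdot> v) (rn \<cdot> u)) = Dom K u"
    using A(1-8) m(2) by simp_all
  obtain e where e: "e \<in> Ar K" "Dom K e = Dom K u" "Cod K e = Dom K rm" "rl \<cdot> e = rl \<cdot> u" "rr \<cdot> e = rr \<cdot> v"
    "rn \<cdot> e = mN (rn \<cdot> v) (rn \<cdot> u)"
    by (rule R_ex[OF ty2(1) m(1) ty2(2-6) m(3) il]) (simp add: ty2(7))
  have "mmult R = e"
    unfolding F
  proof (rule the_equality)
    fix e' assume "e' \<in> hom K (Dom K u) (Dom K rm) \<and> rl \<cdot> e' = rl \<cdot> u \<and> rr \<cdot> e' = rr \<cdot> v \<and> rn \<cdot> e' = mN (rn \<cdot> v) (rn \<cdot> u)"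
    then show "e' = e" using e by - (rule R_eqI, simp_all)
  qed (use e in simp)
  then show "mmult R \<in> Ar K" "Dom K (mmult R) = Dom K u" "Cod K (mmult R) = Dom K rm"
    "rl \<cdot> mmult R = rl \<cdot> u" "rr \<cdot> mmult R = rr \<cdot> v" "rn \<cdot> mmult R = mN (rn \<cdot> v) (rn \<cdot> u)"
    using e by simp_all
qed

lemma mR [simp]:
  assumes "f \<in> Ar K" "g \<in> Ar K" "Cod K f = Dom K rm" "Cod K g = Dom K rm" "Dom K f = Dom K g" "rr \<cdot> f = rl \<cdot> g"
  shows "mR g f \<in> Ar K" "Dom K (mR g f) = Dom K g" "Cod K (mR g f) = Dom K rm"
    "rl \<cdot> mR g f = rl \<cdot> f" "rr \<cdot> mR g f = rr \<cdot> g" "rn \<cdot> mR g f = mN (rn \<cdot> g) (rn \<cdot> f)"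
proof -
  obtain u v where uv: "pb K rr rl = (u, v)" by (cases "pb K rr rl")
  note P = mmult_R(1)[OF uv] and c = mmult_R(2)[OF uv] and e = mmult_R(3-8)[OF uv]
  note A = pullback_Ar[OF P] and B = pairing[OF P, of f g]
  note F = R_fields[OF uv]
  let ?z = "pairing K (u, v) f g"
  have z: "?z \<in> Ar K" "Dom K ?z = Dom K g" "Cod K ?z = Dom K u" "u \<cdot> ?z = f" "v \<cdot> ?z = g"
    using B assms by simp_all
  have M: "mR g f = mmult R \<cdot> ?z" unfolding mR_def by (simp add: span_proj_def F uv)
  show "mR g f \<in> Ar K" "Dom K (mR g f) = Dom K g" "Cod K (mR g f) = Dom K rm"
    unfolding M using e(1-3) z by simp_all
  show "rl \<cdot> mR g f = rl \<cdot> f" "rr \<cdot> mR g f = rr \<cdot> g"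
    unfolding M using e(1-3) z A comp2_eq_extend[OF e(4), of ?z] comp2_eq_extend[OF e(5), of ?z] by simp_all
  show "rn \<cdot> mR g f = mN (rn \<cdot> g) (rn \<cdot> f)"
    unfolding M using e(1-3) z A comp_eq_extend[OF e(6), of ?z] mN_comp[OF _ _ _ _ _ c, of ?z] by simp
qed

lemma rn_composable:
  assumes "f \<in> Ar K" "g \<in> Ar K" "Cod K f = Dom K rm" "Cod K g = Dom K rm" "rr \<cdot> f = rl \<cdot> g"
  shows "nr \<cdot> (rn \<cdot> f) = nl \<cdot> (rn \<cdot> g)"
  using i_legs[of f] i_legs[of g] assms by simp

lemma munit_R: "munit R \<in> Ar K" "Dom K (munit R) = Dom K i" "Cod K (munit R) = Dom K rm"
  "rl \<cdot> munit R = Ident K (Dom K i)" "rr \<cdot> munit R = Ident K (Dom K i)" "rn \<cdot> munit R = munit N \<cdot> i"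
proof -
  obtain u v where uv: "pb K rr rl = (u, v)" by (cases "pb K rr rl")
  note F = R_fields[OF uv]
  obtain e where e: "e \<in> Ar K" "Dom K e = Dom K i" "Cod K e = Dom K rm" "rl \<cdot> e = Ident K (Dom K i)" "rr \<cdot> e = Ident K (Dom K i)"
    "rn \<cdot> e = munit N \<cdot> i"
    by (rule R_ex[of "Ident K (Dom K i)" "munit N \<cdot> i" "Ident K (Dom K i)"]) simp_all
  have mm: "munit R = e"
    unfolding F
  proof (rule the_equality)
    fix e' assume "e' \<in> hom K (Dom K i) (Dom K rm) \<and> rl \<cdot> e' = Ident K (Dom K i) \<and> rr \<cdot> e' = Ident K (Dom K i) \<and> rn \<cdot> e' = munit N \<cdot> i"
    then show "e' = e" using e by - (rule R_eqI, simp_all)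
  qed (use e in simp)
  show "munit R \<in> Ar K" "Dom K (munit R) = Dom K i" "Cod K (munit R) = Dom K rm"
  "rl \<cdot> munit R = Ident K (Dom K i)" "rr \<cdot> munit R = Ident K (Dom K i)" "rn \<cdot> munit R = munit N \<cdot> i"
    unfolding mm by (fact e)+
qed

text \<open>The nerve construction is applied inside the 2-category K itself. The laws are inherited
  from N, because an element is determined by \<open>rl\<close>, \<open>rr\<close> and
  \<open>rn\<close>.\<close>

sublocale restricted: internal_category K "Dom K i" "Dom K rm" rl rr "munit R" mR
proof unfold_locales
  note U = munit_R
  have ux: "rl \<cdot> (munit R \<cdot> x) = x" "rr \<cdot> (munit R \<cdot> x) = x" "rn \<cdot> (munit R \<cdot> x) = munit N \<cdot> (i \<cdot> x)" if "x \<in> Ar K" "Cod K x = Dom K i" for x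
    using comp_eq_extend[OF U(4), of x] comp_eq_extend[OF U(5), of x] comp_eq_extend[OF U(6), of x] U that by simp_all
  fix f g h x
  assume f: "f \<in> Ar K" "Cod K f = Dom K rm"
  show "mR f (munit R \<cdot> (rl \<cdot> f)) = f"
    by (rule R_eqI) (use f U ux mN_unit[of "rn \<cdot> f"] i_legs[of f] in simp_all)
  show "mR (munit R \<cdot> (rr \<cdot> f)) f = f"
    by (rule R_eqI) (use f U ux mN_unit[of "rn \<cdot> f"] i_legs[of f] in simp_all)
  assume g: "g \<in> Ar K" "Cod K g = Dom K rm" "Dom K f = Dom K g" "rr \<cdot> f = rl \<cdot> g"
  note m = mR[OF f(1) g(1) f(2) g(2-4)] and nc = rn_composable[OF f(1) g(1) f(2) g(2,4)]
  { assume x: "x \<in> Ar K" "Cod K x = Dom K g"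
    have e: "rr \<cdot> (f \<cdot> x) = rl \<cdot> (g \<cdot> x)" using f g x comp2_eq_extend[OF g(4), of x] by simp
    have mx: "mR (g \<cdot> x) (f \<cdot> x) \<in> Ar K" "Dom K (mR (g \<cdot> x) (f \<cdot> x)) = Dom K x" "Cod K (mR (g \<cdot> x) (f \<cdot> x)) = Dom K rm"
      "rl \<cdot> mR (g \<cdot> x) (f \<cdot> x) = rl \<cdot> (f \<cdot> x)" "rr \<cdot> mR (g \<cdot> x) (f \<cdot> x) = rr \<cdot> (g \<cdot> x)"
      "rn \<cdot> mR (g \<cdot> x) (f \<cdot> x) = mN (rn \<cdot> (g \<cdot> x)) (rn \<cdot> (f \<cdot> x))"
    proof -
      have ty: "f \<cdot> x \<in> Ar K" "g \<cdot> x \<in> Ar K" "Cod K (f \<cdot> x) = Dom K rm" "Cod K (g \<cdot> x) = Dom K rm"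
        "Dom K (f \<cdot> x) = Dom K (g \<cdot> x)" "Dom K (g \<cdot> x) = Dom K x" using f g x by simp_all
      show "mR (g \<cdot> x) (f \<cdot> x) \<in> Ar K" "Dom K (mR (g \<cdot> x) (f \<cdot> x)) = Dom K x" "Cod K (mR (g \<cdot> x) (f \<cdot> x)) = Dom K rm"
        "rl \<cdot> mR (g \<cdot> x) (f \<cdot> x) = rl \<cdot> (f \<cdot> x)" "rr \<cdot> mR (g \<cdot> x) (f \<cdot> x) = rr \<cdot> (g \<cdot> x)"
        "rn \<cdot> mR (g \<cdot> x) (f \<cdot> x) = mN (rn \<cdot> (g \<cdot> x)) (rn \<cdot> (f \<cdot> x))"
        using mR[OF ty(1-5) e] ty(6) f(1,2) g(1,2) x by (simp_all only: comp_assoc rl_simps)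
    qed
    have "mN (rn \<cdot> g) (rn \<cdot> f) \<cdot> x = mN (rn \<cdot> (g \<cdot> x)) (rn \<cdot> (f \<cdot> x))"
      using mN_comp[OF _ _ _ _ _ nc, of x] f g x by simp
    then show "mR g f \<cdot> x = mR (g \<cdot> x) (f \<cdot> x)"
      using f g(1-3) x m(1-3) mx(1-3) comp2_eq_extend[OF m(4), of x] comp2_eq_extend[OF m(5), of x] comp_eq_extend[OF m(6), of x]
      by - (rule R_eqI, simp_all del: mR add: mx(4-6)) }
  { assume h: "h \<in> Ar K" "Cod K h = Dom K rm" "Dom K h = Dom K g" "rr \<cdot> g = rl \<cdot> h"
    have gh: "Dom K g = Dom K h" using h by simp
    note mh = mR[OF g(1) h(1) g(2) h(2) gh h(4)] and nch = rn_composable[OF g(1) h(1) g(2) h(2,4)]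
    show "mR (mR h g) f = mR h (mR g f)"
      by (rule R_eqI) (use f g h m mh nc nch mR[of f "mR h g"] mR[of "mR g f" h] mN_assoc[of "rn \<cdot> f" "rn \<cdot> g" "rn \<cdot> h"] in simp_all) }
qed (use munit_R pullbacks in simp_all)

theorem corner_category_object_ex:
  "\<exists>Y. category_object K Y \<and> sob Y 0 = Dom K i \<and> monad_of_category_object K Y = R"
proof -
  obtain Y where Y: "category_object K Y" "ob Y = Dom K i" "ar Y = Dom K rm" "src Y = rl" "trg Y = rr" "idn Y = munit R"
    and c: "\<And>f g. f \<in> Ar K \<Longrightarrow> g \<in> Ar K \<Longrightarrow> Cod K f = Dom K rm \<Longrightarrow> Cod K g = Dom K rm \<Longrightarrow> Dom K f = Dom K g \<Longrightarrow>
      rr \<cdot> f = rl \<cdot> g \<Longrightarrow> cmp K Y g f = mR g f"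
    using restricted.nerve by blast
  obtain u v where uv: "pb K rr rl = (u, v)" by (cases "pb K rr rl")
  note P = mmult_R(1)[OF uv] and e = mmult_R(3-8)[OF uv]
  note A = pullback_Ar[OF P]
  note F = R_fields[OF uv]
  \<comment> \<open>At the generic composable pair (u, v) the pairing is an identity, so agreement
    of the compositions on elements becomes equality of the multiplication arrows.\<close>
  have "cmp K Y v u = mmult R \<cdot> pairing K (u, v) u v"
    using c[OF _ _ _ _ _ A(9)] A by (simp add: mR_def span_proj_def F uv)
  then have "cmp K Y v u = mmult R"
    using e A by (simp add: pairing_pullback[OF P])
  then have "monad_of_category_object K Y = R"
    using Y uv F by (simp add: monad_of_category_object_def cmp_def flip: src_def trg_def idn_def)
  then show ?thesis using Y by (auto simp: ob_def)
qed

text \<open>Any category object presenting the monad, not only the constructed nerve, has its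
  source, target, unit and composition; the later arguments thus apply to every choice of
  Cnr(X).\<close>

lemma corner_category_object:
  assumes Y: "category_object K Y" and M: "monad_of_category_object K Y = R"
  shows "src Y = rl" "trg Y = rr" "idn Y = munit R" "ar Y = Dom K rm"
    and "\<lbrakk>f \<in> Ar K; g \<in> Ar K; Cod K f = Dom K rm; Cod K g = Dom K rm; Dom K f = Dom K g; rr \<cdot> f = rl \<cdot> g\<rbrakk> \<Longrightarrow> cmp K Y g f = mR g f"
proof -
  obtain u v where uv: "pb K rr rl = (u, v)" by (cases "pb K rr rl")
  note P = pb_pair[OF _ _ _ uv, simplified]
  note A = pullback_Ar[OF P]
  note F = R_fields[OF uv]
  have M': "lleg (monad_of_category_object K Y) = rl" "rleg (monad_of_category_object K Y) = rr"
    "munit (monad_of_category_object K Y) = munit R" "mmult (monad_of_category_object K Y) = mmult R"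
    unfolding M using F by simp_all
  show l: "src Y = rl" "trg Y = rr" "idn Y = munit R"
    using M'(1-3) by (simp_all add: monad_of_category_object_def src_def trg_def idn_def split: prod.splits)
  show ar: "ar Y = Dom K rm" using Dom_src[OF Y] l by simp
  have m: "cmp K Y v u = mmult R"
    using M'(4) uv l by (simp add: monad_of_category_object_def cmp_def flip: src_def trg_def)
  assume fg: "f \<in> Ar K" "g \<in> Ar K" "Cod K f = Dom K rm" "Cod K g = Dom K rm" "Dom K f = Dom K g" "rr \<cdot> f = rl \<cdot> g"
  have B: "pairing K (u, v) f g \<in> Ar K" "Cod K (pairing K (u, v) f g) = Dom K u" "u \<cdot> pairing K (u, v) f g = f" "v \<cdot> pairing K (u, v) f g = g"
    using pairing[OF P, of f g] fg A by simp_all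
  have "cmp K Y g f = cmp K Y v u \<cdot> pairing K (u, v) f g"
    using Y l ar fg A B by simp
  then show "cmp K Y g f = mR g f" unfolding m mR_def by (simp add: span_proj_def F uv)
qed

section \<open>2-cells into the object of corners\<close>

lemma interchange_\<kappa>:
  assumes "\<xi> \<in> Cell K" "Cod K (Src K \<xi>) = Dom K ds"
  shows "(\<kappa> \<lhd> Trg K \<xi>) \<bullet> (ds \<rhd> \<xi>) = (ct \<rhd> \<xi>) \<bullet> (\<kappa> \<lhd> Src K \<xi>)"
  using interchange[of \<xi> \<kappa>] assms by simp

text \<open>With identity legs a 2-cell between corners reduces to its horizontal part \<sigma>,
  which lies over an identity. The equation between the vertical parts is interchange of the induced
  2-cell with the universal cell of the cotensor.\<close>

lemma corner_cellD:
  assumes \<rho>: "\<rho> \<in> Cell K" "Cod K (Src K \<rho>) = Dom K rm"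
    and l: "rl \<rhd> \<rho> = Ident2 K (rl \<cdot> Src K \<rho>)" and r: "rr \<rhd> \<rho> = Ident2 K (rr \<cdot> Src K \<rho>)"
  obtains \<sigma> where "\<sigma> \<in> Cell K" "Src K \<sigma> = hor (rn \<cdot> Src K \<rho>)" "Trg K \<sigma> = hor (rn \<cdot> Trg K \<rho>)"
    "(src X \<rhd> \<sigma>) \<bullet> vrt (rn \<cdot> Src K \<rho>) = vrt (rn \<cdot> Trg K \<rho>)" "trg X \<rhd> \<sigma> = Ident2 K (i \<cdot> (rr \<cdot> Src K \<rho>))"
proof -
  let ?\<sigma> = "nb \<rhd> (rn \<rhd> \<rho>)" and ?\<xi> = "na \<rhd> (rn \<rhd> \<rho>)"
  have il: "i \<cdot> rl = nl \<cdot> rn" "i \<cdot> rr = nr \<cdot> rn"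
    using i_legs[of "Ident K (Dom K rm)"] Dom_Ob[OF R_simps(1)] by simp_all
  have "ds \<rhd> ?\<xi> = i \<rhd> (rl \<rhd> \<rho>)"
    using \<rho> by (simp add: LWhisk_LWhisk il nl_def)
  then have d: "ds \<rhd> ?\<xi> = Ident2 K (i \<cdot> (rl \<cdot> Src K \<rho>))"
    using \<rho> l by (simp add: LWhisk_Ident2)
  have c: "ct \<rhd> ?\<xi> = src X \<rhd> ?\<sigma>"
    using \<rho> pullback_Ar(9)[OF N_pullback] ct_na[of rn] by (simp add: LWhisk_LWhisk)
  have "trg X \<rhd> ?\<sigma> = i \<rhd> (rr \<rhd> \<rho>)"
    using \<rho> by (simp add: LWhisk_LWhisk il nr_def)
  then have t: "trg X \<rhd> ?\<sigma> = Ident2 K (i \<cdot> (rr \<cdot> Src K \<rho>))"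
    using \<rho> r by (simp add: LWhisk_Ident2)
  have "(\<kappa> \<lhd> Trg K ?\<xi>) \<bullet> Ident2 K (i \<cdot> (rl \<cdot> Src K \<rho>)) = (src X \<rhd> ?\<sigma>) \<bullet> (\<kappa> \<lhd> Src K ?\<xi>)"
    using interchange_\<kappa>[of ?\<xi>] \<rho> unfolding d c by simp
  moreover have "i \<cdot> (rl \<cdot> Src K \<rho>) = ds \<cdot> Trg K ?\<xi>"
  proof -
    have "ds \<cdot> Trg K ?\<xi> = Trg K (ds \<rhd> ?\<xi>)" using \<rho> by simp
    then show ?thesis unfolding d using \<rho> by simp
  qed
  ultimately have "\<kappa> \<lhd> Trg K ?\<xi> = (src X \<rhd> ?\<sigma>) \<bullet> (\<kappa> \<lhd> Src K ?\<xi>)"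
    using \<rho> by simp
  then show ?thesis
    by (intro that[of ?\<sigma>]) (use \<rho> t in \<open>simp_all add: vrt_def hor_def\<close>)
qed

text \<open>The 2-cell is induced in four stages, through the cotensor and the three pullbacks that
  make up the apex, with identities prescribed on both legs.\<close>

lemma corner_cell_ex:
  assumes e: "e \<in> Ar K" "e' \<in> Ar K" "Cod K e = Dom K rm" "Cod K e' = Dom K rm" "Dom K e = Dom K e'"
    "rl \<cdot> e = rl \<cdot> e'" "rr \<cdot> e = rr \<cdot> e'"
    and \<sigma>: "\<sigma> \<in> Cell K" "Src K \<sigma> = hor (rn \<cdot> e)" "Trg K \<sigma> = hor (rn \<cdot> e')"
      "(src X \<rhd> \<sigma>) \<bullet> vrt (rn \<cdot> e) = vrt (rn \<cdot> e')" "trg X \<rhd> \<sigma> = Ident2 K (i \<cdot> (rr \<cdot> e))"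
  obtains \<rho> where "\<rho> \<in> Cell K" "Src K \<rho> = e" "Trg K \<rho> = e'"
proof -
  have il: "ds \<cdot> (na \<cdot> (rn \<cdot> e)) = i \<cdot> (rl \<cdot> e)" "ds \<cdot> (na \<cdot> (rn \<cdot> e')) = i \<cdot> (rl \<cdot> e)"
    using i_legs(1)[of e] i_legs(1)[of e'] e by (simp_all add: nl_def)
  obtain \<xi> where \<xi>: "\<xi> \<in> Cell K" "Src K \<xi> = na \<cdot> (rn \<cdot> e)" "Trg K \<xi> = na \<cdot> (rn \<cdot> e')" "ds \<rhd> \<xi> = Ident2 K (i \<cdot> (rl \<cdot> e))" "ct \<rhd> \<xi> = src X \<rhd> \<sigma>"
  proof (rule cotensor_cells[of "na \<cdot> (rn \<cdot> e)" "na \<cdot> (rn \<cdot> e')" "Ident2 K (i \<cdot> (rl \<cdot> e))" "src X \<rhd> \<sigma>"])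
    show "(\<kappa> \<lhd> (na \<cdot> (rn \<cdot> e'))) \<bullet> Ident2 K (i \<cdot> (rl \<cdot> e)) = (src X \<rhd> \<sigma>) \<bullet> (\<kappa> \<lhd> (na \<cdot> (rn \<cdot> e)))"
      using \<sigma>(4) e il by (simp add: vrt_def)
  qed (use e il \<sigma> in \<open>simp_all add: hor_def\<close>)
  obtain \<eta> where \<eta>: "\<eta> \<in> Cell K" "Cod K (Src K \<eta>) = Dom K na" "na \<rhd> \<eta> = \<xi>" "nb \<rhd> \<eta> = \<sigma>"
    using pullback_cells[OF N_pullback, of \<xi> \<sigma>] \<xi> \<sigma> e by (auto simp: hor_def)
  have "i \<rhd> Ident2 K (rl \<cdot> e) = nl \<rhd> \<eta>"
    using \<eta> e \<xi>(4) by (simp add: LWhisk_Ident2 nl_def flip: LWhisk_LWhisk)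
  moreover have dn: "Dom K (Src K \<eta>) = Dom K e"
  proof -
    have "Dom K (Src K (na \<rhd> \<eta>)) = Dom K (Src K \<eta>)" using \<eta>(1,2) by simp
    then show ?thesis unfolding \<eta>(3) \<xi>(2) using e by simp
  qed
  ultimately obtain \<theta> where \<theta>: "\<theta> \<in> Cell K" "Cod K (Src K \<theta>) = Dom K mi" "mi \<rhd> \<theta> = Ident2 K (rl \<cdot> e)" "mn \<rhd> \<theta> = \<eta>"
    using pullback_cells[OF M_pullback, of "Ident2 K (rl \<cdot> e)" \<eta>] \<eta> e by auto
  have "(nr \<cdot> mn) \<rhd> \<theta> = i \<rhd> Ident2 K (rr \<cdot> e)"
    using \<eta> \<theta> e \<sigma>(5) by (simp add: LWhisk_Ident2 nr_def flip: LWhisk_LWhisk)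
  moreover have "Dom K (Src K \<theta>) = Dom K e"
  proof -
    have "Dom K (Src K (mn \<rhd> \<theta>)) = Dom K (Src K \<theta>)" using \<theta>(1,2) by simp
    then show ?thesis unfolding \<theta>(4) dn ..
  qed
  ultimately obtain \<rho> where \<rho>: "\<rho> \<in> Cell K" "Cod K (Src K \<rho>) = Dom K rm" "rm \<rhd> \<rho> = \<theta>" "rr \<rhd> \<rho> = Ident2 K (rr \<cdot> e)"
    using pullback_cells[OF R_pullback, of \<theta> "Ident2 K (rr \<cdot> e)"] \<theta> e by auto
  have L: "rl \<rhd> \<rho> = Ident2 K (rl \<cdot> e)" "rn \<rhd> \<rho> = \<eta>"
    using \<rho> \<theta> by (simp_all add: rl_def rn_def flip: LWhisk_LWhisk)
  have D: "Dom K (Src K \<rho>) = Dom K e"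
  proof -
    have "Dom K (Src K (rm \<rhd> \<rho>)) = Dom K (Src K \<rho>)" using \<rho>(1,2) by simp
    then show ?thesis unfolding \<rho>(3) using \<open>Dom K (Src K \<theta>) = Dom K e\<close> by simp
  qed
  have s: "rl \<cdot> Src K \<rho> = rl \<cdot> e" "rr \<cdot> Src K \<rho> = rr \<cdot> e" "rl \<cdot> Trg K \<rho> = rl \<cdot> e" "rr \<cdot> Trg K \<rho> = rr \<cdot> e"
    "rn \<cdot> Src K \<rho> = Src K \<eta>" "rn \<cdot> Trg K \<rho> = Trg K \<eta>"
    using L[THEN arg_cong, of "Src K"] L[THEN arg_cong, of "Trg K"] \<rho>(4)[THEN arg_cong, of "Src K"] \<rho>(4)[THEN arg_cong, of "Trg K"] \<rho>(1,2) e
    by simp_all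
  have s2: "na \<cdot> Src K \<eta> = na \<cdot> (rn \<cdot> e)" "nb \<cdot> Src K \<eta> = nb \<cdot> (rn \<cdot> e)" "na \<cdot> Trg K \<eta> = na \<cdot> (rn \<cdot> e')" "nb \<cdot> Trg K \<eta> = nb \<cdot> (rn \<cdot> e')"
    using \<eta>(3,4)[THEN arg_cong, of "Src K"] \<eta>(3,4)[THEN arg_cong, of "Trg K"] \<eta>(1,2) \<xi> \<sigma> by (simp_all add: hor_def)
  \<comment> \<open>\<open>pullback_cells\<close> prescribes only the projections of an induced
    2-cell; its source and target are recovered from them by joint monicity.\<close>
  have "Src K \<eta> = rn \<cdot> e" "Trg K \<eta> = rn \<cdot> e'"
    by (rule pullback_eqI[OF N_pullback]; use \<eta>(1,2) dn e s2 in simp)+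
  then have "Src K \<rho> = e" "Trg K \<rho> = e'"
    using s \<rho>(1,2) D e by - (rule R_eqI; simp)+
  then show ?thesis using that \<rho>(1) by blast
qed

end

section \<open>Corners in terms of generalized elements\<close>

definition map_simp :: "('o \<Rightarrow> 'p) \<Rightarrow> ('a \<Rightarrow> 'b) \<Rightarrow> ('o, 'a) simp \<Rightarrow> ('p, 'b) simp" where
  "map_simp F G X = \<lparr>sob = (\<lambda>n. F (sob X n)), face = (\<lambda>n i. G (face X n i)), degen = (\<lambda>n i. G (degen X n i))\<rparr>"

lemma map_simp_simps [simp]: "sob (map_simp F G X) n = F (sob X n)" "face (map_simp F G X) n i = G (face X n i)"
  "degen (map_simp F G X) n i = G (degen X n i)" "ob (map_simp F G X) = F (ob X)" "ar (map_simp F G X) = F (ar X)"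
  "src (map_simp F G X) = G (src X)" "trg (map_simp F G X) = G (trg X)" "idn (map_simp F G X) = G (idn X)"
  by (simp_all add: map_simp_def ob_def ar_def src_def trg_def idn_def)

text \<open>Functoriality preserves the simplicial identities, so only the Segal squares remain as a
  hypothesis. The result serves the functor of objects, which preserves pullbacks, and \<pi>_0,
  where the squares need a separate argument.\<close>

lemma category_object_map_simp:
  assumes K: "category K" and X: "category_object K X"
    and hom: "\<And>f. f \<in> Ar K \<Longrightarrow> G f \<in> hom C (F (Dom K f)) (F (Cod K f))"
    and ob: "\<And>A. A \<in> Ob K \<Longrightarrow> F A \<in> Ob C"
    and comp: "\<And>f g. f \<in> Ar K \<Longrightarrow> g \<in> Ar K \<Longrightarrow> Dom K g = Cod K f \<Longrightarrow> G (g \<cdot>\<^bsub>K\<^esub> f) = G g \<cdot>\<^bsub>C\<^esub> G f"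
    and ident: "\<And>A. A \<in> Ob K \<Longrightarrow> G (Ident K A) = Ident C (F A)"
    and pbk: "\<And>n. is_pullback C (G (face X n 0)) (G (face X n (n + 1))) (G (face X (n + 1) (n + 2))) (G (face X (n + 1) 0))"
  shows "category_object C (map_simp F G X)"
proof -
  interpret K: category_context K by unfold_locales (rule K)
  note fX = K.face_Ar[OF X] and dX = K.degen_Ar[OF X] and oX = K.sob_Ob[OF X]
  have S: "simplicial_object K X" using X by (simp add: category_object_def)
  have ff: "face X n j \<cdot>\<^bsub>K\<^esub> face X (n + 1) (k + 1) = face X n k \<cdot>\<^bsub>K\<^esub> face X (n + 1) j" if "j \<le> k" "k \<le> n + 1" for n j k
    using K.face_face_arr[OF X that] .
  have "\<forall>n i j. i \<le> j \<and> j \<le> n \<longrightarrow> face X (n + 1) i \<cdot>\<^bsub>K\<^esub> degen X (n + 1) (j + 1) = degen X n j \<cdot>\<^bsub>K\<^esub> face X n i"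
    using S unfolding simplicial_object_def by (elim conjE)
  then have fl: "face X (n + 1) j \<cdot>\<^bsub>K\<^esub> degen X (n + 1) (k + 1) = degen X n k \<cdot>\<^bsub>K\<^esub> face X n j" if "j \<le> k" "k \<le> n" for n j k
    using that by blast
  have "\<forall>n i j. j < i \<and> i \<le> n + 1 \<longrightarrow> face X (n + 1) (i + 1) \<cdot>\<^bsub>K\<^esub> degen X (n + 1) j = degen X n j \<cdot>\<^bsub>K\<^esub> face X n i"
    using S unfolding simplicial_object_def by (elim conjE)
  then have fg: "face X (n + 1) (k + 1) \<cdot>\<^bsub>K\<^esub> degen X (n + 1) j = degen X n j \<cdot>\<^bsub>K\<^esub> face X n k" if "j < k" "k \<le> n + 1" for n j k
    using that by blast
  have "\<forall>n. \<forall>j\<le>n. face X n j \<cdot>\<^bsub>K\<^esub> degen X n j = Ident K (sob X n) \<and> face X n (j + 1) \<cdot>\<^bsub>K\<^esub> degen X n j = Ident K (sob X n)"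
    using S unfolding simplicial_object_def by (elim conjE)
  then have fs: "face X n j \<cdot>\<^bsub>K\<^esub> degen X n j = Ident K (sob X n)" "face X n (j + 1) \<cdot>\<^bsub>K\<^esub> degen X n j = Ident K (sob X n)" if "j \<le> n" for n j
    using that by blast+
  have "\<forall>n i j. i \<le> j \<and> j \<le> n \<longrightarrow> degen X (n + 1) i \<cdot>\<^bsub>K\<^esub> degen X n j = degen X (n + 1) (j + 1) \<cdot>\<^bsub>K\<^esub> degen X n i"
    using S unfolding simplicial_object_def by (elim conjE)
  then have dd: "degen X (n + 1) j \<cdot>\<^bsub>K\<^esub> degen X n k = degen X (n + 1) (k + 1) \<cdot>\<^bsub>K\<^esub> degen X n j" if "j \<le> k" "k \<le> n" for n j k
    using that by blast
  show ?thesis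
    unfolding category_object_def simplicial_object_def map_simp_simps
  proof (intro conjI allI impI)
    fix n j k
    show "F (sob X n) \<in> Ob C" using ob oX by blast
    show "is_pullback C (G (face X n 0)) (G (face X n (n + 1))) (G (face X (n + 1) (n + 2))) (G (face X (n + 1) 0))" by (rule pbk)
    { assume "j \<le> n + 1" then show "G (face X n j) \<in> hom C (F (sob X (n + 1))) (F (sob X n))"
        using hom[of "face X n j"] fX[of j n] by simp }
    { assume "j \<le> n" then show "G (degen X n j) \<in> hom C (F (sob X n)) (F (sob X (n + 1)))"
        using hom[of "degen X n j"] dX[of j n] by simp }
    { assume "j \<le> k \<and> k \<le> n + 1"
      then show "G (face X n j) \<cdot>\<^bsub>C\<^esub> G (face X (n + 1) (k + 1)) = G (face X n k) \<cdot>\<^bsub>C\<^esub> G (face X (n + 1) j)"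
        using fX[of _ n] fX[of _ "n + 1"] ff[of j k n] by (simp flip: comp) }
    { assume "j \<le> k \<and> k \<le> n"
      then show "G (face X (n + 1) j) \<cdot>\<^bsub>C\<^esub> G (degen X (n + 1) (k + 1)) = G (degen X n k) \<cdot>\<^bsub>C\<^esub> G (face X n j)"
        "G (degen X (n + 1) j) \<cdot>\<^bsub>C\<^esub> G (degen X n k) = G (degen X (n + 1) (k + 1)) \<cdot>\<^bsub>C\<^esub> G (degen X n j)"
        using fX[of _ n] fX[of _ "n + 1"] dX[of _ n] dX[of _ "n + 1"] fl[of j k n] dd[of j k n] by (simp_all flip: comp) }
    { assume "k < j \<and> j \<le> n + 1"
      then show "G (face X (n + 1) (j + 1)) \<cdot>\<^bsub>C\<^esub> G (degen X (n + 1) k) = G (degen X n k) \<cdot>\<^bsub>C\<^esub> G (face X n j)"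
        using fX[of _ n] fX[of _ "n + 1"] dX[of _ n] dX[of _ "n + 1"] fg[of k j n] by (simp flip: comp) }
    { assume "j \<le> n"
      then show "G (face X n j) \<cdot>\<^bsub>C\<^esub> G (degen X n j) = Ident C (F (sob X n))"
        "G (face X n (j + 1)) \<cdot>\<^bsub>C\<^esub> G (degen X n j) = Ident C (F (sob X n))"
        using fX[of _ n] dX[of _ n] fs[of j n] ident oX by (simp_all flip: comp) }
  qed
qed

text \<open>Projections of composites that leave composition in Cat(C) folded, where
  \<open>Cat_simps\<close> would unfold it; so reasoning in the 2-category can be mixed with
  reasoning in C.\<close>

lemma Cat_proj:
  "fdom (G \<cdot>\<^bsub>Cat C\<^esub> F) = fdom F" "fcod (G \<cdot>\<^bsub>Cat C\<^esub> F) = fcod G"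
  "fo (G \<cdot>\<^bsub>Cat C\<^esub> F) = fo G \<cdot>\<^bsub>C\<^esub> fo F" "fa (G \<cdot>\<^bsub>Cat C\<^esub> F) = fa G \<cdot>\<^bsub>C\<^esub> fa F"
  "fdom (Ident (Cat C) A) = A" "fcod (Ident (Cat C) A) = A"
  "nsrc (\<beta> \<bullet>\<^bsub>Cat C\<^esub> \<alpha>) = nsrc \<alpha>" "ntrg (\<beta> \<bullet>\<^bsub>Cat C\<^esub> \<alpha>) = ntrg \<beta>"
  "ncomp (\<beta> \<bullet>\<^bsub>Cat C\<^esub> \<alpha>) = cmp C (fcod (nsrc \<alpha>)) (ncomp \<beta>) (ncomp \<alpha>)"
  "nsrc (G \<rhd>\<^bsub>Cat C\<^esub> \<alpha>) = G \<cdot>\<^bsub>Cat C\<^esub> nsrc \<alpha>" "ntrg (G \<rhd>\<^bsub>Cat C\<^esub> \<alpha>) = G \<cdot>\<^bsub>Cat C\<^esub> ntrg \<alpha>"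
  "ncomp (G \<rhd>\<^bsub>Cat C\<^esub> \<alpha>) = fa G \<cdot>\<^bsub>C\<^esub> ncomp \<alpha>"
  "nsrc (\<alpha> \<lhd>\<^bsub>Cat C\<^esub> F) = nsrc \<alpha> \<cdot>\<^bsub>Cat C\<^esub> F" "ntrg (\<alpha> \<lhd>\<^bsub>Cat C\<^esub> F) = ntrg \<alpha> \<cdot>\<^bsub>Cat C\<^esub> F"
  "ncomp (\<alpha> \<lhd>\<^bsub>Cat C\<^esub> F) = ncomp \<alpha> \<cdot>\<^bsub>C\<^esub> fo F"
  "nsrc (Ident2 (Cat C) F) = F" "ntrg (Ident2 (Cat C) F) = F" "ncomp (Ident2 (Cat C) F) = idn (fcod F) \<cdot>\<^bsub>C\<^esub> fo F"
  by (simp_all add: Cat_simps)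

context category_context
begin

lemma category_object_disc [simp]: "A \<in> Ob C \<Longrightarrow> category_object C (disc C A)"
  unfolding category_object_def simplicial_object_def disc_def
  by (auto intro!: is_pullbackI)

lemma disc_simps [simp]: "ob (disc C A) = A" "ar (disc C A) = A" "src (disc C A) = Ident C A" "trg (disc C A) = Ident C A"
  "idn (disc C A) = Ident C A" "sob (disc C A) n = A"
  "face (disc C A) n j = Ident C A" "degen (disc C A) n j = Ident C A"
  by (simp_all add: disc_def ob_def ar_def src_def trg_def idn_def)

lemma cmp_disc [simp]:
  assumes "f \<in> Ar C" "Cod C f = A"
  shows "cmp C (disc C A) f f = f"
proof -
  have "A \<in> Ob C" using assms by auto
  then show ?thesis using cmp_idn_right[of "disc C A" f f] assms by simp
qed

lemma iterated_degen_Suc: "iterated_degen C A (n + 1) = degen A n 0 \<cdot> iterated_degen C A n"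
  unfolding Suc_eq_plus1[symmetric] by simp

lemma iterated_degen_Ar [simp]:
  assumes "category_object C A"
  shows "iterated_degen C A n \<in> Ar C" "Dom C (iterated_degen C A n) = ob A" "Cod C (iterated_degen C A n) = sob A n"
proof -
  have "iterated_degen C A n \<in> hom C (ob A) (sob A n)"
    by (induction n) (use assms degen_Ar[OF assms, of 0] in \<open>simp_all add: ob_def Suc_eq_plus1 iterated_degen_Suc del: iterated_degen.simps(2)\<close>)
  then show "iterated_degen C A n \<in> Ar C" "Dom C (iterated_degen C A n) = ob A" "Cod C (iterated_degen C A n) = sob A n"
    by simp_all
qed

text \<open>Every degeneracy of an iterated degeneracy is the next iterated degeneracy, whatever its
  index; faces then cancel degeneracies.\<close>

lemma objects_inclusion_functor [simp]:
  assumes A: "category_object C A"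
  shows "internal_functor C (objects_inclusion C A)"
proof -
  note S = iterated_degen_Suc[of A]
  have dg: "degen A n j \<cdot> iterated_degen C A n = iterated_degen C A (n + 1)" if "j \<le> n" for n j
    using that
  proof (induction n arbitrary: j)
    case 0 then show ?case using S[of 0] by simp
  next
    case (Suc n)
    show ?case
    proof (cases j)
      case 0 then show ?thesis using S[of "Suc n"] by simp
    next
      case (Suc k)
      then have k: "k \<le> n" "j = k + 1" using Suc.prems by simp_all
      have "degen A (n + 1) j \<cdot> iterated_degen C A (n + 1) = degen A (n + 1) 0 \<cdot> (degen A n k \<cdot> iterated_degen C A n)"
        unfolding S[of n] using degen_degen[OF A, of 0 k n "iterated_degen C A n"] k A by simp
      also have "\<dots> = iterated_degen C A (n + 2)"
        unfolding Suc.IH[OF k(1)] using S[of "n + 1"] by simp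
      finally show ?thesis by (simp add: Suc_eq_plus1)
    qed
  qed
  have fc: "face A n j \<cdot> iterated_degen C A (n + 1) = iterated_degen C A n" if "j \<le> n + 1" for n j
  proof (cases "j \<le> n")
    case True
    then show ?thesis
      unfolding dg[OF True, symmetric] using face_degen_same(1)[OF A True, of "iterated_degen C A n"] A by simp
  next
    case False
    then have j: "j = n + 1" using that by simp
    then show ?thesis
      unfolding dg[OF order_refl, symmetric] using face_degen_same(2)[OF A order_refl, of "iterated_degen C A n"] A by simp
  qed
  have obO: "ob A \<in> Ob C" using A by simp
  show ?thesis
    unfolding internal_functor_def objects_inclusion_def
    using A obO fc dg by (intro conjI allI impI) (simp_all flip: ob_def)
qed

lemma objects_inclusion_simps [simp]:
  "fdom (objects_inclusion C A) = disc C (ob A)" "fcod (objects_inclusion C A) = A"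
  "fo (objects_inclusion C A) = Ident C (ob A)"
  by (simp_all add: objects_inclusion_def fo_def ob_def)

text \<open>An element of \<open>ob A\<close> as a functor from a discrete category, with identities
  as its values on arrows.\<close>

definition point :: "('o, 'a) simp \<Rightarrow> 'a \<Rightarrow> ('o, 'a) sfun" where
  "point A x = mkfun (disc C (Dom C x)) A x (idn A \<cdot> x)"

lemma point [simp]:
  assumes "category_object C A" "x \<in> Ar C" "Cod C x = ob A"
  shows "internal_functor C (point A x)" "fo (point A x) = x" "fa (point A x) = idn A \<cdot> x"
proof -
  have cm: "(idn A \<cdot> x) \<cdot> cmp C (disc C (Dom C x)) g f = cmp C A ((idn A \<cdot> x) \<cdot> g) ((idn A \<cdot> x) \<cdot> f)"
    if "f \<in> Ar C" "g \<in> Ar C" "Cod C f = ar (disc C (Dom C x))" "Cod C g = ar (disc C (Dom C x))" "Dom C f = Dom C g"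
      "trg (disc C (Dom C x)) \<cdot> f = src (disc C (Dom C x)) \<cdot> g" for f g
    using that assms by simp
  show "internal_functor C (point A x)" "fo (point A x) = x" "fa (point A x) = idn A \<cdot> x"
    unfolding point_def
    by ((rule internal_functor_mkfun fo_mkfun fa_mkfun; use assms cm in simp))+
qed

lemma point_dom [simp]: "fdom (point A x) = disc C (Dom C x)" "fcod (point A x) = A"
  by (simp_all add: point_def)

text \<open>A functor out of a discrete category sends every arrow to an identity, so its object
  part determines it.\<close>

lemma disc_functor_eqI:
  assumes "internal_functor C F" "internal_functor C G" "fdom F = disc C U" "fdom G = disc C U" "fcod F = fcod G" "fo F = fo G" "U \<in> Ob C"
  shows "F = G"
proof -
  have "fa H = idn (fcod H) \<cdot> fo H" if "internal_functor C H" "fdom H = disc C U" for H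
    using fa_idn[OF that(1), of "Ident C U" "disc C U"] that assms(7) fa_Ar[OF that(1)] Dom_fa[OF that(1)] Dom_fo[OF that(1)] by simp
  then show ?thesis using assms by (intro functor_eqI) simp_all
qed

lemma comp_point:
  assumes "internal_functor C G" "x \<in> Ar C" "Cod C x = ob (fdom G)" "A = fdom G"
  shows "G \<cdot>\<^bsub>Cat C\<^esub> point A x = point (fcod G) (fo G \<cdot> x)"
proof (rule disc_functor_eqI[of _ _ "Dom C x"])
  show "internal_functor C (G \<cdot>\<^bsub>Cat C\<^esub> point A x)" using assms by (simp add: Cat_simps)
qed (use assms in \<open>simp_all add: Cat_proj\<close>)

text \<open>Between points naturality is automatic, so a 2-cell is just an element of
  \<open>ar A\<close>.\<close>

definition pcell :: "('o, 'a) simp \<Rightarrow> 'a \<Rightarrow> ('o, 'a) snat" where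
  "pcell A f = cat_cell (point A (src A \<cdot> f)) (point A (trg A \<cdot> f)) f"

lemma pcell_simps [simp]: "nsrc (pcell A f) = point A (src A \<cdot> f)" "ntrg (pcell A f) = point A (trg A \<cdot> f)" "ncomp (pcell A f) = f"
  by (simp_all add: pcell_def)

lemma pcell [simp]:
  assumes "category_object C A" "f \<in> Ar C" "Cod C f = ar A"
  shows "internal_nat_trans C (pcell A f)"
  unfolding pcell_def
  by (rule internal_nat_transI) (use assms in simp_all)

lemma disc_cell_eqI:
  assumes "internal_nat_trans C \<alpha>" "internal_nat_trans C \<beta>" "fdom (nsrc \<alpha>) = disc C U" "fdom (nsrc \<beta>) = disc C U" "U \<in> Ob C"
    "fcod (nsrc \<alpha>) = fcod (nsrc \<beta>)" "ncomp \<alpha> = ncomp \<beta>"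
  shows "\<alpha> = \<beta>"
proof (rule cat_cell_eqI)
  have "fo (nsrc \<alpha>) = fo (nsrc \<beta>)" "fo (ntrg \<alpha>) = fo (ntrg \<beta>)"
    using src_nt[OF assms(1)] src_nt[OF assms(2)] trg_nt[OF assms(1)] trg_nt[OF assms(2)] assms(6,7) by metis+
  then show "nsrc \<alpha> = nsrc \<beta>" "ntrg \<alpha> = ntrg \<beta>"
    using disc_functor_eqI[of "nsrc \<alpha>" "nsrc \<beta>" U] disc_functor_eqI[of "ntrg \<alpha>" "ntrg \<beta>" U] assms by simp_all
qed (fact assms)

text \<open>This is the naturality square of \<beta> at the component of \<alpha>.\<close>

lemma interchange_Cat:
  assumes "internal_nat_trans C \<alpha>" "internal_nat_trans C \<beta>" "fdom (nsrc \<beta>) = fcod (nsrc \<alpha>)"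
  shows "(\<beta> \<lhd>\<^bsub>Cat C\<^esub> ntrg \<alpha>) \<bullet>\<^bsub>Cat C\<^esub> (nsrc \<beta> \<rhd>\<^bsub>Cat C\<^esub> \<alpha>) = (ntrg \<beta> \<rhd>\<^bsub>Cat C\<^esub> \<alpha>) \<bullet>\<^bsub>Cat C\<^esub> (\<beta> \<lhd>\<^bsub>Cat C\<^esub> nsrc \<alpha>)"
  by (rule cat_cell_eqI) (use assms nt_natural[OF assms(2), of "ncomp \<alpha>"] in \<open>simp_all add: Cat_proj\<close>)

end

section \<open>The crossed category in Cat(E)\<close>

locale pullback_category = category_context +
  assumes hp: "has_pullbacks C"

locale crossed_category = pullback_category E
  for E :: "('o, 'a) cat" (structure) +
  fixes X :: "(('o, 'a) simp, ('o, 'a) sfun) simp" and D :: "('o, 'a) snat set"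
  assumes crossed: "crossed_internal_category (Cat E) X D"
begin

sublocale K: corner "Cat E" X D "objects_inclusion E (ob X)"
proof -
  interpret T: two_category "Cat E" by (rule two_category_Cat)
  have X: "category_object (Cat E) X" using crossed by (simp add: crossed_internal_category_def)
  have X0: "category_object E (ob X)" using T.obar_Ob(1)[OF X] by (simp add: Cat_simps)
  show "corner (Cat E) X D (objects_inclusion E (ob X))"
  proof unfold_locales
    show "has_pullbacks (Cat E)" by (rule has_pullbacks_Cat[OF hp])
    show "\<exists>\<kappa>. is_cotensor (Cat E) A \<kappa>" if "A \<in> Ob (Cat E)" for A
      using Cat_cotensor[OF hp] that by (simp add: Cat_simps)
    show "crossed_internal_category (Cat E) X D" by (rule crossed)
    show "objects_inclusion E (ob X) \<in> Ar (Cat E)" "Cod (Cat E) (objects_inclusion E (ob X)) = ob X"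
      using X0 by (simp_all add: Cat_simps)
    show "(\<beta> \<lhd>\<^bsub>Cat E\<^esub> Trg (Cat E) \<alpha>) \<bullet>\<^bsub>Cat E\<^esub> (Src (Cat E) \<beta> \<rhd>\<^bsub>Cat E\<^esub> \<alpha>) =
        (Trg (Cat E) \<beta> \<rhd>\<^bsub>Cat E\<^esub> \<alpha>) \<bullet>\<^bsub>Cat E\<^esub> (\<beta> \<lhd>\<^bsub>Cat E\<^esub> Src (Cat E) \<alpha>)"
      if "\<alpha> \<in> Cell (Cat E)" "\<beta> \<in> Cell (Cat E)" "Dom (Cat E) (Src (Cat E) \<beta>) = Cod (Cat E) (Src (Cat E) \<alpha>)" for \<alpha> \<beta>
      using interchange_Cat[of \<alpha> \<beta>] that by (simp add: Cat_simps(2-4,7-9))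
    show "\<exists>\<xi>\<in>Cell (Cat E). Cod (Cat E) (Src (Cat E) \<xi>) = Dom (Cat E) p \<and> p \<rhd>\<^bsub>Cat E\<^esub> \<xi> = \<nu> \<and> q \<rhd>\<^bsub>Cat E\<^esub> \<xi> = \<mu>"
      if "is_pullback (Cat E) f g p q" "\<nu> \<in> Cell (Cat E)" "\<mu> \<in> Cell (Cat E)" "Cod (Cat E) (Src (Cat E) \<nu>) = Dom (Cat E) f"
        "Cod (Cat E) (Src (Cat E) \<mu>) = Dom (Cat E) g" "Dom (Cat E) (Src (Cat E) \<nu>) = Dom (Cat E) (Src (Cat E) \<mu>)"
        "f \<rhd>\<^bsub>Cat E\<^esub> \<nu> = g \<rhd>\<^bsub>Cat E\<^esub> \<mu>" for f g p q \<nu> \<mu>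
    proof -
      note P = that(1) and e = that(7)
      have t: "internal_nat_trans E \<nu>" "internal_nat_trans E \<mu>" "fcod (nsrc \<nu>) = fdom f" "fcod (nsrc \<mu>) = fdom g" "fdom (nsrc \<nu>) = fdom (nsrc \<mu>)"
        using that(2-6) by (simp_all add: Cat_simps)
      obtain \<xi> where "internal_nat_trans E \<xi>" "fcod (nsrc \<xi>) = fdom p" "p \<rhd>\<^bsub>Cat E\<^esub> \<xi> = \<nu>" "q \<rhd>\<^bsub>Cat E\<^esub> \<xi> = \<mu>"
        by (rule Cat_pullback_cells[OF hp P t e])
      then show ?thesis unfolding Cat_simps(3,4,7,8) Bex_def by auto
    qed
  qed
qed

end

context category_context
begin

lemma point_Cat [simp]:
  assumes "category_object C A" "x \<in> Ar C" "Cod C x = ob A"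
  shows "point A x \<in> Ar (Cat C)" "Dom (Cat C) (point A x) = disc C (Dom C x)" "Cod (Cat C) (point A x) = A"
  using assms by (simp_all add: Cat_simps)

lemma pcell_Cat [simp]:
  assumes "category_object C A" "f \<in> Ar C" "Cod C f = ar A"
  shows "pcell A f \<in> Cell (Cat C)" "Src (Cat C) (pcell A f) = point A (src A \<cdot> f)" "Trg (Cat C) (pcell A f) = point A (trg A \<cdot> f)"
  using assms by (simp_all add: Cat_simps)

lemma RWhisk_point:
  assumes "internal_nat_trans C \<alpha>" "x \<in> Ar C" "Cod C x = ob A" "A = fdom (nsrc \<alpha>)"
  shows "\<alpha> \<lhd>\<^bsub>Cat C\<^esub> point A x = pcell (fcod (nsrc \<alpha>)) (ncomp \<alpha> \<cdot> x)"
  by (rule cat_cell_eqI) (use assms in \<open>simp_all add: Cat_proj comp_point\<close>)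

lemma LWhisk_pcell:
  assumes "internal_functor C G" "f \<in> Ar C" "Cod C f = ar A" "A = fdom G"
  shows "G \<rhd>\<^bsub>Cat C\<^esub> pcell A f = pcell (fcod G) (fa G \<cdot> f)"
  by (rule cat_cell_eqI) (use assms in \<open>simp_all add: Cat_proj comp_point\<close>)

lemma VComp_pcell:
  assumes "category_object C A" "f \<in> Ar C" "Cod C f = ar A" "g \<in> Ar C" "Cod C g = ar A" "Dom C f = Dom C g" "trg A \<cdot> f = src A \<cdot> g"
  shows "pcell A g \<bullet>\<^bsub>Cat C\<^esub> pcell A f = pcell A (cmp C A g f)"
  by (rule cat_cell_eqI) (use assms in \<open>simp_all add: Cat_proj\<close>)

lemma Ident2_point:
  assumes "category_object C A" "x \<in> Ar C" "Cod C x = ob A"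
  shows "Ident2 (Cat C) (point A x) = pcell A (idn A \<cdot> x)"
  by (rule cat_cell_eqI) (use assms in \<open>simp_all add: Cat_proj\<close>)

lemma point_eqI:
  assumes "internal_functor C F" "fdom F = disc C U" "U \<in> Ob C"
  shows "F = point (fcod F) (fo F)"
  by (rule disc_functor_eqI[of _ _ U]) (use assms Dom_fo[OF assms(1)] in simp_all)

lemma pcell_eqI:
  assumes "internal_nat_trans C \<alpha>" "fdom (nsrc \<alpha>) = disc C U" "U \<in> Ob C"
  shows "\<alpha> = pcell (fcod (nsrc \<alpha>)) (ncomp \<alpha>)"
  by (rule disc_cell_eqI[of _ _ U]) (use assms Dom_nt[OF assms(1)] in simp_all)

end

context crossed_category
begin

text \<open>The category in E formed by the objects of all Y_n. For X its arrows are the horizontal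
  ones, the objects of X_1.\<close>

definition row :: "(('o, 'a) simp, ('o, 'a) sfun) simp \<Rightarrow> ('o, 'a) simp" where "row Y = map_simp ob fo Y"

lemma row_simps [simp]: "ob (row Y) = ob (ob Y)" "ar (row Y) = ob (ar Y)" "src (row Y) = fo (src Y)" "trg (row Y) = fo (trg Y)"
  "idn (row Y) = fo (idn Y)"
  by (simp_all add: row_def)

lemma category_object_row [simp]:
  assumes Y: "category_object (Cat E) Y"
  shows "category_object E (row Y)"
  unfolding row_def
proof (rule category_object_map_simp[OF category_Cat Y])
  fix n
  show "is_pullback E (fo (face Y n 0)) (fo (face Y n (n + 1))) (fo (face Y (n + 1) (n + 2))) (fo (face Y (n + 1) 0))"
    by (rule Cat_pullback_degreewise(1)[OF hp K.segal_pullback[OF Y]])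
qed (simp_all add: Cat_simps(1-4) Cat_proj fo_Ident)

lemma cmp_row:
  assumes Y: "category_object (Cat E) Y" and FG: "F \<in> Ar (Cat E)" "G \<in> Ar (Cat E)" "Cod (Cat E) F = ar Y" "Cod (Cat E) G = ar Y"
    "Dom (Cat E) F = Dom (Cat E) G" "trg Y \<cdot>\<^bsub>Cat E\<^esub> F = src Y \<cdot>\<^bsub>Cat E\<^esub> G"
  shows "fo (cmp (Cat E) Y G F) = cmp E (row Y) (fo G) (fo F)"
proof -
  obtain x where x: "x \<in> Ar (Cat E)" "Dom (Cat E) x = Dom (Cat E) F" "Cod (Cat E) x = sob Y 2"
    "face Y 1 2 \<cdot>\<^bsub>Cat E\<^esub> x = F" "face Y 1 0 \<cdot>\<^bsub>Cat E\<^esub> x = G" "face Y 1 1 \<cdot>\<^bsub>Cat E\<^esub> x = cmp (Cat E) Y G F"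
    by (rule K.composable_simplex[OF Y FG])
  have x': "fo x \<in> Ar E" "Cod E (fo x) = sob (row Y) 2" using x(1,3) by (simp_all add: Cat_simps row_def)
  have "fo (face Y 1 2) \<cdot> fo x = fo F" "fo (face Y 1 0) \<cdot> fo x = fo G" "fo (face Y 1 1) \<cdot> fo x = fo (cmp (Cat E) Y G F)"
    using x(4-6)[THEN arg_cong, of fo] by (simp_all add: Cat_proj)
  then show ?thesis using cmp_simplex[OF category_object_row[OF Y] x'] by (simp add: row_def)
qed

lemma K_object [simp]: "category_object E (ob X)" "category_object E (ar X)"
  using K.obar_Ob[OF K.X] by (simp_all add: Cat_simps(1))

lemma X_functor [simp]:
  "internal_functor E (src X)" "fdom (src X) = ar X" "fcod (src X) = ob X"
  "internal_functor E (trg X)" "fdom (trg X) = ar X" "fcod (trg X) = ob X"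
  "internal_functor E (idn X)" "fdom (idn X) = ob X" "fcod (idn X) = ar X"
  using K.src_Ar[OF K.X] K.Dom_src[OF K.X] K.Cod_src[OF K.X] K.trg_Ar[OF K.X] K.Dom_trg[OF K.X] K.Cod_trg[OF K.X]
    K.idn_Ar[OF K.X] K.Dom_idn[OF K.X] K.Cod_idn[OF K.X] by (simp_all add: Cat_simps)

lemma src_idn_fo [simp]: "x \<in> Ar E \<Longrightarrow> Cod E x = ob (ob X) \<Longrightarrow> fo (src X) \<cdot> (fo (idn X) \<cdot> x) = x"
  "x \<in> Ar E \<Longrightarrow> Cod E x = ob (ob X) \<Longrightarrow> fo (trg X) \<cdot> (fo (idn X) \<cdot> x) = x"
  using src_idn[OF category_object_row[OF K.X], of x] trg_idn[OF category_object_row[OF K.X], of x] by simp_all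

lemma src_idn_fa [simp]: "x \<in> Ar E \<Longrightarrow> Cod E x = ar (ob X) \<Longrightarrow> fa (src X) \<cdot> (fa (idn X) \<cdot> x) = x"
  "x \<in> Ar E \<Longrightarrow> Cod E x = ar (ob X) \<Longrightarrow> fa (trg X) \<cdot> (fa (idn X) \<cdot> x) = x"
proof -
  assume x: "x \<in> Ar E" "Cod E x = ar (ob X)"
  have "fa (src X) \<cdot> fa (idn X) = Ident E (ar (ob X))" "fa (trg X) \<cdot> fa (idn X) = Ident E (ar (ob X))"
    by (simp_all only: Cat_proj(4)[symmetric] K.Ident_comp_src[OF K.X] fo_Ident)
  then show "fa (src X) \<cdot> (fa (idn X) \<cdot> x) = x" "fa (trg X) \<cdot> (fa (idn X) \<cdot> x) = x"
    using x by (simp_all add: comp_eq_extend)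
qed

text \<open>The arrow \<lambda> of X_1 out of h over the arrow v of X_0, read off from the chosen
  lift at a point.\<close>

definition lam :: "'a \<Rightarrow> 'a \<Rightarrow> 'a" where "lam h v = ncomp (K.lift (point (ar X) h) (pcell (ob X) v))"

lemma
  assumes "h \<in> Ar E" "v \<in> Ar E" "Cod E h = ob (ar X)" "Cod E v = ar (ob X)" "Dom E v = Dom E h" "src (ob X) \<cdot> v = fo (trg X) \<cdot> h"
  shows lift_point: "K.lift (point (ar X) h) (pcell (ob X) v) = pcell (ar X) (lam h v)"
    and lam: "lam h v \<in> Ar E" "Dom E (lam h v) = Dom E h" "Cod E (lam h v) = ar (ar X)" "src (ar X) \<cdot> lam h v = h" "fa (trg X) \<cdot> lam h v = v"
    and lam_D: "pcell (ar X) (lam h v) \<in> D"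
proof -
  let ?L = "K.lift (point (ar X) h) (pcell (ob X) v)"
  have L: "?L \<in> D" "Src (Cat E) ?L = point (ar X) h" "trg X \<rhd>\<^bsub>Cat E\<^esub> ?L = pcell (ob X) v"
    using K.lift[of "point (ar X) h" "pcell (ob X) v"] assms by (simp_all add: comp_point)
  then have L': "internal_nat_trans E ?L" "nsrc ?L = point (ar X) h"
    using K.D_Cell[OF L(1)] by (simp_all add: Cat_simps)
  show l: "lam h v \<in> Ar E" "Dom E (lam h v) = Dom E h" "Cod E (lam h v) = ar (ar X)" "src (ar X) \<cdot> lam h v = h" "fa (trg X) \<cdot> lam h v = v"
    using L' assms src_nt[OF L'(1), of "ar X"] L(3)[THEN arg_cong, of ncomp] unfolding lam_def by (simp_all add: Cat_proj)
  show e: "?L = pcell (ar X) (lam h v)"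
    using pcell_eqI[OF L'(1), of "Dom E h"] L'(2) assms unfolding lam_def by simp
  show "pcell (ar X) (lam h v) \<in> D" using L(1) unfolding e .
qed

lemma lam_idn:
  assumes "v \<in> Ar E" "Cod E v = ar (ob X)"
  shows "lam (fo (idn X) \<cdot> (src (ob X) \<cdot> v)) v = fa (idn X) \<cdot> v"
proof -
  have "K.lift (idn X \<cdot>\<^bsub>Cat E\<^esub> point (ob X) (src (ob X) \<cdot> v)) (pcell (ob X) v) = pcell (ar X) (fa (idn X) \<cdot> v)"
    using K.lift_idn[of "pcell (ob X) v"] assms by (simp add: LWhisk_pcell)
  then show ?thesis using assms by (simp add: lam_def comp_point)
qed

lemma lam_id:
  assumes "h \<in> Ar E" "Cod E h = ob (ar X)"
  shows "lam h (idn (ob X) \<cdot> (fo (trg X) \<cdot> h)) = idn (ar X) \<cdot> h"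
proof -
  have "K.lift (point (ar X) h) (pcell (ob X) (idn (ob X) \<cdot> (fo (trg X) \<cdot> h))) = pcell (ar X) (idn (ar X) \<cdot> h)"
    using K.lift_Ident2[of "point (ar X) h"] assms by (simp add: comp_point Ident2_point)
  then show ?thesis by (simp add: lam_def)
qed

text \<open>Opcartesianness of the chosen lift is applied to \<sigma> itself, with an identity as
  the prescribed 2-cell in X_0; hence the second factor \<chi> lies over an identity.\<close>

lemma lam_opcartesian:
  assumes h: "h \<in> Ar E" "Cod E h = ob (ar X)" and \<sigma>: "\<sigma> \<in> Ar E" "Cod E \<sigma> = ar (ar X)" "src (ar X) \<cdot> \<sigma> = h"
  obtains \<chi> where "\<chi> \<in> Ar E" "Dom E \<chi> = Dom E \<sigma>" "Cod E \<chi> = ar (ar X)" "src (ar X) \<cdot> \<chi> = trg (ar X) \<cdot> lam h (fa (trg X) \<cdot> \<sigma>)"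
    "trg (ar X) \<cdot> \<chi> = trg (ar X) \<cdot> \<sigma>" "cmp E (ar X) \<chi> (lam h (fa (trg X) \<cdot> \<sigma>)) = \<sigma>"
    "fa (trg X) \<cdot> \<chi> = idn (ob X) \<cdot> (fo (trg X) \<cdot> (trg (ar X) \<cdot> \<sigma>))"
proof -
  let ?v = "fa (trg X) \<cdot> \<sigma>" and ?w = "fo (trg X) \<cdot> (trg (ar X) \<cdot> \<sigma>)"
  have D: "Dom E h = Dom E \<sigma>" using \<sigma>(3)[THEN arg_cong, of "Dom E"] \<sigma>(1,2) by simp
  have v: "?v \<in> Ar E" "Cod E ?v = ar (ob X)" "Dom E ?v = Dom E h" "src (ob X) \<cdot> ?v = fo (trg X) \<cdot> h"
    using \<sigma> D by simp_all
  note l = lam[OF h(1) v(1) h(2) v(2-4)]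
  let ?\<phi> = "pcell (ar X) (lam h ?v)"
  have tl: "fo (trg X) \<cdot> (trg (ar X) \<cdot> lam h ?v) = ?w"
  proof -
    have "fo (trg X) \<cdot> (trg (ar X) \<cdot> lam h ?v) = trg (ob X) \<cdot> (fa (trg X) \<cdot> lam h ?v)" using l(1-3) by simp
    then show ?thesis unfolding l(5) using \<sigma> by simp
  qed
  have "opcartesian (Cat E) (trg X) ?\<phi>"
    by (rule K.D_opcartesian[OF lam_D[OF h(1) v(1) h(2) v(2-4)]])
  then have op: "\<exists>!\<chi>. \<chi> \<in> cells (Cat E) (Trg (Cat E) ?\<phi>) (Trg (Cat E) \<psi>) \<and> \<chi> \<bullet>\<^bsub>Cat E\<^esub> ?\<phi> = \<psi> \<and> trg X \<rhd>\<^bsub>Cat E\<^esub> \<chi> = \<gamma>"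
    if "\<psi> \<in> Cell (Cat E)" "\<gamma> \<in> Cell (Cat E)" "Src (Cat E) \<psi> = Src (Cat E) ?\<phi>"
      "\<gamma> \<in> cells (Cat E) (trg X \<cdot>\<^bsub>Cat E\<^esub> Trg (Cat E) ?\<phi>) (trg X \<cdot>\<^bsub>Cat E\<^esub> Trg (Cat E) \<psi>)"
      "\<gamma> \<bullet>\<^bsub>Cat E\<^esub> (trg X \<rhd>\<^bsub>Cat E\<^esub> ?\<phi>) = trg X \<rhd>\<^bsub>Cat E\<^esub> \<psi>" for \<psi> \<gamma>
    using that unfolding opcartesian_def by blast
  have ty: "?w \<in> Ar E" "Cod E ?w = ob (ob X)" "idn (ob X) \<cdot> ?w \<in> Ar E" "Cod E (idn (ob X) \<cdot> ?w) = ar (ob X)" "Dom E ?w = Dom E \<sigma>"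
    using \<sigma> by simp_all
  have "\<exists>\<chi>. \<chi> \<in> cells (Cat E) (Trg (Cat E) ?\<phi>) (Trg (Cat E) (pcell (ar X) \<sigma>)) \<and> \<chi> \<bullet>\<^bsub>Cat E\<^esub> ?\<phi> = pcell (ar X) \<sigma> \<and>
    trg X \<rhd>\<^bsub>Cat E\<^esub> \<chi> = pcell (ob X) (idn (ob X) \<cdot> ?w)"
  proof (rule ex1_implies_ex[OF op])
    show "pcell (ob X) (idn (ob X) \<cdot> ?w) \<in> Cell (Cat E)" using ty by simp
    show "pcell (ob X) (idn (ob X) \<cdot> ?w) \<in> cells (Cat E) (trg X \<cdot>\<^bsub>Cat E\<^esub> Trg (Cat E) ?\<phi>) (trg X \<cdot>\<^bsub>Cat E\<^esub> Trg (Cat E) (pcell (ar X) \<sigma>))"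
      using l \<sigma> ty tl by (simp add: cells_def comp_point)
    have "cmp E (ob X) (idn (ob X) \<cdot> ?w) ?v = ?v" using v \<sigma> by simp
    then show "pcell (ob X) (idn (ob X) \<cdot> ?w) \<bullet>\<^bsub>Cat E\<^esub> (trg X \<rhd>\<^bsub>Cat E\<^esub> ?\<phi>) = trg X \<rhd>\<^bsub>Cat E\<^esub> pcell (ar X) \<sigma>"
      using l(1-3) \<sigma> ty v D by (simp add: LWhisk_pcell l(5) VComp_pcell)
  qed (use l \<sigma> ty in \<open>simp_all\<close>)
  then obtain \<chi> where \<chi>: "\<chi> \<in> cells (Cat E) (Trg (Cat E) ?\<phi>) (Trg (Cat E) (pcell (ar X) \<sigma>))" "\<chi> \<bullet>\<^bsub>Cat E\<^esub> ?\<phi> = pcell (ar X) \<sigma>"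
    "trg X \<rhd>\<^bsub>Cat E\<^esub> \<chi> = pcell (ob X) (idn (ob X) \<cdot> ?w)" by blast
  have n: "internal_nat_trans E \<chi>" "nsrc \<chi> = point (ar X) (trg (ar X) \<cdot> lam h ?v)" "ntrg \<chi> = point (ar X) (trg (ar X) \<cdot> \<sigma>)"
    using \<chi>(1) l \<sigma> by (simp_all add: cells_def Cat_simps)
  have ns: "fdom (nsrc \<chi>) = disc E (Dom E \<sigma>)" "fcod (nsrc \<chi>) = ar X" unfolding n(2) using l D \<sigma> by simp_all
  have sx: "src (ar X) \<cdot> ncomp \<chi> = trg (ar X) \<cdot> lam h ?v" "trg (ar X) \<cdot> ncomp \<chi> = trg (ar X) \<cdot> \<sigma>"
    using src_nt[OF n(1) ns(2)] trg_nt[OF n(1) ns(2)] unfolding n(2,3) using l \<sigma> by simp_all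
  have c: "cmp E (ar X) (ncomp \<chi>) (lam h ?v) = \<sigma>"
    using \<chi>(2)[THEN arg_cong, of ncomp] by (simp add: Cat_proj)
  have f: "fa (trg X) \<cdot> ncomp \<chi> = idn (ob X) \<cdot> ?w"
    using \<chi>(3)[THEN arg_cong, of ncomp] by (simp add: Cat_proj)
  show ?thesis
    by (rule that[OF _ _ _ sx c f]) (use n(1) ns \<sigma> in simp_all)
qed

section \<open>Objects and arrows of Y_1\<close>

definition Y1 :: "('o, 'a) simp" where "Y1 = fdom K.rm"
text \<open>The vertical part of a corner is a 2-cell classified by the cotensor; on objects it is
  read off by the component of the universal cell.\<close>

definition Va :: 'a where "Va = ncomp K.\<kappa> \<cdot> (fo K.na \<cdot> fo K.rn)"
definition Ha :: 'a where "Ha = fo K.nb \<cdot> fo K.rn"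

lemma Y1_functors [simp]:
  "internal_nat_trans E K.\<kappa>" "nsrc K.\<kappa> = K.ds" "ntrg K.\<kappa> = K.ct" "fcod K.ds = ob X"
  "internal_functor E K.na" "fcod K.na = fdom K.ds" "internal_functor E K.nb" "fdom K.nb = fdom K.na" "fcod K.nb = ar X"
  "internal_functor E K.rn" "fdom K.rn = Y1" "fcod K.rn = fdom K.na"
  "internal_functor E K.rl" "fdom K.rl = Y1" "fcod K.rl = disc E (ob (ob X))"
  "internal_functor E K.rr" "fdom K.rr = Y1" "fcod K.rr = disc E (ob (ob X))"
  using K.\<kappa> K.nab K.rl_simps K.R_simps by (simp_all add: Cat_simps Y1_def ob_def[of X])

lemma Y1 [simp]: "category_object E Y1" "Dom (Cat E) K.rm = Y1"
  using functor_objects(1)[OF Y1_functors(10)] by (simp_all add: Cat_simps Y1_def)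

lemma VH [simp]: "Va \<in> Ar E" "Dom E Va = ob Y1" "Cod E Va = ar (ob X)" "Ha \<in> Ar E" "Dom E Ha = ob Y1" "Cod E Ha = ob (ar X)"
  by (simp_all add: Va_def Ha_def)

lemma vrt_point:
  assumes "y \<in> Ar E" "Cod E y = ob Y1"
  shows "K.vrt (K.rn \<cdot>\<^bsub>Cat E\<^esub> point Y1 y) = pcell (ob X) (Va \<cdot> y)" "K.hor (K.rn \<cdot>\<^bsub>Cat E\<^esub> point Y1 y) = point (ar X) (Ha \<cdot> y)"
  using assms by (simp_all add: K.vrt_def K.hor_def comp_point RWhisk_point Va_def Ha_def)

lemma rn_point [simp]:
  assumes "y \<in> Ar E" "Cod E y = ob Y1"
  shows "K.rn \<cdot>\<^bsub>Cat E\<^esub> point Y1 y \<in> Ar (Cat E)" "Dom (Cat E) (K.rn \<cdot>\<^bsub>Cat E\<^esub> point Y1 y) = disc E (Dom E y)"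
    "Cod (Cat E) (K.rn \<cdot>\<^bsub>Cat E\<^esub> point Y1 y) = Dom (Cat E) K.na"
  using assms by simp_all

lemma Va_Ha:
  assumes y: "y \<in> Ar E" "Cod E y = ob Y1"
  shows "trg (ob X) \<cdot> (Va \<cdot> y) = fo (src X) \<cdot> (Ha \<cdot> y)" "fo K.rl \<cdot> y = src (ob X) \<cdot> (Va \<cdot> y)" "fo K.rr \<cdot> y = fo (trg X) \<cdot> (Ha \<cdot> y)"
proof -
  note e = rn_point[OF y]
  note v = K.vrt_hor[OF e(1,3)]
  have "ntrg (K.vrt (K.rn \<cdot>\<^bsub>Cat E\<^esub> point Y1 y)) = src X \<cdot>\<^bsub>Cat E\<^esub> K.hor (K.rn \<cdot>\<^bsub>Cat E\<^esub> point Y1 y)"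
    using v(3) by (simp add: Cat_simps(9))
  then have "fo (point (ob X) (trg (ob X) \<cdot> (Va \<cdot> y))) = fo (src X \<cdot>\<^bsub>Cat E\<^esub> point (ar X) (Ha \<cdot> y))"
    unfolding vrt_point[OF y] by simp
  then show "trg (ob X) \<cdot> (Va \<cdot> y) = fo (src X) \<cdot> (Ha \<cdot> y)" using y by (simp add: Cat_proj)
  let ?i = "objects_inclusion E (ob X)"
  have il: "?i \<cdot>\<^bsub>Cat E\<^esub> (K.rl \<cdot>\<^bsub>Cat E\<^esub> point Y1 y) = nsrc (K.vrt (K.rn \<cdot>\<^bsub>Cat E\<^esub> point Y1 y))"
    "?i \<cdot>\<^bsub>Cat E\<^esub> (K.rr \<cdot>\<^bsub>Cat E\<^esub> point Y1 y) = trg X \<cdot>\<^bsub>Cat E\<^esub> K.hor (K.rn \<cdot>\<^bsub>Cat E\<^esub> point Y1 y)"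
    using K.i_legs[of "point Y1 y"] v(2,7) y by (simp_all add: Cat_simps(8))
  show "fo K.rl \<cdot> y = src (ob X) \<cdot> (Va \<cdot> y)" "fo K.rr \<cdot> y = fo (trg X) \<cdot> (Ha \<cdot> y)"
    using il[THEN arg_cong, of fo] y unfolding vrt_point[OF y] by (simp_all add: Cat_proj)
qed

text \<open>Points of Y_1 with equal parts have the same image in N, and the same legs, since the
  legs are the outer ends of the two parts.\<close>

lemma Y1_eqI:
  assumes y: "y \<in> Ar E" "Cod E y = ob Y1" and y': "y' \<in> Ar E" "Cod E y' = ob Y1" and d: "Dom E y = Dom E y'"
    and V: "Va \<cdot> y = Va \<cdot> y'" and H: "Ha \<cdot> y = Ha \<cdot> y'"
  shows "y = y'"
proof -
  have "K.rn \<cdot>\<^bsub>Cat E\<^esub> point Y1 y = K.rn \<cdot>\<^bsub>Cat E\<^esub> point Y1 y'"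
    by (rule K.N_eqI) (use y y' d V H in \<open>simp_all add: vrt_point\<close>)
  moreover have "fo K.rl \<cdot> y = fo K.rl \<cdot> y'" "fo K.rr \<cdot> y = fo K.rr \<cdot> y'"
    using Va_Ha[OF y] Va_Ha[OF y'] V H by simp_all
  ultimately have "point Y1 y = point Y1 y'"
    using y y' d by - (rule K.R_eqI, simp_all add: comp_point)
  then have "fo (point Y1 y) = fo (point Y1 y')" by simp
  then show ?thesis using y y' by simp
qed

lemma Y1_ex:
  assumes v: "v \<in> Ar E" "Cod E v = ar (ob X)" and h: "h \<in> Ar E" "Cod E h = ob (ar X)" and d: "Dom E v = Dom E h"
    and e: "trg (ob X) \<cdot> v = fo (src X) \<cdot> h"
  obtains y where "y \<in> Ar E" "Dom E y = Dom E v" "Cod E y = ob Y1" "Va \<cdot> y = v" "Ha \<cdot> y = h"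
proof -
  let ?e = "K.mkN (pcell (ob X) v) (point (ar X) h)" and ?d = "disc E (ob (ob X))"
  have te: "Trg (Cat E) (pcell (ob X) v) = src X \<cdot>\<^bsub>Cat E\<^esub> point (ar X) h"
    using v h e d by (simp add: comp_point)
  have pr: "pcell (ob X) v \<in> Cell (Cat E)" "Cod (Cat E) (Src (Cat E) (pcell (ob X) v)) = ob X" "point (ar X) h \<in> Ar (Cat E)"
    "Cod (Cat E) (point (ar X) h) = ar X" "Dom (Cat E) (point (ar X) h) = Dom (Cat E) (Src (Cat E) (pcell (ob X) v))"
    "Dom (Cat E) (point (ar X) h) = disc E (Dom E h)"
    using v h d by simp_all
  note m = K.mkN[OF pr(1-5) te]
  have m': "?e \<in> Ar (Cat E)" "Dom (Cat E) ?e = disc E (Dom E h)" "Cod (Cat E) ?e = Dom (Cat E) K.na" "K.vrt ?e = pcell (ob X) v" "K.hor ?e = point (ar X) h"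
    by (fact m(1) trans[OF m(2) pr(6)] m(3-5))+
  have l: "K.nl \<cdot>\<^bsub>Cat E\<^esub> ?e = point (ob X) (src (ob X) \<cdot> v)" "K.nr \<cdot>\<^bsub>Cat E\<^esub> ?e = point (ob X) (fo (trg X) \<cdot> h)"
    unfolding K.vrt_hor(2)[OF m'(1,3), symmetric] K.vrt_hor(7)[OF m'(1,3), symmetric] m'(4,5)
    using v h by (simp_all add: comp_point)
  have D: "Dom (Cat E) (objects_inclusion E (ob X)) = ?d" by (simp add: Cat_simps)
  have il: "objects_inclusion E (ob X) \<cdot>\<^bsub>Cat E\<^esub> point ?d (src (ob X) \<cdot> v) = K.nl \<cdot>\<^bsub>Cat E\<^esub> ?e"
    "objects_inclusion E (ob X) \<cdot>\<^bsub>Cat E\<^esub> point ?d (fo (trg X) \<cdot> h) = K.nr \<cdot>\<^bsub>Cat E\<^esub> ?e"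
    unfolding l using v h by (simp_all add: comp_point)
  \<comment> \<open>The source of v and the target of h lie in the object of objects, where they
    serve as the two legs required by \<open>R_ex\<close>.\<close>
  obtain x where x: "x \<in> Ar (Cat E)" "Dom (Cat E) x = Dom (Cat E) ?e" "Cod (Cat E) x = Dom (Cat E) K.rm" "K.rn \<cdot>\<^bsub>Cat E\<^esub> x = ?e"
    by (rule K.R_ex[of "point ?d (src (ob X) \<cdot> v)" ?e "point ?d (fo (trg X) \<cdot> h)"]) (use il m' v h d D in simp_all)
  have x': "internal_functor E x" "fdom x = disc E (Dom E h)" "fcod x = Y1"
    using x(1-3) m'(2) by (simp_all add: Cat_simps Y1_def)
  have px: "x = point Y1 (fo x)" using point_eqI[OF x'(1,2)] x'(3) h by simp
  have ty: "fo x \<in> Ar E" "Cod E (fo x) = ob Y1" "Dom E (fo x) = Dom E h" using x' by simp_all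
  have "K.vrt (K.rn \<cdot>\<^bsub>Cat E\<^esub> point Y1 (fo x)) = pcell (ob X) v" "K.hor (K.rn \<cdot>\<^bsub>Cat E\<^esub> point Y1 (fo x)) = point (ar X) h"
    unfolding px[symmetric] x(4) by (fact m')+
  then have "pcell (ob X) (Va \<cdot> fo x) = pcell (ob X) v" "point (ar X) (Ha \<cdot> fo x) = point (ar X) h"
    unfolding vrt_point[OF ty(1,2)] .
  from this(1)[THEN arg_cong, of ncomp] this(2)[THEN arg_cong, of fo]
  show ?thesis using that[of "fo x"] ty v h d by simp
qed

text \<open>The legs of Y_1 end in a discrete category and so send r to identities, as
  \<open>corner_cellD\<close> requires. An arrow of Y_1 is thereby reduced to an arrow s of
  X_1.\<close>

lemma Y1_cellD:
  assumes r: "r \<in> Ar E" "Cod E r = ar Y1"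
  obtains s where "s \<in> Ar E" "Dom E s = Dom E r" "Cod E s = ar (ar X)" "src (ar X) \<cdot> s = Ha \<cdot> (src Y1 \<cdot> r)" "trg (ar X) \<cdot> s = Ha \<cdot> (trg Y1 \<cdot> r)"
    "cmp E (ob X) (fa (src X) \<cdot> s) (Va \<cdot> (src Y1 \<cdot> r)) = Va \<cdot> (trg Y1 \<cdot> r)"
    "fa (trg X) \<cdot> s = idn (ob X) \<cdot> (fo (trg X) \<cdot> (Ha \<cdot> (src Y1 \<cdot> r)))"
proof -
  let ?\<rho> = "pcell Y1 r" and ?y = "src Y1 \<cdot> r" and ?y' = "trg Y1 \<cdot> r"
  have y: "?y \<in> Ar E" "Cod E ?y = ob Y1" and y': "?y' \<in> Ar E" "Cod E ?y' = ob Y1" using r by simp_all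
  have dd: "G \<rhd>\<^bsub>Cat E\<^esub> ?\<rho> = Ident2 (Cat E) (G \<cdot>\<^bsub>Cat E\<^esub> Src (Cat E) ?\<rho>)"
    if "internal_functor E G" "fdom G = Y1" "fcod G = disc E (ob (ob X))" for G
  proof -
    have "fa G \<cdot> r = fo G \<cdot> (src Y1 \<cdot> r)"
      using src_fa[OF that(1), of r "disc E (ob (ob X))"] that r fa_Ar[OF that(1)] Cod_fa[OF that(1)] Dom_fa[OF that(1)] by simp
    then show ?thesis
      using that r y by (simp add: LWhisk_pcell comp_point Ident2_point)
  qed
  obtain \<sigma> where \<sigma>: "\<sigma> \<in> Cell (Cat E)" "Src (Cat E) \<sigma> = K.hor (K.rn \<cdot>\<^bsub>Cat E\<^esub> Src (Cat E) ?\<rho>)"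
    "Trg (Cat E) \<sigma> = K.hor (K.rn \<cdot>\<^bsub>Cat E\<^esub> Trg (Cat E) ?\<rho>)"
    "(src X \<rhd>\<^bsub>Cat E\<^esub> \<sigma>) \<bullet>\<^bsub>Cat E\<^esub> K.vrt (K.rn \<cdot>\<^bsub>Cat E\<^esub> Src (Cat E) ?\<rho>) = K.vrt (K.rn \<cdot>\<^bsub>Cat E\<^esub> Trg (Cat E) ?\<rho>)"
    "trg X \<rhd>\<^bsub>Cat E\<^esub> \<sigma> = Ident2 (Cat E) (objects_inclusion E (ob X) \<cdot>\<^bsub>Cat E\<^esub> (K.rr \<cdot>\<^bsub>Cat E\<^esub> Src (Cat E) ?\<rho>))"
    by (rule K.corner_cellD[of ?\<rho>, OF _ _ dd dd]) (use r y in simp_all)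
  have n: "internal_nat_trans E \<sigma>" "nsrc \<sigma> = point (ar X) (Ha \<cdot> ?y)" "ntrg \<sigma> = point (ar X) (Ha \<cdot> ?y')"
    using \<sigma>(1-3) r y y' by (simp_all add: Cat_simps(7-9) vrt_point)
  have t: "fa (trg X) \<cdot> ncomp \<sigma> = idn (ob X) \<cdot> (fo (trg X) \<cdot> (Ha \<cdot> ?y))"
    using \<sigma>(5)[THEN arg_cong, of ncomp] r y Va_Ha(3)[OF y] by (simp add: Cat_proj)
  have c: "cmp E (ob X) (fa (src X) \<cdot> ncomp \<sigma>) (Va \<cdot> ?y) = Va \<cdot> ?y'"
    using \<sigma>(4)[THEN arg_cong, of ncomp] r y y' n by (simp add: Cat_proj vrt_point)
  show ?thesis
    by (rule that[OF _ _ _ _ _ c t]) (use n y y' r src_nt[OF n(1), of "ar X"] trg_nt[OF n(1), of "ar X"] in simp_all)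
qed

text \<open>The right ends of y and y' agree because s lies over an identity, the left ends because
  the source of s is appended at the far end of the vertical part. So \<open>corner_cell_ex\<close>
  applies to the two points.\<close>

lemma Y1_cell_ex:
  assumes y: "y \<in> Ar E" "Cod E y = ob Y1" and y': "y' \<in> Ar E" "Cod E y' = ob Y1" "Dom E y = Dom E y'"
    and s: "s \<in> Ar E" "Dom E s = Dom E y'" "Cod E s = ar (ar X)" "src (ar X) \<cdot> s = Ha \<cdot> y" "trg (ar X) \<cdot> s = Ha \<cdot> y'"
    "cmp E (ob X) (fa (src X) \<cdot> s) (Va \<cdot> y) = Va \<cdot> y'" "fa (trg X) \<cdot> s = idn (ob X) \<cdot> (fo (trg X) \<cdot> (Ha \<cdot> y))"
  obtains r where "r \<in> Ar E" "Dom E r = Dom E y" "Cod E r = ar Y1" "src Y1 \<cdot> r = y" "trg Y1 \<cdot> r = y'"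
proof -
  have "fo (trg X) \<cdot> (src (ar X) \<cdot> s) = src (ob X) \<cdot> (fa (trg X) \<cdot> s)" "fo (trg X) \<cdot> (trg (ar X) \<cdot> s) = trg (ob X) \<cdot> (fa (trg X) \<cdot> s)"
    using s(1-3) by simp_all
  then have rre: "fo K.rr \<cdot> y = fo K.rr \<cdot> y'"
    unfolding s(4,5,7) Va_Ha(3)[OF y] Va_Ha(3)[OF y'(1,2)] using y by simp
  have c: "trg (ob X) \<cdot> (Va \<cdot> y) = src (ob X) \<cdot> (fa (src X) \<cdot> s)" using Va_Ha(1)[OF y] s(1-4) by simp
  have rle: "fo K.rl \<cdot> y = fo K.rl \<cdot> y'"
    unfolding Va_Ha(2)[OF y] Va_Ha(2)[OF y'(1,2)] s(6)[symmetric] using c s(1-3) y y' by simp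
  have ii: "fo K.rr \<cdot> y = fo (trg X) \<cdot> (Ha \<cdot> y)" by (rule Va_Ha(3)[OF y])
  obtain \<rho> where \<rho>: "\<rho> \<in> Cell (Cat E)" "Src (Cat E) \<rho> = point Y1 y" "Trg (Cat E) \<rho> = point Y1 y'"
  proof (rule K.corner_cell_ex[of "point Y1 y" "point Y1 y'" "pcell (ar X) s"])
    show "(src X \<rhd>\<^bsub>Cat E\<^esub> pcell (ar X) s) \<bullet>\<^bsub>Cat E\<^esub> K.vrt (K.rn \<cdot>\<^bsub>Cat E\<^esub> point Y1 y) = K.vrt (K.rn \<cdot>\<^bsub>Cat E\<^esub> point Y1 y')"
      using y y' s(1-3,6) c by (simp add: vrt_point LWhisk_pcell VComp_pcell)
    have "K.rr \<cdot>\<^bsub>Cat E\<^esub> point Y1 y = point (disc E (ob (ob X))) (fo K.rr \<cdot> y)" using y by (simp add: comp_point)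
    then have "objects_inclusion E (ob X) \<cdot>\<^bsub>Cat E\<^esub> (K.rr \<cdot>\<^bsub>Cat E\<^esub> point Y1 y) = point (ob X) (fo (trg X) \<cdot> (Ha \<cdot> y))"
      unfolding ii using y by (simp add: comp_point)
    then show "trg X \<rhd>\<^bsub>Cat E\<^esub> pcell (ar X) s = Ident2 (Cat E) (objects_inclusion E (ob X) \<cdot>\<^bsub>Cat E\<^esub> (K.rr \<cdot>\<^bsub>Cat E\<^esub> point Y1 y))"
      using y s(1-3,7) by (simp add: LWhisk_pcell Ident2_point)
    show "K.rl \<cdot>\<^bsub>Cat E\<^esub> point Y1 y = K.rl \<cdot>\<^bsub>Cat E\<^esub> point Y1 y'" "K.rr \<cdot>\<^bsub>Cat E\<^esub> point Y1 y = K.rr \<cdot>\<^bsub>Cat E\<^esub> point Y1 y'"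
      using y y' rre rle by (simp_all add: comp_point)
  qed (use y y' s(1-5) in \<open>simp_all add: vrt_point\<close>)
  then have n: "internal_nat_trans E \<rho>" "nsrc \<rho> = point Y1 y" "ntrg \<rho> = point Y1 y'" by (simp_all add: Cat_simps(7-9))
  show ?thesis
    by (rule that[of "ncomp \<rho>"]) (use n y y' src_nt[OF n(1), of Y1] trg_nt[OF n(1), of Y1] in simp_all)
qed

end

section \<open>Pullback-stable coequalisers\<close>

context category_context
begin

lemma coequaliserD:
  assumes "is_coequaliser C u v c"
  shows "u \<in> Ar C" "v \<in> Ar C" "Dom C v = Dom C u" "Cod C v = Cod C u" "c \<in> Ar C" "Dom C c = Cod C u" "c \<cdot> u = c \<cdot> v"
  using assms by (simp_all add: is_coequaliser_def)

lemma coequaliser_factor: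
  assumes c: "is_coequaliser C u v c" and h: "h \<in> Ar C" "Dom C h = Cod C u" "h \<cdot> u = h \<cdot> v"
  obtains k where "k \<in> Ar C" "Dom C k = Cod C c" "Cod C k = Cod C h" "k \<cdot> c = h"
proof -
  have "\<forall>h\<in>Ar C. Dom C h = Cod C u \<and> h \<cdot> u = h \<cdot> v \<longrightarrow> (\<exists>!k. k \<in> hom C (Cod C c) (Cod C h) \<and> k \<cdot> c = h)"
    using c unfolding is_coequaliser_def by (elim conjE)
  then have "\<exists>k. k \<in> hom C (Cod C c) (Cod C h) \<and> k \<cdot> c = h" using h by blast
  then show ?thesis using that by auto
qed

lemma coequaliser_epi:
  assumes c: "is_coequaliser C u v c" and k: "k \<in> Ar C" "k' \<in> Ar C" "Dom C k = Cod C c" "Dom C k' = Cod C c" "Cod C k = Cod C k'"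
    "k \<cdot> c = k' \<cdot> c"
  shows "k = k'"
proof -
  note cD = coequaliserD[OF c]
  let ?h = "k' \<cdot> c"
  have "\<forall>h\<in>Ar C. Dom C h = Cod C u \<and> h \<cdot> u = h \<cdot> v \<longrightarrow> (\<exists>!k. k \<in> hom C (Cod C c) (Cod C h) \<and> k \<cdot> c = h)"
    using c unfolding is_coequaliser_def by (elim conjE)
  moreover have "?h \<in> Ar C" "Dom C ?h = Cod C u" "?h \<cdot> u = ?h \<cdot> v" "Cod C ?h = Cod C k'" using cD k by simp_all
  ultimately have "\<exists>!k. k \<in> hom C (Cod C c) (Cod C k') \<and> k \<cdot> c = ?h" by (metis (no_types, lifting))
  then obtain z where "\<forall>k. k \<in> hom C (Cod C c) (Cod C k') \<and> k \<cdot> c = ?h \<longrightarrow> k = z" by (elim ex1E)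
  then have z: "y = z" if "y \<in> hom C (Cod C c) (Cod C k')" "y \<cdot> c = ?h" for y using that by blast
  have "k = z" "k' = z" by (rule z; use k in simp)+
  then show ?thesis by simp
qed

lemma is_coequaliserI:
  assumes "u \<in> Ar C" "v \<in> Ar C" "Dom C v = Dom C u" "Cod C v = Cod C u" "c \<in> Ar C" "Dom C c = Cod C u" "c \<cdot> u = c \<cdot> v"
    and ex: "\<And>h. h \<in> Ar C \<Longrightarrow> Dom C h = Cod C u \<Longrightarrow> h \<cdot> u = h \<cdot> v \<Longrightarrow> \<exists>k. k \<in> Ar C \<and> Dom C k = Cod C c \<and> Cod C k = Cod C h \<and> k \<cdot> c = h"
    and epi: "\<And>k k'. k \<in> Ar C \<Longrightarrow> k' \<in> Ar C \<Longrightarrow> Dom C k = Cod C c \<Longrightarrow> Dom C k' = Cod C c \<Longrightarrow> Cod C k = Cod C k' \<Longrightarrow> k \<cdot> c = k' \<cdot> c \<Longrightarrow> k = k'"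
  shows "is_coequaliser C u v c"
  unfolding is_coequaliser_def
proof (intro conjI ballI impI)
  fix h assume h: "h \<in> Ar C" "Dom C h = Cod C u \<and> h \<cdot> u = h \<cdot> v"
  then obtain k where k: "k \<in> Ar C \<and> Dom C k = Cod C c \<and> Cod C k = Cod C h \<and> k \<cdot> c = h" using ex by blast
  show "\<exists>!k. k \<in> hom C (Cod C c) (Cod C h) \<and> k \<cdot> c = h"
  proof (rule ex1I[of _ k])
    fix y assume "y \<in> hom C (Cod C c) (Cod C h) \<and> y \<cdot> c = h"
    then show "y = k" using k epi[of y k] by simp
  qed (use k in simp)
qed (use assms in simp_all)

lemma slice_simps:
  "p \<in> Ob (slice C B) \<longleftrightarrow> p \<in> Ar C \<and> Cod C p = B"
  "(p, q, h) \<in> Ar (slice C B) \<longleftrightarrow> p \<in> Ar C \<and> q \<in> Ar C \<and> Cod C p = B \<and> Cod C q = B \<and> h \<in> hom C (Dom C p) (Dom C q) \<and> q \<cdot> h = p"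
  "Dom (slice C B) (p, q, h) = p" "Cod (slice C B) (p, q, h) = q"
  "(q', r, k) \<cdot>\<^bsub>slice C B\<^esub> (p, q, h) = (p, r, k \<cdot> h)" "Ident (slice C B) p = (p, p, Ident C (Dom C p))"
  by (simp_all add: slice_def)

lemma category_slice: "category (slice C B)"
  unfolding category_def
proof (intro conjI ballI impI)
  fix A assume "A \<in> Ob (slice C B)"
  then show "Ident (slice C B) A \<in> hom (slice C B) A A" by (simp add: slice_simps)
next
  fix f assume f: "f \<in> Ar (slice C B)"
  obtain p q h where pq: "f = (p, q, h)" by (cases f) auto
  show "Dom (slice C B) f \<in> Ob (slice C B)" "Cod (slice C B) f \<in> Ob (slice C B)"
    "f \<cdot>\<^bsub>slice C B\<^esub> Ident (slice C B) (Dom (slice C B) f) = f" "Ident (slice C B) (Cod (slice C B) f) \<cdot>\<^bsub>slice C B\<^esub> f = f"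
    using f unfolding pq by (simp_all add: slice_simps)
  fix g assume g: "g \<in> Ar (slice C B)"
  obtain p' q' h' where pq': "g = (p', q', h')" by (cases g) auto
  { assume "Dom (slice C B) g = Cod (slice C B) f"
    then show "g \<cdot>\<^bsub>slice C B\<^esub> f \<in> hom (slice C B) (Dom (slice C B) f) (Cod (slice C B) g)"
      using f g comp_eq_extend[of q' h' p' h] unfolding pq pq' by (simp add: slice_simps) }
  fix k assume k: "k \<in> Ar (slice C B)"
    and e: "Dom (slice C B) g = Cod (slice C B) f \<and> Dom (slice C B) k = Cod (slice C B) g"
  obtain p'' q'' h'' where pq'': "k = (p'', q'', h'')" by (cases k) auto
  show "(k \<cdot>\<^bsub>slice C B\<^esub> g) \<cdot>\<^bsub>slice C B\<^esub> f = k \<cdot>\<^bsub>slice C B\<^esub> (g \<cdot>\<^bsub>slice C B\<^esub> f)"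
    using f g k e unfolding pq pq' pq'' by (simp add: slice_simps)
qed

text \<open>The factorisation computed in C is automatically an arrow over the base, because c is
  epi.\<close>

lemma coequaliser_slice:
  assumes c: "is_coequaliser C u v c" and b: "b \<in> Ar C" "Dom C b = Cod C c"
  shows "is_coequaliser (slice C (Cod C b)) (b \<cdot> (c \<cdot> u), b \<cdot> c, u) (b \<cdot> (c \<cdot> u), b \<cdot> c, v) (b \<cdot> c, b, c)"
proof -
  note cD = coequaliserD[OF c]
  interpret S: category_context "slice C (Cod C b)" by unfold_locales (rule category_slice)
  show ?thesis
  proof (rule S.is_coequaliserI)
    fix h assume "h \<in> Ar (slice C (Cod C b))" "Dom (slice C (Cod C b)) h = Cod (slice C (Cod C b)) (b \<cdot> (c \<cdot> u), b \<cdot> c, u)"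
      "h \<cdot>\<^bsub>slice C (Cod C b)\<^esub> (b \<cdot> (c \<cdot> u), b \<cdot> c, u) = h \<cdot>\<^bsub>slice C (Cod C b)\<^esub> (b \<cdot> (c \<cdot> u), b \<cdot> c, v)"
    moreover obtain p t h0 where "h = (p, t, h0)" by (cases h) auto
    ultimately have h: "h = (b \<cdot> c, t, h0)" "t \<in> Ar C" "Cod C t = Cod C b" "h0 \<in> Ar C" "Dom C h0 = Cod C u" "Cod C h0 = Dom C t" "t \<cdot> h0 = b \<cdot> c" "h0 \<cdot> u = h0 \<cdot> v"
      using cD b by (simp_all add: slice_simps)
    obtain k where k: "k \<in> Ar C" "Dom C k = Cod C c" "Cod C k = Cod C h0" "k \<cdot> c = h0" by (rule coequaliser_factor[OF c h(4,5,8)])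
    have "t \<cdot> k = b" by (rule coequaliser_epi[OF c]) (use k h b cD in simp_all)
    then show "\<exists>k. k \<in> Ar (slice C (Cod C b)) \<and> Dom (slice C (Cod C b)) k = Cod (slice C (Cod C b)) (b \<cdot> c, b, c) \<and>
        Cod (slice C (Cod C b)) k = Cod (slice C (Cod C b)) h \<and> k \<cdot>\<^bsub>slice C (Cod C b)\<^esub> (b \<cdot> c, b, c) = h"
      using k h b by (intro exI[of _ "(b, t, k)"]) (simp add: slice_simps)
  next
    fix k k' assume *: "k \<in> Ar (slice C (Cod C b))" "k' \<in> Ar (slice C (Cod C b))" "Dom (slice C (Cod C b)) k = Cod (slice C (Cod C b)) (b \<cdot> c, b, c)"
      "Dom (slice C (Cod C b)) k' = Cod (slice C (Cod C b)) (b \<cdot> c, b, c)" "Cod (slice C (Cod C b)) k = Cod (slice C (Cod C b)) k'"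
      "k \<cdot>\<^bsub>slice C (Cod C b)\<^esub> (b \<cdot> c, b, c) = k' \<cdot>\<^bsub>slice C (Cod C b)\<^esub> (b \<cdot> c, b, c)"
    obtain p t k0 where k: "k = (p, t, k0)" by (cases k) auto
    obtain p' t' k0' where k': "k' = (p', t', k0')" by (cases k') auto
    have "k0 = k0'" by (rule coequaliser_epi[OF c]) (use * k k' b in \<open>simp_all add: slice_simps\<close>)
    then show "k = k'" using * k k' by (simp add: slice_simps)
  qed (use cD b in \<open>simp_all add: slice_simps\<close>)
qed

text \<open>The slice coequaliser is compared with a coequaliser d of the same pair taken in C,
  which also lies over B. In this way pullback stability, formulated in slices, yields coequalisers
  in C.\<close>

lemma slice_coequaliser:
  assumes W: "is_coequaliser (slice C B) (p, q, u) (p, q, v) (q, r, w)" and R: "reflexive_pair C u v" and hc: "has_reflexive_coequalisers C"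
  shows "is_coequaliser C u v w"
proof -
  interpret S: category_context "slice C B" by unfold_locales (rule category_slice)
  note WD = S.coequaliserD[OF W, unfolded slice_simps]
  have t: "p \<in> Ar C" "q \<in> Ar C" "r \<in> Ar C" "Cod C p = B" "Cod C q = B" "Cod C r = B" "u \<in> Ar C" "v \<in> Ar C" "w \<in> Ar C" "Dom C u = Dom C p" "Cod C u = Dom C q"
    "Dom C v = Dom C p" "Cod C v = Dom C q" "Dom C w = Dom C q" "Cod C w = Dom C r" "q \<cdot> u = p" "q \<cdot> v = p" "r \<cdot> w = q" "w \<cdot> u = w \<cdot> v"
    using WD by simp_all
  obtain d where d: "is_coequaliser C u v d" using R hc by (auto simp: has_reflexive_coequalisers_def)
  note dD = coequaliserD[OF d]
  have quv: "q \<cdot> u = q \<cdot> v" using t by simp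
  obtain q' where q': "q' \<in> Ar C" "Dom C q' = Cod C d" "Cod C q' = B" "q' \<cdot> d = q"
    by (rule coequaliser_factor[OF d, of q]) (use t quv in auto)
  have "(q, q', d) \<in> Ar (slice C B)" "Dom (slice C B) (q, q', d) = Cod (slice C B) (p, q, u)"
    "(q, q', d) \<cdot>\<^bsub>slice C B\<^esub> (p, q, u) = (q, q', d) \<cdot>\<^bsub>slice C B\<^esub> (p, q, v)"
    using t q' dD by (simp_all add: slice_simps)
  then obtain K where K: "K \<in> Ar (slice C B)" "Dom (slice C B) K = r" "Cod (slice C B) K = q'" "K \<cdot>\<^bsub>slice C B\<^esub> (q, r, w) = (q, q', d)"
    using S.coequaliser_factor[OF W] by (metis slice_simps(4))
  obtain k where Kk: "K = (r, q', k)" using K(2,3) by (cases K) (simp add: slice_simps)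
  have k: "k \<in> Ar C" "Dom C k = Dom C r" "Cod C k = Cod C d" "k \<cdot> w = d" "q' \<cdot> k = r"
    using K q' unfolding Kk by (simp_all add: slice_simps)
  obtain l where l: "l \<in> Ar C" "Dom C l = Cod C d" "Cod C l = Dom C r" "l \<cdot> d = w"
    by (rule coequaliser_factor[OF d, of w]) (use t in auto)
  have rl: "r \<cdot> l = q'" by (rule coequaliser_epi[OF d]) (use t l q' dD in simp_all)
  \<comment> \<open>The comparisons are k, carrying w to d, and l, carrying d back to w; their
    composite on the side of w is an identity since w is epi in the slice.\<close>
  have "(r, r, l \<cdot> k) = (r, r, Ident C (Dom C r))"
  proof (rule S.coequaliser_epi[OF W])
    have "r \<cdot> (l \<cdot> k) = r" using comp_eq_extend[OF rl, of k] t l k q' by simp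
    then show "(r, r, l \<cdot> k) \<in> Ar (slice C B)" using t l k by (simp add: slice_simps)
    have "(l \<cdot> k) \<cdot> w = w" using l k t dD by simp
    then show "(r, r, l \<cdot> k) \<cdot>\<^bsub>slice C B\<^esub> (q, r, w) = (r, r, Ident C (Dom C r)) \<cdot>\<^bsub>slice C B\<^esub> (q, r, w)"
      using t by (simp add: slice_simps)
  qed (use t in \<open>simp_all add: slice_simps\<close>)
  then have lk: "l \<cdot> k = Ident C (Dom C r)" by simp
  show ?thesis
  proof (rule is_coequaliserI)
    fix h assume h: "h \<in> Ar C" "Dom C h = Cod C u" "h \<cdot> u = h \<cdot> v"
    obtain h' where h': "h' \<in> Ar C" "Dom C h' = Cod C d" "Cod C h' = Cod C h" "h' \<cdot> d = h" by (rule coequaliser_factor[OF d h])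
    then show "\<exists>k. k \<in> Ar C \<and> Dom C k = Cod C w \<and> Cod C k = Cod C h \<and> k \<cdot> w = h"
      using k t by (intro exI[of _ "h' \<cdot> k"]) simp
  next
    fix x y assume x: "x \<in> Ar C" "y \<in> Ar C" "Dom C x = Cod C w" "Dom C y = Cod C w" "Cod C x = Cod C y" "x \<cdot> w = y \<cdot> w"
    have "x \<cdot> l = y \<cdot> l" by (rule coequaliser_epi[OF d]) (use x l dD t in simp_all)
    then have "x \<cdot> (l \<cdot> k) = y \<cdot> (l \<cdot> k)"
      using x l k t comp2_eq_extend[of x l y l k] by simp
    then show "x = y" unfolding lk using x t by simp
  qed (use t in simp_all)
qed

end

locale stable_category = pullback_category +
  assumes ps: "pullback_stable_reflexive_coequalisers C"
begin

lemma hc: "has_reflexive_coequalisers C"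
  using ps by (simp add: pullback_stable_reflexive_coequalisers_def)

text \<open>Pullback stability freed from slices and chosen pullbacks. For a coequaliser c of a
  reflexive pair, over a base via b, the induced map w between arbitrary pullbacks along f is again
  epi. An arrow factors through w once it identifies any two elements with equal first coordinate
  whose second coordinates are linked by an element r of the pair.\<close>

lemma pullback_coequaliser:
  assumes c: "is_coequaliser C u v c" and s: "s \<in> Ar C" "Dom C s = Cod C u" "Cod C s = Dom C u" "u \<cdot> s = Ident C (Cod C u)" "v \<cdot> s = Ident C (Cod C u)"
    and b: "b \<in> Ar C" "Dom C b = Cod C c" and f: "f \<in> Ar C" "Cod C f = Cod C b"
    and P: "is_pullback C f (b \<cdot> c) a1 a2" and P': "is_pullback C f b a1' a2'"
    and w: "w \<in> Ar C" "Dom C w = Dom C a1" "Cod C w = Dom C a1'" "a1' \<cdot> w = a1" "a2' \<cdot> w = c \<cdot> a2"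
  shows "\<And>k k'. \<lbrakk>k \<in> Ar C; k' \<in> Ar C; Dom C k = Dom C a1'; Dom C k' = Dom C a1'; Cod C k = Cod C k'; k \<cdot> w = k' \<cdot> w\<rbrakk> \<Longrightarrow> k = k'"
    and "\<And>h. h \<in> Ar C \<Longrightarrow> Dom C h = Dom C a1 \<Longrightarrow>
      (\<And>x y r. \<lbrakk>x \<in> Ar C; y \<in> Ar C; r \<in> Ar C; Dom C x = Dom C y; Dom C r = Dom C y; Cod C x = Dom C a1; Cod C y = Dom C a1; Cod C r = Dom C u;
         a1 \<cdot> x = a1 \<cdot> y; u \<cdot> r = a2 \<cdot> x; v \<cdot> r = a2 \<cdot> y\<rbrakk> \<Longrightarrow> h \<cdot> x = h \<cdot> y) \<Longrightarrow>
      \<exists>k. k \<in> Ar C \<and> Dom C k = Dom C a1' \<and> Cod C k = Cod C h \<and> k \<cdot> w = h"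
proof -
  note cD = coequaliserD[OF c]
  let ?B = "Cod C f" and ?A = "Dom C f"
  let ?p = "b \<cdot> (c \<cdot> u)" and ?q = "b \<cdot> c"
  define x1 x2 where "x1 = fst (pb C f ?q)" and "x2 = snd (pb C f ?q)"
  define y1 y2 where "y1 = fst (pb C f b)" and "y2 = snd (pb C f b)"
  define z1 z2 where "z1 = fst (pb C f ?p)" and "z2 = snd (pb C f ?p)"
  have X: "is_pullback C f ?q x1 x2" unfolding x1_def x2_def using cD b f by (intro pb_is_pullback[OF hp]) simp_all
  have Y: "is_pullback C f b y1 y2" unfolding y1_def y2_def using cD b f by (intro pb_is_pullback[OF hp]) simp_all
  have Z: "is_pullback C f ?p z1 z2" unfolding z1_def z2_def using cD b f by (intro pb_is_pullback[OF hp]) simp_all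
  have xx: "pb C f ?q = (x1, x2)" "pb C f b = (y1, y2)" "pb C f ?p = (z1, z2)" by (simp_all add: x1_def x2_def y1_def y2_def z1_def z2_def)
  note XD = pullback_Ar[OF X] and YD = pullback_Ar[OF Y] and ZD = pullback_Ar[OF Z] and PD = pullback_Ar[OF P] and PD' = pullback_Ar[OF P']
  let ?u = "pairing C (x1, x2) z1 (u \<cdot> z2)" and ?v = "pairing C (x1, x2) z1 (v \<cdot> z2)" and ?w = "pairing C (y1, y2) x1 (c \<cdot> x2)"
    and ?s = "pairing C (z1, z2) x1 (s \<cdot> x2)"
  have cuv: "c \<cdot> (u \<cdot> z2) = c \<cdot> (v \<cdot> z2)" using comp2_eq_extend[OF cD(7), of z2] cD ZD b by simp
  have eu: "f \<cdot> z1 = ?q \<cdot> (u \<cdot> z2)" "f \<cdot> z1 = ?q \<cdot> (v \<cdot> z2)"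
    using ZD cD b cuv by simp_all
  have cus: "c \<cdot> (u \<cdot> (s \<cdot> x2)) = c \<cdot> x2" "c \<cdot> (v \<cdot> (s \<cdot> x2)) = c \<cdot> x2"
    using comp_eq_extend[OF s(4), of x2] comp_eq_extend[OF s(5), of x2] s XD cD b by simp_all
  have es: "f \<cdot> x1 = ?p \<cdot> (s \<cdot> x2)" "f \<cdot> x1 = b \<cdot> (c \<cdot> x2)"
    using XD cD b s cus by simp_all
  have U: "?u \<in> Ar C" "Dom C ?u = Dom C z1" "Cod C ?u = Dom C x1" "x1 \<cdot> ?u = z1" "x2 \<cdot> ?u = u \<cdot> z2"
    using pairing[OF X _ _ _ _ _ eu(1)] ZD XD cD b by simp_all
  have V: "?v \<in> Ar C" "Dom C ?v = Dom C z1" "Cod C ?v = Dom C x1" "x1 \<cdot> ?v = z1" "x2 \<cdot> ?v = v \<cdot> z2"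
    using pairing[OF X _ _ _ _ _ eu(2)] ZD XD cD b by simp_all
  have W: "?w \<in> Ar C" "Dom C ?w = Dom C x1" "Cod C ?w = Dom C y1" "y1 \<cdot> ?w = x1" "y2 \<cdot> ?w = c \<cdot> x2"
    using pairing[OF Y _ _ _ _ _ es(2)] XD YD cD b by simp_all
  have S: "?s \<in> Ar C" "Dom C ?s = Dom C x1" "Cod C ?s = Dom C z1" "z1 \<cdot> ?s = x1" "z2 \<cdot> ?s = s \<cdot> x2"
    using pairing[OF Z _ _ _ _ _ es(1)] XD ZD cD b s by simp_all
  have sec: "u \<cdot> (s \<cdot> x2) = x2" "v \<cdot> (s \<cdot> x2) = x2"
    using comp_eq_extend[OF s(4), of x2] comp_eq_extend[OF s(5), of x2] s XD cD b by simp_all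
  have "?u \<cdot> ?s = Ident C (Dom C x1)" "?v \<cdot> ?s = Ident C (Dom C x1)"
    by (rule pullback_eqI[OF X]; use U V S XD ZD s cD b sec comp_eq_extend[OF U(4), of ?s] comp_eq_extend[OF U(5), of ?s]
      comp_eq_extend[OF V(4), of ?s] comp_eq_extend[OF V(5), of ?s] in simp)+
  then have R: "reflexive_pair C ?u ?v"
    unfolding reflexive_pair_def using U V S by (intro conjI bexI[of _ ?s]) simp_all
  have rs: "reflexive_pair (slice C ?B) (?p, ?q, u) (?p, ?q, v)"
  proof -
    have bcs: "b \<cdot> (c \<cdot> (u \<cdot> s)) = b \<cdot> c" using s cD b by simp
    show ?thesis
      unfolding reflexive_pair_def
      by (intro conjI bexI[of _ "(?q, ?p, s)"]) (use bcs cD b f s in \<open>simp_all add: slice_simps\<close>)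
  qed
  have "is_coequaliser (slice C ?B) (?p, ?q, u) (?p, ?q, v) (?q, b, c)"
    using coequaliser_slice[OF c b] f by simp
  then have "is_coequaliser (slice C ?A) (pullback_functor C f (?p, ?q, u)) (pullback_functor C f (?p, ?q, v)) (pullback_functor C f (?q, b, c))"
    using ps f rs unfolding pullback_stable_reflexive_coequalisers_def by blast
  then have "is_coequaliser (slice C ?A) (z1, x1, ?u) (z1, x1, ?v) (x1, y1, ?w)"
    by (simp add: pullback_functor_def xx)
  \<comment> \<open>The chosen pullbacks now give a coequaliser in C; the isomorphisms t and
    \<open>o1\<close> transport it to the given pullbacks.\<close>
  from slice_coequaliser[OF this R hc] have CW: "is_coequaliser C ?u ?v ?w" .
  obtain t t' where t: "t \<in> Ar C" "t' \<in> Ar C" "Dom C t' = Cod C t" "Cod C t' = Dom C t" "Dom C t = Dom C a1" "Cod C t = Dom C x1"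
    "t \<cdot> t' = Ident C (Cod C t)" "t' \<cdot> t = Ident C (Dom C t)" "x1 \<cdot> t = a1" "x2 \<cdot> t = a2"
    by (rule pullback_iso[OF X P])
  obtain o1 o2 where o: "o1 \<in> Ar C" "o2 \<in> Ar C" "Dom C o2 = Cod C o1" "Cod C o2 = Dom C o1" "Dom C o1 = Dom C a1'" "Cod C o1 = Dom C y1"
    "o1 \<cdot> o2 = Ident C (Cod C o1)" "o2 \<cdot> o1 = Ident C (Dom C o1)" "y1 \<cdot> o1 = a1'" "y2 \<cdot> o1 = a2'"
    by (rule pullback_iso[OF Y P'])
  have ow: "o1 \<cdot> w = ?w \<cdot> t"
    by (rule pullback_eqI[OF Y])
      (use t o w W XD YD PD PD' cD b comp_eq_extend[OF o(9), of w] comp_eq_extend[OF o(10), of w] comp_eq_extend[OF W(4), of t] comp_eq_extend[OF W(5), of t] in simp_all)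
  have wt: "w \<cdot> t' = o2 \<cdot> ?w"
  proof -
    have "o2 \<cdot> ((o1 \<cdot> w) \<cdot> t') = o2 \<cdot> ((?w \<cdot> t) \<cdot> t')" unfolding ow ..
    moreover have "o2 \<cdot> ((o1 \<cdot> w) \<cdot> t') = w \<cdot> t'"
      using o t w comp_eq_extend[OF o(8), of "w \<cdot> t'"] by simp
    ultimately show ?thesis using o t w W by simp
  qed
  { fix k k' assume k: "k \<in> Ar C" "k' \<in> Ar C" "Dom C k = Dom C a1'" "Dom C k' = Dom C a1'" "Cod C k = Cod C k'" "k \<cdot> w = k' \<cdot> w"
    have "(k \<cdot> w) \<cdot> t' = (k' \<cdot> w) \<cdot> t'" unfolding k(6) ..
    then have "k \<cdot> (o2 \<cdot> ?w) = k' \<cdot> (o2 \<cdot> ?w)" using k(1-5) w t wt by simp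
    then have "k \<cdot> o2 = k' \<cdot> o2" using k(1-5) o W by - (rule coequaliser_epi[OF CW], simp_all)
    then have "k \<cdot> (o2 \<cdot> o1) = k' \<cdot> (o2 \<cdot> o1)" using comp2_eq_extend[of k o2 k' o2 o1] k(1-5) o by simp
    then show "k = k'" using k(1-5) o by simp }
  { fix h assume h: "h \<in> Ar C" "Dom C h = Dom C a1"
      and H: "\<And>x y r. \<lbrakk>x \<in> Ar C; y \<in> Ar C; r \<in> Ar C; Dom C x = Dom C y; Dom C r = Dom C y; Cod C x = Dom C a1; Cod C y = Dom C a1; Cod C r = Dom C u;
         a1 \<cdot> x = a1 \<cdot> y; u \<cdot> r = a2 \<cdot> x; v \<cdot> r = a2 \<cdot> y\<rbrakk> \<Longrightarrow> h \<cdot> x = h \<cdot> y"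
    have at: "a1 \<cdot> t' = x1" "a2 \<cdot> t' = x2"
    proof -
      have "(x1 \<cdot> t) \<cdot> t' = x1" "(x2 \<cdot> t) \<cdot> t' = x2" using t(1-7) XD(3,4,6) by simp_all
      then show "a1 \<cdot> t' = x1" "a2 \<cdot> t' = x2" unfolding t(9,10) .
    qed
    have "h \<cdot> (t' \<cdot> ?u) = h \<cdot> (t' \<cdot> ?v)"
      by (rule H[of _ _ z2]) (use t(1-6) U V ZD(3,4,6,7,8) PD(3,4,6) cD(1-6) b comp_eq_extend[OF at(1)] comp_eq_extend[OF at(2)] in simp_all)
    then have "(h \<cdot> t') \<cdot> ?u = (h \<cdot> t') \<cdot> ?v" using h t U V by simp
    then obtain k where k: "k \<in> Ar C" "Dom C k = Cod C ?w" "Cod C k = Cod C (h \<cdot> t')" "k \<cdot> ?w = h \<cdot> t'"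
      using coequaliser_factor[OF CW, of "h \<cdot> t'"] h t U by auto
    have "(k \<cdot> o1) \<cdot> w = k \<cdot> (?w \<cdot> t)" using k o w W ow by simp
    also have "\<dots> = h" using comp_eq_extend[OF k(4), of t] k h t W by simp
    finally show "\<exists>k. k \<in> Ar C \<and> Dom C k = Dom C a1' \<and> Cod C k = Cod C h \<and> k \<cdot> w = h"
      using k o h t W by (intro exI[of _ "k \<cdot> o1"]) simp }
qed

end

text \<open>Iterating d_0 discards vertices from the front and leaves the last one;
  \<open>last_edge\<close> likewise leaves the last edge of an (n + 1)-simplex.\<close>

primrec last_vertex :: "('o, 'a, 'm) cat_scheme \<Rightarrow> ('o, 'a) simp \<Rightarrow> nat \<Rightarrow> 'a" where
  "last_vertex C Y 0 = Ident C (sob Y 0)"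
| "last_vertex C Y (Suc n) = last_vertex C Y n \<cdot>\<^bsub>C\<^esub> face Y n 0"

primrec last_edge :: "('o, 'a, 'm) cat_scheme \<Rightarrow> ('o, 'a) simp \<Rightarrow> nat \<Rightarrow> 'a" where
  "last_edge C Y 0 = Ident C (sob Y 1)"
| "last_edge C Y (Suc n) = last_edge C Y n \<cdot>\<^bsub>C\<^esub> face Y (n + 1) 0"

context category_context
begin

lemma pullback_paste:
  assumes R: "is_pullback C f g p q" and L: "is_pullback C h p p' q'"
  shows "is_pullback C (f \<cdot> h) g p' (q \<cdot> q')"
proof (rule is_pullbackI)
  note RD = pullback_Ar[OF R] and LD = pullback_Ar[OF L]
  have "f \<cdot> (h \<cdot> p') = f \<cdot> (p \<cdot> q')" using LD by simp
  then show "(f \<cdot> h) \<cdot> p' = g \<cdot> (q \<cdot> q')" using RD(1-8) LD(1-8) pullback_square[OF R, of q'] by simp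
  { fix u v assume uv: "u \<in> Ar C" "v \<in> Ar C" "Dom C u = Dom C v" "Cod C u = Dom C (f \<cdot> h)" "Cod C v = Dom C g" "(f \<cdot> h) \<cdot> u = g \<cdot> v"
    have cu: "Cod C u = Dom C h" using uv RD(1-8) LD(1-8) by simp
    have e: "f \<cdot> (h \<cdot> u) = g \<cdot> v" using uv RD(1-8) LD(1-8) cu by simp
    let ?a = "pairing C (p, q) (h \<cdot> u) v"
    have a: "?a \<in> Ar C" "Dom C ?a = Dom C v" "Cod C ?a = Dom C p" "p \<cdot> ?a = h \<cdot> u" "q \<cdot> ?a = v"
      using pairing[OF R _ _ _ _ _ e] uv(1-3,5) RD(1-8) LD(1-8) cu by simp_all
    let ?b = "pairing C (p', q') u ?a"
    have b: "?b \<in> Ar C" "Dom C ?b = Dom C v" "Cod C ?b = Dom C p'" "p' \<cdot> ?b = u" "q' \<cdot> ?b = ?a"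
      using pairing[OF L _ _ _ _ _ a(4)[symmetric]] a(1-3) uv(1-3) LD(1-8) cu by simp_all
    show "\<exists>w. w \<in> Ar C \<and> Dom C w = Dom C u \<and> Cod C w = Dom C p' \<and> p' \<cdot> w = u \<and> (q \<cdot> q') \<cdot> w = v"
      using a b RD(1-8) LD(1-8) uv(1-3) by (intro exI[of _ ?b]) simp }
  { fix w w' assume w: "w \<in> Ar C" "w' \<in> Ar C" "Dom C w = Dom C w'" "Cod C w = Dom C p'" "Cod C w' = Dom C p'"
      "p' \<cdot> w = p' \<cdot> w'" "(q \<cdot> q') \<cdot> w = (q \<cdot> q') \<cdot> w'"
    have "h \<cdot> (p' \<cdot> w) = p \<cdot> (q' \<cdot> w)" "h \<cdot> (p' \<cdot> w') = p \<cdot> (q' \<cdot> w')"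
      using pullback_square[OF L] w(1-5) by simp_all
    then have pq: "p \<cdot> (q' \<cdot> w) = p \<cdot> (q' \<cdot> w')" unfolding w(6) by simp
    have qq: "q \<cdot> (q' \<cdot> w) = q \<cdot> (q' \<cdot> w')" using w RD(1-8) LD(1-8) by simp
    have "q' \<cdot> w = q' \<cdot> w'"
      by (rule pullback_eqI[OF R]) (use w(1-5) pq qq RD(1-8) LD(1-8) in simp_all)
    then show "w = w'" using w by - (rule pullback_eqI[OF L], simp_all) }
qed (use pullback_Ar(1-8)[OF R] pullback_Ar(1-8)[OF L] in simp_all)

lemma last_Suc:
  "last_vertex C Y (n + 1) = last_vertex C Y n \<cdot> face Y n 0" "last_edge C Y (n + 1) = last_edge C Y n \<cdot> face Y (n + 1) 0"
  using last_vertex.simps(2)[of C Y n] last_edge.simps(2)[of C Y n]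
  by (simp_all only: Suc_eq_plus1)

lemma last_Ar:
  assumes Y: "category_object C Y"
  shows "last_vertex C Y n \<in> Ar C" "Dom C (last_vertex C Y n) = sob Y n" "Cod C (last_vertex C Y n) = ob Y"
    "last_edge C Y n \<in> Ar C" "Dom C (last_edge C Y n) = sob Y (n + 1)" "Cod C (last_edge C Y n) = ar Y"
proof -
  have "last_vertex C Y n \<in> hom C (sob Y n) (ob Y)"
    by (induction n) (use Y face_Ar[OF Y, of 0] in \<open>simp_all add: ob_def Suc_eq_plus1 last_Suc del: last_vertex.simps(2)\<close>)
  moreover have "last_edge C Y n \<in> hom C (sob Y (n + 1)) (ar Y)"
    by (induction n) (use Y face_Ar[OF Y, of 0] in \<open>simp_all add: ar_def Suc_eq_plus1 last_Suc del: last_edge.simps(2)\<close>)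
  ultimately show "last_vertex C Y n \<in> Ar C" "Dom C (last_vertex C Y n) = sob Y n" "Cod C (last_vertex C Y n) = ob Y"
    "last_edge C Y n \<in> Ar C" "Dom C (last_edge C Y n) = sob Y (n + 1)" "Cod C (last_edge C Y n) = ar Y"
    by simp_all
qed

text \<open>Pasting Segal squares exhibits \<open>sob Y (n + 1)\<close> as a pullback of
  \<open>sob Y n\<close> and \<open>ar Y\<close> over the object of objects. For Cnr(X) this base is
  discrete, in contrast to the base \<open>sob Y n\<close> of a general Segal square.\<close>

lemma last_pullback:
  assumes Y: "category_object C Y"
  shows "is_pullback C (last_vertex C Y n) (src Y) (face Y n (n + 1)) (last_edge C Y n)"
proof (induction n)
  case 0
  have "is_pullback C (Ident C (ob Y)) (src Y) (src Y) (Ident C (ar Y))"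
  proof (rule is_pullbackI)
    fix u v assume "u \<in> Ar C" "v \<in> Ar C" "Cod C u = Dom C (Ident C (ob Y))" "Cod C v = Dom C (src Y)" "Ident C (ob Y) \<cdot> u = src Y \<cdot> v"
      "Dom C u = Dom C v"
    then show "\<exists>w. w \<in> Ar C \<and> Dom C w = Dom C u \<and> Cod C w = Dom C (src Y) \<and> src Y \<cdot> w = u \<and> Ident C (ar Y) \<cdot> w = v"
      using Y by (intro exI[of _ v]) simp
  qed (use Y in simp_all)
  then show ?case by (simp add: src_def ob_def ar_def)
next
  case (Suc n)
  have "is_pullback C (last_vertex C Y (n + 1)) (src Y) (face Y (n + 1) (n + 2)) (last_edge C Y (n + 1))"
    using pullback_paste[OF Suc segal_pullback[OF Y, of n]] by (simp add: last_Suc)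
  then show ?case by (simp add: Suc_eq_plus1)
qed

end

context stable_category
begin

section \<open>Connected components and the pullbacks they preserve\<close>

lemma pi0_coequaliser:
  assumes A: "category_object C A"
  shows "is_coequaliser C (src A) (trg A) (pi0_proj C A)"
proof -
  have "reflexive_pair C (src A) (trg A)"
    unfolding reflexive_pair_def using A by (intro conjI bexI[of _ "idn A"]) simp_all
  then have "\<exists>c. is_coequaliser C (face A 0 1) (face A 0 0) c"
    using hc unfolding has_reflexive_coequalisers_def src_def trg_def by blast
  then show ?thesis unfolding pi0_proj_def src_def trg_def by (rule someI_ex)
qed

lemma pi0_proj_Ar [simp]:
  assumes "category_object C A"
  shows "pi0_proj C A \<in> Ar C" "Dom C (pi0_proj C A) = ob A" "Cod C (pi0_proj C A) = pi0 C A" "pi0 C A \<in> Ob C"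
    "pi0_proj C A \<cdot> src A = pi0_proj C A \<cdot> trg A"
  using coequaliserD[OF pi0_coequaliser[OF assms]] assms Cod_Ob[of "pi0_proj C A"] by (simp_all add: pi0_def)

lemma pi0_proj_src:
  assumes "category_object C A" "r \<in> Ar C" "Cod C r = ar A"
  shows "pi0_proj C A \<cdot> (src A \<cdot> r) = pi0_proj C A \<cdot> (trg A \<cdot> r)"
  by (rule comp2_eq_extend[OF pi0_proj_Ar(5)]) (use assms in simp_all)

lemma pi0_epi:
  assumes "category_object C A" "k \<in> Ar C" "k' \<in> Ar C" "Dom C k = pi0 C A" "Dom C k' = pi0 C A" "Cod C k = Cod C k'"
    "k \<cdot> pi0_proj C A = k' \<cdot> pi0_proj C A"
  shows "k = k'"
  by (rule coequaliser_epi[OF pi0_coequaliser[OF assms(1)]]) (use assms in simp_all)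

lemma pi0_factor:
  assumes "category_object C A" "h \<in> Ar C" "Dom C h = ob A" "h \<cdot> src A = h \<cdot> trg A"
  obtains k where "k \<in> Ar C" "Dom C k = pi0 C A" "Cod C k = Cod C h" "k \<cdot> pi0_proj C A = h"
  using coequaliser_factor[OF pi0_coequaliser[OF assms(1)], of h] assms by (metis Cod_src pi0_proj_Ar(3))

lemma pi0_map:
  assumes F: "internal_functor C F"
  shows "pi0_map C F \<in> Ar C" "Dom C (pi0_map C F) = pi0 C (fdom F)" "Cod C (pi0_map C F) = pi0 C (fcod F)"
    "pi0_map C F \<cdot> pi0_proj C (fdom F) = pi0_proj C (fcod F) \<cdot> fo F"
proof -
  have e: "(pi0_proj C (fcod F) \<cdot> fo F) \<cdot> src (fdom F) = (pi0_proj C (fcod F) \<cdot> fo F) \<cdot> trg (fdom F)"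
    using pi0_proj_src[of "fcod F" "fa F"] F by simp
  obtain k where k: "k \<in> Ar C" "Dom C k = pi0 C (fdom F)" "Cod C k = Cod C (pi0_proj C (fcod F) \<cdot> fo F)"
    "k \<cdot> pi0_proj C (fdom F) = pi0_proj C (fcod F) \<cdot> fo F"
    by (rule pi0_factor[of "fdom F", OF _ _ _ e]) (use F in simp_all)
  have "pi0_map C F = k"
    unfolding pi0_map_def
  proof (rule the_equality)
    show "k \<in> hom C (pi0 C (fdom F)) (pi0 C (fcod F)) \<and> k \<cdot> pi0_proj C (fdom F) = pi0_proj C (fcod F) \<cdot> fmap F 0"
      using k F by (simp flip: fo_def)
    fix y assume "y \<in> hom C (pi0 C (fdom F)) (pi0 C (fcod F)) \<and> y \<cdot> pi0_proj C (fdom F) = pi0_proj C (fcod F) \<cdot> fmap F 0"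
    then show "y = k" using k F by - (rule pi0_epi[of "fdom F"], simp_all flip: fo_def)
  qed
  then show "pi0_map C F \<in> Ar C" "Dom C (pi0_map C F) = pi0 C (fdom F)" "Cod C (pi0_map C F) = pi0 C (fcod F)"
    "pi0_map C F \<cdot> pi0_proj C (fdom F) = pi0_proj C (fcod F) \<cdot> fo F"
    using k F by simp_all
qed

lemma pi0_map_proj:
  assumes "internal_functor C F" "y \<in> Ar C" "Cod C y = ob (fdom F)" "A = fdom F"
  shows "pi0_map C F \<cdot> (pi0_proj C A \<cdot> y) = pi0_proj C (fcod F) \<cdot> (fo F \<cdot> y)"
  unfolding assms(4) by (rule comp2_eq_extend[OF pi0_map(4)[OF assms(1)]]) (use assms pi0_map[OF assms(1)] in simp_all)

lemma pi0_map_eqI: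
  assumes "internal_functor C F" "k \<in> Ar C" "Dom C k = pi0 C (fdom F)" "Cod C k = pi0 C (fcod F)"
    "k \<cdot> pi0_proj C (fdom F) = pi0_proj C (fcod F) \<cdot> fo F"
  shows "pi0_map C F = k"
  by (rule pi0_epi[of "fdom F"]) (use assms pi0_map[OF assms(1)] in simp_all)

text \<open>\<open>pi0_proj\<close> is an arbitrary choice of coequaliser, so on a discrete category
  it is an isomorphism but possibly not the identity.\<close>

lemma pi0_disc:
  assumes U: "U \<in> Ob C"
  obtains k where "k \<in> Ar C" "Dom C k = pi0 C (disc C U)" "Cod C k = U" "k \<cdot> pi0_proj C (disc C U) = Ident C U"
    "pi0_proj C (disc C U) \<cdot> k = Ident C (pi0 C (disc C U))"
proof -
  let ?\<pi> = "pi0_proj C (disc C U)"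
  obtain k where k: "k \<in> Ar C" "Dom C k = pi0 C (disc C U)" "Cod C k = Cod C (Ident C U)" "k \<cdot> ?\<pi> = Ident C U"
    by (rule pi0_factor[of "disc C U" "Ident C U"]) (use U in simp_all)
  have "?\<pi> \<cdot> k = Ident C (pi0 C (disc C U))"
    by (rule pi0_epi[of "disc C U"]) (use U k in simp_all)
  then show ?thesis using that k U by simp
qed

text \<open>Let A and B be the domains of l and m. Over a discrete base U the pullback has objects
  A_0 x_U B_0. Replacing A_0 and then B_0 by its components takes one pullback-stable coequaliser
  each; the resulting map to \<pi>_0 A x_U \<pi>_0 B is the quotient by the arrows of the
  pullback.\<close>

theorem pi0_pullback:
  assumes P: "is_pullback (Cat C) l m p q" and U: "U \<in> Ob C" and D: "fcod l = disc C U"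
  shows "is_pullback C (pi0_map C l) (pi0_map C m) (pi0_map C p) (pi0_map C q)"
proof -
  interpret K: category_context "Cat C" by unfold_locales (rule category_Cat)
  let ?A = "fdom l" and ?B = "fdom m" and ?P = "fdom p"
  have F [simp]: "internal_functor C l" "internal_functor C m" "internal_functor C p" "internal_functor C q"
    "fcod m = disc C U" "fcod l = disc C U" "fcod p = ?A" "fcod q = ?B" "fdom q = ?P"
    using K.pullback_Ar[OF P] D by (simp_all add: Cat_simps)
  note P0 = Cat_pullback_degreewise(1)[OF hp P] and P1 = Cat_pullback_degreewise(2)[OF hp P]
  let ?a = "fo l" and ?c = "fo m" and ?\<alpha> = "pi0_proj C ?A" and ?\<beta> = "pi0_proj C ?B" and ?\<pi> = "pi0_proj C ?P"
  \<comment> \<open>A functor into a discrete category sends arrows to identities, so l and m factor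
    through components.\<close>
  have dl: "fa l = ?a \<cdot> src ?A" "?a \<cdot> src ?A = ?a \<cdot> trg ?A" "fa m = ?c \<cdot> src ?B" "?c \<cdot> src ?B = ?c \<cdot> trg ?B"
    using src_fa_arr[OF F(1), of "disc C U"] src_fa_arr[OF F(2), of "disc C U"] fa_Ar[OF F(1)] Cod_fa[OF F(1)] fa_Ar[OF F(2)] Cod_fa[OF F(2)]
    by simp_all
  have ac [simp]: "Cod C ?a = U" "Cod C ?c = U" using Cod_fo[OF F(1)] Cod_fo[OF F(2)] by simp_all
  obtain a' where a': "a' \<in> Ar C" "Dom C a' = pi0 C ?A" "Cod C a' = U" "a' \<cdot> ?\<alpha> = ?a"
    by (rule pi0_factor[of ?A ?a]) (use dl in simp_all)
  obtain c' where c': "c' \<in> Ar C" "Dom C c' = pi0 C ?B" "Cod C c' = U" "c' \<cdot> ?\<beta> = ?c"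
    by (rule pi0_factor[of ?B ?c]) (use dl in simp_all)
  \<comment> \<open>The intermediate object, in which only the category A is replaced by its
    components; in M below both are.\<close>
  obtain n1 n2 where N: "is_pullback C ?c a' n1 n2"
    using pb_is_pullback[OF hp, of ?c a'] a' by auto
  obtain m1 m2 where M: "is_pullback C a' c' m1 m2"
    using pb_is_pullback[OF hp, of a' c'] a' c' by auto
  note ND = pullback_Ar(1-8)[OF N] and MD = pullback_Ar(1-8)[OF M]
  have sq0: "?a \<cdot> fo p = ?c \<cdot> fo q" by (rule pullback_Ar(9)[OF P0])
  have e1: "?c \<cdot> fo q = a' \<cdot> (?\<alpha> \<cdot> fo p)" using comp_eq_extend[OF a'(4), of "fo p"] a' sq0 by simp
  let ?w1 = "pairing C (n1, n2) (fo q) (?\<alpha> \<cdot> fo p)"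
  have w1: "?w1 \<in> Ar C" "Dom C ?w1 = ob ?P" "Cod C ?w1 = Dom C n1" "n1 \<cdot> ?w1 = fo q" "n2 \<cdot> ?w1 = ?\<alpha> \<cdot> fo p"
    using pairing[OF N _ _ _ _ _ e1] a' by simp_all
  have e2: "a' \<cdot> n2 = c' \<cdot> (?\<beta> \<cdot> n1)" using comp_eq_extend[OF c'(4), of n1] c' ND pullback_Ar(9)[OF N] by simp
  let ?w2 = "pairing C (m1, m2) n2 (?\<beta> \<cdot> n1)"
  have w2: "?w2 \<in> Ar C" "Dom C ?w2 = Dom C n1" "Cod C ?w2 = Dom C m1" "m1 \<cdot> ?w2 = n2" "m2 \<cdot> ?w2 = ?\<beta> \<cdot> n1"
    using pairing[OF M _ _ _ _ _ e2] a' c' ND by simp_all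
  let ?w = "?w2 \<cdot> ?w1"
  have w: "?w \<in> Ar C" "Dom C ?w = ob ?P" "Cod C ?w = Dom C m1" "m1 \<cdot> ?w = ?\<alpha> \<cdot> fo p" "m2 \<cdot> ?w = ?\<beta> \<cdot> fo q"
    using w1 w2 MD ND a' c' comp_eq_extend[OF w2(4), of ?w1] comp_eq_extend[OF w2(5), of ?w1] by simp_all
  have secA: "idn ?A \<in> Ar C" "Dom C (idn ?A) = Cod C (src ?A)" "Cod C (idn ?A) = Dom C (src ?A)"
    "src ?A \<cdot> idn ?A = Ident C (Cod C (src ?A))" "trg ?A \<cdot> idn ?A = Ident C (Cod C (src ?A))" by simp_all
  have secB: "idn ?B \<in> Ar C" "Dom C (idn ?B) = Cod C (src ?B)" "Cod C (idn ?B) = Dom C (src ?B)"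
    "src ?B \<cdot> idn ?B = Ident C (Cod C (src ?B))" "trg ?B \<cdot> idn ?B = Ident C (Cod C (src ?B))" by simp_all
  have P0s: "is_pullback C ?c (a' \<cdot> ?\<alpha>) (fo q) (fo p)" unfolding a'(4) by (rule pullback_swap[OF P0])
  have b1: "Dom C a' = Cod C ?\<alpha>" "Cod C ?c = Cod C a'" "Dom C c' = Cod C ?\<beta>" "Cod C a' = Cod C c'" using a' c' by simp_all
  have Ns: "is_pullback C a' (c' \<cdot> ?\<beta>) n2 n1" unfolding c'(4) by (rule pullback_swap[OF N])
  have w1t: "?w1 \<in> Ar C" "Dom C ?w1 = Dom C (fo q)" "Cod C ?w1 = Dom C n1" using w1 by simp_all
  have w2t: "?w2 \<in> Ar C" "Dom C ?w2 = Dom C n2" "Cod C ?w2 = Dom C m1" using w2 ND by simp_all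
  note S1 = pullback_coequaliser[OF pi0_coequaliser[of ?A] secA a'(1) b1(1) fo_Ar[OF F(2)] b1(2) P0s N w1t w1(4,5), simplified]
  note S2 = pullback_coequaliser[OF pi0_coequaliser[of ?B] secB c'(1) b1(3) a'(1) b1(4) Ns M w2t w2(4,5), simplified]
  \<comment> \<open>An arrow of the pullback is a pair of arrows of A and B over the same element of
    U. Pairs with one identity component move a single coordinate.\<close>
  have par: "\<exists>\<rho>. \<rho> \<in> Ar C \<and> Dom C \<rho> = Dom C r \<and> Cod C \<rho> = ar ?P \<and> fa p \<cdot> \<rho> = r \<and> fa q \<cdot> \<rho> = s"
    if "r \<in> Ar C" "s \<in> Ar C" "Dom C r = Dom C s" "Cod C r = ar ?A" "Cod C s = ar ?B" "?a \<cdot> (src ?A \<cdot> r) = ?c \<cdot> (src ?B \<cdot> s)" for r s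
  proof -
    have "fa l \<cdot> r = fa m \<cdot> s" unfolding dl(1,3) using that by simp
    from pairing[OF P1 _ _ _ _ _ this] that show ?thesis by (intro exI[of _ "pairing C (fa p, fa q) r s"]) simp
  qed
  have eqP: "x = y" if "x \<in> Ar C" "y \<in> Ar C" "Dom C x = Dom C y" "Cod C x = ob ?P" "Cod C y = ob ?P" "fo p \<cdot> x = fo p \<cdot> y" "fo q \<cdot> x = fo q \<cdot> y" for x y
    by (rule pullback_eqI[OF P0]) (use that in simp_all)
  have epi: "k = k'" if k: "k \<in> Ar C" "k' \<in> Ar C" "Dom C k = Dom C m1" "Dom C k' = Dom C m1" "Cod C k = Cod C k'" "k \<cdot> ?w = k' \<cdot> ?w" for k k'
  proof -
    have "k \<cdot> ?w2 = k' \<cdot> ?w2" using k w1(1-3) w2(1-3) by - (rule S1(1), simp_all)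
    then show ?thesis using k w2(1-3) by - (rule S2(1), simp_all)
  qed
  have fac: "\<exists>k. k \<in> Ar C \<and> Dom C k = Dom C m1 \<and> Cod C k = Cod C h \<and> k \<cdot> ?w = h"
    if h: "h \<in> Ar C" "Dom C h = ob ?P" "h \<cdot> src ?P = h \<cdot> trg ?P" for h
  proof -
    have hx: "h \<cdot> (src ?P \<cdot> r) = h \<cdot> (trg ?P \<cdot> r)" if "r \<in> Ar C" "Cod C r = ar ?P" for r
      by (rule comp2_eq_extend[OF h(3)]) (use that h in simp_all)
    \<comment> \<open>The coordinate in A moves along an arrow r while the one in B stays fixed; the
      pair of r and an identity is an arrow of the pullback.\<close>
    have "\<exists>k. k \<in> Ar C \<and> Dom C k = Dom C n1 \<and> Cod C k = Cod C h \<and> k \<cdot> ?w1 = h"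
    proof (rule S1(2)[OF h(1,2)])
      fix x y r assume xy: "x \<in> Ar C" "y \<in> Ar C" "r \<in> Ar C" "Dom C x = Dom C y" "Dom C r = Dom C y" "Cod C x = ob ?P" "Cod C y = ob ?P"
        "Cod C r = ar ?A" "fo q \<cdot> x = fo q \<cdot> y" "src ?A \<cdot> r = fo p \<cdot> x" "trg ?A \<cdot> r = fo p \<cdot> y"
      have sqx: "?a \<cdot> (fo p \<cdot> x) = ?c \<cdot> (fo q \<cdot> x)" using pullback_square[OF P0, of x] xy by simp
      obtain \<rho> where \<rho>: "\<rho> \<in> Ar C" "Dom C \<rho> = Dom C r" "Cod C \<rho> = ar ?P" "fa p \<cdot> \<rho> = r" "fa q \<cdot> \<rho> = idn ?B \<cdot> (fo q \<cdot> x)"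
        using par[of r "idn ?B \<cdot> (fo q \<cdot> x)"] xy sqx by auto
      have "fo p \<cdot> (src ?P \<cdot> \<rho>) = src ?A \<cdot> (fa p \<cdot> \<rho>)" "fo q \<cdot> (src ?P \<cdot> \<rho>) = src ?B \<cdot> (fa q \<cdot> \<rho>)"
        "fo p \<cdot> (trg ?P \<cdot> \<rho>) = trg ?A \<cdot> (fa p \<cdot> \<rho>)" "fo q \<cdot> (trg ?P \<cdot> \<rho>) = trg ?B \<cdot> (fa q \<cdot> \<rho>)"
        using \<rho>(1-3) by simp_all
      note c = this[unfolded \<rho>(4,5)]
      have "src ?P \<cdot> \<rho> = x" by (rule eqP) (use c(1,2) \<rho>(1-3) xy in simp_all)
      moreover have "trg ?P \<cdot> \<rho> = y" by (rule eqP) (use c(3,4) \<rho>(1-3) xy in simp_all)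
      ultimately show "h \<cdot> x = h \<cdot> y" using hx[of \<rho>] \<rho>(1-3) by simp
    qed
    then obtain k1 where k1: "k1 \<in> Ar C" "Dom C k1 = Dom C n1" "Cod C k1 = Cod C h" "k1 \<cdot> ?w1 = h" by blast
    \<comment> \<open>That \<open>k1\<close> identifies the ends of arrows of B is a statement over
      T = B_1 x_U \<pi>_0 A, whose elements carry only a component of A. A third stable coequaliser,
      from V = B_1 x_U A_0 to T, reduces it to actual objects of A.\<close>
    obtain t1 t2 where T: "is_pullback C (?c \<cdot> src ?B) a' t1 t2"
      using pb_is_pullback[OF hp, of "?c \<cdot> src ?B" a'] a' by auto
    note TD = pullback_Ar(1-8)[OF T]
    obtain v1 v2 where V: "is_pullback C (?c \<cdot> src ?B) (a' \<cdot> ?\<alpha>) v1 v2"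
      using pb_is_pullback[OF hp, of "?c \<cdot> src ?B" "a' \<cdot> ?\<alpha>"] a' by auto
    note VD = pullback_Ar(1-8)[OF V]
    have Vs: "(?c \<cdot> src ?B) \<cdot> v1 = ?a \<cdot> v2" using pullback_Ar(9)[OF V] unfolding a'(4) .
    have VD': "v1 \<in> Ar C" "v2 \<in> Ar C" "Dom C v2 = Dom C v1" "Cod C v1 = ar ?B" "Cod C v2 = ob ?A"
      using VD a' by simp_all
    have TD': "t1 \<in> Ar C" "t2 \<in> Ar C" "Dom C t2 = Dom C t1" "Cod C t1 = ar ?B" "Cod C t2 = pi0 C ?A"
      using TD a' by simp_all
    have ev: "(?c \<cdot> src ?B) \<cdot> v1 = a' \<cdot> (?\<alpha> \<cdot> v2)" unfolding Vs using comp_eq_extend[OF a'(4), of v2] a' VD' by simp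
    let ?x = "pairing C (t1, t2) v1 (?\<alpha> \<cdot> v2)"
    have x: "?x \<in> Ar C" "Dom C ?x = Dom C v1" "Cod C ?x = Dom C t1" "t1 \<cdot> ?x = v1" "t2 \<cdot> ?x = ?\<alpha> \<cdot> v2"
      using pairing[OF T _ _ _ _ _ ev] VD' a' by simp_all
    have cs: "?c \<cdot> src ?B \<in> Ar C" "Cod C (?c \<cdot> src ?B) = Cod C a'" using a' by simp_all
    note S3 = pullback_coequaliser(1)[OF pi0_coequaliser[of ?A] secA a'(1) b1(1) cs V T x, simplified]
    have en: "?c \<cdot> (src ?B \<cdot> t1) = a' \<cdot> t2" "?c \<cdot> (trg ?B \<cdot> t1) = a' \<cdot> t2"
      using pullback_Ar(9)[OF T] TD' comp2_eq_extend[OF dl(4), of t1] by simp_all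
    let ?y = "pairing C (n1, n2) (src ?B \<cdot> t1) t2" and ?z = "pairing C (n1, n2) (trg ?B \<cdot> t1) t2"
    have y: "?y \<in> Ar C" "Dom C ?y = Dom C t1" "Cod C ?y = Dom C n1" "n1 \<cdot> ?y = src ?B \<cdot> t1" "n2 \<cdot> ?y = t2"
      using pairing[OF N _ _ _ _ _ en(1)] TD' a' by simp_all
    have z: "?z \<in> Ar C" "Dom C ?z = Dom C t1" "Cod C ?z = Dom C n1" "n1 \<cdot> ?z = trg ?B \<cdot> t1" "n2 \<cdot> ?z = t2"
      using pairing[OF N _ _ _ _ _ en(2)] TD' a' by simp_all
    have "k1 \<cdot> ?y = k1 \<cdot> ?z"
    proof (rule S3)
      have av: "?a \<cdot> v2 = ?c \<cdot> (src ?B \<cdot> v1)" using Vs VD' by simp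
      obtain \<rho> where \<rho>: "\<rho> \<in> Ar C" "Dom C \<rho> = Dom C v1" "Cod C \<rho> = ar ?P" "fa p \<cdot> \<rho> = idn ?A \<cdot> v2" "fa q \<cdot> \<rho> = v1"
        using par[of "idn ?A \<cdot> v2" v1] VD' av by auto
      have "fo p \<cdot> (src ?P \<cdot> \<rho>) = src ?A \<cdot> (fa p \<cdot> \<rho>)" "fo q \<cdot> (src ?P \<cdot> \<rho>) = src ?B \<cdot> (fa q \<cdot> \<rho>)"
        "fo p \<cdot> (trg ?P \<cdot> \<rho>) = trg ?A \<cdot> (fa p \<cdot> \<rho>)" "fo q \<cdot> (trg ?P \<cdot> \<rho>) = trg ?B \<cdot> (fa q \<cdot> \<rho>)"
        using \<rho>(1-3) by simp_all
      note c = this[unfolded \<rho>(4,5)]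
      have c': "fo p \<cdot> (src ?P \<cdot> \<rho>) = v2" "fo p \<cdot> (trg ?P \<cdot> \<rho>) = v2" using c(1,3) VD' by simp_all
      have w1x: "n1 \<cdot> (?w1 \<cdot> x) = fo q \<cdot> x" "n2 \<cdot> (?w1 \<cdot> x) = ?\<alpha> \<cdot> (fo p \<cdot> x)" if "x \<in> Ar C" "Cod C x = ob ?P" for x
        using comp_eq_extend[OF w1(4), of x] comp_eq_extend[OF w1(5), of x] w1(1-3) ND that by simp_all
      have yx: "n1 \<cdot> (?y \<cdot> ?x) = src ?B \<cdot> v1" "n2 \<cdot> (?y \<cdot> ?x) = ?\<alpha> \<cdot> v2" "n1 \<cdot> (?z \<cdot> ?x) = trg ?B \<cdot> v1" "n2 \<cdot> (?z \<cdot> ?x) = ?\<alpha> \<cdot> v2"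
        using comp_eq_extend[OF y(4), of ?x] comp_eq_extend[OF y(5), of ?x] comp_eq_extend[OF z(4), of ?x] comp_eq_extend[OF z(5), of ?x]
          x y(1-3) z(1-3) ND TD' by simp_all
      have "?w1 \<cdot> (src ?P \<cdot> \<rho>) = ?y \<cdot> ?x"
        by (rule pullback_eqI[OF N]) (use w1x[of "src ?P \<cdot> \<rho>"] yx c(2) c' \<rho>(1-3) w1(1-3) x(1-3) y(1-3) in simp_all)
      moreover have "?w1 \<cdot> (trg ?P \<cdot> \<rho>) = ?z \<cdot> ?x"
        by (rule pullback_eqI[OF N]) (use w1x[of "trg ?P \<cdot> \<rho>"] yx c(4) c' \<rho>(1-3) w1(1-3) x(1-3) z(1-3) in simp_all)
      moreover have "k1 \<cdot> (?w1 \<cdot> (src ?P \<cdot> \<rho>)) = k1 \<cdot> (?w1 \<cdot> (trg ?P \<cdot> \<rho>))"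
        using hx[of \<rho>] comp_eq_extend[OF k1(4)] k1(1-3) w1(1-3) \<rho>(1-3) by simp
      ultimately show "(k1 \<cdot> ?y) \<cdot> ?x = (k1 \<cdot> ?z) \<cdot> ?x" using k1(1-3) x(1-3) y(1-3) z(1-3) by simp
    qed (use k1(1-3) y(1-3) z(1-3) TD' in simp_all)
    note ky = this
    have "\<exists>k. k \<in> Ar C \<and> Dom C k = Dom C m1 \<and> Cod C k = Cod C k1 \<and> k \<cdot> ?w2 = k1"
    proof (rule S2(2)[OF k1(1)])
      show "Dom C k1 = Dom C n2" using k1 ND by simp
      fix xx yy r assume xy: "xx \<in> Ar C" "yy \<in> Ar C" "r \<in> Ar C" "Dom C xx = Dom C yy" "Dom C r = Dom C yy" "Cod C xx = Dom C n2" "Cod C yy = Dom C n2"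
        "Cod C r = ar ?B" "n2 \<cdot> xx = n2 \<cdot> yy" "src ?B \<cdot> r = n1 \<cdot> xx" "trg ?B \<cdot> r = n1 \<cdot> yy"
      have "?c \<cdot> (n1 \<cdot> xx) = a' \<cdot> (n2 \<cdot> xx)" using pullback_square[OF N, of xx] xy(1-8) ND by simp
      then have er: "(?c \<cdot> src ?B) \<cdot> r = a' \<cdot> (n2 \<cdot> xx)" using xy(1-8,10) by simp
      let ?r = "pairing C (t1, t2) r (n2 \<cdot> xx)"
      have r: "?r \<in> Ar C" "Dom C ?r = Dom C r" "Cod C ?r = Dom C t1" "t1 \<cdot> ?r = r" "t2 \<cdot> ?r = n2 \<cdot> xx"
        using pairing[OF T _ _ _ _ _ er] xy(1-8) ND a' by simp_all
      have "?y \<cdot> ?r = xx"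
        by (rule pullback_eqI[OF N]) (use r y xy ND TD' comp_eq_extend[OF y(4), of ?r] comp_eq_extend[OF y(5), of ?r] in simp_all)
      moreover have "?z \<cdot> ?r = yy"
        by (rule pullback_eqI[OF N]) (use r z xy ND TD' comp_eq_extend[OF z(4), of ?r] comp_eq_extend[OF z(5), of ?r] in simp_all)
      moreover have "k1 \<cdot> (?y \<cdot> ?r) = k1 \<cdot> (?z \<cdot> ?r)"
        by (rule comp2_eq_extend[OF ky]) (use k1(1-3) y(1-3) z(1-3) r(1-3) in simp_all)
      ultimately show "k1 \<cdot> xx = k1 \<cdot> yy" by simp
    qed
    then obtain k2 where k2: "k2 \<in> Ar C" "Dom C k2 = Dom C m1" "Cod C k2 = Cod C k1" "k2 \<cdot> ?w2 = k1" by blast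
    have "k2 \<cdot> ?w = h" using comp_eq_extend[OF k2(4), of ?w1] k1 k2 w1(1-3) w2(1-3) by simp
    then show ?thesis using k1 k2 by auto
  qed
  have "?w \<cdot> src ?P = ?w \<cdot> trg ?P"
  proof (rule pullback_eqI[OF M])
    show "m1 \<cdot> (?w \<cdot> src ?P) = m1 \<cdot> (?w \<cdot> trg ?P)" "m2 \<cdot> (?w \<cdot> src ?P) = m2 \<cdot> (?w \<cdot> trg ?P)"
      using comp_eq_extend[OF w(4), of "src ?P"] comp_eq_extend[OF w(4), of "trg ?P"] comp_eq_extend[OF w(5), of "src ?P"]
        comp_eq_extend[OF w(5), of "trg ?P"] w(1-3) MD a' c' pi0_proj_src[of ?A "fa p"] pi0_proj_src[of ?B "fa q"] by simp_all
  qed (use w(1-3) in simp_all)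
  \<comment> \<open>Both \<open>?w\<close> and \<open>?\<pi>\<close> are universal among the arrows
    that identify the ends of arrows of the pullback, so \<theta> and \<theta>' are mutually
    inverse.\<close>
  then obtain \<theta> where \<theta>: "\<theta> \<in> Ar C" "Dom C \<theta> = pi0 C ?P" "Cod C \<theta> = Cod C ?w" "\<theta> \<cdot> ?\<pi> = ?w"
    using pi0_factor[of ?P ?w] w(1-3) F(3) by (metis functor_objects(1))
  obtain \<theta>' where \<theta>': "\<theta>' \<in> Ar C" "Dom C \<theta>' = Dom C m1" "Cod C \<theta>' = pi0 C ?P" "\<theta>' \<cdot> ?w = ?\<pi>"
    using fac[of ?\<pi>] by auto
  have i1: "\<theta>' \<cdot> \<theta> = Ident C (Dom C \<theta>)"
    by (rule pi0_epi[of ?P]) (use \<theta> \<theta>' w(1-3) in simp_all)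
  have i2: "\<theta> \<cdot> \<theta>' = Ident C (Cod C \<theta>)"
    by (rule epi) (use \<theta> \<theta>' w(1-3) MD in simp_all)
  have "pi0_map C p = m1 \<cdot> \<theta>"
    by (rule pi0_map_eqI) (use \<theta> w MD a' in simp_all)
  moreover have "pi0_map C q = m2 \<cdot> \<theta>"
    by (rule pi0_map_eqI) (use \<theta> w MD a' c' in simp_all)
  ultimately have Q: "is_pullback C a' c' (pi0_map C p) (pi0_map C q)"
    using pullback_iso_transport[OF M \<theta>(1) \<theta>'(1) _ _ _ i2 i1] \<theta> \<theta>' w(1-3) by simp
  \<comment> \<open>So far the square lies over U, whereas \<open>pi0_map\<close> ends in \<pi>_0 of
    the discrete category. Composing both legs with the split mono \<open>?\<delta>\<close> keeps
    the square a pullback.\<close>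
  obtain k where k: "k \<in> Ar C" "Dom C k = pi0 C (disc C U)" "Cod C k = U" "k \<cdot> pi0_proj C (disc C U) = Ident C U"
    by (rule pi0_disc[OF U])
  let ?\<delta> = "pi0_proj C (disc C U)"
  have lm: "pi0_map C l = ?\<delta> \<cdot> a'" "pi0_map C m = ?\<delta> \<cdot> c'"
    by (rule pi0_map_eqI; use a' c' U in simp)+
  note QD = pullback_Ar[OF Q]
  have kx: "k \<cdot> (?\<delta> \<cdot> x) = x" if "x \<in> Ar C" "Cod C x = U" for x
    using comp_eq_extend[OF k(4), of x] k U that by simp
  show ?thesis
    unfolding lm
  proof (rule is_pullbackI)
    show "(?\<delta> \<cdot> a') \<cdot> pi0_map C p = (?\<delta> \<cdot> c') \<cdot> pi0_map C q" using QD a' c' U by simp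
    fix u v assume uv: "u \<in> Ar C" "v \<in> Ar C" "Dom C u = Dom C v" "Cod C u = Dom C (?\<delta> \<cdot> a')" "Cod C v = Dom C (?\<delta> \<cdot> c')"
      "(?\<delta> \<cdot> a') \<cdot> u = (?\<delta> \<cdot> c') \<cdot> v"
    then have uv': "Cod C u = Dom C a'" "Cod C v = Dom C c'" using a' c' U by simp_all
    have "k \<cdot> (?\<delta> \<cdot> (a' \<cdot> u)) = k \<cdot> (?\<delta> \<cdot> (c' \<cdot> v))" using uv(1,2,6) uv' a' c' U by simp
    then have "a' \<cdot> u = c' \<cdot> v" using kx uv(1,2) uv' a' c' by simp
    from pullback_ex1[OF Q uv(1-3) uv' this] show "\<exists>w. w \<in> Ar C \<and> Dom C w = Dom C u \<and> Cod C w = Dom C (pi0_map C p) \<and> pi0_map C p \<cdot> w = u \<and> pi0_map C q \<cdot> w = v"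
      by auto
  qed (use QD(1-8) a' c' U pullback_eqI[OF Q] in simp_all)
qed

text \<open>The base Y_n of a Segal square is in general not discrete, so
  \<open>pi0_pullback\<close> does not apply to it. It applies to the squares of
  \<open>last_pullback\<close>, whose base Y_0 is discrete; two consecutive ones form a rectangle
  from which the Segal square is recovered by \<open>pullback_cancel\<close>.\<close>

theorem pi0_star_category_object:
  assumes Y: "category_object (Cat C) Y" and U: "U \<in> Ob C" "ob Y = disc C U"
  shows "category_object C (pi0_star C Y)"
proof -
  interpret K: category_context "Cat C" by unfold_locales (rule category_Cat)
  note fY = K.face_Ar[OF Y]
  have comp: "pi0_map C (g \<cdot>\<^bsub>Cat C\<^esub> f) = pi0_map C g \<cdot> pi0_map C f"
    if "internal_functor C f" "internal_functor C g" "fdom g = fcod f" for f g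
  proof (rule pi0_map_eqI)
    show "internal_functor C (g \<cdot>\<^bsub>Cat C\<^esub> f)" using that by (simp add: Cat_simps)
    show "(pi0_map C g \<cdot> pi0_map C f) \<cdot> pi0_proj C (fdom (g \<cdot>\<^bsub>Cat C\<^esub> f)) = pi0_proj C (fcod (g \<cdot>\<^bsub>Cat C\<^esub> f)) \<cdot> fo (g \<cdot>\<^bsub>Cat C\<^esub> f)"
    proof -
      have "(pi0_map C g \<cdot> pi0_map C f) \<cdot> pi0_proj C (fdom f) = pi0_map C g \<cdot> (pi0_map C f \<cdot> pi0_proj C (fdom f))"
        using that pi0_map(1-3)[of f] pi0_map(1-3)[of g] by simp
      also have "\<dots> = pi0_proj C (fcod g) \<cdot> (fo g \<cdot> fo f)"
        unfolding pi0_map(4)[OF that(1)] using that by (intro pi0_map_proj) simp_all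
      finally show ?thesis by (simp add: Cat_proj)
    qed
  qed (use that pi0_map(1-3)[of f] pi0_map(1-3)[of g] in \<open>simp_all add: Cat_proj\<close>)
  have id: "pi0_map C (Ident (Cat C) A) = Ident C (pi0 C A)" if "category_object C A" for A
    by (rule pi0_map_eqI) (use that K.Ident_Ar[of A] in \<open>simp_all add: Cat_proj fo_Ident Cat_simps(1,2)\<close>)
  have lp: "is_pullback C (pi0_map C (last_vertex (Cat C) Y n)) (pi0_map C (src Y)) (pi0_map C (face Y n (n + 1))) (pi0_map C (last_edge (Cat C) Y n))" for n
    by (rule pi0_pullback[OF K.last_pullback[OF Y] U(1)]) (use K.last_Ar(3)[OF Y, of n] U(2) in \<open>simp add: Cat_simps\<close>)
  note f' = fY[unfolded Cat_simps] and l' = K.last_Ar[OF Y, unfolded Cat_simps]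
  have "category_object C (map_simp (pi0 C) (pi0_map C) Y)"
  proof (rule category_object_map_simp[OF category_Cat Y])
    fix n
    have "is_pullback C (pi0_map C (face Y n (n + 1))) (pi0_map C (face Y n 0)) (pi0_map C (face Y (n + 1) 0)) (pi0_map C (face Y (n + 1) (n + 2)))"
    proof (rule pullback_cancel[OF pullback_swap[OF lp[of n]]])
      have O: "is_pullback C (pi0_map C (last_vertex (Cat C) Y (n + 1))) (pi0_map C (src Y)) (pi0_map C (face Y (n + 1) (n + 2))) (pi0_map C (last_edge (Cat C) Y (n + 1)))"
        using lp[of "n + 1"] by simp
      have lv: "pi0_map C (last_vertex (Cat C) Y (n + 1)) = pi0_map C (last_vertex (Cat C) Y n) \<cdot> pi0_map C (face Y n 0)"
        unfolding K.last_Suc by (rule comp) (use f'[of 0 n] l'[of n] in simp_all)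
      show "is_pullback C (pi0_map C (src Y)) (pi0_map C (last_vertex (Cat C) Y n) \<cdot> pi0_map C (face Y n 0))
          (pi0_map C (last_edge (Cat C) Y (n + 1))) (pi0_map C (face Y (n + 1) (n + 2)))"
        using pullback_swap[OF O] unfolding lv .
      show "pi0_map C (last_edge (Cat C) Y n) \<cdot> pi0_map C (face Y (n + 1) 0) = pi0_map C (last_edge (Cat C) Y (n + 1))"
        unfolding K.last_Suc by (rule comp[symmetric]) (use f'[of 0 "n + 1"] l'[of n] in simp_all)
      have "pi0_map C (face Y n (n + 1) \<cdot>\<^bsub>Cat C\<^esub> face Y (n + 1) 0) = pi0_map C (face Y n 0 \<cdot>\<^bsub>Cat C\<^esub> face Y (n + 1) (n + 2))"
        using K.face_face_arr[OF Y, of 0 "n + 1" n] by simp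
      then show "pi0_map C (face Y n (n + 1)) \<cdot> pi0_map C (face Y (n + 1) 0) = pi0_map C (face Y n 0) \<cdot> pi0_map C (face Y (n + 1) (n + 2))"
        using comp[of "face Y (n + 1) 0" "face Y n (n + 1)"] comp[of "face Y (n + 1) (n + 2)" "face Y n 0"] f'[of _ n] f'[of _ "n + 1"] by simp
    qed (use f'[of _ n] f'[of _ "n + 1"] l'[of n] l'[of "n + 1"] pi0_map(1-3) in simp_all)
    then show "is_pullback C (pi0_map C (face Y n 0)) (pi0_map C (face Y n (n + 1))) (pi0_map C (face Y (n + 1) (n + 2))) (pi0_map C (face Y (n + 1) 0))"
      by (rule pullback_swap)
  qed (use pi0_map(1-3) comp id in \<open>simp_all add: Cat_simps(1-4)\<close>)
  then show ?thesis by (simp add: map_simp_def pi0_star_def)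
qed

end

context crossed_category
begin

lemma corner_monad_eq: "corner_monad E X D = K.R"
  unfolding corner_monad_def K.R_def K.N_def K.T_def K.S_def unfolding ob_def ..

lemma Cnr_ex: "\<exists>Y. is_Cnr E X D Y"
  using K.corner_category_object_ex by (simp add: is_Cnr_def corner_monad_eq Cat_simps ob_def)

end

section \<open>The codescent object\<close>

text \<open>The formula is to hold for every presentation of Cnr(X), hence Y is fixed
  arbitrarily.\<close>

locale corner_object = crossed_category E X D + stable_category E
  for E :: "('o, 'a) cat" (structure) and X :: "(('o, 'a) simp, ('o, 'a) sfun) simp" and D :: "('o, 'a) snat set" +
  fixes Y :: "(('o, 'a) simp, ('o, 'a) sfun) simp"
  assumes Cnr: "is_Cnr E X D Y"
begin

abbreviation "O0 \<equiv> ob (ob X)"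
abbreviation "V0 \<equiv> ar (ob X)"
abbreviation "H0 \<equiv> ob (ar X)"
abbreviation "S0 \<equiv> ar (ar X)"

lemma Y [simp]: "category_object (Cat E) Y" "ob Y = disc E O0" "ar Y = Y1"
  and Y_arrows: "src Y = K.rl" "trg Y = K.rr" "idn Y = munit K.R"
    "\<lbrakk>F \<in> Ar (Cat E); G \<in> Ar (Cat E); Cod (Cat E) F = Y1; Cod (Cat E) G = Y1; Dom (Cat E) F = Dom (Cat E) G; K.rr \<cdot>\<^bsub>Cat E\<^esub> F = K.rl \<cdot>\<^bsub>Cat E\<^esub> G\<rbrakk> \<Longrightarrow>
      cmp (Cat E) Y G F = K.mR G F"
proof -
  have C: "category_object (Cat E) Y" "monad_of_category_object (Cat E) Y = K.R"
    using Cnr by (simp_all add: is_Cnr_def corner_monad_eq)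
  show "category_object (Cat E) Y" by (rule C)
  show "ob Y = disc E O0" using Cnr by (simp add: is_Cnr_def ob_def)
  show "ar Y = Y1" using K.corner_category_object(4)[OF C] by simp
  show "src Y = K.rl" "trg Y = K.rr" "idn Y = munit K.R"
    using K.corner_category_object(1-3)[OF C] by simp_all
  show "\<lbrakk>F \<in> Ar (Cat E); G \<in> Ar (Cat E); Cod (Cat E) F = Y1; Cod (Cat E) G = Y1; Dom (Cat E) F = Dom (Cat E) G; K.rr \<cdot>\<^bsub>Cat E\<^esub> F = K.rl \<cdot>\<^bsub>Cat E\<^esub> G\<rbrakk> \<Longrightarrow>
      cmp (Cat E) Y G F = K.mR G F"
    using K.corner_category_object(5)[OF C, of F G] unfolding Y1(2) .
qed

lemma O0_Ob [simp]: "O0 \<in> Ob E" "V0 \<in> Ob E" "H0 \<in> Ob E" "S0 \<in> Ob E" "ob Y1 \<in> Ob E" by simp_all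

lemma Y_fo [simp]:
  assumes "y \<in> Ar E" "Cod E y = ob Y1"
  shows "fo (src Y) \<cdot> y = src (ob X) \<cdot> (Va \<cdot> y)" "fo (trg Y) \<cdot> y = fo (trg X) \<cdot> (Ha \<cdot> y)" "trg (ob X) \<cdot> (Va \<cdot> y) = fo (src X) \<cdot> (Ha \<cdot> y)"
  using Va_Ha[OF assms] by (simp_all add: Y_arrows)

definition cY :: "'a \<Rightarrow> 'a \<Rightarrow> 'a" where "cY g f = cmp E (row Y) g f"

text \<open>The composite of two points of Y is a point. Comparing its two parts with those of
  \<open>mN\<close> turns the abstract multiplication into a formula for elements, with
  \<open>lam\<close> as the lift.\<close>

lemma cY:
  assumes y: "y \<in> Ar E" "Cod E y = ob Y1" and y': "y' \<in> Ar E" "Cod E y' = ob Y1" and d: "Dom E y = Dom E y'"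
    and c: "fo (trg X) \<cdot> (Ha \<cdot> y) = src (ob X) \<cdot> (Va \<cdot> y')"
  shows "cY y' y \<in> Ar E" "Dom E (cY y' y) = Dom E y'" "Cod E (cY y' y) = ob Y1"
    "Va \<cdot> cY y' y = cmp E (ob X) (fa (src X) \<cdot> lam (Ha \<cdot> y) (Va \<cdot> y')) (Va \<cdot> y)"
    "Ha \<cdot> cY y' y = cmp E (row X) (Ha \<cdot> y') (trg (ar X) \<cdot> lam (Ha \<cdot> y) (Va \<cdot> y'))"
proof -
  let ?p = "point Y1 y" and ?p' = "point Y1 y'" and ?c = "cY y' y"
  show ty: "?c \<in> Ar E" "Dom E ?c = Dom E y'" "Cod E ?c = ob Y1"
    unfolding cY_def using y y' d c by simp_all
  have rc: "K.rr \<cdot>\<^bsub>Cat E\<^esub> ?p = K.rl \<cdot>\<^bsub>Cat E\<^esub> ?p'"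
    using y y' c Va_Ha[OF y] Va_Ha[OF y'] by (simp add: comp_point)
  have pt: "?p \<in> Ar (Cat E)" "?p' \<in> Ar (Cat E)" "Cod (Cat E) ?p = Y1" "Cod (Cat E) ?p' = Y1" "Dom (Cat E) ?p = Dom (Cat E) ?p'"
    using y y' d by simp_all
  have m: "cmp (Cat E) Y ?p' ?p = K.mR ?p' ?p" by (rule Y_arrows(4)[OF pt rc])
  have pt': "Cod (Cat E) ?p = Dom (Cat E) K.rm" "Cod (Cat E) ?p' = Dom (Cat E) K.rm" using pt unfolding Y1(2) by simp_all
  note mR = K.mR[OF pt(1,2) pt' pt(5) rc]
  have mf: "internal_functor E (K.mR ?p' ?p)" "fdom (K.mR ?p' ?p) = disc E (Dom E y')" "fcod (K.mR ?p' ?p) = Y1"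
    using mR(1-3) y y' d by (simp_all add: Cat_simps Y1_def)
  have "fo (K.mR ?p' ?p) = ?c"
  proof -
    have "fo (cmp (Cat E) Y ?p' ?p) = cmp E (row Y) (fo ?p') (fo ?p)"
      by (rule cmp_row) (use pt rc in \<open>simp_all add: Y_arrows(1,2)\<close>)
    then show ?thesis unfolding m using y y' by (simp add: cY_def)
  qed
  then have e: "K.mR ?p' ?p = point Y1 ?c"
    using point_eqI[OF mf(1,2)] mf(3) y' by simp
  note rnp = rn_point[OF y] and rnp' = rn_point[OF y']
  have dd: "Dom (Cat E) (K.rn \<cdot>\<^bsub>Cat E\<^esub> ?p) = Dom (Cat E) (K.rn \<cdot>\<^bsub>Cat E\<^esub> ?p')" using rnp(2) rnp'(2) d by simp
  note mN = K.mN[OF rnp(1) rnp'(1) rnp(3) rnp'(3) dd K.rn_composable[OF pt(1,2) pt' rc]]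
  have h: "Ha \<cdot> y \<in> Ar E" "Va \<cdot> y' \<in> Ar E" "Cod E (Ha \<cdot> y) = H0" "Cod E (Va \<cdot> y') = V0" "Dom E (Va \<cdot> y') = Dom E (Ha \<cdot> y)"
    "src (ob X) \<cdot> (Va \<cdot> y') = fo (trg X) \<cdot> (Ha \<cdot> y)" using y y' d c by simp_all
  note l = lam[OF h] and lp = lift_point[OF h]
  let ?l = "lam (Ha \<cdot> y) (Va \<cdot> y')"
  have tl: "fo (trg X) \<cdot> (trg (ar X) \<cdot> ?l) = fo (src X) \<cdot> (Ha \<cdot> y')"
  proof -
    have "fo (trg X) \<cdot> (trg (ar X) \<cdot> ?l) = trg (ob X) \<cdot> (fa (trg X) \<cdot> ?l)" using l(1-3) by simp
    then show ?thesis unfolding l(5) using y' by simp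
  qed
  have sl: "src (ob X) \<cdot> (fa (src X) \<cdot> ?l) = trg (ob X) \<cdot> (Va \<cdot> y)" using l(1-4) y by simp
  have "K.vrt (K.rn \<cdot>\<^bsub>Cat E\<^esub> point Y1 ?c) = (src X \<rhd>\<^bsub>Cat E\<^esub> pcell (ar X) ?l) \<bullet>\<^bsub>Cat E\<^esub> pcell (ob X) (Va \<cdot> y)"
    unfolding e[symmetric] mR(6) mN(4) unfolding vrt_point[OF y] vrt_point[OF y'] lp ..
  also have "\<dots> = pcell (ob X) (cmp E (ob X) (fa (src X) \<cdot> ?l) (Va \<cdot> y))"
    using l(1-3) sl y d y' by (simp add: LWhisk_pcell VComp_pcell)
  finally have "ncomp (pcell (ob X) (Va \<cdot> ?c)) = ncomp (pcell (ob X) (cmp E (ob X) (fa (src X) \<cdot> ?l) (Va \<cdot> y)))"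
    unfolding vrt_point[OF ty(1,3)] by (rule arg_cong)
  then show "Va \<cdot> ?c = cmp E (ob X) (fa (src X) \<cdot> ?l) (Va \<cdot> y)" by simp
  have "K.hor (K.rn \<cdot>\<^bsub>Cat E\<^esub> point Y1 ?c) = cmp (Cat E) X (point (ar X) (Ha \<cdot> y')) (Trg (Cat E) (pcell (ar X) ?l))"
    unfolding e[symmetric] mR(6) mN(5) unfolding vrt_point[OF y] vrt_point[OF y'] lp ..
  then have "point (ar X) (Ha \<cdot> ?c) = cmp (Cat E) X (point (ar X) (Ha \<cdot> y')) (point (ar X) (trg (ar X) \<cdot> ?l))"
    unfolding vrt_point[OF ty(1,3)] using l(1-3) by simp
  then have "fo (point (ar X) (Ha \<cdot> ?c)) = fo (cmp (Cat E) X (point (ar X) (Ha \<cdot> y')) (point (ar X) (trg (ar X) \<cdot> ?l)))"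
    by (rule arg_cong)
  also have "\<dots> = cmp E (row X) (fo (point (ar X) (Ha \<cdot> y'))) (fo (point (ar X) (trg (ar X) \<cdot> ?l)))"
    by (rule cmp_row[OF K.X]) (use l(1-3) y y' d tl in \<open>simp_all add: comp_point\<close>)
  finally show "Ha \<cdot> ?c = cmp E (row X) (Ha \<cdot> y') (trg (ar X) \<cdot> ?l)" using l(1-3) y' ty by simp
qed

lemma idn_Y:
  assumes x: "x \<in> Ar E" "Cod E x = O0"
  shows "fo (idn Y) \<cdot> x \<in> Ar E" "Dom E (fo (idn Y) \<cdot> x) = Dom E x" "Cod E (fo (idn Y) \<cdot> x) = ob Y1"
    "Va \<cdot> (fo (idn Y) \<cdot> x) = idn (ob X) \<cdot> x" "Ha \<cdot> (fo (idn Y) \<cdot> x) = fo (idn X) \<cdot> x"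
proof -
  have f: "internal_functor E (idn Y)" "fdom (idn Y) = disc E O0" "fcod (idn Y) = Y1"
    using K.idn_Ar[OF Y(1)] K.Dom_idn[OF Y(1)] K.Cod_idn[OF Y(1)] by (simp_all add: Cat_simps)
  show ty: "fo (idn Y) \<cdot> x \<in> Ar E" "Dom E (fo (idn Y) \<cdot> x) = Dom E x" "Cod E (fo (idn Y) \<cdot> x) = ob Y1"
    using f x by simp_all
  let ?d = "point (disc E O0) x" and ?i = "objects_inclusion E (ob X)"
  have p: "idn Y \<cdot>\<^bsub>Cat E\<^esub> ?d = point Y1 (fo (idn Y) \<cdot> x)" using f x by (simp add: comp_point)
  have ii: "?i \<cdot>\<^bsub>Cat E\<^esub> ?d = point (ob X) x" using x by (simp add: comp_point)
  have ia: "?i \<in> Ar (Cat E)" "Dom (Cat E) ?i = disc E O0" "Cod (Cat E) ?i = ob X" by (simp_all add: Cat_simps)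
  have da: "?d \<in> Ar (Cat E)" "Cod (Cat E) ?d = disc E O0" using x by simp_all
  have ra: "K.rn \<in> Ar (Cat E)" "Dom (Cat E) K.rn = Y1" by (simp_all add: Cat_simps)
  have ya: "idn Y \<in> Ar (Cat E)" "Dom (Cat E) (idn Y) = disc E O0" "Cod (Cat E) (idn Y) = Y1" using f by (simp_all add: Cat_simps)
  have "K.rn \<cdot>\<^bsub>Cat E\<^esub> point Y1 (fo (idn Y) \<cdot> x) = (K.rn \<cdot>\<^bsub>Cat E\<^esub> idn Y) \<cdot>\<^bsub>Cat E\<^esub> ?d"
    unfolding p[symmetric] by (rule K.comp_assoc[symmetric]) (use ra ya da in simp_all)
  also have "\<dots> = munit K.N \<cdot>\<^bsub>Cat E\<^esub> (?i \<cdot>\<^bsub>Cat E\<^esub> ?d)"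
    unfolding Y_arrows(3) K.munit_R(6) by (rule K.comp_assoc) (use ia da K.munit_N_simps(1,2) in simp_all)
  finally have r: "K.rn \<cdot>\<^bsub>Cat E\<^esub> point Y1 (fo (idn Y) \<cdot> x) = munit K.N \<cdot>\<^bsub>Cat E\<^esub> point (ob X) x"
    unfolding ii .
  have px: "point (ob X) x \<in> Ar (Cat E)" "Cod (Cat E) (point (ob X) x) = ob X" using x by simp_all
  have "pcell (ob X) (Va \<cdot> (fo (idn Y) \<cdot> x)) = Ident2 (Cat E) (point (ob X) x)"
    using vrt_point(1)[OF ty(1,3)] K.munit_N_simps(4)[OF px] unfolding r by simp
  then have "pcell (ob X) (Va \<cdot> (fo (idn Y) \<cdot> x)) = pcell (ob X) (idn (ob X) \<cdot> x)" using x by (simp add: Ident2_point)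
  then show "Va \<cdot> (fo (idn Y) \<cdot> x) = idn (ob X) \<cdot> x" by (metis pcell_simps(3))
  have "point (ar X) (Ha \<cdot> (fo (idn Y) \<cdot> x)) = idn X \<cdot>\<^bsub>Cat E\<^esub> point (ob X) x"
    using vrt_point(2)[OF ty(1,3)] K.munit_N_simps(5)[OF px] unfolding r by simp
  then have "fo (point (ar X) (Ha \<cdot> (fo (idn Y) \<cdot> x))) = fo (point (ar X) (fo (idn X) \<cdot> x))" using x by (simp add: comp_point)
  then show "Ha \<cdot> (fo (idn Y) \<cdot> x) = fo (idn X) \<cdot> x" using x ty by simp
qed

text \<open>The corner with components \<open>v\<close> and \<open>h\<close>; the vertical corner \<open>(v, 1)\<close> and the horizontal corner \<open>(1, h)\<close>.\<close>

definition cn :: "'a \<Rightarrow> 'a \<Rightarrow> 'a" where "cn v h = (SOME y. y \<in> hom E (Dom E v) (ob Y1) \<and> Va \<cdot> y = v \<and> Ha \<cdot> y = h)"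
definition vq :: "'a \<Rightarrow> 'a" where "vq v = cn v (fo (idn X) \<cdot> (trg (ob X) \<cdot> v))"
definition hq :: "'a \<Rightarrow> 'a" where "hq h = cn (idn (ob X) \<cdot> (fo (src X) \<cdot> h)) h"

lemma cn [simp]:
  assumes "v \<in> Ar E" "Cod E v = V0" "h \<in> Ar E" "Cod E h = H0" "Dom E v = Dom E h" "trg (ob X) \<cdot> v = fo (src X) \<cdot> h"
  shows "cn v h \<in> Ar E" "Dom E (cn v h) = Dom E h" "Cod E (cn v h) = ob Y1" "Va \<cdot> cn v h = v" "Ha \<cdot> cn v h = h"
proof -
  have "\<exists>y. y \<in> hom E (Dom E v) (ob Y1) \<and> Va \<cdot> y = v \<and> Ha \<cdot> y = h"
    using Y1_ex[OF assms] by (metis hom_iff)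
  from someI_ex[OF this] show "cn v h \<in> Ar E" "Dom E (cn v h) = Dom E h" "Cod E (cn v h) = ob Y1" "Va \<cdot> cn v h = v" "Ha \<cdot> cn v h = h"
    using assms unfolding cn_def by simp_all
qed

lemma vq [simp]:
  assumes "v \<in> Ar E" "Cod E v = V0"
  shows "vq v \<in> Ar E" "Dom E (vq v) = Dom E v" "Cod E (vq v) = ob Y1" "Va \<cdot> vq v = v" "Ha \<cdot> vq v = fo (idn X) \<cdot> (trg (ob X) \<cdot> v)"
  using cn[of v "fo (idn X) \<cdot> (trg (ob X) \<cdot> v)"] assms unfolding vq_def by simp_all

lemma hq [simp]:
  assumes "h \<in> Ar E" "Cod E h = H0"
  shows "hq h \<in> Ar E" "Dom E (hq h) = Dom E h" "Cod E (hq h) = ob Y1" "Va \<cdot> hq h = idn (ob X) \<cdot> (fo (src X) \<cdot> h)" "Ha \<cdot> hq h = h"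
  using cn[of "idn (ob X) \<cdot> (fo (src X) \<cdot> h)" h] assms unfolding hq_def by simp_all

lemma Va_Ha_comp: 
  assumes "y \<in> Ar E" "Cod E y = ob Y1" "x \<in> Ar E" "Cod E x = Dom E y" 
  shows "Va \<cdot> (y \<cdot> x) = (Va \<cdot> y) \<cdot> x" "Ha \<cdot> (y \<cdot> x) = (Ha \<cdot> y) \<cdot> x"
  using assms by simp_all

text \<open>\<open>cn\<close> is picked by choice, but a corner is determined by its two parts, so
  the choice commutes with change of domain.\<close>

lemma vq_comp: "v \<in> Ar E \<Longrightarrow> Cod E v = V0 \<Longrightarrow> x \<in> Ar E \<Longrightarrow> Cod E x = Dom E v \<Longrightarrow> vq v \<cdot> x = vq (v \<cdot> x)"
  by (rule Y1_eqI) (simp_all add: Va_Ha_comp del: comp_assoc, simp_all)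

lemma hq_comp: "h \<in> Ar E \<Longrightarrow> Cod E h = H0 \<Longrightarrow> x \<in> Ar E \<Longrightarrow> Cod E x = Dom E h \<Longrightarrow> hq h \<cdot> x = hq (h \<cdot> x)"
  by (rule Y1_eqI) (simp_all add: Va_Ha_comp del: comp_assoc, simp_all)

lemma rowX_units [simp]:
  assumes "h \<in> Ar E" "Cod E h = H0"
  shows "x = fo (src X) \<cdot> h \<Longrightarrow> cmp E (row X) h (fo (idn X) \<cdot> x) = h" "x = fo (trg X) \<cdot> h \<Longrightarrow> cmp E (row X) (fo (idn X) \<cdot> x) h = h"
  using cmp_idn_right[OF category_object_row[OF K.X], of h x] cmp_idn_left[OF category_object_row[OF K.X], of h x] assms by simp_all

lemma fa_idn_src [simp]: "h \<in> Ar E \<Longrightarrow> Cod E h = H0 \<Longrightarrow> fa (src X) \<cdot> (idn (ar X) \<cdot> h) = idn (ob X) \<cdot> (fo (src X) \<cdot> h)"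
  "h \<in> Ar E \<Longrightarrow> Cod E h = H0 \<Longrightarrow> fa (trg X) \<cdot> (idn (ar X) \<cdot> h) = idn (ob X) \<cdot> (fo (trg X) \<cdot> h)"
  using fa_idn[of "src X" h "ar X"] fa_idn[of "trg X" h "ar X"] by simp_all

text \<open>The first horizontal part is a unit, at which the lift of v' is the image of v' under
  s_0; so only the vertical arrows are composed.\<close>

lemma cY_vq:
  assumes "v \<in> Ar E" "Cod E v = V0" "v' \<in> Ar E" "Cod E v' = V0" "Dom E v = Dom E v'" "trg (ob X) \<cdot> v = src (ob X) \<cdot> v'"
  shows "cY (vq v') (vq v) = vq (cmp E (ob X) v' v)"
proof -
  have c: "fo (trg X) \<cdot> (Ha \<cdot> vq v) = src (ob X) \<cdot> (Va \<cdot> vq v')" using assms by simp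
  have ty: "vq v \<in> Ar E" "Cod E (vq v) = ob Y1" "vq v' \<in> Ar E" "Cod E (vq v') = ob Y1" "Dom E (vq v) = Dom E (vq v')" using assms by simp_all
  note m = cY[OF ty c]
  have l: "lam (Ha \<cdot> vq v) (Va \<cdot> vq v') = fa (idn X) \<cdot> v'" using lam_idn[of v'] assms by simp
  show ?thesis
    by (rule Y1_eqI) (use m(1-3) m(4,5)[unfolded l] assms trg_fa[of "idn X" v' "ar X"] in simp_all)
qed

text \<open>The second vertical part is an identity, whose chosen lift is an identity; so only the
  horizontal arrows are composed.\<close>

lemma cY_hq:
  assumes "h \<in> Ar E" "Cod E h = H0" "k \<in> Ar E" "Cod E k = H0" "Dom E h = Dom E k" "fo (trg X) \<cdot> h = fo (src X) \<cdot> k"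
  shows "cY (hq k) (hq h) = hq (cmp E (row X) k h)"
proof -
  have c: "fo (trg X) \<cdot> (Ha \<cdot> hq h) = src (ob X) \<cdot> (Va \<cdot> hq k)" using assms by simp
  have ty: "hq h \<in> Ar E" "Cod E (hq h) = ob Y1" "hq k \<in> Ar E" "Cod E (hq k) = ob Y1" "Dom E (hq h) = Dom E (hq k)" using assms by simp_all
  note m = cY[OF ty c]
  have l: "lam (Ha \<cdot> hq h) (Va \<cdot> hq k) = idn (ar X) \<cdot> h" using lam_id[of h] assms by simp
  have kh: "cmp E (row X) k h \<in> Ar E" "Dom E (cmp E (row X) k h) = Dom E k" "Cod E (cmp E (row X) k h) = H0" "fo (src X) \<cdot> cmp E (row X) k h = fo (src X) \<cdot> h"
    using cmp_Ar[OF category_object_row[OF K.X], of h k] Dom_cmp[OF category_object_row[OF K.X], of h k]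
      Cod_cmp[OF category_object_row[OF K.X], of h k] src_cmp[OF category_object_row[OF K.X], of h k] assms by simp_all
  show ?thesis
    by (rule Y1_eqI) (use m(1-3) m(4,5)[unfolded l] assms kh in simp_all)
qed

text \<open>In the order vertical, then horizontal, the two middle parts are a unit and an identity.
  Their lift is an identity and the composite keeps both outer parts.\<close>

lemma cY_factor:
  assumes y: "y \<in> Ar E" "Cod E y = ob Y1"
  shows "cY (hq (Ha \<cdot> y)) (vq (Va \<cdot> y)) = y"
proof -
  let ?v = "vq (Va \<cdot> y)" and ?h = "hq (Ha \<cdot> y)"
  have c: "fo (trg X) \<cdot> (Ha \<cdot> ?v) = src (ob X) \<cdot> (Va \<cdot> ?h)" using y by simp
  have ty: "?v \<in> Ar E" "Cod E ?v = ob Y1" "?h \<in> Ar E" "Cod E ?h = ob Y1" "Dom E ?v = Dom E ?h" using y by simp_all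
  note m = cY[OF ty c]
  have l: "lam (Ha \<cdot> ?v) (Va \<cdot> ?h) = idn (ar X) \<cdot> (fo (idn X) \<cdot> (fo (src X) \<cdot> (Ha \<cdot> y)))"
    using lam_id[of "fo (idn X) \<cdot> (fo (src X) \<cdot> (Ha \<cdot> y))"] y by simp
  show ?thesis
    by (rule Y1_eqI) (use m(1-3) m(4,5)[unfolded l] y in simp_all)
qed

text \<open>In the opposite order the lift \<lambda> does not vanish: the outer parts are trivial
  and what remains is the source d_1 \<lambda> followed by the target of \<lambda>.\<close>

lemma cY_vq_hq:
  assumes h: "h \<in> Ar E" "Cod E h = H0" and v: "v \<in> Ar E" "Cod E v = V0" "Dom E v = Dom E h" "src (ob X) \<cdot> v = fo (trg X) \<cdot> h"
  shows "Va \<cdot> cY (vq v) (hq h) = fa (src X) \<cdot> lam h v" "Ha \<cdot> cY (vq v) (hq h) = trg (ar X) \<cdot> lam h v"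
    "cY (vq v) (hq h) \<in> Ar E" "Dom E (cY (vq v) (hq h)) = Dom E h" "Cod E (cY (vq v) (hq h)) = ob Y1"
    "fo (trg X) \<cdot> (trg (ar X) \<cdot> lam h v) = trg (ob X) \<cdot> v"
proof -
  have c: "fo (trg X) \<cdot> (Ha \<cdot> hq h) = src (ob X) \<cdot> (Va \<cdot> vq v)" using h v by simp
  have ty: "hq h \<in> Ar E" "Cod E (hq h) = ob Y1" "vq v \<in> Ar E" "Cod E (vq v) = ob Y1" "Dom E (hq h) = Dom E (vq v)" using h v by simp_all
  note m = cY[OF ty c]
  note l = lam[OF h(1) v(1) h(2) v(2-4)]
  have "fo (trg X) \<cdot> (trg (ar X) \<cdot> lam h v) = trg (ob X) \<cdot> (fa (trg X) \<cdot> lam h v)" using l(1-3) by simp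
  then show tl: "fo (trg X) \<cdot> (trg (ar X) \<cdot> lam h v) = trg (ob X) \<cdot> v" unfolding l(5) .
  have lv: "lam (Ha \<cdot> hq h) (Va \<cdot> vq v) = lam h v" using h v by simp
  have sl: "src (ob X) \<cdot> (fa (src X) \<cdot> lam h v) = fo (src X) \<cdot> h" using l(1-4) by simp
  show "Va \<cdot> cY (vq v) (hq h) = fa (src X) \<cdot> lam h v" unfolding m(4) lv using h v l(1-3) sl by simp
  show "Ha \<cdot> cY (vq v) (hq h) = trg (ar X) \<cdot> lam h v" unfolding m(5) lv using h v l(1-3) tl by simp
  show "cY (vq v) (hq h) \<in> Ar E" "Dom E (cY (vq v) (hq h)) = Dom E h" "Cod E (cY (vq v) (hq h)) = ob Y1"
    using m(1-3) v by simp_all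
qed

section \<open>The quotient Q of Y by components\<close>

definition Q :: "('o, 'a) simp" where "Q = pi0_star E Y"
definition p0 :: 'a where "p0 = pi0_proj E (disc E O0)"
definition p1 :: 'a where "p1 = pi0_proj E Y1"

lemma Q_map: "Q = map_simp (pi0 E) (pi0_map E) Y"
  by (simp add: Q_def pi0_star_def map_simp_def)

lemma Q [simp]: "category_object E Q" "ob Q = pi0 E (disc E O0)" "ar Q = pi0 E Y1"
proof -
  show "category_object E Q" unfolding Q_def by (rule pi0_star_category_object[OF Y(1) _ Y(2)]) simp
qed (simp_all add: Q_map)

lemma p01 [simp]: "p0 \<in> Ar E" "Dom E p0 = O0" "Cod E p0 = ob Q" "p1 \<in> Ar E" "Dom E p1 = ob Y1" "Cod E p1 = ar Q"
  by (simp_all add: p0_def p1_def)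

lemma p1_cell: "r \<in> Ar E \<Longrightarrow> Cod E r = ar Y1 \<Longrightarrow> p1 \<cdot> (src Y1 \<cdot> r) = p1 \<cdot> (trg Y1 \<cdot> r)"
  unfolding p1_def by (rule pi0_proj_src) simp_all

text \<open>The second factor \<chi> of s after the chosen lift \<lambda> lies over an identity and
  so is an arrow of Y_1. It joins the corner of d_1 \<lambda> and the target of \<lambda> to the
  corner of d_1 s and the target of s, and these are the two composites.\<close>

lemma interchange_corner:
  assumes s: "s \<in> Ar E" "Cod E s = S0"
  shows "p1 \<cdot> cY (vq (fa (trg X) \<cdot> s)) (hq (src (ar X) \<cdot> s)) = p1 \<cdot> cY (hq (trg (ar X) \<cdot> s)) (vq (fa (src X) \<cdot> s))"
proof -
  let ?h = "src (ar X) \<cdot> s" and ?v = "fa (trg X) \<cdot> s"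
  have h: "?h \<in> Ar E" "Cod E ?h = H0" and v: "?v \<in> Ar E" "Cod E ?v = V0" "Dom E ?v = Dom E ?h" "src (ob X) \<cdot> ?v = fo (trg X) \<cdot> ?h"
    using s by simp_all
  let ?y1 = "cY (vq ?v) (hq ?h)" and ?y2 = "cn (fa (src X) \<cdot> s) (trg (ar X) \<cdot> s)"
  note y1 = cY_vq_hq[OF h v]
  have y2: "?y2 \<in> Ar E" "Dom E ?y2 = Dom E s" "Cod E ?y2 = ob Y1" "Va \<cdot> ?y2 = fa (src X) \<cdot> s" "Ha \<cdot> ?y2 = trg (ar X) \<cdot> s"
    using cn[of "fa (src X) \<cdot> s" "trg (ar X) \<cdot> s"] s by simp_all
  note l = lam[OF h(1) v(1) h(2) v(2-4)]
  obtain \<chi> where x: "\<chi> \<in> Ar E" "Dom E \<chi> = Dom E s" "Cod E \<chi> = S0" "src (ar X) \<cdot> \<chi> = trg (ar X) \<cdot> lam ?h ?v"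
    "trg (ar X) \<cdot> \<chi> = trg (ar X) \<cdot> s" "cmp E (ar X) \<chi> (lam ?h ?v) = s" "fa (trg X) \<cdot> \<chi> = idn (ob X) \<cdot> (fo (trg X) \<cdot> (trg (ar X) \<cdot> s))"
    by (rule lam_opcartesian[OF h s refl])
  have "fa (src X) \<cdot> cmp E (fdom (src X)) \<chi> (lam ?h ?v) = cmp E (fcod (src X)) (fa (src X) \<cdot> \<chi>) (fa (src X) \<cdot> lam ?h ?v)"
    by (rule fa_cmp) (use x(1-4) l(1-3) s in simp_all)
  then have c: "cmp E (ob X) (fa (src X) \<cdot> \<chi>) (Va \<cdot> ?y1) = Va \<cdot> ?y2"
    unfolding y1(1) y2(4) using x(6) by simp
  have t: "fa (trg X) \<cdot> \<chi> = idn (ob X) \<cdot> (fo (trg X) \<cdot> (Ha \<cdot> ?y1))" unfolding y1(2,6) x(7) using s by simp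
  obtain r where "r \<in> Ar E" "Cod E r = ar Y1" "src Y1 \<cdot> r = ?y1" "trg Y1 \<cdot> r = ?y2"
    by (rule Y1_cell_ex[OF y1(3,5) y2(1,3) _ x(1) _ x(3) _ _ c t]) (use y1(2,4) y2 x(1-5) s in simp_all)
  then have "p1 \<cdot> ?y1 = p1 \<cdot> ?y2" using p1_cell[of r] by simp
  moreover have "?y2 = cY (hq (trg (ar X) \<cdot> s)) (vq (fa (src X) \<cdot> s))"
    using cY_factor[OF y2(1,3)] unfolding y2(4,5) by simp
  ultimately show ?thesis by simp
qed

lemma Q_src:
  assumes y: "y \<in> Ar E" "Cod E y = ob Y1"
  shows "src Q \<cdot> (p1 \<cdot> y) = p0 \<cdot> (src (ob X) \<cdot> (Va \<cdot> y))" "trg Q \<cdot> (p1 \<cdot> y) = p0 \<cdot> (fo (trg X) \<cdot> (Ha \<cdot> y))"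
proof -
  have f: "internal_functor E (src Y)" "fdom (src Y) = Y1" "fcod (src Y) = disc E O0"
    "internal_functor E (trg Y)" "fdom (trg Y) = Y1" "fcod (trg Y) = disc E O0"
    using K.src_Ar[OF Y(1)] K.Dom_src[OF Y(1)] K.Cod_src[OF Y(1)] K.trg_Ar[OF Y(1)] K.Dom_trg[OF Y(1)] K.Cod_trg[OF Y(1)]
    unfolding Y(2,3) Cat_simps(2-4) by blast+
  have yd: "Cod E y = ob (fdom (src Y))" "Cod E y = ob (fdom (trg Y))" unfolding f by (rule y)+
  note m = pi0_map_proj[OF f(1) y(1) yd(1) f(2)[symmetric]] pi0_map_proj[OF f(4) y(1) yd(2) f(5)[symmetric]]
  show "src Q \<cdot> (p1 \<cdot> y) = p0 \<cdot> (src (ob X) \<cdot> (Va \<cdot> y))"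
    unfolding Q_map map_simp_simps p0_def p1_def m(1) f(3) Y_fo(1)[OF y] ..
  show "trg Q \<cdot> (p1 \<cdot> y) = p0 \<cdot> (fo (trg X) \<cdot> (Ha \<cdot> y))"
    unfolding Q_map map_simp_simps p0_def p1_def m(2) f(6) Y_fo(2)[OF y] ..
qed

lemma Q_idn:
  assumes x: "x \<in> Ar E" "Cod E x = O0"
  shows "idn Q \<cdot> (p0 \<cdot> x) = p1 \<cdot> (fo (idn Y) \<cdot> x)"
proof -
  have f: "internal_functor E (idn Y)" "fdom (idn Y) = disc E O0" "fcod (idn Y) = Y1"
    using K.idn_Ar[OF Y(1)] K.Dom_idn[OF Y(1)] K.Cod_idn[OF Y(1)] unfolding Y(2,3) Cat_simps(2-4) by blast+
  have xd: "Cod E x = ob (fdom (idn Y))" unfolding f using x by simp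
  show ?thesis
    unfolding Q_map map_simp_simps p0_def p1_def pi0_map_proj[OF f(1) x(1) xd f(2)[symmetric]] f(3) ..
qed

text \<open>A composable pair y, y' is an object z of Y_2, and the faces of Q in degree 2 are
  induced by those of Y; so composition in Q can be computed on representatives.\<close>

lemma Q_cmp:
  assumes y: "y \<in> Ar E" "Cod E y = ob Y1" and y': "y' \<in> Ar E" "Cod E y' = ob Y1" and d: "Dom E y = Dom E y'"
    and c: "fo (trg X) \<cdot> (Ha \<cdot> y) = src (ob X) \<cdot> (Va \<cdot> y')"
  shows "cmp E Q (p1 \<cdot> y') (p1 \<cdot> y) = p1 \<cdot> cY y' y"
proof -
  obtain z where z: "z \<in> Ar E" "Dom E z = Dom E y" "Cod E z = sob (row Y) 2"
    "face (row Y) 1 2 \<cdot> z = y" "face (row Y) 1 0 \<cdot> z = y'" "face (row Y) 1 1 \<cdot> z = cmp E (row Y) y' y"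
    by (rule composable_simplex[OF category_object_row[OF Y(1)], of y y']) (use y y' d c in simp_all)
  have z2: "Cod E z = ob (sob Y 2)" using z(3) by (simp add: row_def)
  have fz: "fo (face Y 1 2) \<cdot> z = y" "fo (face Y 1 0) \<cdot> z = y'" "fo (face Y 1 1) \<cdot> z = cY y' y"
    using z(4-6) by (simp_all add: row_def cY_def)
  have s1: "sob Y 1 = Y1" using Y(3) by (simp add: ar_def)
  have f: "internal_functor E (face Y 1 j)" "fdom (face Y 1 j) = sob Y 2" "fcod (face Y 1 j) = Y1" if "j \<le> 2" for j
    using K.face_Ar[OF Y(1), of j 1] that s1 by (simp_all add: Cat_simps)
  have c2: "category_object E (sob Y 2)" using functor_objects(1)[OF f(1)[of 0]] f(2)[of 0] by simp
  let ?z = "pi0_proj E (sob Y 2) \<cdot> z"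
  have zz: "?z \<in> Ar E" "Cod E ?z = sob Q 2" using z(1) z2 c2 by (simp_all add: Q_map)
  have "face Q 1 j \<cdot> ?z = p1 \<cdot> (fo (face Y 1 j) \<cdot> z)" if "j \<le> 2" for j
    using pi0_map_proj[OF f(1)[OF that] z(1)] z2 f[OF that] by (simp add: Q_map p1_def)
  from this[of 0] this[of 1] this[of 2] show ?thesis using cmp_simplex[OF Q(1) zz] fz by simp
qed

lemma p0_epi:
  assumes "a \<in> Ar E" "b \<in> Ar E" "Dom E a = ob Q" "Dom E b = ob Q" "Cod E a = Cod E b" "a \<cdot> p0 = b \<cdot> p0"
  shows "a = b"
  using pi0_epi[OF category_object_disc[OF O0_Ob(1)] assms(1,2)] assms(3-6) unfolding p0_def[symmetric] Q(2)[symmetric] by blast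

lemma p1_epi:
  assumes "a \<in> Ar E" "b \<in> Ar E" "Dom E a = ar Q" "Dom E b = ar Q" "Cod E a = Cod E b" "a \<cdot> p1 = b \<cdot> p1"
  shows "a = b"
  using pi0_epi[OF Y1(1) assms(1,2)] assms(3-6) unfolding p1_def[symmetric] Q(3)[symmetric] by blast

text \<open>The classes of the generic vertical and the generic horizontal corner become the arrow
  part of \<open>q0\<close> and the component of \<open>q1\<close>.\<close>

definition qv :: 'a where "qv = p1 \<cdot> vq (Ident E V0)"
definition qh :: 'a where "qh = p1 \<cdot> hq (Ident E H0)"

lemma qv_qh [simp]: "qv \<in> Ar E" "Dom E qv = V0" "Cod E qv = ar Q" "qh \<in> Ar E" "Dom E qh = H0" "Cod E qh = ar Q"
proof -
  have v: "vq (Ident E V0) \<in> Ar E" "Dom E (vq (Ident E V0)) = V0" "Cod E (vq (Ident E V0)) = ob Y1"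
    using vq(1-3)[of "Ident E V0"] Ident_Ar[OF O0_Ob(2)] by simp_all
  have h: "hq (Ident E H0) \<in> Ar E" "Dom E (hq (Ident E H0)) = H0" "Cod E (hq (Ident E H0)) = ob Y1"
    using hq(1-3)[of "Ident E H0"] Ident_Ar[OF O0_Ob(3)] by simp_all
  show "qv \<in> Ar E" "Dom E qv = V0" "Cod E qv = ar Q" "qh \<in> Ar E" "Dom E qh = H0" "Cod E qh = ar Q"
    unfolding qv_def qh_def
    using comp_Ar[OF v(1) p01(4)] Dom_comp[OF v(1) p01(4)] Cod_comp[OF v(1) p01(4)]
      comp_Ar[OF h(1) p01(4)] Dom_comp[OF h(1) p01(4)] Cod_comp[OF h(1) p01(4)]
    unfolding v(2,3) h(2,3) p01(5,6) by blast+
qed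

lemma qv_vq:
  assumes "v \<in> Ar E" "Cod E v = V0"
  shows "qv \<cdot> v = p1 \<cdot> vq v"
proof -
  have i: "Ident E V0 \<in> Ar E" "Cod E (Ident E V0) = V0" "Dom E (Ident E V0) = V0" by simp_all
  have "qv \<cdot> v = p1 \<cdot> (vq (Ident E V0) \<cdot> v)" unfolding qv_def
    by (rule comp_assoc) (use vq(1-3)[OF i(1,2)] i(3) assms in simp_all)
  also have "vq (Ident E V0) \<cdot> v = vq v" using vq_comp[OF i(1,2) assms(1)] i(3) assms by simp
  finally show ?thesis .
qed

lemma qh_hq:
  assumes "h \<in> Ar E" "Cod E h = H0"
  shows "qh \<cdot> h = p1 \<cdot> hq h"
proof -
  have i: "Ident E H0 \<in> Ar E" "Cod E (Ident E H0) = H0" "Dom E (Ident E H0) = H0" by simp_all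
  have "qh \<cdot> h = p1 \<cdot> (hq (Ident E H0) \<cdot> h)" unfolding qh_def
    by (rule comp_assoc) (use hq(1-3)[OF i(1,2)] i(3) assms in simp_all)
  also have "hq (Ident E H0) \<cdot> h = hq h" using hq_comp[OF i(1,2) assms(1)] i(3) assms by simp
  finally show ?thesis .
qed

lemma qv_src:
  assumes "v \<in> Ar E" "Cod E v = V0"
  shows "src Q \<cdot> (qv \<cdot> v) = p0 \<cdot> (src (ob X) \<cdot> v)" "trg Q \<cdot> (qv \<cdot> v) = p0 \<cdot> (trg (ob X) \<cdot> v)"
  unfolding qv_vq[OF assms] Q_src[OF vq(1,3)[OF assms]] vq(4,5)[OF assms] using assms by simp_all

lemma qh_src:
  assumes "h \<in> Ar E" "Cod E h = H0"
  shows "src Q \<cdot> (qh \<cdot> h) = p0 \<cdot> (fo (src X) \<cdot> h)" "trg Q \<cdot> (qh \<cdot> h) = p0 \<cdot> (fo (trg X) \<cdot> h)"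
  unfolding qh_hq[OF assms] Q_src[OF hq(1,3)[OF assms]] hq(4,5)[OF assms] using assms by simp_all

lemma q_idn:
  assumes x: "x \<in> Ar E" "Cod E x = O0"
  shows "qv \<cdot> (idn (ob X) \<cdot> x) = idn Q \<cdot> (p0 \<cdot> x)" "qh \<cdot> (fo (idn X) \<cdot> x) = idn Q \<cdot> (p0 \<cdot> x)"
proof -
  note i = idn_Y[OF x]
  have v: "idn (ob X) \<cdot> x \<in> Ar E" "Cod E (idn (ob X) \<cdot> x) = V0" "Dom E (idn (ob X) \<cdot> x) = Dom E x" using x by simp_all
  have h: "fo (idn X) \<cdot> x \<in> Ar E" "Cod E (fo (idn X) \<cdot> x) = H0" "Dom E (fo (idn X) \<cdot> x) = Dom E x" using x by simp_all
  have "vq (idn (ob X) \<cdot> x) = fo (idn Y) \<cdot> x"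
    by (rule Y1_eqI[OF vq(1,3)[OF v(1,2)] i(1,3)]) (use vq(2,4,5)[OF v(1,2)] i v x in simp_all)
  then show "qv \<cdot> (idn (ob X) \<cdot> x) = idn Q \<cdot> (p0 \<cdot> x)" unfolding qv_vq[OF v(1,2)] Q_idn[OF x] by simp
  have "hq (fo (idn X) \<cdot> x) = fo (idn Y) \<cdot> x"
    by (rule Y1_eqI[OF hq(1,3)[OF h(1,2)] i(1,3)]) (use hq(2,4,5)[OF h(1,2)] i h x in simp_all)
  then show "qh \<cdot> (fo (idn X) \<cdot> x) = idn Q \<cdot> (p0 \<cdot> x)" unfolding qh_hq[OF h(1,2)] Q_idn[OF x] by simp
qed

lemma qv_cmp:
  assumes "v \<in> Ar E" "Cod E v = V0" "v' \<in> Ar E" "Cod E v' = V0" "Dom E v = Dom E v'" "trg (ob X) \<cdot> v = src (ob X) \<cdot> v'"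
  shows "qv \<cdot> cmp E (ob X) v' v = cmp E Q (qv \<cdot> v') (qv \<cdot> v)"
proof -
  have c: "cmp E (ob X) v' v \<in> Ar E" "Cod E (cmp E (ob X) v' v) = V0" using assms by simp_all
  have "cmp E Q (p1 \<cdot> vq v') (p1 \<cdot> vq v) = p1 \<cdot> cY (vq v') (vq v)"
    by (rule Q_cmp) (use vq[OF assms(1,2)] vq[OF assms(3,4)] assms in simp_all)
  then show ?thesis unfolding qv_vq[OF c] qv_vq[OF assms(1,2)] qv_vq[OF assms(3,4)] cY_vq[OF assms] by simp
qed

lemma qh_cmp:
  assumes "h \<in> Ar E" "Cod E h = H0" "k \<in> Ar E" "Cod E k = H0" "Dom E h = Dom E k" "fo (trg X) \<cdot> h = fo (src X) \<cdot> k"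
  shows "qh \<cdot> cmp E (row X) k h = cmp E Q (qh \<cdot> k) (qh \<cdot> h)"
proof -
  have c: "cmp E (row X) k h \<in> Ar E" "Cod E (cmp E (row X) k h) = H0"
    using cmp_Ar[OF category_object_row[OF K.X], of h k] Cod_cmp[OF category_object_row[OF K.X], of h k] assms by simp_all
  have "cmp E Q (p1 \<cdot> hq k) (p1 \<cdot> hq h) = p1 \<cdot> cY (hq k) (hq h)"
    by (rule Q_cmp) (use hq[OF assms(1,2)] hq[OF assms(3,4)] assms in simp_all)
  then show ?thesis unfolding qh_hq[OF c] qh_hq[OF assms(1,2)] qh_hq[OF assms(3,4)] cY_hq[OF assms] by simp
qed

text \<open>This is the naturality of \<open>q1\<close> on elements:
  \<open>interchange_corner\<close> read in Q.\<close>

lemma q_interchange: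
  assumes s: "s \<in> Ar E" "Cod E s = S0"
  shows "cmp E Q (qv \<cdot> (fa (trg X) \<cdot> s)) (qh \<cdot> (src (ar X) \<cdot> s)) = cmp E Q (qh \<cdot> (trg (ar X) \<cdot> s)) (qv \<cdot> (fa (src X) \<cdot> s))"
proof -
  have v: "fa (trg X) \<cdot> s \<in> Ar E" "Cod E (fa (trg X) \<cdot> s) = V0" "fa (src X) \<cdot> s \<in> Ar E" "Cod E (fa (src X) \<cdot> s) = V0"
    and h: "src (ar X) \<cdot> s \<in> Ar E" "Cod E (src (ar X) \<cdot> s) = H0" "trg (ar X) \<cdot> s \<in> Ar E" "Cod E (trg (ar X) \<cdot> s) = H0"
    using s by simp_all
  have "cmp E Q (p1 \<cdot> vq (fa (trg X) \<cdot> s)) (p1 \<cdot> hq (src (ar X) \<cdot> s)) = p1 \<cdot> cY (vq (fa (trg X) \<cdot> s)) (hq (src (ar X) \<cdot> s))"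
    by (rule Q_cmp) (use vq[OF v(1,2)] hq[OF h(1,2)] s in simp_all)
  also have "\<dots> = p1 \<cdot> cY (hq (trg (ar X) \<cdot> s)) (vq (fa (src X) \<cdot> s))" by (rule interchange_corner[OF s])
  also have "\<dots> = cmp E Q (p1 \<cdot> hq (trg (ar X) \<cdot> s)) (p1 \<cdot> vq (fa (src X) \<cdot> s))"
    by (rule Q_cmp[symmetric]) (use vq[OF v(3,4)] hq[OF h(3,4)] s in simp_all)
  finally show ?thesis unfolding qv_vq[OF v(1,2)] qv_vq[OF v(3,4)] qh_hq[OF h(1,2)] qh_hq[OF h(3,4)] .
qed

text \<open>The image of \<open>cY_factor\<close> in Q: every class is a horizontal one after a
  vertical one. Hence Q is generated by \<open>qv\<close> and \<open>qh\<close>, on which uniqueness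
  of arrows out of Q rests.\<close>

lemma p1_factor:
  assumes y: "y \<in> Ar E" "Cod E y = ob Y1"
  shows "p1 \<cdot> y = cmp E Q (qh \<cdot> (Ha \<cdot> y)) (qv \<cdot> (Va \<cdot> y))"
proof -
  have v: "Va \<cdot> y \<in> Ar E" "Cod E (Va \<cdot> y) = V0" and h: "Ha \<cdot> y \<in> Ar E" "Cod E (Ha \<cdot> y) = H0" using y by simp_all
  have "cmp E Q (p1 \<cdot> hq (Ha \<cdot> y)) (p1 \<cdot> vq (Va \<cdot> y)) = p1 \<cdot> cY (hq (Ha \<cdot> y)) (vq (Va \<cdot> y))"
    by (rule Q_cmp) (use vq[OF v] hq[OF h] y in simp_all)
  then show ?thesis unfolding cY_factor[OF y] qv_vq[OF v] qh_hq[OF h] by simp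
qed

end

section \<open>Cocones in terms of elements\<close>

context crossed_category
begin

text \<open>On elements the two cocone equations say that the component of f1 preserves units and
  composites of horizontal arrows, hence that it is the arrow part of a functor from
  \<open>row X\<close> to Z.\<close>

lemma codescent_coconeD:
  assumes "codescent_cocone (Cat E) X Z f0 f1"
  shows "category_object E Z" "internal_functor E f0" "fdom f0 = ob X" "fcod f0 = Z" "internal_nat_trans E f1"
    "nsrc f1 = f0 \<cdot>\<^bsub>Cat E\<^esub> src X" "ntrg f1 = f0 \<cdot>\<^bsub>Cat E\<^esub> trg X"
    "ncomp f1 \<cdot> fo (idn X) = idn Z \<cdot> fo f0"
    "\<And>h k. \<lbrakk>h \<in> Ar E; Cod E h = ob (ar X); k \<in> Ar E; Cod E k = ob (ar X); Dom E h = Dom E k; fo (trg X) \<cdot> h = fo (src X) \<cdot> k\<rbrakk> \<Longrightarrow>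
      ncomp f1 \<cdot> cmp E (row X) k h = cmp E Z (ncomp f1 \<cdot> k) (ncomp f1 \<cdot> h)"
proof -
  have c: "Z \<in> Ob (Cat E)" "f0 \<in> hom (Cat E) (ob X) Z"
    "f1 \<in> cells (Cat E) (f0 \<cdot>\<^bsub>Cat E\<^esub> src X) (f0 \<cdot>\<^bsub>Cat E\<^esub> trg X)"
    "f1 \<lhd>\<^bsub>Cat E\<^esub> idn X = Ident2 (Cat E) f0"
    "(f1 \<lhd>\<^bsub>Cat E\<^esub> face X 1 0) \<bullet>\<^bsub>Cat E\<^esub> (f1 \<lhd>\<^bsub>Cat E\<^esub> face X 1 2) = f1 \<lhd>\<^bsub>Cat E\<^esub> face X 1 1"
    using assms unfolding codescent_cocone_def ob_def src_def trg_def idn_def by blast+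
  show f: "category_object E Z" "internal_functor E f0" "fdom f0 = ob X" "fcod f0 = Z" "internal_nat_trans E f1"
    "nsrc f1 = f0 \<cdot>\<^bsub>Cat E\<^esub> src X" "ntrg f1 = f0 \<cdot>\<^bsub>Cat E\<^esub> trg X"
    using c(1-3) by (simp_all add: cells_def hom_def Cat_simps(1-4,7-9))
  show "ncomp f1 \<cdot> fo (idn X) = idn Z \<cdot> fo f0"
    using arg_cong[OF c(4), of ncomp] unfolding Cat_proj f(4) .
  fix h k assume h: "h \<in> Ar E" "Cod E h = ob (ar X)" "k \<in> Ar E" "Cod E k = ob (ar X)" "Dom E h = Dom E k" "fo (trg X) \<cdot> h = fo (src X) \<cdot> k"
  have n: "Dom E (ncomp f1) = ob (ar X)" "Cod E (ncomp f1) = ar Z" "ncomp f1 \<in> Ar E"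
    using Dom_nt[OF f(5)] Cod_nt[OF f(5)] nt_Ar[OF f(5)] unfolding f(6) Cat_proj f(4) by simp_all
  obtain z where z: "z \<in> Ar E" "Dom E z = Dom E h" "Cod E z = sob (row X) 2"
    "face (row X) 1 2 \<cdot> z = h" "face (row X) 1 0 \<cdot> z = k" "face (row X) 1 1 \<cdot> z = cmp E (row X) k h"
    by (rule composable_simplex[OF category_object_row[OF K.X], of h k]) (use h in simp_all)
  have z2: "Cod E z = ob (sob X 2)" using z(3) by (simp add: row_def)
  have zf: "fo (face X 1 2) \<cdot> z = h" "fo (face X 1 0) \<cdot> z = k" "fo (face X 1 1) \<cdot> z = cmp E (row X) k h"
    using z(4-6) by (simp_all add: row_def)
  have fc: "fo (face X 1 j) \<in> Ar E" "Dom E (fo (face X 1 j)) = ob (sob X 2)" "Cod E (fo (face X 1 j)) = ob (ar X)" if "j \<le> 2" for j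
    using K.face_Ar[OF K.X, of j 1] that by (simp_all add: Cat_simps(2-4) ar_def)
  have e: "cmp E Z (ncomp f1 \<cdot> fo (face X 1 0)) (ncomp f1 \<cdot> fo (face X 1 2)) = ncomp f1 \<cdot> fo (face X 1 1)"
    using arg_cong[OF c(5), of ncomp] unfolding Cat_proj f(6) f(4) .
  have nf: "(ncomp f1 \<cdot> fo (face X 1 j)) \<cdot> z = ncomp f1 \<cdot> (fo (face X 1 j) \<cdot> z)" if "j \<le> 2" for j
    by (rule comp_assoc) (use fc[OF that] n z z2 in simp_all)
  have ty: "ncomp f1 \<cdot> fo (face X 1 j) \<in> Ar E" "Dom E (ncomp f1 \<cdot> fo (face X 1 j)) = ob (sob X 2)" "Cod E (ncomp f1 \<cdot> fo (face X 1 j)) = ar Z"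
    if "j \<le> 2" for j
    using fc[OF that] n by simp_all
  have zc: "fo (trg X) \<cdot> fo (face X 1 2) = fo (src X) \<cdot> fo (face X 1 0)"
    using pullback_Ar(9)[OF composable_pullback[OF category_object_row[OF K.X]]] by (simp add: row_def)
  have "trg Z \<cdot> (ncomp f1 \<cdot> fo (face X 1 2)) = fo (ntrg f1) \<cdot> fo (face X 1 2)"
    "src Z \<cdot> (ncomp f1 \<cdot> fo (face X 1 0)) = fo (nsrc f1) \<cdot> fo (face X 1 0)"
    using src_nt_comp[OF f(5), of "fo (face X 1 0)" Z] src_nt_comp[OF f(5), of "fo (face X 1 2)" Z] fc[of 0] fc[of 2]
    unfolding f(6) Cat_proj f(4) by simp_all
  then have tc: "trg Z \<cdot> (ncomp f1 \<cdot> fo (face X 1 2)) = src Z \<cdot> (ncomp f1 \<cdot> fo (face X 1 0))"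
    unfolding f(6,7) Cat_proj using zc fc[of 0] fc[of 2] f(2,3) by simp
  have "cmp E Z (ncomp f1 \<cdot> fo (face X 1 0)) (ncomp f1 \<cdot> fo (face X 1 2)) \<cdot> z =
      cmp E Z ((ncomp f1 \<cdot> fo (face X 1 0)) \<cdot> z) ((ncomp f1 \<cdot> fo (face X 1 2)) \<cdot> z)"
    by (rule cmp_comp[OF f(1) ty(1) ty(1) ty(3) ty(3) _ tc z(1)]) (use ty(2)[of 0] ty(2)[of 2] z2 in simp_all)
  then show "ncomp f1 \<cdot> cmp E (row X) k h = cmp E Z (ncomp f1 \<cdot> k) (ncomp f1 \<cdot> h)"
    unfolding e using nf[of 0] nf[of 1] nf[of 2] zf by simp
qed

lemma codescent_coconeI:
  assumes Z: "category_object E Z" "internal_functor E f0" "fdom f0 = ob X" "fcod f0 = Z" "internal_nat_trans E f1"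
    "nsrc f1 = f0 \<cdot>\<^bsub>Cat E\<^esub> src X" "ntrg f1 = f0 \<cdot>\<^bsub>Cat E\<^esub> trg X"
    "ncomp f1 \<cdot> fo (idn X) = idn Z \<cdot> fo f0"
    and m: "\<And>h k. \<lbrakk>h \<in> Ar E; Cod E h = ob (ar X); k \<in> Ar E; Cod E k = ob (ar X); Dom E h = Dom E k; fo (trg X) \<cdot> h = fo (src X) \<cdot> k\<rbrakk> \<Longrightarrow>
      ncomp f1 \<cdot> cmp E (row X) k h = cmp E Z (ncomp f1 \<cdot> k) (ncomp f1 \<cdot> h)"
  shows "codescent_cocone (Cat E) X Z f0 f1"
proof -
  have f0: "f0 \<in> Ar (Cat E)" "Dom (Cat E) f0 = ob X" using Z by (simp_all add: Cat_simps(2-4))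
  note as = K.comp_assoc[of _ _ f0, OF _ _ f0(1)]
  have fc: "face X 1 j \<in> Ar (Cat E)" "Dom (Cat E) (face X 1 j) = sob X 2" "Cod (Cat E) (face X 1 j) = ar X" if "j \<le> 2" for j
    using K.face_Ar[OF K.X, of j 1] that by (simp_all add: ar_def)
  have u: "f1 \<lhd>\<^bsub>Cat E\<^esub> idn X = Ident2 (Cat E) f0"
  proof (rule cat_cell_eqI)
    have "(f0 \<cdot>\<^bsub>Cat E\<^esub> g) \<cdot>\<^bsub>Cat E\<^esub> idn X = f0" if "g = src X \<or> g = trg X" for g
      using that as[of "idn X" g] f0 K.X K.Ident_comp_src[OF K.X] K.comp_Ident[OF f0] by auto
    then show "nsrc (f1 \<lhd>\<^bsub>Cat E\<^esub> idn X) = nsrc (Ident2 (Cat E) f0)" "ntrg (f1 \<lhd>\<^bsub>Cat E\<^esub> idn X) = ntrg (Ident2 (Cat E) f0)"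
      unfolding Cat_proj Z(6,7) by blast+
    show "ncomp (f1 \<lhd>\<^bsub>Cat E\<^esub> idn X) = ncomp (Ident2 (Cat E) f0)" unfolding Cat_proj Z(4,8) ..
  qed
  have c: "(f1 \<lhd>\<^bsub>Cat E\<^esub> face X 1 0) \<bullet>\<^bsub>Cat E\<^esub> (f1 \<lhd>\<^bsub>Cat E\<^esub> face X 1 2) = f1 \<lhd>\<^bsub>Cat E\<^esub> face X 1 1"
  proof (rule cat_cell_eqI)
    have "src X \<cdot>\<^bsub>Cat E\<^esub> face X 1 2 = src X \<cdot>\<^bsub>Cat E\<^esub> face X 1 1" "trg X \<cdot>\<^bsub>Cat E\<^esub> face X 1 1 = trg X \<cdot>\<^bsub>Cat E\<^esub> face X 1 0"
      using K.face_face_arr[OF K.X, of 1 1 0] K.face_face_arr[OF K.X, of 0 0 0] by (simp_all add: src_def trg_def)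
    then have "(f0 \<cdot>\<^bsub>Cat E\<^esub> src X) \<cdot>\<^bsub>Cat E\<^esub> face X 1 2 = (f0 \<cdot>\<^bsub>Cat E\<^esub> src X) \<cdot>\<^bsub>Cat E\<^esub> face X 1 1"
      "(f0 \<cdot>\<^bsub>Cat E\<^esub> trg X) \<cdot>\<^bsub>Cat E\<^esub> face X 1 0 = (f0 \<cdot>\<^bsub>Cat E\<^esub> trg X) \<cdot>\<^bsub>Cat E\<^esub> face X 1 1"
      using as[OF fc(1)[of 2] K.src_Ar[OF K.X]] as[OF fc(1)[of 1] K.src_Ar[OF K.X]] as[OF fc(1)[of 0] K.trg_Ar[OF K.X]] as[OF fc(1)[of 1] K.trg_Ar[OF K.X]]
        fc[of 0] fc[of 1] fc[of 2] f0 K.X by simp_all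
    then show "nsrc ((f1 \<lhd>\<^bsub>Cat E\<^esub> face X 1 0) \<bullet>\<^bsub>Cat E\<^esub> (f1 \<lhd>\<^bsub>Cat E\<^esub> face X 1 2)) = nsrc (f1 \<lhd>\<^bsub>Cat E\<^esub> face X 1 1)"
      "ntrg ((f1 \<lhd>\<^bsub>Cat E\<^esub> face X 1 0) \<bullet>\<^bsub>Cat E\<^esub> (f1 \<lhd>\<^bsub>Cat E\<^esub> face X 1 2)) = ntrg (f1 \<lhd>\<^bsub>Cat E\<^esub> face X 1 1)"
      unfolding Cat_proj Z(6,7) by blast+
    have fr: "face (row X) 1 j = fo (face X 1 j)" for j by (simp add: row_def)
    have fE: "fo (face X 1 j) \<in> Ar E" "Dom E (fo (face X 1 j)) = ob (sob X 2)" "Cod E (fo (face X 1 j)) = ob (ar X)" "ob (sob X 2) \<in> Ob E" if "j \<le> 2" for j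
      using fc[OF that] Dom_Ob[OF fo_Ar[of "face X 1 j"]] by (simp_all add: Cat_simps(2-4))
    \<comment> \<open>The outer faces of X_2 form the generic composable pair of horizontal arrows,
      whose composite is the inner face.\<close>
    have "cmp E (row X) (fo (face X 1 0)) (fo (face X 1 2)) = fo (face X 1 1)"
      using cmp_simplex[OF category_object_row[OF K.X], of "Ident E (ob (sob X 2))"] fE[of 0] fE[of 1] fE[of 2]
      unfolding fr by (simp add: row_def)
    moreover have "fo (trg X) \<cdot> fo (face X 1 2) = fo (src X) \<cdot> fo (face X 1 0)"
      using pullback_Ar(9)[OF composable_pullback[OF category_object_row[OF K.X]]] by (simp add: row_def)
    ultimately have "ncomp f1 \<cdot> fo (face X 1 1) = cmp E Z (ncomp f1 \<cdot> fo (face X 1 0)) (ncomp f1 \<cdot> fo (face X 1 2))"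
      using m[of "fo (face X 1 2)" "fo (face X 1 0)"] fE[of 0] fE[of 2] by simp
    then show "ncomp ((f1 \<lhd>\<^bsub>Cat E\<^esub> face X 1 0) \<bullet>\<^bsub>Cat E\<^esub> (f1 \<lhd>\<^bsub>Cat E\<^esub> face X 1 2)) = ncomp (f1 \<lhd>\<^bsub>Cat E\<^esub> face X 1 1)"
      unfolding Cat_proj Z(6) Z(4) by simp
  qed
  show ?thesis
    unfolding codescent_cocone_def
    using u c Z unfolding ob_def[symmetric] src_def[symmetric] trg_def[symmetric] idn_def[symmetric]
    by (simp add: cells_def hom_def Cat_simps(1-4,7-9))
qed

end

section \<open>The universal cocone\<close>

context corner_object
begin

definition q0 :: "('o, 'a) sfun" where "q0 = mkfun (ob X) Q p0 qv"
definition q1 :: "('o, 'a) snat" where "q1 = cat_cell (q0 \<cdot>\<^bsub>Cat E\<^esub> src X) (q0 \<cdot>\<^bsub>Cat E\<^esub> trg X) qh"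

lemma q0 [simp]: "internal_functor E q0" "fdom q0 = ob X" "fcod q0 = Q" "fo q0 = p0" "fa q0 = qv"
proof -
  have X0: "category_object E (ob X)" by simp
  have i: "Ident E V0 \<in> Ar E" "Cod E (Ident E V0) = V0" "Ident E O0 \<in> Ar E" "Cod E (Ident E O0) = O0" by simp_all
  have st: "src Q \<cdot> qv = p0 \<cdot> src (ob X)" "trg Q \<cdot> qv = p0 \<cdot> trg (ob X)" using qv_src[OF i(1,2)] by simp_all
  have id: "qv \<cdot> idn (ob X) = idn Q \<cdot> p0" using q_idn(1)[OF i(3,4)] by simp
  have cm: "qv \<cdot> cmp E (ob X) g f = cmp E Q (qv \<cdot> g) (qv \<cdot> f)"
    if "f \<in> Ar E" "g \<in> Ar E" "Cod E f = V0" "Cod E g = V0" "Dom E f = Dom E g" "trg (ob X) \<cdot> f = src (ob X) \<cdot> g" for f g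
    by (rule qv_cmp) (use that in simp_all)
  note a = X0 Q(1) p01(1,2,3) qv_qh(1,2,3) st id cm
  show "internal_functor E q0" unfolding q0_def by (rule internal_functor_mkfun[OF a])
  show "fo q0 = p0" unfolding q0_def by (rule fo_mkfun[OF a])
  show "fa q0 = qv" unfolding q0_def by (rule fa_mkfun[OF a])
qed (simp_all add: q0_def)

lemma q1 [simp]: "internal_nat_trans E q1" "nsrc q1 = q0 \<cdot>\<^bsub>Cat E\<^esub> src X" "ntrg q1 = q0 \<cdot>\<^bsub>Cat E\<^esub> trg X" "ncomp q1 = qh"
proof -
  have i: "Ident E H0 \<in> Ar E" "Cod E (Ident E H0) = H0" by simp_all
  have c: "internal_functor E (q0 \<cdot>\<^bsub>Cat E\<^esub> src X)" "internal_functor E (q0 \<cdot>\<^bsub>Cat E\<^esub> trg X)"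
    unfolding Cat_simps(6) by (rule internal_functor_comp; simp)+
  show "internal_nat_trans E q1"
    unfolding q1_def
  proof (rule internal_nat_transI[OF c], unfold Cat_proj)
    show "src (fcod q0) \<cdot> qh = fo q0 \<cdot> fo (src X)" "trg (fcod q0) \<cdot> qh = fo q0 \<cdot> fo (trg X)"
      using qh_src[OF i] by simp_all
    fix s assume s: "s \<in> Ar E" "Cod E s = ar (fdom (src X))"
    then have "Cod E s = S0" by simp
    from q_interchange[OF s(1) this]
    show "cmp E (fcod q0) (qh \<cdot> (trg (fdom (src X)) \<cdot> s)) ((fa q0 \<cdot> fa (src X)) \<cdot> s) =
        cmp E (fcod q0) ((fa q0 \<cdot> fa (trg X)) \<cdot> s) (qh \<cdot> (src (fdom (src X)) \<cdot> s))"
      using s by simp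
  qed (simp_all)
qed (simp_all add: q1_def)

lemma q_cocone: "codescent_cocone (Cat E) X Q q0 q1"
proof (rule codescent_coconeI[OF Q(1) q0(1-3) q1(1-3)])
  have i: "Ident E O0 \<in> Ar E" "Cod E (Ident E O0) = O0" by simp_all
  show "ncomp q1 \<cdot> fo (idn X) = idn Q \<cdot> fo q0" using q_idn(2)[OF i] by simp
qed (simp only: q1(4) qh_cmp)

end

context category_context
begin

text \<open>A rebracketing that isolates the middle pair of a fourfold composite, where an
  interchange is to be applied.\<close>

lemma cmp_assoc4:
  assumes A: "category_object C A" and "f \<in> Ar C" "g \<in> Ar C" "h \<in> Ar C" "k \<in> Ar C"
    "Cod C f = ar A" "Cod C g = ar A" "Cod C h = ar A" "Cod C k = ar A" "Dom C f = Dom C k" "Dom C g = Dom C k" "Dom C h = Dom C k"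
    "trg A \<cdot> f = src A \<cdot> g" "trg A \<cdot> g = src A \<cdot> h" "trg A \<cdot> h = src A \<cdot> k"
  shows "cmp C A (cmp C A k h) (cmp C A g f) = cmp C A k (cmp C A (cmp C A h g) f)"
proof -
  have gf: "cmp C A g f \<in> Ar C" "Cod C (cmp C A g f) = ar A" "Dom C (cmp C A g f) = Dom C k" "trg A \<cdot> cmp C A g f = trg A \<cdot> g"
    using cmp_Ar[OF A, of f g] Cod_cmp[OF A, of f g] Dom_cmp[OF A, of f g] trg_cmp[OF A, of f g] assms by simp_all
  have "cmp C A (cmp C A k h) (cmp C A g f) = cmp C A k (cmp C A h (cmp C A g f))"
    by (rule cmp_assoc[OF A]) (use gf assms in simp_all)
  also have "cmp C A h (cmp C A g f) = cmp C A (cmp C A h g) f"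
    by (rule cmp_assoc[OF A, symmetric]) (use assms in simp_all)
  finally show ?thesis .
qed

end

section \<open>Factoring a cocone through Q\<close>

locale corner_cocone = corner_object E X D Y
  for E :: "('o, 'a) cat" (structure) and X :: "(('o, 'a) simp, ('o, 'a) sfun) simp" and D :: "('o, 'a) snat set"
    and Y :: "(('o, 'a) simp, ('o, 'a) sfun) simp" +
  fixes Z :: "('o, 'a) simp" and f0 :: "('o, 'a) sfun" and f1 :: "('o, 'a) snat"
  assumes cocone: "codescent_cocone (Cat E) X Z f0 f1"
begin

abbreviation n :: 'a where "n \<equiv> ncomp f1"
abbreviation F :: 'a where "F \<equiv> fa f0"
abbreviation F0 :: 'a where "F0 \<equiv> fo f0"

lemma cocone_f0 [simp]: "category_object E Z" "internal_functor E f0" "fdom f0 = ob X" "fcod f0 = Z"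
  by (rule codescent_coconeD[OF cocone])+

lemma n_Ar [simp]: "n \<in> Ar E" "Dom E n = H0" "Cod E n = ar Z"
  using nt_Ar[OF codescent_coconeD(5)[OF cocone]] Dom_nt[OF codescent_coconeD(5)[OF cocone]] Cod_nt[OF codescent_coconeD(5)[OF cocone]]
  unfolding codescent_coconeD(6)[OF cocone] Cat_proj by simp_all

lemma F_Ar [simp]: "F \<in> Ar E" "Dom E F = V0" "Cod E F = ar Z" "F0 \<in> Ar E" "Dom E F0 = O0" "Cod E F0 = ob Z"
  by simp_all

lemma n_src [simp]:
  assumes "h \<in> Ar E" "Cod E h = H0"
  shows "src Z \<cdot> (n \<cdot> h) = F0 \<cdot> (fo (src X) \<cdot> h)" "trg Z \<cdot> (n \<cdot> h) = F0 \<cdot> (fo (trg X) \<cdot> h)"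
  using src_nt_comp[OF codescent_coconeD(5)[OF cocone] assms(1), of Z] assms
  unfolding codescent_coconeD(6,7)[OF cocone] Cat_proj by simp_all

lemma F_src [simp]:
  assumes "v \<in> Ar E" "Cod E v = V0"
  shows "src Z \<cdot> (F \<cdot> v) = F0 \<cdot> (src (ob X) \<cdot> v)" "trg Z \<cdot> (F \<cdot> v) = F0 \<cdot> (trg (ob X) \<cdot> v)"
  using src_fa[of f0 v Z] trg_fa[of f0 v Z] assms by simp_all

lemma n_idn:
  assumes "x \<in> Ar E" "Cod E x = O0"
  shows "n \<cdot> (fo (idn X) \<cdot> x) = idn Z \<cdot> (F0 \<cdot> x)"
  by (rule comp2_eq_extend[OF codescent_coconeD(8)[OF cocone]]) (use assms in simp_all)

lemma n_natural:
  assumes s: "s \<in> Ar E" "Cod E s = S0"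
  shows "cmp E Z (n \<cdot> (trg (ar X) \<cdot> s)) (F \<cdot> (fa (src X) \<cdot> s)) = cmp E Z (F \<cdot> (fa (trg X) \<cdot> s)) (n \<cdot> (src (ar X) \<cdot> s))"
proof -
  have "Cod E s = ar (fdom (nsrc f1))" unfolding codescent_coconeD(6)[OF cocone] Cat_proj using s by simp
  from nt_natural[OF codescent_coconeD(5)[OF cocone] s(1) this] show ?thesis
    unfolding codescent_coconeD(6,7)[OF cocone] Cat_proj using s by simp
qed

definition G :: "'a \<Rightarrow> 'a" where "G y = cmp E Z (n \<cdot> (Ha \<cdot> y)) (F \<cdot> (Va \<cdot> y))"

lemma G:
  assumes y: "y \<in> Ar E" "Cod E y = ob Y1"
  shows "G y \<in> Ar E" "Dom E (G y) = Dom E y" "Cod E (G y) = ar Z"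
    "src Z \<cdot> G y = F0 \<cdot> (src (ob X) \<cdot> (Va \<cdot> y))" "trg Z \<cdot> G y = F0 \<cdot> (fo (trg X) \<cdot> (Ha \<cdot> y))"
    "\<And>x. x \<in> Ar E \<Longrightarrow> Cod E x = Dom E y \<Longrightarrow> G y \<cdot> x = G (y \<cdot> x)"
proof -
  let ?h = "n \<cdot> (Ha \<cdot> y)" and ?v = "F \<cdot> (Va \<cdot> y)"
  have c: "?v \<in> Ar E" "?h \<in> Ar E" "Cod E ?v = ar Z" "Cod E ?h = ar Z" "Dom E ?v = Dom E ?h" "trg Z \<cdot> ?v = src Z \<cdot> ?h"
    using y by simp_all
  show "G y \<in> Ar E" "Dom E (G y) = Dom E y" "Cod E (G y) = ar Z"
    "src Z \<cdot> G y = F0 \<cdot> (src (ob X) \<cdot> (Va \<cdot> y))" "trg Z \<cdot> G y = F0 \<cdot> (fo (trg X) \<cdot> (Ha \<cdot> y))"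
    unfolding G_def using cmp_Ar[OF cocone_f0(1) c] Dom_cmp[OF cocone_f0(1) c] Cod_cmp[OF cocone_f0(1) c] src_cmp[OF cocone_f0(1) c] trg_cmp[OF cocone_f0(1) c] y by simp_all
  fix x assume x: "x \<in> Ar E" "Cod E x = Dom E y"
  have "?h \<cdot> x = n \<cdot> (Ha \<cdot> (y \<cdot> x))" "?v \<cdot> x = F \<cdot> (Va \<cdot> (y \<cdot> x))" "Cod E x = Dom E ?h" using x y by simp_all
  then show "G y \<cdot> x = G (y \<cdot> x)" unfolding G_def using cmp_comp[OF cocone_f0(1) c x(1)] by simp
qed

text \<open>An arrow of Y_1 is an arrow s of X_1 over an identity. Naturality of f1 at s absorbs the
  source of s, by which the vertical parts differ, into the horizontal part; the value of F at the
  identity under s drops out.\<close>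

lemma G_cell:
  assumes r: "r \<in> Ar E" "Cod E r = ar Y1"
  shows "G (src Y1 \<cdot> r) = G (trg Y1 \<cdot> r)"
proof -
  let ?y = "src Y1 \<cdot> r" and ?y' = "trg Y1 \<cdot> r"
  obtain s where s: "s \<in> Ar E" "Dom E s = Dom E r" "Cod E s = S0" "src (ar X) \<cdot> s = Ha \<cdot> ?y" "trg (ar X) \<cdot> s = Ha \<cdot> ?y'"
    "cmp E (ob X) (fa (src X) \<cdot> s) (Va \<cdot> ?y) = Va \<cdot> ?y'"
    "fa (trg X) \<cdot> s = idn (ob X) \<cdot> (fo (trg X) \<cdot> (Ha \<cdot> ?y))"
    by (rule Y1_cellD[OF r])
  have y: "?y \<in> Ar E" "Cod E ?y = ob Y1" "Dom E ?y = Dom E r" "?y' \<in> Ar E" "Cod E ?y' = ob Y1" "Dom E ?y' = Dom E r"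
    using r by simp_all
  have v: "Va \<cdot> ?y \<in> Ar E" "Cod E (Va \<cdot> ?y) = V0" "Dom E (Va \<cdot> ?y) = Dom E r" using y by simp_all
  have w: "fa (src X) \<cdot> s \<in> Ar E" "Cod E (fa (src X) \<cdot> s) = V0" "Dom E (fa (src X) \<cdot> s) = Dom E r" using s(1-3) by simp_all
  have sw: "src (ob X) \<cdot> (fa (src X) \<cdot> s) = fo (src X) \<cdot> (src (ar X) \<cdot> s)" "trg (ob X) \<cdot> (fa (src X) \<cdot> s) = fo (src X) \<cdot> (trg (ar X) \<cdot> s)"
    using s(1,3) by simp_all
  have vw: "trg (ob X) \<cdot> (Va \<cdot> ?y) = src (ob X) \<cdot> (fa (src X) \<cdot> s)"
    unfolding sw(1) s(4) by (rule Y_fo(3)[OF y(1,2)])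
  have h: "Ha \<cdot> ?y \<in> Ar E" "Cod E (Ha \<cdot> ?y) = H0" "Dom E (Ha \<cdot> ?y) = Dom E r" "Ha \<cdot> ?y' \<in> Ar E" "Cod E (Ha \<cdot> ?y') = H0" "Dom E (Ha \<cdot> ?y') = Dom E r"
    using y by simp_all
  have Fc: "F \<cdot> (Va \<cdot> ?y') = cmp E Z (F \<cdot> (fa (src X) \<cdot> s)) (F \<cdot> (Va \<cdot> ?y))"
    unfolding s(6)[symmetric] using fa_cmp[of f0 "Va \<cdot> ?y" "fa (src X) \<cdot> s"] v w vw by simp
  have "G ?y' = cmp E Z (cmp E Z (n \<cdot> (Ha \<cdot> ?y')) (F \<cdot> (fa (src X) \<cdot> s))) (F \<cdot> (Va \<cdot> ?y))"
    unfolding G_def Fc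
    by (rule cmp_assoc[OF cocone_f0(1), symmetric])
      (use v w h n_Ar F_Ar cocone_f0(1) F_src[OF v(1,2)] F_src[OF w(1,2)] n_src[OF h(4,5)] vw sw(2) s(5) in \<open>simp_all del: comp_assoc\<close>)
  also have "cmp E Z (n \<cdot> (Ha \<cdot> ?y')) (F \<cdot> (fa (src X) \<cdot> s)) = cmp E Z (F \<cdot> (fa (trg X) \<cdot> s)) (n \<cdot> (Ha \<cdot> ?y))"
    using n_natural[OF s(1,3)] unfolding s(4,5) .
  also have "F \<cdot> (fa (trg X) \<cdot> s) = idn Z \<cdot> (trg Z \<cdot> (n \<cdot> (Ha \<cdot> ?y)))"
    unfolding s(7) n_src(2)[OF h(1,2)] using fa_idn[of f0 "fo (trg X) \<cdot> (Ha \<cdot> ?y)" "ob X"] h by simp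
  also have "cmp E Z (idn Z \<cdot> (trg Z \<cdot> (n \<cdot> (Ha \<cdot> ?y)))) (n \<cdot> (Ha \<cdot> ?y)) = n \<cdot> (Ha \<cdot> ?y)"
    by (rule cmp_idn_left[OF cocone_f0(1) _ _ refl]) (use h in simp_all)
  finally show ?thesis unfolding G_def by simp
qed

lemma G_cY:
  assumes y: "y \<in> Ar E" "Cod E y = ob Y1" and y': "y' \<in> Ar E" "Cod E y' = ob Y1" and d: "Dom E y = Dom E y'"
    and c: "fo (trg X) \<cdot> (Ha \<cdot> y) = src (ob X) \<cdot> (Va \<cdot> y')"
  shows "G (cY y' y) = cmp E Z (G y') (G y)"
proof -
  let ?l = "lam (Ha \<cdot> y) (Va \<cdot> y')"
  let ?w = "fa (src X) \<cdot> ?l" and ?t = "trg (ar X) \<cdot> ?l"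
  have v: "Va \<cdot> y \<in> Ar E" "Cod E (Va \<cdot> y) = V0" "Dom E (Va \<cdot> y) = Dom E y'"
    and v': "Va \<cdot> y' \<in> Ar E" "Cod E (Va \<cdot> y') = V0" "Dom E (Va \<cdot> y') = Dom E y'"
    and h: "Ha \<cdot> y \<in> Ar E" "Cod E (Ha \<cdot> y) = H0" "Dom E (Ha \<cdot> y) = Dom E y'"
    and h': "Ha \<cdot> y' \<in> Ar E" "Cod E (Ha \<cdot> y') = H0" "Dom E (Ha \<cdot> y') = Dom E y'"
    using y y' d by simp_all
  have hv: "Dom E (Va \<cdot> y') = Dom E (Ha \<cdot> y)" using h v' by simp
  note l = lam[OF h(1) v'(1) h(2) v'(2) hv c[symmetric]]
  have ld: "Dom E ?l = Dom E y'" using l(2) h(3) by simp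
  have w: "?w \<in> Ar E" "Cod E ?w = V0" "Dom E ?w = Dom E y'" and t: "?t \<in> Ar E" "Cod E ?t = H0" "Dom E ?t = Dom E y'"
    using l(1,3) ld by simp_all
  have sw: "src (ob X) \<cdot> ?w = fo (src X) \<cdot> (src (ar X) \<cdot> ?l)" "trg (ob X) \<cdot> ?w = fo (src X) \<cdot> ?t" "trg (ob X) \<cdot> (fa (trg X) \<cdot> ?l) = fo (trg X) \<cdot> ?t"
    using l(1,3) by simp_all
  have vw: "trg (ob X) \<cdot> (Va \<cdot> y) = src (ob X) \<cdot> ?w"
    unfolding sw(1) l(4) by (rule Y_fo(3)[OF y])
  have th: "fo (trg X) \<cdot> ?t = fo (src X) \<cdot> (Ha \<cdot> y')"
    unfolding sw(3)[symmetric] l(5) by (rule Y_fo(3)[OF y'])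
  have Fc: "F \<cdot> cmp E (ob X) ?w (Va \<cdot> y) = cmp E Z (F \<cdot> ?w) (F \<cdot> (Va \<cdot> y))"
    using fa_cmp[of f0 "Va \<cdot> y" ?w] v w vw by simp
  have nc: "n \<cdot> cmp E (row X) (Ha \<cdot> y') ?t = cmp E Z (n \<cdot> (Ha \<cdot> y')) (n \<cdot> ?t)"
    by (rule codescent_coconeD(9)[OF cocone t(1,2) h'(1,2) _ th]) (use t h' in simp)
  have Fa: "F \<cdot> (Va \<cdot> y) \<in> Ar E" "F \<cdot> ?w \<in> Ar E" "n \<cdot> ?t \<in> Ar E" "n \<cdot> (Ha \<cdot> y') \<in> Ar E" "n \<cdot> (Ha \<cdot> y) \<in> Ar E" "F \<cdot> (Va \<cdot> y') \<in> Ar E"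
    "Cod E (F \<cdot> (Va \<cdot> y)) = ar Z" "Cod E (F \<cdot> ?w) = ar Z" "Cod E (n \<cdot> ?t) = ar Z" "Cod E (n \<cdot> (Ha \<cdot> y')) = ar Z" "Cod E (n \<cdot> (Ha \<cdot> y)) = ar Z" "Cod E (F \<cdot> (Va \<cdot> y')) = ar Z"
    "Dom E (F \<cdot> (Va \<cdot> y)) = Dom E y'" "Dom E (F \<cdot> ?w) = Dom E y'" "Dom E (n \<cdot> ?t) = Dom E y'" "Dom E (n \<cdot> (Ha \<cdot> y')) = Dom E y'" "Dom E (n \<cdot> (Ha \<cdot> y)) = Dom E y'" "Dom E (F \<cdot> (Va \<cdot> y')) = Dom E y'"
    using comp_Ar Dom_comp Cod_comp v v' h h' w t n_Ar F_Ar by presburger+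
  have st: "trg Z \<cdot> (F \<cdot> (Va \<cdot> y)) = src Z \<cdot> (F \<cdot> ?w)" "trg Z \<cdot> (F \<cdot> ?w) = src Z \<cdot> (n \<cdot> ?t)" "trg Z \<cdot> (n \<cdot> ?t) = src Z \<cdot> (n \<cdot> (Ha \<cdot> y'))"
    "trg Z \<cdot> (F \<cdot> (Va \<cdot> y)) = src Z \<cdot> (n \<cdot> (Ha \<cdot> y))" "trg Z \<cdot> (n \<cdot> (Ha \<cdot> y)) = src Z \<cdot> (F \<cdot> (Va \<cdot> y'))"
    "trg Z \<cdot> (F \<cdot> (Va \<cdot> y')) = src Z \<cdot> (n \<cdot> (Ha \<cdot> y'))"
    unfolding F_src[OF v(1,2)] F_src[OF v'(1,2)] F_src[OF w(1,2)] n_src[OF h(1,2)] n_src[OF h'(1,2)] n_src[OF t(1,2)]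
      vw sw(2) th c Y_fo(3)[OF y'] by (simp_all only: sw(1) l(4))
  have st': "src Z \<cdot> (F \<cdot> ?w) = src Z \<cdot> (n \<cdot> (Ha \<cdot> y))" by (rule trans[OF st(1)[symmetric] st(4)])
  have "G (cY y' y) = cmp E Z (cmp E Z (n \<cdot> (Ha \<cdot> y')) (n \<cdot> ?t)) (cmp E Z (F \<cdot> ?w) (F \<cdot> (Va \<cdot> y)))"
    unfolding G_def cY(4,5)[OF y y' d c] Fc nc ..
  also have "\<dots> = cmp E Z (n \<cdot> (Ha \<cdot> y')) (cmp E Z (cmp E Z (n \<cdot> ?t) (F \<cdot> ?w)) (F \<cdot> (Va \<cdot> y)))"
    by (rule cmp_assoc4[OF cocone_f0(1)]) (simp_all only: Fa st st')
  \<comment> \<open>Naturality of f1 at the chosen lift interchanges the two middle factors.\<close>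
  also have "cmp E Z (n \<cdot> ?t) (F \<cdot> ?w) = cmp E Z (F \<cdot> (Va \<cdot> y')) (n \<cdot> (Ha \<cdot> y))"
    using n_natural[OF l(1,3)] unfolding l(4,5) .
  also have "cmp E Z (n \<cdot> (Ha \<cdot> y')) (cmp E Z (cmp E Z (F \<cdot> (Va \<cdot> y')) (n \<cdot> (Ha \<cdot> y))) (F \<cdot> (Va \<cdot> y))) = cmp E Z (G y') (G y)"
    unfolding G_def by (rule cmp_assoc4[OF cocone_f0(1), symmetric]) (simp_all only: Fa st st')
  finally show ?thesis .
qed

text \<open>The object part is F0 after a retraction \<kappa> of \<open>p0\<close>, and the arrow
  part g factors the value of G at the generic corner through \<open>p1\<close>. The functor laws
  are then checked after precomposition with the epis \<open>p0\<close>, \<open>p1\<close> and the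
  projection of Y_2.\<close>

lemma cocone_factor:
  obtains f' where "internal_functor E f'" "fdom f' = Q" "fcod f' = Z" "fo f' \<cdot> p0 = F0" "fa f' \<cdot> qv = F" "fa f' \<cdot> qh = n"
proof -
  obtain \<kappa> where \<kappa>: "\<kappa> \<in> Ar E" "Dom E \<kappa> = ob Q" "Cod E \<kappa> = O0" "\<kappa> \<cdot> p0 = Ident E O0"
    using pi0_disc[OF O0_Ob(1)] unfolding p0_def[symmetric] Q(2)[symmetric] by metis
  let ?I = "Ident E (ob Y1)"
  have I: "?I \<in> Ar E" "Cod E ?I = ob Y1" "Dom E ?I = ob Y1" by simp_all
  have R: "Ident E (ar Y1) \<in> Ar E" "Cod E (Ident E (ar Y1)) = ar Y1" by simp_all
  have GI: "G ?I \<in> Ar E" "Dom E (G ?I) = ob Y1" "Cod E (G ?I) = ar Z" using G[OF I(1,2)] I(3) by simp_all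
  have GIx: "G ?I \<cdot> y = G y" if "y \<in> Ar E" "Cod E y = ob Y1" for y
    using G(6)[OF I(1,2), of y] that I(3) by simp
  have "G ?I \<cdot> src Y1 = G ?I \<cdot> trg Y1" using G_cell[OF R] GIx[of "src Y1"] GIx[of "trg Y1"] by simp
  then obtain g where g: "g \<in> Ar E" "Dom E g = ar Q" "Cod E g = ar Z" "g \<cdot> p1 = G ?I"
    using pi0_factor[OF Y1(1) GI(1,2)] GI(3) unfolding p1_def[symmetric] Q(3)[symmetric] by metis
  have gp: "g \<cdot> (p1 \<cdot> y) = G y" if y: "y \<in> Ar E" "Cod E y = ob Y1" for y
    using comp_eq_extend[OF g(4), of y] g y GIx[OF y] by simp
  have gv: "g \<cdot> (qv \<cdot> v) = F \<cdot> v" if v: "v \<in> Ar E" "Cod E v = V0" for v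
  proof -
    have fv: "F \<cdot> v \<in> Ar E" "Cod E (F \<cdot> v) = ar Z" and tv: "trg (ob X) \<cdot> v \<in> Ar E" "Cod E (trg (ob X) \<cdot> v) = O0" using v by simp_all
    show ?thesis
      unfolding qv_vq[OF v] gp[OF vq(1,3)[OF v]] G_def vq(4,5)[OF v] n_idn[OF tv]
      by (rule cmp_idn_left[OF cocone_f0(1) fv]) (rule F_src(2)[OF v, symmetric])
  qed
  have gh: "g \<cdot> (qh \<cdot> h) = n \<cdot> h" if h: "h \<in> Ar E" "Cod E h = H0" for h
  proof -
    have nh: "n \<cdot> h \<in> Ar E" "Cod E (n \<cdot> h) = ar Z" and sh: "fo (src X) \<cdot> h \<in> Ar E" "Cod E (fo (src X) \<cdot> h) = O0" using h by simp_all
    have "F \<cdot> (idn (ob X) \<cdot> (fo (src X) \<cdot> h)) = idn Z \<cdot> (F0 \<cdot> (fo (src X) \<cdot> h))"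
      using fa_idn[of f0 "fo (src X) \<cdot> h" "ob X"] sh by simp
    then show ?thesis
      unfolding qh_hq[OF h] gp[OF hq(1,3)[OF h]] G_def hq(4,5)[OF h]
      using cmp_idn_right[OF cocone_f0(1) nh n_src(1)[OF h, symmetric]] by simp
  qed
  have iV: "Ident E V0 \<in> Ar E" "Cod E (Ident E V0) = V0" and iH: "Ident E H0 \<in> Ar E" "Cod E (Ident E H0) = H0"
    and iO: "Ident E O0 \<in> Ar E" "Cod E (Ident E O0) = O0" by simp_all
  have gqv: "g \<cdot> qv = F" and gqh: "g \<cdot> qh = n" using gv[OF iV] gh[OF iH] by simp_all
  let ?g0 = "F0 \<cdot> \<kappa>"
  have g0: "?g0 \<in> Ar E" "Dom E ?g0 = ob Q" "Cod E ?g0 = ob Z" using \<kappa> by simp_all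
  have g0p: "?g0 \<cdot> (p0 \<cdot> x) = F0 \<cdot> x" if x: "x \<in> Ar E" "Cod E x = O0" for x
    using comp_eq_extend[OF \<kappa>(4), of x] \<kappa> x by simp
  have sI: "src Z \<cdot> G ?I = F0 \<cdot> (src (ob X) \<cdot> Va)" "trg Z \<cdot> G ?I = F0 \<cdot> (fo (trg X) \<cdot> Ha)"
    "src Q \<cdot> p1 = p0 \<cdot> (src (ob X) \<cdot> Va)" "trg Q \<cdot> p1 = p0 \<cdot> (fo (trg X) \<cdot> Ha)"
    using G(4,5)[OF I(1,2)] Q_src[OF I(1,2)] by simp_all
  have st: "src Z \<cdot> g = ?g0 \<cdot> src Q" "trg Z \<cdot> g = ?g0 \<cdot> trg Q"
  proof -
    have x: "src (ob X) \<cdot> Va \<in> Ar E" "Cod E (src (ob X) \<cdot> Va) = O0" "fo (trg X) \<cdot> Ha \<in> Ar E" "Cod E (fo (trg X) \<cdot> Ha) = O0" by simp_all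
    have "(src Z \<cdot> g) \<cdot> p1 = src Z \<cdot> (g \<cdot> p1)" "(trg Z \<cdot> g) \<cdot> p1 = trg Z \<cdot> (g \<cdot> p1)"
      by (rule comp_assoc; use g in simp)+
    moreover have "(?g0 \<cdot> src Q) \<cdot> p1 = ?g0 \<cdot> (src Q \<cdot> p1)" "(?g0 \<cdot> trg Q) \<cdot> p1 = ?g0 \<cdot> (trg Q \<cdot> p1)"
      by (rule comp_assoc; use g0 in \<open>simp del: comp_assoc\<close>)+
    ultimately have "(src Z \<cdot> g) \<cdot> p1 = (?g0 \<cdot> src Q) \<cdot> p1" "(trg Z \<cdot> g) \<cdot> p1 = (?g0 \<cdot> trg Q) \<cdot> p1"
      unfolding g(4) sI g0p[OF x(1,2)] g0p[OF x(3,4)] by - (rule trans, assumption, rule sym, assumption)+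
    then show "src Z \<cdot> g = ?g0 \<cdot> src Q" "trg Z \<cdot> g = ?g0 \<cdot> trg Q"
      by - (rule p1_epi; use g g0 in \<open>simp del: comp_assoc\<close>)+
  qed
  have id: "g \<cdot> idn Q = idn Z \<cdot> ?g0"
  proof (rule p0_epi)
    have "(g \<cdot> idn Q) \<cdot> p0 = g \<cdot> (idn Q \<cdot> p0)" by (rule comp_assoc) (use g in simp_all)
    also have "idn Q \<cdot> p0 = qv \<cdot> idn (ob X)" using q_idn(1)[OF iO] by simp
    also have "g \<cdot> (qv \<cdot> idn (ob X)) = F \<cdot> idn (ob X)" by (rule gv) simp_all
    also have "\<dots> = idn Z \<cdot> F0" using fa_idn[of f0 "Ident E O0" "ob X"] by simp
    also have "\<dots> = idn Z \<cdot> (?g0 \<cdot> p0)" using g0p[OF iO] by simp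
    also have "\<dots> = (idn Z \<cdot> ?g0) \<cdot> p0" by (rule comp_assoc[symmetric]) (use g0 in \<open>simp_all del: comp_assoc\<close>)
    finally show "(g \<cdot> idn Q) \<cdot> p0 = (idn Z \<cdot> ?g0) \<cdot> p0" .
  qed (use g g0 in \<open>simp_all del: comp_assoc\<close>)
  let ?fY = "\<lambda>j. fo (face Y 1 j)" and ?\<pi> = "pi0_proj E (sob Y 2)"
  have s1: "sob Y 1 = Y1" using Y(3) by (simp add: ar_def)
  have fY: "internal_functor E (face Y 1 j)" "fdom (face Y 1 j) = sob Y 2" "fcod (face Y 1 j) = Y1" if "j \<le> 2" for j
    using K.face_Ar[OF Y(1), of j 1] that s1 by (simp_all add: Cat_simps)
  have c2: "category_object E (sob Y 2)" using functor_objects(1)[OF fY(1)[of 0]] fY(2)[of 0] by simp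
  have fYa: "?fY j \<in> Ar E" "Dom E (?fY j) = ob (sob Y 2)" "Cod E (?fY j) = ob Y1" if "j \<le> 2" for j
    using fY[OF that] by simp_all
  have fQ: "face Q 1 j \<in> Ar E" "Dom E (face Q 1 j) = pi0 E (sob Y 2)" "Cod E (face Q 1 j) = ar Q" "face Q 1 j \<cdot> ?\<pi> = p1 \<cdot> ?fY j" if "j \<le> 2" for j
    using pi0_map[OF fY(1)[OF that]] fY(2,3)[OF that] unfolding Q_map map_simp_simps p1_def by (simp_all del: Q)
  have row: "face (row Y) 1 j = ?fY j" for j by (simp add: row_def)
  have c22: "fo (trg Y) \<cdot> ?fY 2 = fo (src Y) \<cdot> ?fY 0"
    using pullback_Ar(9)[OF composable_pullback[OF category_object_row[OF Y(1)]]] unfolding row row_simps .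
  have cc: "fo (trg X) \<cdot> (Ha \<cdot> ?fY 2) = src (ob X) \<cdot> (Va \<cdot> ?fY 0)"
    using c22 Y_fo(2)[OF fYa(1)[of 2] fYa(3)[of 2]] Y_fo(1)[OF fYa(1)[of 0] fYa(3)[of 0]] by simp
  have m: "cY (?fY 0) (?fY 2) = ?fY 1"
  proof -
    have "Ident E (ob (sob Y 2)) \<in> Ar E" "Cod E (Ident E (ob (sob Y 2))) = sob (row Y) 2" using c2 by (simp_all add: row_def)
    from cmp_simplex[OF category_object_row[OF Y(1)] this] show ?thesis
      unfolding row cY_def using fYa[of 0] fYa[of 1] fYa[of 2] by simp
  qed
  have gf: "g \<cdot> face Q 1 j \<in> Ar E" "Dom E (g \<cdot> face Q 1 j) = pi0 E (sob Y 2)" "Cod E (g \<cdot> face Q 1 j) = ar Z"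
      "(g \<cdot> face Q 1 j) \<cdot> ?\<pi> = G (?fY j)" if "j \<le> 2" for j
  proof -
    note q = fQ[OF that]
    show "g \<cdot> face Q 1 j \<in> Ar E" "Dom E (g \<cdot> face Q 1 j) = pi0 E (sob Y 2)" "Cod E (g \<cdot> face Q 1 j) = ar Z"
      using q(1-3) g by simp_all
    have "(g \<cdot> face Q 1 j) \<cdot> ?\<pi> = g \<cdot> (face Q 1 j \<cdot> ?\<pi>)" by (rule comp_assoc) (use q(1-3) g c2 in simp_all)
    then show "(g \<cdot> face Q 1 j) \<cdot> ?\<pi> = G (?fY j)" unfolding q(4) gp[OF fYa(1,3)[OF that]] .
  qed
  have tg: "trg Z \<cdot> (g \<cdot> face Q 1 2) = src Z \<cdot> (g \<cdot> face Q 1 0)"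
  proof -
    have "trg Q \<cdot> face Q 1 2 = src Q \<cdot> face Q 1 0" by (rule pullback_Ar(9)[OF composable_pullback[OF Q(1)]])
    moreover have "trg Z \<cdot> (g \<cdot> face Q 1 2) = ?g0 \<cdot> (trg Q \<cdot> face Q 1 2)" "src Z \<cdot> (g \<cdot> face Q 1 0) = ?g0 \<cdot> (src Q \<cdot> face Q 1 0)"
      by (rule comp2_eq_extend[OF st(2)] comp2_eq_extend[OF st(1)]; use g g0 fQ[of 0] fQ[of 2] in \<open>simp del: comp_assoc\<close>)+
    ultimately show ?thesis by simp
  qed
  \<comment> \<open>Composition is compared on the degree-2 object of Q. That object is \<pi>_0 of
    Y_2, so it suffices to compare on objects of Y_2, where \<open>G_cY\<close> applies to the two
    outer faces.\<close>
  have gm: "g \<cdot> face Q 1 1 = cmp E Z (g \<cdot> face Q 1 0) (g \<cdot> face Q 1 2)"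
  proof (rule pi0_epi[OF c2])
    have t: "g \<cdot> face Q 1 2 \<in> Ar E" "g \<cdot> face Q 1 0 \<in> Ar E" "Cod E (g \<cdot> face Q 1 2) = ar Z" "Cod E (g \<cdot> face Q 1 0) = ar Z"
      "Dom E (g \<cdot> face Q 1 2) = Dom E (g \<cdot> face Q 1 0)" using gf(1-3)[of 0] gf(1-3)[of 2] by simp_all
    note ct = cocone_f0(1) t tg
    show "g \<cdot> face Q 1 1 \<in> Ar E" "Dom E (g \<cdot> face Q 1 1) = pi0 E (sob Y 2)" using gf[of 1] by simp_all
    show "cmp E Z (g \<cdot> face Q 1 0) (g \<cdot> face Q 1 2) \<in> Ar E" by (rule cmp_Ar[OF ct])
    show "Dom E (cmp E Z (g \<cdot> face Q 1 0) (g \<cdot> face Q 1 2)) = pi0 E (sob Y 2)" using Dom_cmp[OF ct] gf(2)[of 0] by simp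
    show "Cod E (g \<cdot> face Q 1 1) = Cod E (cmp E Z (g \<cdot> face Q 1 0) (g \<cdot> face Q 1 2))" using Cod_cmp[OF ct] gf(3)[of 1] by simp
    have pd: "?\<pi> \<in> Ar E" "Cod E ?\<pi> = Dom E (g \<cdot> face Q 1 0)" using c2 gf(2)[of 0] by simp_all
    have dd: "Dom E (?fY 2) = Dom E (?fY 0)" using fYa[of 0] fYa[of 2] by simp
    have "cmp E Z (g \<cdot> face Q 1 0) (g \<cdot> face Q 1 2) \<cdot> ?\<pi> = cmp E Z (G (?fY 0)) (G (?fY 2))"
      using cmp_comp[OF ct pd] gf(4)[of 0] gf(4)[of 2] by simp
    also have "\<dots> = G (?fY 1)"
      using G_cY[OF fYa(1,3)[of 2] fYa(1,3)[of 0] dd cc] unfolding m by simp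
    finally show "(g \<cdot> face Q 1 1) \<cdot> ?\<pi> = cmp E Z (g \<cdot> face Q 1 0) (g \<cdot> face Q 1 2) \<cdot> ?\<pi>" using gf(4)[of 1] by simp
  qed
  \<comment> \<open>A composable pair of elements of Q need not come from a pair in Y; it is a
    2-simplex x of Q, at which the generic identity \<open>gm\<close> is evaluated.\<close>
  have cm: "g \<cdot> cmp E Q b a = cmp E Z (g \<cdot> b) (g \<cdot> a)"
    if ab: "a \<in> Ar E" "b \<in> Ar E" "Cod E a = ar Q" "Cod E b = ar Q" "Dom E a = Dom E b" "trg Q \<cdot> a = src Q \<cdot> b" for a b
  proof -
    obtain x where x: "x \<in> Ar E" "Dom E x = Dom E a" "Cod E x = sob Q 2" "face Q 1 2 \<cdot> x = a" "face Q 1 0 \<cdot> x = b" "face Q 1 1 \<cdot> x = cmp E Q b a"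
      by (rule composable_simplex[OF Q(1) ab])
    have xd: "Cod E x = Dom E (g \<cdot> face Q 1 0)" unfolding gf(2)[of 0, simplified] x(3) by (simp add: Q_map del: Q)
    have as: "(g \<cdot> face Q 1 j) \<cdot> x = g \<cdot> (face Q 1 j \<cdot> x)" if "j \<le> 2" for j
      by (rule comp_assoc) (use fQ(1-3)[OF that] fQ(1-3)[of 0] gf(2)[of 0] xd g x(1) in simp_all)
    have t: "g \<cdot> face Q 1 2 \<in> Ar E" "g \<cdot> face Q 1 0 \<in> Ar E" "Cod E (g \<cdot> face Q 1 2) = ar Z" "Cod E (g \<cdot> face Q 1 0) = ar Z"
      "Dom E (g \<cdot> face Q 1 2) = Dom E (g \<cdot> face Q 1 0)" using gf(1-3)[of 0] gf(1-3)[of 2] by simp_all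
    have "(g \<cdot> face Q 1 1) \<cdot> x = cmp E Z ((g \<cdot> face Q 1 0) \<cdot> x) ((g \<cdot> face Q 1 2) \<cdot> x)"
      unfolding gm by (rule cmp_comp[OF cocone_f0(1) t tg x(1) xd])
    then show ?thesis using as[of 0] as[of 1] as[of 2] x(4-6) by simp
  qed
  note a = Q(1) cocone_f0(1) g0 g(1-3) st id cm
  have fm: "fo (mkfun Q Z ?g0 g) = ?g0" "fa (mkfun Q Z ?g0 g) = g" by (rule fo_mkfun[OF a] fa_mkfun[OF a]; assumption)+
  show ?thesis
  proof
    show "internal_functor E (mkfun Q Z ?g0 g)" by (rule internal_functor_mkfun[OF a])
    show "fo (mkfun Q Z ?g0 g) \<cdot> p0 = F0" unfolding fm using g0p[OF iO] by simp
    show "fa (mkfun Q Z ?g0 g) \<cdot> qv = F" "fa (mkfun Q Z ?g0 g) \<cdot> qh = n" unfolding fm by (rule gqv gqh)+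
  qed simp_all
qed

end

context corner_object
begin

text \<open>The generic corner is its horizontal part after its vertical part, and functors preserve
  composites.\<close>

lemma fa_p1:
  assumes f: "internal_functor E f" "fdom f = Q"
  shows "fa f \<cdot> p1 = cmp E (fcod f) ((fa f \<cdot> qh) \<cdot> Ha) ((fa f \<cdot> qv) \<cdot> Va)"
proof -
  have V: "Va \<in> Ar E" "Cod E Va = V0" and H: "Ha \<in> Ar E" "Cod E Ha = H0" by simp_all
  have t: "trg Q \<cdot> (qv \<cdot> Va) = src Q \<cdot> (qh \<cdot> Ha)"
    unfolding qv_src[OF V] qh_src[OF H] using Y_fo(3)[of "Ident E (ob Y1)"] by simp
  have "p1 = cmp E Q (qh \<cdot> Ha) (qv \<cdot> Va)" using p1_factor[of "Ident E (ob Y1)"] by simp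
  then have "fa f \<cdot> p1 = fa f \<cdot> cmp E (fdom f) (qh \<cdot> Ha) (qv \<cdot> Va)" unfolding f(2) by (rule arg_cong)
  also have "\<dots> = cmp E (fcod f) (fa f \<cdot> (qh \<cdot> Ha)) (fa f \<cdot> (qv \<cdot> Va))"
    by (rule fa_cmp[OF f(1)]) (use t f(2) in simp_all)
  also have "\<dots> = cmp E (fcod f) ((fa f \<cdot> qh) \<cdot> Ha) ((fa f \<cdot> qv) \<cdot> Va)" using f by simp
  finally show ?thesis .
qed

text \<open>\<open>p0\<close> and \<open>p1\<close> are epi, and by \<open>fa_p1\<close> the arrow
  part precomposed with \<open>p1\<close> depends only on the values at \<open>qv\<close> and
  \<open>qh\<close>.\<close>

lemma functor_from_Q_eqI:
  assumes f: "internal_functor E f" "fdom f = Q" and g: "internal_functor E g" "fdom g = Q" and c: "fcod f = fcod g"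
    and e: "fo f \<cdot> p0 = fo g \<cdot> p0" "fa f \<cdot> qv = fa g \<cdot> qv" "fa f \<cdot> qh = fa g \<cdot> qh"
  shows "f = g"
proof (rule functor_eqI[OF f(1) g(1) _ c])
  show "fdom f = fdom g" using f g by simp
  show "fo f = fo g" by (rule p0_epi) (use f g c e(1) in simp_all)
  have "fa f \<cdot> p1 = fa g \<cdot> p1" unfolding fa_p1[OF f] fa_p1[OF g] c e ..
  then show "fa f = fa g" by - (rule p1_epi, use f g c in simp_all)
qed

end

context corner_cocone
begin

text \<open>Functors are equal when their parts in degrees 0 and 1 are, and the ends of the two
  2-cells agree once the functors do; so three equations in E remain.\<close>

lemma factor_iff:
  assumes f': "internal_functor E f'" "fdom f' = Q" "fcod f' = Z"
  shows "f' \<cdot>\<^bsub>Cat E\<^esub> q0 = f0 \<and> f' \<rhd>\<^bsub>Cat E\<^esub> q1 = f1 \<longleftrightarrow> fo f' \<cdot> p0 = F0 \<and> fa f' \<cdot> qv = F \<and> fa f' \<cdot> qh = n"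
proof (intro iffI conjI)
  assume "f' \<cdot>\<^bsub>Cat E\<^esub> q0 = f0 \<and> f' \<rhd>\<^bsub>Cat E\<^esub> q1 = f1"
  then have e: "f0 = f' \<cdot>\<^bsub>Cat E\<^esub> q0" "f1 = f' \<rhd>\<^bsub>Cat E\<^esub> q1" by blast+
  show "fo f' \<cdot> p0 = F0" "fa f' \<cdot> qv = F" "fa f' \<cdot> qh = n" unfolding e Cat_proj q0(4,5) q1(4) by (rule refl)+
next
  assume e: "fo f' \<cdot> p0 = F0 \<and> fa f' \<cdot> qv = F \<and> fa f' \<cdot> qh = n"
  have c: "internal_functor E (f' \<cdot>\<^bsub>Cat E\<^esub> q0)"
    unfolding Cat_simps(6) by (rule internal_functor_comp) (use f' in simp_all)
  show e0: "f' \<cdot>\<^bsub>Cat E\<^esub> q0 = f0"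
    by (rule functor_eqI[OF c cocone_f0(2)]; unfold Cat_proj q0(2,4,5) cocone_f0 f'(3)) (use e in simp_all)
  have A: "q0 \<in> Ar (Cat E)" "f' \<in> Ar (Cat E)" "Dom (Cat E) f' = Cod (Cat E) q0" "Dom (Cat E) q0 = ob X"
    using f' by (simp_all add: Cat_simps(2-4))
  have "f' \<cdot>\<^bsub>Cat E\<^esub> (q0 \<cdot>\<^bsub>Cat E\<^esub> g) = f0 \<cdot>\<^bsub>Cat E\<^esub> g" if "g \<in> Ar (Cat E)" "Cod (Cat E) g = ob X" for g
    unfolding e0[symmetric] by (rule K.comp_assoc[symmetric]) (use A that in simp_all)
  then have "f' \<cdot>\<^bsub>Cat E\<^esub> (q0 \<cdot>\<^bsub>Cat E\<^esub> src X) = f0 \<cdot>\<^bsub>Cat E\<^esub> src X" "f' \<cdot>\<^bsub>Cat E\<^esub> (q0 \<cdot>\<^bsub>Cat E\<^esub> trg X) = f0 \<cdot>\<^bsub>Cat E\<^esub> trg X"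
    using K.src_Ar[OF K.X] K.trg_Ar[OF K.X] K.Cod_src[OF K.X] K.Cod_trg[OF K.X] by blast+
  then show "f' \<rhd>\<^bsub>Cat E\<^esub> q1 = f1"
    by - (rule cat_cell_eqI; unfold Cat_proj q1(2-4) codescent_coconeD(6,7)[OF cocone]; use e in blast)
qed

lemma codescent_factor: "\<exists>!f'. f' \<in> hom (Cat E) Q Z \<and> f' \<cdot>\<^bsub>Cat E\<^esub> q0 = f0 \<and> f' \<rhd>\<^bsub>Cat E\<^esub> q1 = f1"
proof -
  have h: "f' \<in> hom (Cat E) Q Z \<longleftrightarrow> internal_functor E f' \<and> fdom f' = Q \<and> fcod f' = Z" for f'
    by (simp add: hom_def Cat_simps(2-4))
  obtain f' where f': "internal_functor E f'" "fdom f' = Q" "fcod f' = Z" "fo f' \<cdot> p0 = F0" "fa f' \<cdot> qv = F" "fa f' \<cdot> qh = n"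
    by (rule cocone_factor)
  show ?thesis
  proof (rule ex1I[of _ f'])
    show "f' \<in> hom (Cat E) Q Z \<and> f' \<cdot>\<^bsub>Cat E\<^esub> q0 = f0 \<and> f' \<rhd>\<^bsub>Cat E\<^esub> q1 = f1"
      unfolding h factor_iff[OF f'(1-3)] using f' by blast
    fix g assume g: "g \<in> hom (Cat E) Q Z \<and> g \<cdot>\<^bsub>Cat E\<^esub> q0 = f0 \<and> g \<rhd>\<^bsub>Cat E\<^esub> q1 = f1"
    then have g': "internal_functor E g" "fdom g = Q" "fcod g = Z" unfolding h by blast+
    have e: "fo g \<cdot> p0 = F0" "fa g \<cdot> qv = F" "fa g \<cdot> qh = n" using g factor_iff[OF g'] by blast+
    show "g = f'" by (rule functor_from_Q_eqI[OF g'(1,2) f'(1,2)]) (simp_all only: g' f' e)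
  qed
qed

end

context corner_object
begin

text \<open>The component on Q has to be that of \<phi> after the retraction \<kappa> of
  \<open>p0\<close>. Its naturality is tested on \<open>p1\<close>, where it splits into naturality
  of \<phi> at vertical arrows and the compatibility \<open>sq\<close> at horizontal ones.\<close>

lemma codescent_factor_cell:
  assumes cf: "codescent_cocone (Cat E) X Z f0 f1" and cg: "codescent_cocone (Cat E) X Z g0 g1"
    and \<phi>: "\<phi> \<in> cells (Cat E) f0 g0"
    and sq: "(\<phi> \<lhd>\<^bsub>Cat E\<^esub> trg X) \<bullet>\<^bsub>Cat E\<^esub> f1 = g1 \<bullet>\<^bsub>Cat E\<^esub> (\<phi> \<lhd>\<^bsub>Cat E\<^esub> src X)"
    and f': "f' \<in> hom (Cat E) Q Z" "f' \<cdot>\<^bsub>Cat E\<^esub> q0 = f0" "f' \<rhd>\<^bsub>Cat E\<^esub> q1 = f1"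
    and g': "g' \<in> hom (Cat E) Q Z" "g' \<cdot>\<^bsub>Cat E\<^esub> q0 = g0" "g' \<rhd>\<^bsub>Cat E\<^esub> q1 = g1"
  shows "\<exists>!\<phi>'. \<phi>' \<in> cells (Cat E) f' g' \<and> \<phi>' \<lhd>\<^bsub>Cat E\<^esub> q0 = \<phi>"
proof -
  interpret A: corner_cocone E X D Y Z f0 f1 by unfold_locales (rule cf)
  interpret B: corner_cocone E X D Y Z g0 g1 by unfold_locales (rule cg)
  have F: "internal_functor E f'" "fdom f' = Q" "fcod f' = Z" and G: "internal_functor E g'" "fdom g' = Q" "fcod g' = Z"
    using f'(1) g'(1) by (simp_all add: hom_def Cat_simps(2-4))
  have Fe: "fo f' \<cdot> p0 = A.F0" "fa f' \<cdot> qv = A.F" "fa f' \<cdot> qh = A.n" using A.factor_iff[OF F] f' by blast+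
  have Ge: "fo g' \<cdot> p0 = B.F0" "fa g' \<cdot> qv = B.F" "fa g' \<cdot> qh = B.n" using B.factor_iff[OF G] g' by blast+
  have P: "internal_nat_trans E \<phi>" "nsrc \<phi> = f0" "ntrg \<phi> = g0"
    using \<phi> by (simp_all add: cells_def Cat_simps(7-9))
  let ?m = "ncomp \<phi>"
  have m: "?m \<in> Ar E" "Dom E ?m = O0" "Cod E ?m = ar Z" "src Z \<cdot> ?m = A.F0" "trg Z \<cdot> ?m = B.F0"
    using nt_Ar[OF P(1)] Dom_nt[OF P(1)] Cod_nt[OF P(1)] src_nt[OF P(1), of Z] trg_nt[OF P(1), of Z] unfolding P A.cocone_f0 by blast+
  have ms: "src Z \<cdot> (?m \<cdot> x) = A.F0 \<cdot> x" "trg Z \<cdot> (?m \<cdot> x) = B.F0 \<cdot> x" if "x \<in> Ar E" "Cod E x = O0" for x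
    using comp_eq_extend[OF m(4), of x] comp_eq_extend[OF m(5), of x] m that by simp_all
  have mn: "cmp E Z (?m \<cdot> (trg (ob X) \<cdot> v)) (A.F \<cdot> v) = cmp E Z (B.F \<cdot> v) (?m \<cdot> (src (ob X) \<cdot> v))" if "v \<in> Ar E" "Cod E v = V0" for v
    using nt_natural[OF P(1) that(1)] that(2) unfolding P A.cocone_f0 by blast
  have V: "Va \<in> Ar E" "Cod E Va = V0" and H: "Ha \<in> Ar E" "Cod E Ha = H0" by simp_all
  \<comment> \<open>The compatibility of \<phi> with the two cocones, evaluated at the horizontal
    part of the generic corner.\<close>
  have hn: "cmp E Z (?m \<cdot> (fo (trg X) \<cdot> Ha)) (A.n \<cdot> Ha) = cmp E Z (B.n \<cdot> Ha) (?m \<cdot> (fo (src X) \<cdot> Ha))"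
  proof -
    have e: "cmp E Z (?m \<cdot> fo (trg X)) A.n = cmp E Z B.n (?m \<cdot> fo (src X))"
      using arg_cong[OF sq, of ncomp] unfolding Cat_proj codescent_coconeD(6)[OF cf] P A.cocone_f0 .
    have x: "fo (trg X) \<in> Ar E" "Cod E (fo (trg X)) = O0" "fo (src X) \<in> Ar E" "Cod E (fo (src X)) = O0" by simp_all
    have iH: "Ident E H0 \<in> Ar E" "Cod E (Ident E H0) = H0" by simp_all
    have 1: "cmp E Z (?m \<cdot> fo (trg X)) A.n \<cdot> Ha = cmp E Z ((?m \<cdot> fo (trg X)) \<cdot> Ha) (A.n \<cdot> Ha)"
      by (rule cmp_comp[OF A.cocone_f0(1)]) (use ms[OF x(1,2)] A.n_src(2)[OF iH] m(1-3) in simp_all)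
    have 2: "cmp E Z B.n (?m \<cdot> fo (src X)) \<cdot> Ha = cmp E Z (B.n \<cdot> Ha) ((?m \<cdot> fo (src X)) \<cdot> Ha)"
      by (rule cmp_comp[OF A.cocone_f0(1)]) (use ms[OF x(3,4)] B.n_src(1)[OF iH] m(1-3) in simp_all)
    have "(?m \<cdot> fo (trg X)) \<cdot> Ha = ?m \<cdot> (fo (trg X) \<cdot> Ha)" "(?m \<cdot> fo (src X)) \<cdot> Ha = ?m \<cdot> (fo (src X) \<cdot> Ha)"
      by (rule comp_assoc; use m(1-3) in simp)+
    with 1 2 show ?thesis unfolding e by simp
  qed
  obtain \<kappa> where \<kappa>: "\<kappa> \<in> Ar E" "Dom E \<kappa> = ob Q" "Cod E \<kappa> = O0" "\<kappa> \<cdot> p0 = Ident E O0"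
    using pi0_disc[OF O0_Ob(1)] unfolding p0_def[symmetric] Q(2)[symmetric] by metis
  let ?k = "?m \<cdot> \<kappa>"
  have k: "?k \<in> Ar E" "Dom E ?k = ob Q" "Cod E ?k = ar Z" using \<kappa> m(1-3) by simp_all
  have kp: "?k \<cdot> (p0 \<cdot> x) = ?m \<cdot> x" if x: "x \<in> Ar E" "Cod E x = O0" for x
    using comp_eq_extend[OF \<kappa>(4), of x] \<kappa> x m(1-3) by simp
  have kp0: "?k \<cdot> p0 = ?m" using kp[of "Ident E O0"] m(1-3) by simp
  have ks: "src Z \<cdot> ?k = fo f'" "trg Z \<cdot> ?k = fo g'"
  proof -
    have "(src Z \<cdot> ?k) \<cdot> p0 = src Z \<cdot> (?k \<cdot> p0)" "(trg Z \<cdot> ?k) \<cdot> p0 = trg Z \<cdot> (?k \<cdot> p0)"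
      by (rule comp_assoc; use k A.cocone_f0(1) in \<open>simp del: comp_assoc\<close>)+
    then have "(src Z \<cdot> ?k) \<cdot> p0 = fo f' \<cdot> p0" "(trg Z \<cdot> ?k) \<cdot> p0 = fo g' \<cdot> p0"
      unfolding kp0 Fe(1) Ge(1) m(4,5) .
    then show "src Z \<cdot> ?k = fo f'" "trg Z \<cdot> ?k = fo g'"
      by - (rule p0_epi; use k F G A.cocone_f0(1) in \<open>simp del: comp_assoc\<close>)+
  qed
  have I: "Ident E (ob Y1) \<in> Ar E" "Cod E (Ident E (ob Y1)) = ob Y1" by simp_all
  have qs: "src Q \<cdot> p1 = p0 \<cdot> (src (ob X) \<cdot> Va)" "trg Q \<cdot> p1 = p0 \<cdot> (fo (trg X) \<cdot> Ha)" using Q_src[OF I] by simp_all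
  have VH0: "trg (ob X) \<cdot> Va = fo (src X) \<cdot> Ha" using Y_fo(3)[OF I] by simp
  let ?a = "?k \<cdot> trg Q" and ?b = "?k \<cdot> src Q"
  have ab: "?a \<in> Ar E" "Dom E ?a = ar Q" "Cod E ?a = ar Z" "?b \<in> Ar E" "Dom E ?b = ar Q" "Cod E ?b = ar Z"
    "?a \<cdot> p1 = ?m \<cdot> (fo (trg X) \<cdot> Ha)" "?b \<cdot> p1 = ?m \<cdot> (src (ob X) \<cdot> Va)"
  proof -
    show "?a \<in> Ar E" "Dom E ?a = ar Q" "Cod E ?a = ar Z" "?b \<in> Ar E" "Dom E ?b = ar Q" "Cod E ?b = ar Z"
      using k by (simp_all del: comp_assoc)
    have "?a \<cdot> p1 = ?k \<cdot> (trg Q \<cdot> p1)" "?b \<cdot> p1 = ?k \<cdot> (src Q \<cdot> p1)"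
      by (rule comp_assoc; use k in \<open>simp del: comp_assoc\<close>)+
    then show "?a \<cdot> p1 = ?m \<cdot> (fo (trg X) \<cdot> Ha)" "?b \<cdot> p1 = ?m \<cdot> (src (ob X) \<cdot> Va)"
      unfolding qs using kp[of "fo (trg X) \<cdot> Ha"] kp[of "src (ob X) \<cdot> Va"] by simp_all
  qed
  have ff: "fa f' \<in> Ar E" "Dom E (fa f') = ar Q" "Cod E (fa f') = ar Z" "src Z \<cdot> fa f' = fo f' \<cdot> src Q" "trg Z \<cdot> fa f' = fo f' \<cdot> trg Q"
    "fa g' \<in> Ar E" "Dom E (fa g') = ar Q" "Cod E (fa g') = ar Z" "src Z \<cdot> fa g' = fo g' \<cdot> src Q" "trg Z \<cdot> fa g' = fo g' \<cdot> trg Q"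
    using F G by simp_all
  have tab: "trg Z \<cdot> fa f' = src Z \<cdot> ?a" "trg Z \<cdot> ?b = src Z \<cdot> fa g'"
    unfolding ff ks[symmetric] by (rule comp_assoc comp_assoc[symmetric]; use k A.cocone_f0(1) in \<open>simp del: comp_assoc\<close>)+
  have nat: "cmp E Z ?a (fa f') = cmp E Z (fa g') ?b"
  proof (rule p1_epi)
    have ca: "fa f' \<in> Ar E" "?a \<in> Ar E" "Cod E (fa f') = ar Z" "Cod E ?a = ar Z" "Dom E (fa f') = Dom E ?a"
      and cb: "?b \<in> Ar E" "fa g' \<in> Ar E" "Cod E ?b = ar Z" "Cod E (fa g') = ar Z" "Dom E ?b = Dom E (fa g')"
      by (simp_all only: ab ff)
    note ca = A.cocone_f0(1) ca tab(1) and cb = A.cocone_f0(1) cb tab(2)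
    show "cmp E Z ?a (fa f') \<in> Ar E" by (rule cmp_Ar[OF ca])
    show "cmp E Z (fa g') ?b \<in> Ar E" by (rule cmp_Ar[OF cb])
    show "Dom E (cmp E Z ?a (fa f')) = ar Q" using Dom_cmp[OF ca] unfolding ab .
    show "Dom E (cmp E Z (fa g') ?b) = ar Q" using Dom_cmp[OF cb] unfolding ff .
    show "Cod E (cmp E Z ?a (fa f')) = Cod E (cmp E Z (fa g') ?b)" unfolding Cod_cmp[OF ca] Cod_cmp[OF cb] ..
    have p: "p1 \<in> Ar E" "Cod E p1 = Dom E ?a" "Cod E p1 = Dom E (fa g')" by (simp_all only: p01 ab ff)
    let ?x1 = "A.F \<cdot> Va" and ?x2 = "A.n \<cdot> Ha" and ?x3 = "?m \<cdot> (fo (trg X) \<cdot> Ha)"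
      and ?y1 = "?m \<cdot> (src (ob X) \<cdot> Va)" and ?y2 = "B.F \<cdot> Va" and ?y3 = "B.n \<cdot> Ha" and ?z = "?m \<cdot> (trg (ob X) \<cdot> Va)"
    have x: "fo (trg X) \<cdot> Ha \<in> Ar E" "Cod E (fo (trg X) \<cdot> Ha) = O0" "src (ob X) \<cdot> Va \<in> Ar E" "Cod E (src (ob X) \<cdot> Va) = O0"
      "trg (ob X) \<cdot> Va \<in> Ar E" "Cod E (trg (ob X) \<cdot> Va) = O0"
      "Dom E (fo (trg X) \<cdot> Ha) = ob Y1" "Dom E (src (ob X) \<cdot> Va) = ob Y1" "Dom E (trg (ob X) \<cdot> Va) = ob Y1" by simp_all
    have ty: "?x1 \<in> Ar E" "?x2 \<in> Ar E" "?x3 \<in> Ar E" "?y1 \<in> Ar E" "?y2 \<in> Ar E" "?y3 \<in> Ar E" "?z \<in> Ar E"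
      "Cod E ?x1 = ar Z" "Cod E ?x2 = ar Z" "Cod E ?x3 = ar Z" "Cod E ?y1 = ar Z" "Cod E ?y2 = ar Z" "Cod E ?y3 = ar Z" "Cod E ?z = ar Z"
      "Dom E ?x1 = ob Y1" "Dom E ?x2 = ob Y1" "Dom E ?x3 = ob Y1" "Dom E ?y1 = ob Y1" "Dom E ?y2 = ob Y1" "Dom E ?y3 = ob Y1" "Dom E ?z = ob Y1"
      using x m(1-3) by (simp_all del: comp_assoc)
    have st: "trg Z \<cdot> ?x1 = src Z \<cdot> ?x2" "trg Z \<cdot> ?x2 = src Z \<cdot> ?x3" "trg Z \<cdot> ?x1 = src Z \<cdot> ?z" "trg Z \<cdot> ?z = src Z \<cdot> ?y3"
      "trg Z \<cdot> ?y1 = src Z \<cdot> ?y2" "trg Z \<cdot> ?y2 = src Z \<cdot> ?y3"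
      unfolding A.F_src[OF V] B.F_src[OF V] A.n_src[OF H] B.n_src[OF H] ms[OF x(1,2)] ms[OF x(3,4)] ms[OF x(5,6)[unfolded VH0]] VH0 by (rule refl)+
    have "cmp E Z ?a (fa f') \<cdot> p1 = cmp E Z ?x3 (cmp E Z ?x2 ?x1)"
      unfolding cmp_comp[OF ca p(1,2)] ab(7) fa_p1[OF F(1,2)] F(3) Fe ..
    also have "\<dots> = cmp E Z (cmp E Z ?x3 ?x2) ?x1"
      by (rule cmp_assoc[OF A.cocone_f0(1), symmetric]) (simp_all only: ty st(1,2))
    \<comment> \<open>The component of \<phi> moves backwards along the corner, past its horizontal
      part by \<open>hn\<close> and, after rebracketing, past its vertical part by
      \<open>mn\<close>.\<close>
    also have "cmp E Z ?x3 ?x2 = cmp E Z ?y3 ?z" unfolding hn VH0 ..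
    also have "cmp E Z (cmp E Z ?y3 ?z) ?x1 = cmp E Z ?y3 (cmp E Z ?z ?x1)"
      by (rule cmp_assoc[OF A.cocone_f0(1)]) (simp_all only: ty st(3,4))
    also have "cmp E Z ?z ?x1 = cmp E Z ?y2 ?y1" by (rule mn[OF V])
    also have "cmp E Z ?y3 (cmp E Z ?y2 ?y1) = cmp E Z (cmp E Z ?y3 ?y2) ?y1"
      by (rule cmp_assoc[OF A.cocone_f0(1), symmetric]) (simp_all only: ty st(5,6))
    also have "\<dots> = cmp E Z (fa g') ?b \<cdot> p1"
      unfolding cmp_comp[OF cb p(1,3)] ab(8) fa_p1[OF G(1,2)] G(3) Ge ..
    finally show "cmp E Z ?a (fa f') \<cdot> p1 = cmp E Z (fa g') ?b \<cdot> p1" .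
  qed
  have nt: "internal_nat_trans E (cat_cell f' g' ?k)"
  proof (rule internal_nat_transI[OF F(1) G(1)], unfold F G)
    fix x assume x: "x \<in> Ar E" "Cod E x = ar Q" "Dom E x = ar Q"
    have ca: "fa f' \<in> Ar E" "?a \<in> Ar E" "Cod E (fa f') = ar Z" "Cod E ?a = ar Z" "Dom E (fa f') = Dom E ?a"
      and cb: "?b \<in> Ar E" "fa g' \<in> Ar E" "Cod E ?b = ar Z" "Cod E (fa g') = ar Z" "Dom E ?b = Dom E (fa g')"
      and xd: "Cod E x = Dom E ?a" "Cod E x = Dom E (fa g')"
      by (simp_all only: ab ff x)
    have as: "?a \<cdot> x = ?k \<cdot> (trg Q \<cdot> x)" "?b \<cdot> x = ?k \<cdot> (src Q \<cdot> x)"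
      by (rule comp_assoc; use k x in \<open>simp del: comp_assoc\<close>)+
    show "cmp E Z (?k \<cdot> (trg Q \<cdot> x)) (fa f' \<cdot> x) = cmp E Z (fa g' \<cdot> x) (?k \<cdot> (src Q \<cdot> x))"
      unfolding as[symmetric] cmp_comp[OF A.cocone_f0(1) ca tab(1) x(1) xd(1), symmetric]
        cmp_comp[OF A.cocone_f0(1) cb tab(2) x(1) xd(2), symmetric] nat ..
  qed (rule refl k ks)+
  have cell: "\<psi> \<in> cells (Cat E) f' g' \<longleftrightarrow> internal_nat_trans E \<psi> \<and> nsrc \<psi> = f' \<and> ntrg \<psi> = g'" for \<psi>
    by (simp add: cells_def Cat_simps(7-9))
  show ?thesis
  proof (rule ex1I[of _ "cat_cell f' g' ?k"])
    have "cat_cell f' g' ?k \<lhd>\<^bsub>Cat E\<^esub> q0 = \<phi>"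
      by (rule cat_cell_eqI; unfold Cat_proj cat_cell_simps P q0(4)) (rule f'(2) g'(2) kp0)+
    then show "cat_cell f' g' ?k \<in> cells (Cat E) f' g' \<and> cat_cell f' g' ?k \<lhd>\<^bsub>Cat E\<^esub> q0 = \<phi>"
      unfolding cell using nt by simp
    fix \<psi> assume \<psi>: "\<psi> \<in> cells (Cat E) f' g' \<and> \<psi> \<lhd>\<^bsub>Cat E\<^esub> q0 = \<phi>"
    then have t: "internal_nat_trans E \<psi>" "nsrc \<psi> = f'" "ntrg \<psi> = g'" unfolding cell by blast+
    have e: "ncomp \<psi> \<cdot> p0 = ?m" using \<psi> Cat_proj(15)[of E \<psi> q0] unfolding q0(4) by simp
    have "ncomp \<psi> = ?k"
    proof (rule p0_epi)
      show "ncomp \<psi> \<in> Ar E" "Dom E (ncomp \<psi>) = ob Q" "Cod E (ncomp \<psi>) = Cod E ?k"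
        using nt_Ar[OF t(1)] Dom_nt[OF t(1)] Cod_nt[OF t(1)] unfolding t F k by blast+
    qed (simp_all only: k e kp0)
    then show "\<psi> = cat_cell f' g' ?k" using t by - (rule cat_cell_eqI, simp_all only: cat_cell_simps)
  qed
qed

theorem codescent: "is_codescent_object (Cat E) X Q q0 q1"
  unfolding is_codescent_object_def
proof (intro conjI allI impI)
  show "codescent_cocone (Cat E) X Q q0 q1" by (rule q_cocone)
  show "\<exists>!f'. f' \<in> hom (Cat E) Q Z \<and> f' \<cdot>\<^bsub>Cat E\<^esub> q0 = f0 \<and> f' \<rhd>\<^bsub>Cat E\<^esub> q1 = f1"
    if "codescent_cocone (Cat E) X Z f0 f1" for Z f0 f1
  proof -
    interpret corner_cocone E X D Y Z f0 f1 by unfold_locales (rule that)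
    show ?thesis by (rule codescent_factor)
  qed
qed (elim conjE, rule codescent_factor_cell, unfold src_def trg_def)

end

theorem corollary5p4p5:
  fixes E :: "('o, 'a) cat"
    and X :: "(('o, 'a) simp, ('o, 'a) sfun) simp"
    and D :: "('o, 'a) snat set"
  assumes "category E"
    and "has_pullbacks E"
    and "pullback_stable_reflexive_coequalisers E"
    and "crossed_internal_category (Cat E) X D"
  shows "(\<exists>Q q0 q1. is_codescent_object (Cat E) X Q q0 q1) \<and>
         (\<exists>Y. is_Cnr E X D Y) \<and>
         (\<forall>Y. is_Cnr E X D Y \<longrightarrow>
            (\<exists>q0 q1. is_codescent_object (Cat E) X (pi0_star E Y) q0 q1))"
proof -
  interpret crossed_category E X D
    by unfold_locales (fact assms)+
  have *: "\<exists>q0 q1. is_codescent_object (Cat E) X (pi0_star E Y) q0 q1" if "is_Cnr E X D Y" for Y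
  proof -
    interpret corner_object E X D Y
      by unfold_locales (fact assms that)+
    show ?thesis using codescent unfolding Q_def by blast
  qed
  \<comment> \<open>Existence of a codescent object follows from the formula at some presentation of
    Cnr(X), which \<open>Cnr_ex\<close> provides.\<close>
  then show ?thesis using Cnr_ex by blast
qed

end
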